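(* Let $p>\max\{1,N/2\}$ and let $f:\mathbb{R}\to[0,+\infty)$ be a continuous and nonzero (i.e. not identically zero) function. Consider the autonomous problem $$(G_\lambda^f)\qquad \Delta(|\Delta u|^{p-2}\Delta u)=\lambda f(u)\ \text{ in }\Omega,\qquad u=\Delta u=0\ \text{ on }\partial\Omega .$$ Assume that there exists a real constant $\gamma>0$ such that $f(t)=0$ for every $t\in[-\gamma,\gamma]$, and in addition that $$\lim_{|t|\to\infty}\frac{f(t)}{|t|^{s-1}}=0$$ for some $1\le s\le p$. Then there exist two real intervals of parameters $\Lambda_1'$ and $\Lambda_2'$ such that: for every $\lambda\in\Lambda_1'$ problem $(G_\lambda^f)$ admits two distinct nontrivial weak solutions in $W^{2,p}(\Omega)\cap W_0^{1,p}(\Omega)$ and, moreover, for each $\lambda\in\Lambda_2'$ there are two distinct nontrivial weak solutions of $(G_\lambda^f)$ in $W^{2,p}(\Omega)\cap W_0^{1,p}(\Omega)$ uniformly bounded in norm with respect to the parameter $\lambda$.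
   Context: $\Omega$ is an open bounded subset of $\mathbb{R}^N$ with a smooth enough boundary $\partial\Omega$, $\Delta$ is the usual Laplace operator, and $\lambda$ is a positive parameter. The space $X:=W^{2,p}(\Omega)\cap W_0^{1,p}(\Omega)$ is endowed with the norm $\|u\|=\left(\int_\Omega|\Delta u(x)|^p\,dx\right)^{1/p}$. A weak solution of $(G_\lambda^f)$ is a function $u\in X$ such that $\int_\Omega|\Delta u(x)|^{p-2}\Delta u(x)\,\Delta v(x)\,dx=\lambda\int_\Omega f(u(x))v(x)\,dx$ for every $v\in X$. Nontrivial means not identically zero. Uniformly bounded in norm with respect to $\lambda$ means that there is a real number $\sigma>0$, not depending on $\lambda\in\Lambda_2'$, such that the norms of these solutions are less than $\sigma$.
   Formalization: The intervals are claimed to consist of positive λ only when f is nonzero somewhere on (0,∞); if f vanishes there, no nontrivial solution exists for any λ>0, and the intervals may then be negative. *)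

theory Defs
  imports "HOL-Analysis.Analysis"
begin

definition partial :: "'a::euclidean_space \<Rightarrow> ('a \<Rightarrow> real) \<Rightarrow> 'a \<Rightarrow> real" where
  "partial i \<phi> x = frechet_derivative \<phi> (at x) i"

text \<open>Functions on the whole space all of whose partial derivatives of order up to \<open>k\<close>
  exist and are continuous.\<close>

primrec Ck :: "nat \<Rightarrow> ('a::euclidean_space \<Rightarrow> real) \<Rightarrow> bool" where
  "Ck 0 \<phi> \<longleftrightarrow> continuous_on UNIV \<phi>"
| "Ck (Suc k) \<phi> \<longleftrightarrow> \<phi> differentiable_on UNIV \<and> (\<forall>i\<in>Basis. Ck k (partial i \<phi>))"

text \<open>Near each of its boundary points, \<open>\<Omega>\<close> is the part of a ball lying strictly above the graph
  of a \<open>Ck\<close> function over the hyperplane orthogonal to some unit vector \<open>e\<close>; the vector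
  \<open>y - (y \<bullet> e) *\<^sub>R e\<close> is the orthogonal projection of \<open>y\<close> to that hyperplane.\<close>

definition Ck_boundary :: "nat \<Rightarrow> 'a::euclidean_space set \<Rightarrow> bool" where
  "Ck_boundary k \<Omega> \<longleftrightarrow>
     (\<forall>x0\<in>frontier \<Omega>. \<exists>r>0. \<exists>e h. norm e = 1 \<and> Ck k h \<and>
        \<Omega> \<inter> ball x0 r = {y \<in> ball x0 r. y \<bullet> e > h (y - (y \<bullet> e) *\<^sub>R e)})"

definition test_function :: "'a::euclidean_space set \<Rightarrow> ('a \<Rightarrow> real) \<Rightarrow> bool" where
  "test_function \<Omega> \<phi> \<longleftrightarrow> (\<forall>k. Ck k \<phi>) \<and>
     compact (closure {x. \<phi> x \<noteq> 0}) \<and> closure {x. \<phi> x \<noteq> 0} \<subseteq> \<Omega>"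

text \<open>Elements of the function spaces below are functions on the whole type, of which only
  the restriction to \<open>\<Omega>\<close> matters; they represent the same element of the space if they agree
  almost everywhere in \<open>\<Omega>\<close>.\<close>

definition locally_integrable :: "'a::euclidean_space set \<Rightarrow> ('a \<Rightarrow> real) \<Rightarrow> bool" where
  "locally_integrable \<Omega> u \<longleftrightarrow> (\<forall>K. compact K \<and> K \<subseteq> \<Omega> \<longrightarrow> integrable (lebesgue_on K) u)"

definition has_weak_partial ::
    "'a::euclidean_space set \<Rightarrow> 'a \<Rightarrow> ('a \<Rightarrow> real) \<Rightarrow> ('a \<Rightarrow> real) \<Rightarrow> bool" where
  "has_weak_partial \<Omega> i u g \<longleftrightarrow> locally_integrable \<Omega> u \<and> locally_integrable \<Omega> g \<and>
     (\<forall>\<phi>. test_function \<Omega> \<phi> \<longrightarrow>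
        (LINT x|lebesgue_on \<Omega>. u x * partial i \<phi> x) = - (LINT x|lebesgue_on \<Omega>. g x * \<phi> x))"

text \<open>A representative of the weak partial derivative, which is unique up to null sets;
  meaningful only if the weak derivative exists.\<close>

definition weak_partial :: "'a::euclidean_space set \<Rightarrow> 'a \<Rightarrow> ('a \<Rightarrow> real) \<Rightarrow> 'a \<Rightarrow> real" where
  "weak_partial \<Omega> i u = (SOME g. has_weak_partial \<Omega> i u g)"

definition weak_laplacian :: "'a::euclidean_space set \<Rightarrow> ('a \<Rightarrow> real) \<Rightarrow> 'a \<Rightarrow> real" where
  "weak_laplacian \<Omega> u x = (\<Sum>i\<in>Basis. weak_partial \<Omega> i (weak_partial \<Omega> i u) x)"

definition Lp :: "real \<Rightarrow> 'a::euclidean_space set \<Rightarrow> ('a \<Rightarrow> real) set" where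
  "Lp p \<Omega> = {u. u \<in> borel_measurable (lebesgue_on \<Omega>) \<and>
                 integrable (lebesgue_on \<Omega>) (\<lambda>x. \<bar>u x\<bar> powr p)}"

definition Lp_norm :: "real \<Rightarrow> 'a::euclidean_space set \<Rightarrow> ('a \<Rightarrow> real) \<Rightarrow> real" where
  "Lp_norm p \<Omega> u = (LINT x|lebesgue_on \<Omega>. \<bar>u x\<bar> powr p) powr (1 / p)"

primrec sobolev :: "nat \<Rightarrow> real \<Rightarrow> 'a::euclidean_space set \<Rightarrow> ('a \<Rightarrow> real) set" where
  "sobolev 0 p \<Omega> = Lp p \<Omega>"
| "sobolev (Suc k) p \<Omega> =
     {u \<in> Lp p \<Omega>. \<forall>i\<in>Basis. \<exists>g \<in> sobolev k p \<Omega>. has_weak_partial \<Omega> i u g}"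

definition sobolev1_norm :: "real \<Rightarrow> 'a::euclidean_space set \<Rightarrow> ('a \<Rightarrow> real) \<Rightarrow> real" where
  "sobolev1_norm p \<Omega> u = Lp_norm p \<Omega> u + (\<Sum>i\<in>Basis. Lp_norm p \<Omega> (weak_partial \<Omega> i u))"

text \<open>The closure of the test functions in the first order Sobolev space.\<close>

definition sobolev1_zero :: "real \<Rightarrow> 'a::euclidean_space set \<Rightarrow> ('a \<Rightarrow> real) set" where
  "sobolev1_zero p \<Omega> = {u \<in> sobolev 1 p \<Omega>.
     \<exists>\<phi>. (\<forall>n. test_function \<Omega> (\<phi> n)) \<and>
         (\<lambda>n. sobolev1_norm p \<Omega> (\<lambda>x. u x - \<phi> n x)) \<longlonglongrightarrow> 0}"

definition navier_space :: "real \<Rightarrow> 'a::euclidean_space set \<Rightarrow> ('a \<Rightarrow> real) set" where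
  "navier_space p \<Omega> = sobolev 2 p \<Omega> \<inter> sobolev1_zero p \<Omega>"

definition navier_norm :: "real \<Rightarrow> 'a::euclidean_space set \<Rightarrow> ('a \<Rightarrow> real) \<Rightarrow> real" where
  "navier_norm p \<Omega> u = Lp_norm p \<Omega> (weak_laplacian \<Omega> u)"

text \<open>For \<open>p < 2\<close> and \<open>weak_laplacian \<Omega> u x = 0\<close> the factor \<open>0 powr (p - 2)\<close> is \<open>0\<close>, so the
  product has the value that the continuous map \<open>\<bar>t\<bar> powr (p - 2) * t\<close> takes at \<open>0\<close>.\<close>

definition weak_solution ::
    "real \<Rightarrow> 'a::euclidean_space set \<Rightarrow> (real \<Rightarrow> real) \<Rightarrow> real \<Rightarrow> ('a \<Rightarrow> real) \<Rightarrow> bool" where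
  "weak_solution p \<Omega> f \<mu> u \<longleftrightarrow> u \<in> navier_space p \<Omega> \<and>
     (\<forall>v \<in> navier_space p \<Omega>.
        (LINT x|lebesgue_on \<Omega>.
           \<bar>weak_laplacian \<Omega> u x\<bar> powr (p - 2) * weak_laplacian \<Omega> u x * weak_laplacian \<Omega> v x)
        = \<mu> * (LINT x|lebesgue_on \<Omega>. f (u x) * v x))"

definition same_ae :: "'a::euclidean_space set \<Rightarrow> ('a \<Rightarrow> real) \<Rightarrow> ('a \<Rightarrow> real) \<Rightarrow> bool" where
  "same_ae \<Omega> u v \<longleftrightarrow> (AE x in lebesgue_on \<Omega>. u x = v x)"

definition nontrivial_weak_solution ::
    "real \<Rightarrow> 'a::euclidean_space set \<Rightarrow> (real \<Rightarrow> real) \<Rightarrow> real \<Rightarrow> ('a \<Rightarrow> real) \<Rightarrow> bool" where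
  "nontrivial_weak_solution p \<Omega> f \<mu> u \<longleftrightarrow>
     weak_solution p \<Omega> f \<mu> u \<and> \<not> same_ae \<Omega> u (\<lambda>_. 0)"

definition nondegenerate_interval :: "real set \<Rightarrow> bool" where
  "nondegenerate_interval \<Lambda> \<longleftrightarrow> is_interval \<Lambda> \<and> interior \<Lambda> \<noteq> {}"

end

(* With G the Green operator of the Dirichlet Laplacian, u = G g solves the problem as soon as the
  continuous function g satisfies |g|^(p-2) g = mu G (f (G g)). If f does not vanish on the positive
  axis, look for g >= 0: these are the fixed points of A g = (mu G (f (G g)))^(1/(p-1)), which maps a
  compact convex set of nonnegative functions into itself because f grows more slowly than t^(p-1).
  The map A decreases the energy J g = (int g^p)/p - mu int F (G g), F' = f. For mu in a suitable
  compact interval J takes a negative value, so a minimum of J on the compact set is a fixed point at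
  negative level; since f vanishes on [-gamma, gamma], J is positive where 0 < |G g| <= gamma in the
  sup norm, which gives a mountain pass, hence a fixed point at positive level. Both lie in one
  bounded set for all mu. If f vanishes on the positive axis, replace f t by f (-t) and mu by -mu.

  G is the limit, by the theorem of Arzela and Ascoli, of solutions of discretised mean value
  equations with barriers at the boundary. Comparing mean values of u = G g at the scales 2^-n and
  2^-(n+1) shows that the mollifications of u converge geometrically together with their second
  derivatives when g is Hoelder continuous; reflecting the kernel at the tangent plane bounds the
  second derivatives up to the boundary by the logarithm of the boundary distance, so they are in L^p. *)
theory Submission
 imports Defs "HOL-Complex_Analysis.Great_Picard"
begin

text \<open>With g = -Lap u the fourth order problem is the pair of Dirichlet problems -Lap u = g
  and -Lap w = mu f(u) with w = |g|^(p-2) g, so only the inverse of the Laplacian is needed and the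
  unknown g can be kept continuous. Compactness of the set of admissible g then takes the place of a
  Palais-Smale condition. The energy falls from g towards A g because its derivative there is -int
  (w - g^(p-1)) (A g - g), and A g is an increasing function of w. The set consists of Hoelder
  functions, since w is Lipschitz and A g is a power of it. The obstacle is that u must have second
  derivatives in L^p up to a boundary that is only C^2. Everything rests on one identity: a
  compactly supported kernel b whose Laplacian is a kernel a minus a rescaled copy of a. Testing the
  equation with b compares the means of u at the scales t and t/2 exactly. The minimum principle,
  the expansion of mean values and the convergence of first and second derivatives all follow from
  this identity with bounded smooth kernels and geometric series, without a fundamental solution or
  singular integrals.\<close>

abbreviation tends_seq :: "(nat => 'a::topological_space) => 'a => bool" (infixr "---->" 60) where
 "X ----> L == X \<longlonglongrightarrow> L"

lemmas Lint_nonneg = Bochner_Integration.integral_nonneg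
 and Lint_add = Bochner_Integration.integral_add
 and Lint_diff = Bochner_Integration.integral_diff
 and Lint_sum = Bochner_Integration.integral_sum

section \<open>Partial derivatives and smooth functions\<close>

definition smooth :: "('a::euclidean_space => real) => bool" where
 "smooth phi \<longleftrightarrow> (ALL k. Ck k phi)"

lemma has_derivative_partial:
 fixes phi :: "'a::euclidean_space => real"
 assumes "phi differentiable at x"
 shows "(phi has_derivative (%h. \<Sum>i\<in>Basis. (h \<bullet> i) * partial i phi x)) (at x)"
proof -
 have D: "(phi has_derivative frechet_derivative phi (at x)) (at x)"
  using assms frechet_derivative_works by blast
 then have l: "linear (frechet_derivative phi (at x))"
  by (simp add: has_derivative_linear)
 have "frechet_derivative phi (at x) = (%h. \<Sum>i\<in>Basis. (h \<bullet> i) * partial i phi x)"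
 proof
  fix h
  have "frechet_derivative phi (at x) h = frechet_derivative phi (at x) (\<Sum>i\<in>Basis. (h \<bullet> i) *\<^sub>R i)"
   by (simp add: euclidean_representation)
  also have "... = (\<Sum>i\<in>Basis. (h \<bullet> i) * partial i phi x)"
   using l by (simp add: linear_sum linear_scale partial_def)
  finally show "frechet_derivative phi (at x) h = (\<Sum>i\<in>Basis. (h \<bullet> i) * partial i phi x)" .
 qed
 with D show ?thesis by simp
qed

lemma partial_eqI:
 assumes "(phi has_derivative D) (at x)"
 shows "partial i phi x = D i"
 using frechet_derivative_at[OF assms] by (simp add: partial_def)

lemma Ck_differentiable: "Ck (Suc k) phi ==> phi differentiable at x"
 by (simp add: differentiable_on_eq_differentiable_at)

lemma Ck_continuous: "Ck k phi ==> continuous_on UNIV phi"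
 by (cases k) (auto intro: differentiable_imp_continuous_on)

lemma Ck_SucD: "Ck (Suc k) phi ==> Ck k phi"
proof (induction k arbitrary: phi)
 case 0 then show ?case by (auto intro: differentiable_imp_continuous_on)
next
 case (Suc k) then show ?case by (metis Ck.simps(2))
qed

lemma Ck_SucI:
 assumes "!!x. (phi has_derivative D x) (at x)" "!!i. i : Basis ==> Ck k (%x. D x i)"
 shows "Ck (Suc k) phi"
proof -
 have "partial i phi = (%x. D x i)" for i
  using partial_eqI[OF assms(1)] by auto
 then show ?thesis using assms
  by (auto simp: differentiable_on_eq_differentiable_at differentiable_def)
qed

lemma partial_add:
 assumes "f differentiable at x" "g differentiable at x"
 shows "partial i (%x. f x + g x) x = partial i f x + partial i g x"
 using partial_eqI[OF has_derivative_add[OF assms[unfolded frechet_derivative_works]]]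
 by (simp add: partial_def)

lemma partial_mult:
 assumes "f differentiable at x" "g differentiable at x"
 shows "partial i (%x. f x * g x) x = f x * partial i g x + partial i f x * g x"
 using partial_eqI[OF has_derivative_mult[OF assms[unfolded frechet_derivative_works]]]
 by (simp add: partial_def)

lemma partial_const [simp]: "partial i (%x. c) = (%x. 0)"
 using partial_eqI[OF has_derivative_const] by auto

lemma partial_cmult:
 assumes "f differentiable at x"
 shows "partial i (%x. c * f x) x = c * partial i f x"
 using partial_mult[of "%_. c" x f i] assms by simp

lemma partial_diff:
 assumes "f differentiable at x" "g differentiable at x"
 shows "partial i (%x. f x - g x) x = partial i f x - partial i g x"
 using partial_eqI[OF has_derivative_diff[OF assms[unfolded frechet_derivative_works]]]
 by (simp add: partial_def)

lemma partial_affine: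
 assumes "f differentiable at (c + m *\<^sub>R x)"
 shows "partial i (%x. f (c + m *\<^sub>R x)) x = m * partial i f (c + m *\<^sub>R x)"
proof -
 have 1: "((%x. c + m *\<^sub>R x) has_derivative (%h. m *\<^sub>R h)) (at x)"
  by (auto intro!: derivative_eq_intros)
 have 2: "(f has_derivative frechet_derivative f (at (c + m *\<^sub>R x))) (at (c + m *\<^sub>R x))"
  using assms frechet_derivative_works by blast
 have "((%x. f (c + m *\<^sub>R x)) has_derivative (%h. frechet_derivative f (at (c + m *\<^sub>R x)) (m *\<^sub>R h))) (at x)"
  using has_derivative_compose[OF 1 2] by simp
 from partial_eqI[OF this] show ?thesis
  using has_derivative_linear[OF 2] by (simp add: linear_scale partial_def)
qed

lemma Ck_const [simp, intro]: "Ck k (%x. c)"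
 by (induction k arbitrary: c) auto

lemma Ck_add: "Ck k f ==> Ck k g ==> Ck k (%x. f x + g x)"
proof (induction k arbitrary: f g)
 case 0 then show ?case by (auto intro: continuous_intros)
next
 case (Suc k)
 note d = Suc.prems[THEN Ck_differentiable]
 have "partial i (%x. f x + g x) = (%x. partial i f x + partial i g x)" for i
  using partial_add[OF d] by blast
 then show ?case using Suc
  by (auto simp: differentiable_on_eq_differentiable_at)
qed

lemma Ck_mult: "Ck k f ==> Ck k g ==> Ck k (%x. f x * g x)"
proof (induction k arbitrary: f g)
 case 0 then show ?case by (auto intro: continuous_intros)
next
 case (Suc k)
 note d = Suc.prems[THEN Ck_differentiable]
 have *: "partial i (%x. f x * g x) = (%x. f x * partial i g x + partial i f x * g x)" for i
  using partial_mult[OF d] by blast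
 have "Ck k f" "Ck k g" using Suc.prems Ck_SucD by blast+
 then have "Ck k (%x. f x * partial i g x + partial i f x * g x)" if "i : Basis" for i
  using Suc that by (auto intro!: Ck_add)
 with * d show ?case
  by (auto simp: differentiable_on_eq_differentiable_at)
qed

lemma Ck_sum: "(!!j. j : I ==> Ck k (f j)) ==> Ck k (%x. \<Sum>j\<in>I. f j x)"
 by (induction I rule: infinite_finite_induct) (auto intro: Ck_add)

lemma Ck_affine: "Ck k f ==> Ck k (%x. f (c + m *\<^sub>R x))"
proof (induction k arbitrary: f)
 case 0 then show ?case
  by (auto intro!: continuous_intros continuous_on_compose2[of UNIV f])
next
 case (Suc k)
 have d: "f differentiable at x" for x using Suc.prems by (rule Ck_differentiable)
 have "(%x. f (c + m *\<^sub>R x)) differentiable at x" for x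
 proof -
  have "(%x. c + m *\<^sub>R x) differentiable at x"
   unfolding differentiable_def by (auto intro!: derivative_eq_intros)
  then show ?thesis using differentiable_chain_at[of "%x. c + m *\<^sub>R x" x f] d by (simp add: o_def)
 qed
 moreover have "partial i (%x. f (c + m *\<^sub>R x)) = (%x. m * partial i f (c + m *\<^sub>R x))" for i
  using partial_affine[OF d] by blast
 ultimately show ?case using Suc
  by (auto simp: differentiable_on_eq_differentiable_at intro!: Ck_mult)
qed

lemma Ck_linear:
 assumes "bounded_linear (f :: 'a::euclidean_space => real)"
 shows "Ck k f"
proof (cases k)
 case 0 then show ?thesis using assms by (simp add: linear_continuous_on)
next
 case (Suc m)
 show ?thesis unfolding Suc
  by (rule Ck_SucI[where D="%_. f"]) (use assms in \<open>auto intro: bounded_linear_imp_has_derivative\<close>)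
qed

lemma Ck_inner [intro]: "Ck k (%x. x \<bullet> v)"
 by (rule Ck_linear) (rule bounded_linear_inner_left)

text \<open>Carrying all derivatives of a one-variable profile as one sequence turns the chain rule
  into a shift of the index, so the smoothness of a composite is an induction in which no iterated
  derivative has to be computed.\<close>

definition deriv_seq :: "(nat => real => real) => bool" where
 "deriv_seq D \<longleftrightarrow> (ALL n x. (D n has_real_derivative D (Suc n) x) (at x))"

lemma deriv_seqD: "deriv_seq D ==> (D n has_real_derivative D (Suc n) x) (at x)"
 by (simp add: deriv_seq_def)

lemma deriv_seq_continuous: "deriv_seq D ==> continuous_on S (D n)"
 by (meson DERIV_isCont continuous_at_imp_continuous_on deriv_seqD)

lemma deriv_seq_compose:
 assumes "deriv_seq D" "f differentiable at x"
 shows "((%x. D n (f x)) has_derivative (%h. D (Suc n) (f x) * frechet_derivative f (at x) h)) (at x)"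
proof -
 have "(D n has_derivative (*) (D (Suc n) (f x))) (at (f x))"
  using deriv_seqD[OF assms(1)] by (simp add: has_field_derivative_def)
 from has_derivative_compose[OF assms(2)[unfolded frechet_derivative_works] this]
 show ?thesis .
qed

lemma partial_compose:
 assumes "deriv_seq D" "f differentiable at x"
 shows "partial i (%x. D n (f x)) x = D (Suc n) (f x) * partial i f x"
 using partial_eqI[OF deriv_seq_compose[OF assms]] by (simp add: partial_def)

lemma Ck_compose:
 assumes "deriv_seq D"
 shows "Ck k f ==> Ck k (%x. D n (f x))"
proof (induction k arbitrary: f n)
 case 0 then show ?case
  using deriv_seq_continuous[OF assms, of UNIV] by (auto intro: continuous_on_compose2)
next
 case (Suc k)
 note d = Suc.prems[THEN Ck_differentiable]
 have "partial i (%x. D n (f x)) = (%x. D (Suc n) (f x) * partial i f x)" for i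
  using partial_compose[OF assms d] by blast
 moreover have "Ck k (%x. D (Suc n) (f x))" by (rule Suc.IH) (rule Ck_SucD[OF Suc.prems])
 ultimately show ?case using Suc.prems deriv_seq_compose[OF assms d]
  by (auto intro!: Ck_mult simp: differentiable_on_eq_differentiable_at differentiable_def)
qed

lemma Ck_partial: "Ck (Suc k) f ==> i : Basis ==> Ck k (partial i f)"
 by simp

lemma smooth_Ck: "smooth f ==> Ck k f" by (simp add: smooth_def)
lemma smooth_differentiable: "smooth f ==> f differentiable at x"
 by (meson smooth_def Ck_differentiable)
lemma smooth_continuous: "smooth f ==> continuous_on S f"
 by (meson smooth_def Ck_continuous continuous_on_subset subset_UNIV)
lemma smooth_partial: "smooth f ==> i : Basis ==> smooth (partial i f)"
 using Ck_partial by (auto simp: smooth_def simp del: Ck.simps)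
lemma smooth_const [simp, intro]: "smooth (%x. c)" by (simp add: smooth_def)
lemma smooth_inner [simp, intro]: "smooth (%x. x \<bullet> v)" unfolding smooth_def using Ck_inner by blast
lemma smooth_add: "smooth f ==> smooth g ==> smooth (%x. f x + g x)"
 by (simp add: smooth_def Ck_add)
lemma smooth_mult: "smooth f ==> smooth g ==> smooth (%x. f x * g x)"
 by (simp add: smooth_def Ck_mult)
lemma smooth_uminus: "smooth f ==> smooth (%x. - f x)"
 using smooth_mult[of "%_. -1" f] by simp
lemma smooth_diff: "smooth f ==> smooth g ==> smooth (%x. f x - g x)"
 using smooth_add[OF _ smooth_uminus, of f g] by simp
lemma smooth_sum: "(!!j. j : I ==> smooth (f j)) ==> smooth (%x. \<Sum>j\<in>I. f j x)"
 by (simp add: smooth_def Ck_sum)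
lemma smooth_affine: "smooth f ==> smooth (%x. f (c + m *\<^sub>R x))"
 by (simp add: smooth_def Ck_affine)
lemma smooth_compose: "deriv_seq D ==> smooth f ==> smooth (%x. D n (f x))"
 by (simp add: smooth_def Ck_compose)
lemma smooth_norm2: "smooth (%x::'a::euclidean_space. (norm x)^2)"
proof -
 have "(%x::'a. (norm x)^2) = (%x. \<Sum>i\<in>Basis. (x \<bullet> i) * (x \<bullet> i))"
  by (auto simp: power2_norm_eq_inner euclidean_inner[of x x for x])
 then show ?thesis by (simp only: ) (intro smooth_sum smooth_mult smooth_inner)
qed

lemmas smooth_intros = smooth_const smooth_inner smooth_add smooth_mult smooth_uminus smooth_diff
 smooth_sum smooth_affine smooth_norm2

section \<open>The Laplacian of smooth and of radial functions\<close>

definition lap :: "('a::euclidean_space => real) => 'a => real" where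
 "lap phi x = (\<Sum>i\<in>Basis. partial i (partial i phi) x)"

lemma smooth_lap: "smooth f ==> smooth (lap f)"
 unfolding lap_def[abs_def] by (intro smooth_sum smooth_partial)

lemma partial_add_smooth: "smooth f ==> smooth g ==>
  partial i (%x. f x + g x) = (%x. partial i f x + partial i g x)"
 by (intro ext partial_add smooth_differentiable; blast)
lemma partial_diff_smooth: "smooth f ==> smooth g ==>
  partial i (%x. f x - g x) = (%x. partial i f x - partial i g x)"
 by (intro ext partial_diff smooth_differentiable; blast)
lemma partial_mult_smooth: "smooth f ==> smooth g ==>
  partial i (%x. f x * g x) = (%x. f x * partial i g x + partial i f x * g x)"
 by (intro ext partial_mult smooth_differentiable; blast)
lemma partial_cmult_smooth: "smooth f ==> partial i (%x. c * f x) = (%x. c * partial i f x)"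
 by (intro ext partial_cmult smooth_differentiable; blast)
lemma partial_affine_smooth: "smooth f ==>
  partial i (%x. f (c + m *\<^sub>R x)) = (%x. m * partial i f (c + m *\<^sub>R x))"
 by (intro ext partial_affine smooth_differentiable; blast)

lemma lap_add: "smooth f ==> smooth g ==> lap (%x. f x + g x) x = lap f x + lap g x"
 by (simp add: lap_def partial_add_smooth smooth_partial sum.distrib)
lemma lap_diff: "smooth f ==> smooth g ==> lap (%x. f x - g x) x = lap f x - lap g x"
 by (simp add: lap_def partial_diff_smooth smooth_partial sum_subtractf)
lemma lap_cmult: "smooth f ==> lap (%x. c * f x) x = c * lap f x"
 by (simp add: lap_def partial_cmult_smooth smooth_partial sum_distrib_left)
lemma lap_affine:
 assumes f: "smooth f"
 shows "lap (%x. f (c + m *\<^sub>R x)) x = m^2 * lap f (c + m *\<^sub>R x)"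
proof -
 have "partial i (partial i (%x. f (c + m *\<^sub>R x))) x = m^2 * partial i (partial i f) (c + m *\<^sub>R x)"
  if "i : Basis" for i
 proof -
  have g: "smooth (partial i f)" using f that by (rule smooth_partial)
  show ?thesis
   unfolding partial_affine_smooth[OF f] partial_cmult_smooth[OF smooth_affine[OF g]]
    partial_affine_smooth[OF g] by (simp add: power2_eq_square)
 qed
 then show ?thesis by (simp add: lap_def sum_distrib_left)
qed

lemma lap_mult:
 assumes f: "smooth f" and g: "smooth g"
 shows "lap (%x. f x * g x) x = lap f x * g x + 2 * (\<Sum>i\<in>Basis. partial i f x * partial i g x) + f x * lap g x"
proof -
 have "partial i (partial i (%x. f x * g x)) x = partial i (partial i f) x * g x
   + 2 * (partial i f x * partial i g x) + f x * partial i (partial i g) x"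
  if "i : Basis" for i
 proof -
  have f': "smooth (partial i f)" and g': "smooth (partial i g)" 
   using f g that by (auto intro: smooth_partial)
  show ?thesis
   unfolding partial_mult_smooth[OF f g] 
    partial_add_smooth[OF smooth_mult[OF f g'] smooth_mult[OF f' g]]
    partial_mult_smooth[OF f g'] partial_mult_smooth[OF f' g] by simp
 qed
 then show ?thesis 
  by (simp add: lap_def sum.distrib sum_distrib_left[symmetric] sum_distrib_right[symmetric])
qed

lemma partial_inner: "partial i (%x. x \<bullet> v) = (%x. i \<bullet> v)"
 by (rule ext, rule partial_eqI) (auto intro!: derivative_eq_intros)

lemma partial_norm2: "partial i (%x. (norm x)^2) = (%x. 2 * (x \<bullet> i))"
 by (rule ext, rule partial_eqI) 
   (auto intro!: derivative_eq_intros simp: power2_norm_eq_inner inner_commute)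

text \<open>The entries of \<open>D\<close> are the successive derivatives of a profile in the variable \<open>(norm z)^2\<close>.\<close>

abbreviation radial :: "(nat => real => real) => nat => 'a::euclidean_space => real" where
 "radial D n \<equiv> %z. D n ((norm z)^2)"

lemma smooth_radial: "deriv_seq D ==> smooth (radial D n)"
 using smooth_compose[OF _ smooth_norm2] .

lemma partial_radial: "deriv_seq D ==> partial i (radial D n) = (%z. 2 * (z \<bullet> i) * radial D (Suc n) z)"
 by (intro ext) (simp add: partial_compose[OF _ smooth_differentiable[OF smooth_norm2]] partial_norm2)

lemma sum_inner_Basis2: "(\<Sum>i\<in>Basis. (x \<bullet> i) * (i \<bullet> y)) = x \<bullet> (y::'a::euclidean_space)"
 by (subst (2) euclidean_inner) (simp add: inner_commute)

lemma lap_radial: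
 assumes "deriv_seq D"
 shows "lap (radial D n) (z::'a::euclidean_space)
  = 4 * (norm z)^2 * radial D (Suc (Suc n)) z + 2 * DIM('a) * radial D (Suc n) z"
proof -
 have "partial i (partial i (radial D n)) z =
   4 * ((z \<bullet> i) * (i \<bullet> z)) * radial D (Suc (Suc n)) z + 2 * (i \<bullet> i) * radial D (Suc n) z" for i :: 'a
  by (simp add: partial_radial[OF assms] partial_mult_smooth partial_cmult_smooth smooth_intros
    smooth_radial[OF assms] partial_inner inner_commute)
 then show ?thesis
  by (simp add: lap_def sum.distrib sum_distrib_right[symmetric] sum_distrib_left[symmetric]
    sum_inner_Basis2 power2_norm_eq_inner)
qed

lemma lap_inner: "lap (%x. x \<bullet> v) = (%x. 0)"
 by (auto simp: lap_def partial_inner)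

text \<open>A linear factor raises the coefficient of the first derivative by 4, exactly as one
  differentiation in s does to 4 s D'' + 2 N D'. For this reason the differential equation of the
  profile passes to the first and second derivatives of the kernel.\<close>

lemma lap_radial1:
 assumes "deriv_seq D"
 shows "lap (%z. (z \<bullet> xi) * radial D n z) (z::'a::euclidean_space)
  = (z \<bullet> xi) * (4 * (norm z)^2 * radial D (Suc (Suc n)) z + (2 * DIM('a) + 4) * radial D (Suc n) z)"
proof -
 have "(\<Sum>i\<in>Basis. partial i (%x. x \<bullet> xi) z * partial i (radial D n) z)
   = (\<Sum>i\<in>Basis. (z \<bullet> i) * (i \<bullet> xi)) * (2 * radial D (Suc n) z)"
  unfolding sum_distrib_right by (simp add: partial_inner partial_radial[OF assms] mult_ac)
 then show ?thesis
  unfolding sum_inner_Basis2 lap_mult[OF smooth_inner smooth_radial[OF assms]]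
  by (simp add: lap_inner lap_radial[OF assms] algebra_simps)
qed

lemma lap_radial2:
 assumes "deriv_seq D"
 shows "lap (%z. (z \<bullet> xi) * (z \<bullet> eta) * radial D n z) (z::'a::euclidean_space)
  = (z \<bullet> xi) * (z \<bullet> eta) * (4 * (norm z)^2 * radial D (Suc (Suc n)) z + (2 * DIM('a) + 8) * radial D (Suc n) z)
   + 2 * (xi \<bullet> eta) * radial D n z"
proof -
 have p: "partial i (%z. (z \<bullet> eta) * radial D n z) z
   = 2 * (z \<bullet> eta) * (z \<bullet> i) * radial D (Suc n) z + (i \<bullet> eta) * radial D n z" for i
  by (simp add: partial_mult_smooth smooth_intros smooth_radial[OF assms] partial_inner
    partial_radial[OF assms])
 have "(\<Sum>i\<in>Basis. partial i (%x. x \<bullet> xi) z * partial i (%z. (z \<bullet> eta) * radial D n z) z)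
   = (\<Sum>i\<in>Basis. (z \<bullet> i) * (i \<bullet> xi)) * (2 * (z \<bullet> eta) * radial D (Suc n) z)
    + (\<Sum>i\<in>Basis. (xi \<bullet> i) * (i \<bullet> eta)) * radial D n z"
  unfolding sum_distrib_right sum.distrib[symmetric]
  by (simp add: p partial_inner algebra_simps inner_commute)
 moreover have "lap (%z. (z \<bullet> xi) * (z \<bullet> eta) * radial D n z) z = lap (%z. (z \<bullet> xi) * ((z \<bullet> eta) * radial D n z)) z"
  by (simp add: mult.assoc)
 ultimately show ?thesis
  unfolding sum_inner_Basis2 lap_mult[OF smooth_inner smooth_mult[OF smooth_inner smooth_radial[OF assms]]]
  by (simp add: lap_inner lap_radial1[OF assms] algebra_simps)
qed

section \<open>A radial kernel adapted to the Laplacian\<close>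

text \<open>With y = 1/x the chain rule gives d/dx (P(y) exp(-y)) = y^2 (P(y) - P'(y)) exp(-y),
  which is the recursion.\<close>

primrec flat_poly :: "nat => real poly" where
 "flat_poly 0 = 1"
| "flat_poly (Suc n) = monom 1 2 * (flat_poly n - pderiv (flat_poly n))"

text \<open>The derivatives of \<open>exp (-1/x)\<close>, extended by zero to the negative half line.\<close>

definition flat :: "nat => real => real" where
 "flat n x = (if x > 0 then poly (flat_poly n) (1/x) * exp (- (1/x)) else 0)"

lemma poly_div_exp_tendsto_0: "((%y. poly p y/exp y) \<longlongrightarrow> 0) (at_top :: real filter)"
proof -
 have "((%y. \<Sum>i\<le>degree p. coeff p i * (y^i/exp y)) \<longlongrightarrow> (\<Sum>i\<le>degree p. coeff p i * 0)) (at_top :: real filter)"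
  by (intro tendsto_intros tendsto_power_div_exp_0)
 then show ?thesis by (simp add: poly_altdef sum_divide_distrib)
qed

lemma poly_inverse_exp_tendsto_0:
 "((%x. poly p (1/x) * exp (- (1/x))) \<longlongrightarrow> 0) (at_right (0::real))"
proof -
 have "filterlim (%x. 1/x) at_top (at_right (0::real))"
  using filterlim_inverse_at_top_right by (simp add: inverse_eq_divide)
 from filterlim_compose[OF poly_div_exp_tendsto_0 this]
 show ?thesis by (simp add: exp_minus divide_inverse)
qed

lemma deriv_seq_flat: "deriv_seq flat"
 unfolding deriv_seq_def
proof (intro allI)
 fix n :: nat and x :: real
 consider "x > 0" | "x < 0" | "x = 0" by linarith
 then show "(flat n has_real_derivative flat (Suc n) x) (at x)"
 proof cases
  case 1
  have "((%x. poly (flat_poly n) (1/x) * exp (- (1/x))) has_real_derivative flat (Suc n) x) (at x)"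
   using 1 by (auto intro!: derivative_eq_intros DERIV_chain'[OF _ poly_DERIV]
     simp: flat_def poly_monom field_simps power2_eq_square)
  then show ?thesis
   by (rule has_field_derivative_transform_within[where d=x]) (use 1 in \<open>auto simp: flat_def dist_real_def\<close>)
 next
  case 2
  have "((%x. 0) has_real_derivative flat (Suc n) x) (at x)" using 2 by (simp add: flat_def)
  then show ?thesis
   by (rule has_field_derivative_transform_within[where d="-x"]) (use 2 in \<open>auto simp: flat_def dist_real_def\<close>)
 next
  case 3
  have r: "((%h. flat n h/h) \<longlongrightarrow> 0) (at_right 0)"
  proof (rule Lim_transform_eventually)
   \<comment> \<open>At 0 the difference quotient from the right has the same form as the function
     itself: division by x multiplies the polynomial in 1/x by its variable.\<close>
   show "((%x. poly (pCons 0 (flat_poly n)) (1/x) * exp (- (1/x))) \<longlongrightarrow> 0) (at_right (0::real))"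
    by (rule poly_inverse_exp_tendsto_0)
   show "\<forall>\<^sub>F x in at_right 0. poly (pCons 0 (flat_poly n)) (1/x) * exp (- (1/x)) = flat n x/x"
    by (auto simp: eventually_at_filter flat_def)
  qed
  have "((%h. flat n h/h) \<longlongrightarrow> 0) (at_left 0)"
   by (rule Lim_transform_eventually[of "%_. 0"]) (auto simp: eventually_at_filter flat_def)
  with r have "((%h. flat n h/h) \<longlongrightarrow> 0) (at 0)" by (simp add: filterlim_split_at)
  then show ?thesis by (simp add: 3 DERIV_def flat_def)
 qed
qed

lemma flat_nonneg: "flat 0 x >= 0" "flat (Suc 0) x >= 0"
 by (auto simp: flat_def poly_monom)

lemma flat_pos: "x > 0 ==> flat 0 x > 0" "x > 0 ==> flat (Suc 0) x > 0"
 by (auto simp: flat_def poly_monom)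

lemma flat_eq_0: "x <= 0 ==> flat n x = 0"
 by (auto simp: flat_def)

text \<open>With \<open>R(s) = exp (-1/(1-s))\<close> and \<open>P = -R'\<close>, the function
 \<open>k(s) = 1/4 \<integral>\<^sub>1\<^sup>4 t\<^bsup>N/2-2\<^esup> R(st) dt\<close> satisfies \<open>4sk'' + 2Nk' = P(s) - 2\<^sup>N P(4s)\<close>:
 the left side is the integral of the \<open>t\<close>-derivative of \<open>t\<^bsup>N/2\<^esup> R'(st)\<close>.\<close>

definition bumpR :: "nat => real => real" where
 "bumpR n s = (-1)^n * flat n (1 - s)"

definition bumpP :: "nat => real => real" where
 "bumpP n s = - bumpR (Suc n) s"

definition bumpk :: "nat => nat => real => real" where
 "bumpk N n s = 1/4 * integral {1..4} (%t. t powr (N/2 - 2 + n) * bumpR n (s * t))"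

lemma deriv_seq_bumpR: "deriv_seq bumpR"
 unfolding deriv_seq_def bumpR_def
 by (auto intro!: derivative_eq_intros DERIV_chain'[OF _ deriv_seqD[OF deriv_seq_flat]])

lemma deriv_seq_bumpP: "deriv_seq bumpP"
 using deriv_seq_bumpR unfolding deriv_seq_def bumpP_def
 by (auto intro!: derivative_eq_intros)

lemma deriv_seq_bumpk: "deriv_seq (bumpk N)"
 unfolding deriv_seq_def
proof (intro allI)
 fix n and s :: real
 have cont: "continuous_on (UNIV \<times> cbox 1 4) (%(s, t). t powr (N/2 - 2 + Suc n) * bumpR (Suc n) (s * t))"
  unfolding split_beta
  by (intro continuous_intros continuous_on_compose2[OF deriv_seq_continuous[OF deriv_seq_bumpR, of UNIV]]) auto
 have "((%s. integral (cbox 1 4) (%t. t powr (N/2 - 2 + n) * bumpR n (s * t))) has_real_derivative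
   integral (cbox 1 4) (%t. t powr (N/2 - 2 + Suc n) * bumpR (Suc n) (s * t))) (at s within UNIV)"
 proof (rule leibniz_rule_field_derivative[OF _ _ cont])
  fix s t :: real assume "t : cbox 1 4"
  then have "t powr (N/2 - 2 + Suc n) = t powr (N/2 - 2 + n) * t"
   by (simp add: powr_add[symmetric] powr_mult_base add.commute mult.commute)
  then show "((%s. t powr (N/2 - 2 + n) * bumpR n (s * t)) has_real_derivative
      t powr (N/2 - 2 + Suc n) * bumpR (Suc n) (s * t)) (at s within UNIV)"
   by (auto intro!: derivative_eq_intros DERIV_chain'[OF _ deriv_seqD[OF deriv_seq_bumpR]])
 next
  fix s :: real
  show "(%t. t powr (N/2 - 2 + n) * bumpR n (s * t)) integrable_on cbox 1 4"
   by (intro integrable_continuous continuous_intros continuous_on_compose2[OF deriv_seq_continuous[OF deriv_seq_bumpR, of UNIV]]) auto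
 qed auto
 from DERIV_cmult[OF this, of "1/4"] show "(bumpk N n has_real_derivative bumpk N (Suc n) s) (at s)"
  unfolding bumpk_def[abs_def] by simp
qed

lemma bump_eq_0: "s >= 1 ==> bumpR n s = 0" "s >= 1 ==> bumpP n s = 0" "s >= 1 ==> bumpk N n s = 0"
proof -
 show R: "bumpR n s = 0" if "s >= 1" for n s using that by (simp add: bumpR_def flat_eq_0)
 show "s >= 1 ==> bumpP n s = 0" using R by (simp add: bumpP_def)
 show "bumpk N n s = 0" if "s >= 1"
 proof -
  have "integral {1..4} (%t. t powr (N/2 - 2 + n) * bumpR n (s * t)) = integral {1..4::real} (%t. 0)"
  proof (rule integral_cong)
   fix t :: real assume "t : {1..4}"
   with that have "s * t >= 1" using mult_mono[of 1 s 1 t] by auto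
   then show "t powr (N/2 - 2 + n) * bumpR n (s * t) = 0" using R by simp
  qed
  then show ?thesis by (simp add: bumpk_def)
 qed
qed

lemma bump_nonneg: "bumpP 0 s >= 0" "bumpk N 0 s >= 0"
 unfolding bumpP_def bumpR_def bumpk_def
 using flat_nonneg by (auto intro!: integral_nonneg integrable_continuous_interval continuous_intros 
   continuous_on_compose2[OF deriv_seq_continuous[OF deriv_seq_flat, of UNIV]])

lemma bump_ode0: "4 * s * bumpk N 2 s + 2 * N * bumpk N 1 s = bumpP 0 s - 2^N * bumpP 0 (4 * s)"
proof -
 define F where "F t = t powr (N/2) * bumpR 1 (s * t)" for t
 define F' where "F' t = N/2 * (t powr (N/2 - 1) * bumpR 1 (s * t)) + s * (t powr (N/2) * bumpR 2 (s * t))" for t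
 have "(F has_vector_derivative F' t) (at t within {1..4})" if "t : {1..4}" for t
 proof -
  have "(F has_real_derivative F' t) (at t)"
   unfolding F_def F'_def using that
   by (auto intro!: derivative_eq_intros DERIV_chain'[OF _ deriv_seqD[OF deriv_seq_bumpR]] simp: numeral_2_eq_2)
  then show ?thesis
   by (simp add: has_real_derivative_iff_has_vector_derivative has_vector_derivative_at_within)
 qed
 then have I: "(F' has_integral F 4 - F 1) {1..4}"
  by (intro fundamental_theorem_of_calculus) auto
 have i1: "(%t. t powr (N/2 - 1) * bumpR 1 (s * t)) integrable_on {1..4}"
  and i2: "(%t. t powr (N/2) * bumpR 2 (s * t)) integrable_on {1..4}"
  by (intro integrable_continuous_interval continuous_intros continuous_on_compose2[OF deriv_seq_continuous[OF deriv_seq_bumpR, of UNIV]]; auto)+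
 have "F 4 - F 1 = integral {1..4} F'" using I by (simp add: integral_unique)
 also have "... = N/2 * integral {1..4} (%t. t powr (N/2 - 1) * bumpR 1 (s * t))
   + s * integral {1..4} (%t. t powr (N/2) * bumpR 2 (s * t))"
  unfolding F'_def
  by (subst integral_add[OF integrable_on_mult_right[OF i1] integrable_on_mult_right[OF i2]]) simp
 also have "... = 4 * s * bumpk N 2 s + 2 * N * bumpk N 1 s"
  by (simp add: bumpk_def)
 finally have "4 * s * bumpk N 2 s + 2 * N * bumpk N 1 s = F 4 - F 1" by simp
 moreover have "(4::real) powr (N/2) = 2^N"
 proof -
  have "(4::real) powr (N/2) = (2 powr 2) powr (N/2)" by simp
  also have "... = 2 powr N" unfolding powr_powr by simp
  finally show ?thesis by (simp add: powr_realpow)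
 qed
 ultimately show ?thesis by (simp add: F_def bumpP_def mult.commute)
qed

text \<open>The case n = 0 differentiated n times in s. Uniqueness of derivatives reduces each
  induction step to comparing the derivatives of the two sides.\<close>

lemma bump_ode:
 "4 * s * bumpk N (Suc (Suc n)) s + (2 * N + 4 * n) * bumpk N (Suc n) s = bumpP n s - 2^N * 4^n * bumpP n (4 * s)"
proof (induction n arbitrary: s)
 case 0 show ?case using bump_ode0[of s N] by (simp add: numeral_2_eq_2)
next
 case (Suc n)
 note D = deriv_seqD[OF deriv_seq_bumpk, of N] deriv_seqD[OF deriv_seq_bumpP]
 have "((%s. 4 * s * bumpk N (Suc (Suc n)) s + (2 * real N + 4 * real n) * bumpk N (Suc n) s) has_real_derivative
   4 * s * bumpk N (Suc (Suc (Suc n))) s + (2 * real N + 4 * real (Suc n)) * bumpk N (Suc (Suc n)) s) (at s)"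
  by (auto intro!: derivative_eq_intros D simp: algebra_simps)
 moreover have "((%s. bumpP n s - 2^N * 4^n * bumpP n (4 * s)) has_real_derivative
   bumpP (Suc n) s - 2^N * 4^Suc n * bumpP (Suc n) (4 * s)) (at s)"
  by (auto intro!: derivative_eq_intros D DERIV_chain'[OF _ D(2)])
 ultimately show ?case unfolding Suc.IH by (rule DERIV_unique)
qed

section \<open>Integration by parts and mollification\<close>

lemma emeasure_ball_finite [simp]: "emeasure lborel (ball (c::'a::euclidean_space) r) < top"
 using emeasure_bounded_finite[OF bounded_ball] by simp

lemma integrable_indicator_ball [simp]: "integrable lborel (indicator (ball (c::'a::euclidean_space) r) :: 'a => real)"
 by (rule integrable_real_indicator) auto

lemma integrable_bounded_support:
 fixes f :: "'a::euclidean_space => real"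
 assumes "f : borel_measurable borel" "!!x. abs (f x) <= B" "bounded S" "!!x. x ~: S ==> f x = 0"
 shows "integrable lborel f"
proof -
 obtain r where r: "S <= ball 0 r" using assms(3) bounded_subset_ballD by blast
 show ?thesis
  by (rule integrableI_bounded_set[where A="ball 0 r" and B=B])
    (use assms(1,2,4) r in \<open>auto intro!: AE_I2 assms(4) simp: subset_iff\<close>)
qed

lemma abs_integral_le_ball:
 fixes f :: "'a::euclidean_space => real"
 assumes "!!x. x : ball c r ==> abs (f x) <= B" "!!x. x ~: ball c r ==> f x = 0" "B >= 0"
 shows "abs (LINT x|lborel. f x) <= B * measure lborel (ball c r)"
proof -
 have "abs (LINT x|lborel. f x) <= (LINT x|lborel. B * indicator (ball c r) x)"
 proof (cases "integrable lborel f")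
  case True
  then have "abs (LINT x|lborel. f x) <= (LINT x|lborel. abs (f x))"
   using integral_norm_bound[of lborel f] by simp
  also have "... <= (LINT x|lborel. B * indicator (ball c r) x)"
   by (rule integral_mono) (use True assms in \<open>auto simp del: mem_ball split: split_indicator\<close>)
  finally show ?thesis .
 next
  \<comment> \<open>The integral of a function that is not integrable is 0 by convention, so the
    bound holds because B is nonnegative.\<close>
  case False
  then show ?thesis using assms(3) by (simp add: not_integrable_integral_eq)
 qed
 then show ?thesis by simp
qed

lemma bounded_support_bound:
 fixes f :: "'a::euclidean_space => real"
 assumes "continuous_on UNIV f" "bounded S" "!!x. x ~: S ==> f x = 0"
 shows "EX B>=0. ALL x. abs (f x) <= B"
proof -
 obtain r where r: "S <= cball 0 r" using assms(2) bounded_subset_ballD ball_subset_cball by (metis subset_trans)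
 have "bounded (f ` cball 0 r)"
  by (intro compact_imp_bounded compact_continuous_image continuous_on_subset[OF assms(1)]) auto
 then obtain B where "ALL x:cball 0 r. abs (f x) <= B" by (auto simp: bounded_iff)
 then have "abs (f x) <= max B 0" for x using r assms(3)[of x] by (cases "x : S") force+
 then show ?thesis by (meson max.cobounded2)
qed

lemma integrable_continuous_support:
 fixes f :: "'a::euclidean_space => real"
 assumes "continuous_on UNIV f" "bounded S" "!!x. x ~: S ==> f x = 0"
 shows "integrable lborel f"
 using bounded_support_bound[OF assms] integrable_bounded_support[of f _ S] assms(2,3)
  borel_measurable_continuous_onI[OF assms(1)] by blast

lemma bounded_support_uniformly_continuous:
 fixes f :: "'a::euclidean_space => real"
 assumes c: "continuous_on UNIV f" and "bounded S" "!!x. x ~: S ==> f x = 0"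
 shows "uniformly_continuous_on UNIV f"
 unfolding uniformly_continuous_on_def
proof (intro allI impI)
 fix e :: real assume e: "e > 0"
 obtain r where r: "S <= cball 0 r" using assms(2) bounded_subset_ballD ball_subset_cball by (metis subset_trans)
 have "uniformly_continuous_on (cball 0 (r + 1)) f"
  by (intro compact_uniformly_continuous continuous_on_subset[OF c]) auto
 then obtain d where d: "d > 0" "!!x y. x : cball 0 (r+1) ==> y : cball 0 (r+1) ==> dist y x < d ==> dist (f y) (f x) < e"
  unfolding uniformly_continuous_on_def using e by metis
 show "EX d>0. ALL x:UNIV. ALL x':UNIV. dist x' x < d --> dist (f x') (f x) < e"
 proof (intro exI[of _ "min d 1"] conjI ballI impI)
  fix x y :: 'a assume xy: "dist y x < min d 1"
  show "dist (f y) (f x) < e"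
  proof (cases "x : cball 0 (r+1) & y : cball 0 (r+1)")
   case True then show ?thesis using d xy by auto
  next
   case False
   have "x ~: cball 0 r" "y ~: cball 0 r"
    using False xy norm_triangle_ineq2[of x y] norm_triangle_ineq2[of y x]
    by (auto simp: dist_norm norm_minus_commute)
   then have "f x = 0" "f y = 0" using assms(3) r by blast+
   then show ?thesis using e by simp
  qed
 qed (use d in auto)
qed

lemma lborel_integral_affine:
 fixes f :: "'a::euclidean_space => real"
 assumes [measurable]: "f : borel_measurable borel" and c: "c ~= 0"
 shows "(LINT x|lborel. f x) = abs c^DIM('a) * (LINT x|lborel. f (t + c *\<^sub>R x))"
 by (subst lborel_affine[OF c, of t]) (simp add: integral_density integral_distr)

lemma lborel_integral_translate:
 fixes f :: "'a::euclidean_space => real"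
 assumes "f : borel_measurable borel"
 shows "(LINT x|lborel. f (x + a)) = (LINT x|lborel. f x)"
 using lborel_integral_affine[OF assms, of 1 a] by (simp add: add.commute)

lemma Ck1_abs_diff_le:
 fixes f :: "'a::euclidean_space => real" and B :: real
 assumes f: "!!x. f differentiable at x" and S: "convex S" "a : S" "b : S"
  and B: "!!x i. x : S ==> i : Basis ==> abs (partial i f x) <= B"
 shows "abs (f b - f a) <= DIM('a) * B * norm (b - a)"
proof -
 have "norm (f b - f a) <= (real DIM('a) * B) * norm (b - a)"
 proof (rule differentiable_bound[OF S(1) _ _ S(3,2)])
  fix x assume x: "x : S"
  show "(f has_derivative (%h. \<Sum>i\<in>Basis. (h \<bullet> i) * partial i f x)) (at x within S)"
   using has_derivative_partial[OF f] by (rule has_derivative_at_withinI)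
  show "onorm (%h. \<Sum>i\<in>Basis. (h \<bullet> i) * partial i f x) <= DIM('a) * B"
  proof (rule onorm_le)
   fix h :: 'a
   have "norm (\<Sum>i\<in>Basis. (h \<bullet> i) * partial i f x) <= (\<Sum>i\<in>Basis. abs ((h \<bullet> i)) * abs (partial i f x))"
    by (rule order_trans[OF norm_sum]) (simp add: abs_mult)
   also have "... <= (\<Sum>i\<in>(Basis::'a set). norm h * B)"
    by (intro sum_mono mult_mono Basis_le_norm B x) auto
   finally show "norm (\<Sum>i\<in>Basis. (h \<bullet> i) * partial i f x) <= DIM('a) * B * norm h"
    by (simp add: mult_ac)
  qed
 qed
 then show ?thesis by simp
qed

lemma partial_eq_0_outside:
 assumes "open U" "x : U" "!!y. y : U ==> f y = 0"
 shows "partial i f x = 0"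
proof -
 have "(f has_derivative (%h. 0)) (at x)"
  by (rule has_derivative_transform_within_open[OF has_derivative_const assms(1,2)]) (use assms in auto)
 from partial_eqI[OF this] show ?thesis by simp
qed

lemma partial_support:
 assumes "closed K" "!!x. x ~: K ==> f x = 0" "x ~: K"
 shows "partial i f x = 0"
 using partial_eq_0_outside[of "- K" x f i] assms by auto

lemma lap_support:
 assumes "closed K" "!!x. x ~: K ==> f x = 0" "x ~: K"
 shows "lap f x = 0"
 unfolding lap_def using partial_support[OF assms(1) partial_support[OF assms(1,2)] assms(3)] by simp

text \<open>By translation invariance every difference quotient has integral 0; dominated
  convergence passes this on to the partial derivative.\<close>

lemma integral_partial_eq_0:
 fixes f :: "'a::euclidean_space => real"
 assumes f: "Ck 1 f" and i: "i : Basis" and K: "compact K" "!!x. x ~: K ==> f x = 0"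
 shows "(LINT x|lborel. partial i f x) = 0"
proof -
 have diff: "f differentiable at x" for x using f Ck_differentiable[of 0 f] by simp
 have cp: "continuous_on UNIV (partial j f)" if "j : Basis" for j using f that by simp
 have cf: "continuous_on UNIV f" using f by (rule Ck_continuous)
 note [measurable] = borel_measurable_continuous_onI[OF cf] borel_measurable_continuous_onI[OF cp[OF i]]
 have bK: "bounded K" using K(1) compact_imp_bounded by blast
 have "EX B>=0. ALL x. abs (partial j f x) <= B" if "j : Basis" for j
  by (rule bounded_support_bound[OF cp[OF that] bK]) (use partial_support K compact_imp_closed in blast)
 then obtain B where B: "!!j x. j : Basis ==> abs (partial j f x) <= B j" "!!j. j : Basis ==> B j >= 0" by metis
 define M where "M = (\<Sum>j\<in>Basis. B j)"
 have M: "abs (partial j f x) <= M" if "j : Basis" for j x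
  using B that unfolding M_def by (metis (no_types, lifting) dual_order.trans finite_Basis member_le_sum DiffD1)
 define h where "h n = 1/(real n + 1)" for n
 have h: "h n > 0" "h n <= 1" for n by (auto simp: h_def)
 obtain r where r: "K <= ball 0 r" using bK bounded_subset_ballD by blast
 have intf: "integrable lborel f" by (rule integrable_continuous_support[OF cf bK K(2)])
 have int_sh: "integrable lborel (%x. f (x + h n *\<^sub>R i))" for n
 proof (rule integrable_continuous_support)
  show "continuous_on UNIV (%x. f (x + h n *\<^sub>R i))"
   by (intro continuous_on_compose2[OF cf] continuous_intros) auto
  show "bounded ((%x. - (h n *\<^sub>R i) + x) ` K)" using bK by (rule bounded_translation)
  show "f (x + h n *\<^sub>R i) = 0" if "x ~: (%x. - (h n *\<^sub>R i) + x) ` K" for x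
   using that K(2) by (metis (no_types, lifting) add.commute add_diff_cancel image_iff uminus_add_conv_diff)
 qed
 have lim: "(%n. LINT x|lborel. (f (x + h n *\<^sub>R i) - f x)/h n) ----> (LINT x|lborel. partial i f x)"
 proof (rule integral_dominated_convergence[where w="%x. (DIM('a) * M) * indicator (ball 0 (r + 1)) x"])
  show "(%x. (f (x + h n *\<^sub>R i) - f x)/h n) : borel_measurable lborel" for n by measurable
  show "integrable lborel (%x. (DIM('a) * M) * indicator (ball 0 (r + 1)) x :: real)"
   by simp
  show "AE x in lborel. norm ((f (x + h n *\<^sub>R i) - f x)/h n) <= (DIM('a) * M) * indicator (ball 0 (r + 1)) x" for n
  proof (intro AE_I2)
   fix x :: 'a
   have "abs (f (x + h n *\<^sub>R i) - f x) <= DIM('a) * M * norm (x + h n *\<^sub>R i - x)"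
    by (rule Ck1_abs_diff_le[OF diff convex_UNIV]) (use M in auto)
   then have "abs (f (x + h n *\<^sub>R i) - f x)/h n <= DIM('a) * M"
    using h[of n] i by (simp add: divide_le_eq)
   moreover have "f (x + h n *\<^sub>R i) = 0 & f x = 0" if "x ~: ball 0 (r + 1)"
   proof -
    have "norm (x + h n *\<^sub>R i) >= norm x - 1" 
     using norm_diff_ineq[of x "h n *\<^sub>R i"] h[of n] i by auto
    then have "x + h n *\<^sub>R i ~: ball 0 r" "x ~: ball 0 r" using that by auto
    then show ?thesis using r K(2) by blast
   qed
   ultimately show "norm ((f (x + h n *\<^sub>R i) - f x)/h n) <= (DIM('a) * M) * indicator (ball 0 (r + 1)) x"
    using h[of n] by (auto simp: indicator_def)
  qed
  show "AE x in lborel. (%n. (f (x + h n *\<^sub>R i) - f x)/h n) ----> partial i f x"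
  proof (intro AE_I2)
   fix x
   have "((%t. x + t *\<^sub>R i) has_derivative (%t. t *\<^sub>R i)) (at (0::real))"
    by (auto intro!: derivative_eq_intros)
   moreover have "(f has_derivative frechet_derivative f (at x)) (at (x + 0 *\<^sub>R i))"
    using diff[of x, unfolded frechet_derivative_works] by simp
   ultimately have "((%t. f (x + t *\<^sub>R i)) has_derivative (%t. frechet_derivative f (at x) (t *\<^sub>R i))) (at (0::real))"
    by (rule has_derivative_compose)
   moreover have "(%t. frechet_derivative f (at x) (t *\<^sub>R i)) = (*) (partial i f x)"
    using diff[of x] frechet_derivative_works has_derivative_linear[of f]
    by (fastforce simp: partial_def linear_scale mult.commute)
   ultimately have "((%t. f (x + t *\<^sub>R i)) has_real_derivative partial i f x) (at 0)"
    by (simp add: has_field_derivative_def)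
   then have "((%t. (f (x + t *\<^sub>R i) - f x)/t) \<longlongrightarrow> partial i f x) (at 0)"
    by (simp add: DERIV_def)
   moreover have "filterlim h (at 0) sequentially"
    unfolding h_def filterlim_at using LIMSEQ_inverse_real_of_nat
    by (auto simp: inverse_eq_divide add.commute intro!: always_eventually)
   ultimately show "(%n. (f (x + h n *\<^sub>R i) - f x)/h n) ----> partial i f x"
    by (rule filterlim_compose)
  qed
 qed (use cp[OF i] in measurable)
 have "(LINT x|lborel. (f (x + h n *\<^sub>R i) - f x)/h n) = 0" for n
  using intf int_sh lborel_integral_translate[of f "h n *\<^sub>R i"] by simp
 with lim show ?thesis by (simp only: LIMSEQ_const_iff)
qed

lemma integral_by_parts:
 fixes f g :: "'a::euclidean_space => real"
 assumes "Ck 1 f" "Ck 1 g" "i : Basis" "compact K" "!!x. x ~: K ==> g x = 0"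
 shows "(LINT x|lborel. f x * partial i g x) = - (LINT x|lborel. partial i f x * g x)"
proof -
 have d: "f differentiable at x" "g differentiable at x" for x
  using assms(1,2) Ck_differentiable[of 0] by auto
 have c: "continuous_on UNIV f" "continuous_on UNIV g" using assms(1,2) Ck_continuous by blast+
 have cp: "continuous_on UNIV (partial i f)" "continuous_on UNIV (partial i g)" using assms(1-3) by auto
 have bK: "bounded K" "closed K" using assms(4) compact_imp_bounded compact_imp_closed by auto
 have 1: "integrable lborel (%x. f x * partial i g x)"
  by (rule integrable_continuous_support[OF _ bK(1)])
    (use partial_support[OF bK(2) assms(5)] in \<open>auto intro!: continuous_intros c cp\<close>)
 have 2: "integrable lborel (%x. partial i f x * g x)"
  by (rule integrable_continuous_support[OF _ bK(1)])
    (use assms(5) in \<open>auto intro!: continuous_intros c cp\<close>)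
 have "(LINT x|lborel. partial i (%x. f x * g x) x) = 0"
  by (rule integral_partial_eq_0[OF Ck_mult[OF assms(1,2)] assms(3,4)]) (use assms(5) in auto)
 then show ?thesis using 1 2 by (simp add: partial_mult[OF d])
qed

section \<open>Convolutions and weighted averages at scale t\<close>

definition conv :: "('a::euclidean_space => real) => ('a => real) => 'a => real" where
 "conv u k x = (LINT y|lborel. u y * k (x - y))"

text \<open>The average of u around x at scale t with weight a. Keeping the kernel fixed and scaling
  the argument of u makes the limit t -> 0 and the comparison of the scales t and t/2 transparent.
  The weight may change sign, as the derivatives of a mollifier do.\<close>

definition Sop :: "real => ('a::euclidean_space => real) => ('a => real) => 'a => real" where
 "Sop t a u x = (LINT z|lborel. a z * u (x - t *\<^sub>R z))"

definition bdd_borel :: "('a::euclidean_space => real) => bool" where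
 "bdd_borel u \<longleftrightarrow> u : borel_measurable borel & (EX B. ALL x. abs (u x) <= B)"

lemma bdd_borelD:
 assumes "bdd_borel u"
 shows "u : borel_measurable borel" "EX B>0. ALL x. abs (u x) <= B"
proof -
 show "u : borel_measurable borel" using assms by (simp add: bdd_borel_def)
 obtain B where "ALL x. abs (u x) <= B" using assms by (auto simp: bdd_borel_def)
 then have "ALL x. abs (u x) <= abs B + 1" by (metis abs_ge_self add_increasing2 order_trans zero_le_one)
 then show "EX B>0. ALL x. abs (u x) <= B" by (intro exI[of _ "abs B + 1"]) auto
qed

lemma bdd_borelI: "u : borel_measurable borel ==> (!!x. abs (u x) <= B) ==> bdd_borel u"
 by (auto simp: bdd_borel_def)

lemma bdd_borel_continuous_support:
 fixes f :: "'a::euclidean_space => real"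
 assumes "continuous_on UNIV f" "bounded S" "!!x. x ~: S ==> f x = 0"
 shows "bdd_borel f"
 using bounded_support_bound[OF assms] borel_measurable_continuous_onI[OF assms(1)]
 unfolding bdd_borel_def by blast

text \<open>The partial derivatives of a C^1 kernel with bounded support are uniformly continuous,
  which makes the linearisation error uniform in z. Only a uniform error survives the integration
  against a bounded function.\<close>

lemma partial_linearization:
 fixes k :: "'a::euclidean_space => real"
 assumes k: "Ck 1 k" and K: "bounded K" "closed K" "!!x. x ~: K ==> k x = 0" and e: "e > 0"
 shows "EX d>0. ALL z h. norm h < d --> abs (k (z + h) - k z - (\<Sum>i\<in>Basis. (h \<bullet> i) * partial i k z)) <= e * norm h"
proof -
 have diff: "k differentiable at x" for x using k Ck_differentiable[of 0 k] by simp
 have "uniformly_continuous_on UNIV (partial i k)" if "i : Basis" for i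
  by (rule bounded_support_uniformly_continuous[OF _ K(1)])
    (use k that partial_support[OF K(2,3)] in auto)
 then have "ALL i:Basis. EX d>0. ALL x y. dist x y < d --> dist (partial i k x) (partial i k y) < e/DIM('a)"
  unfolding uniformly_continuous_on_def using e by (metis DIM_positive UNIV_I divide_pos_pos of_nat_0_less_iff)
 then obtain d where d: "!!i. i : Basis ==> d i > 0"
  "!!i x y. i : Basis ==> dist x y < d i ==> dist (partial i k x) (partial i k y) < e/DIM('a)"
  by metis
 define delta where "delta = Min (d ` Basis)"
 have delta: "delta > 0" "!!i. i : Basis ==> delta <= d i" using d(1) by (auto simp: delta_def)
 have "abs (k (z + h) - k z - (\<Sum>i\<in>Basis. (h \<bullet> i) * partial i k z)) <= e * norm h" if h: "norm h < delta" for z h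
 proof -
  have "norm (k (z + h) - k z - (\<Sum>i\<in>Basis. ((z + h - z) \<bullet> i) * partial i k z)) <= norm (z + h - z) * e"
  proof (rule differentiable_bound_linearization[where S="ball z delta"])
   show "z + t *\<^sub>R (z + h - z) : ball z delta" if "t : {0..1}" for t
    using that h mult_right_mono[of t 1 "norm h"] by (auto simp: dist_norm)
   show "(k has_derivative (%h. \<Sum>i\<in>Basis. (h \<bullet> i) * partial i k x)) (at x within ball z delta)" for x
    using has_derivative_partial[OF diff] by (rule has_derivative_at_withinI)
   show "z : ball z delta" using delta by simp
   fix x assume x: "x : ball z delta"
   show "onorm ((%h. \<Sum>i\<in>Basis. (h \<bullet> i) * partial i k x) - (%h. \<Sum>i\<in>Basis. (h \<bullet> i) * partial i k z)) <= e"
   proof (rule onorm_le)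
    fix h :: 'a
    have "norm (((%h. \<Sum>i\<in>Basis. (h \<bullet> i) * partial i k x) - (%h. \<Sum>i\<in>Basis. (h \<bullet> i) * partial i k z)) h)
     = norm (\<Sum>i\<in>Basis. (h \<bullet> i) * (partial i k x - partial i k z))"
     by (simp add: sum_subtractf right_diff_distrib)
    also have "... <= (\<Sum>i\<in>(Basis::'a set). abs (h \<bullet> i) * abs (partial i k x - partial i k z))"
     by (rule order_trans[OF norm_sum]) (simp add: abs_mult)
    also have "... <= (\<Sum>i\<in>(Basis::'a set). norm h * (e/DIM('a)))"
    proof (intro sum_mono mult_mono Basis_le_norm)
     fix i :: 'a assume i: "i : Basis"
     have "dist x z < d i" using x delta(2)[OF i] by (auto simp: dist_commute)
     from d(2)[OF i this] show "abs (partial i k x - partial i k z) <= e/DIM('a)"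
      by (simp add: dist_real_def)
    qed auto
    finally show "norm (((%h. \<Sum>i\<in>Basis. (h \<bullet> i) * partial i k x) - (%h. \<Sum>i\<in>Basis. (h \<bullet> i) * partial i k z)) h) <= e * norm h"
     by (simp add: mult.commute)
   qed
  qed
  then show ?thesis by (simp add: mult.commute)
 qed
 with delta(1) show ?thesis by blast
qed

lemma conv_integrable:
 fixes u k :: "'a::euclidean_space => real"
 assumes u: "bdd_borel u" and k: "continuous_on UNIV k" "bounded K" "!!x. x ~: K ==> k x = 0"
 shows "integrable lborel (%y. u y * k (x - y))"
proof -
 obtain B where B: "!!y. abs (u y) <= B" "B > 0" using bdd_borelD(2)[OF u] by blast
 obtain M where M: "!!y. abs (k y) <= M" "M >= 0" using bounded_support_bound[OF k] by blast
 have [measurable]: "u : borel_measurable borel" "k : borel_measurable borel"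
  using u k(1) by (auto simp: bdd_borel_def intro: borel_measurable_continuous_onI)
 show ?thesis
 proof (rule integrable_bounded_support[where B="B * M" and S="(%z. x - z) ` K"])
  show "abs (u y * k (x - y)) <= B * M" for y
   unfolding abs_mult by (intro mult_mono B M) (use B(2) in auto)
  have "bounded ((%z. x + z) ` ((%z. - z) ` K))" using k(2) by (intro bounded_translation) (simp add: bounded_uminus)
  then show "bounded ((%z. x - z) ` K)" by (simp add: image_image)
  show "u y * k (x - y) = 0" if "y ~: (%z. x - z) ` K" for y
  proof -
   have "y = x - (x - y)" by simp
   then have "x - y ~: K" using that by blast
   then show ?thesis using k(3) by simp
  qed
 qed measurable
qed

lemma conv_has_derivative:
 fixes u k :: "'a::euclidean_space => real"
 assumes u: "bdd_borel u" and k: "Ck 1 k" and K: "compact K" "!!x. x ~: K ==> k x = 0"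
 shows "(conv u k has_derivative (%h. \<Sum>i\<in>Basis. (h \<bullet> i) * conv u (partial i k) x)) (at x)"
proof -
 have bK: "bounded K" "closed K" using K(1) compact_imp_bounded compact_imp_closed by auto
 obtain B where B: "!!y. abs (u y) <= B" "B > 0" using bdd_borelD(2)[OF u] by blast
 have ck: "continuous_on UNIV k" using k Ck_continuous by blast
 have cp: "continuous_on UNIV (partial i k)" if "i : Basis" for i using k that by simp
 have i1: "integrable lborel (%y. u y * k (x - y))" for x
  by (rule conv_integrable[OF u ck bK(1) K(2)])
 have i2: "integrable lborel (%y. u y * partial i k (x - y))" if "i : Basis" for i x
  by (rule conv_integrable[OF u cp[OF that] bK(1)]) (use partial_support[OF bK(2) K(2)] in auto)
 obtain r where r: "K <= ball 0 r" using bK(1) bounded_subset_ballD by blast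
 \<comment> \<open>For increments below 1 the integrand vanishes outside the ball of radius
   \<open>r + 1\<close>, so a pointwise error of \<open>e/(B * V) * norm h\<close> in the kernel
   integrates to at most \<open>e * norm h\<close>. The summand 1 keeps V positive.\<close>
 define V where "V = measure lborel (ball x (r + 1)) + 1"
 have V: "V > 0" "measure lborel (ball x (r + 1)) <= V" unfolding V_def by (auto simp: add_nonneg_pos)
 show ?thesis
  unfolding has_derivative_at_alt
 proof (intro conjI allI impI)
  show "bounded_linear (%h. \<Sum>i\<in>Basis. (h \<bullet> i) * conv u (partial i k) x)"
   by (intro bounded_linear_sum bounded_linear_mult_const bounded_linear_inner_left)
  fix e :: real assume e: "e > 0"
  obtain d where d: "d > 0" "!!z h. norm h < d ==>
    abs (k (z + h) - k z - (\<Sum>i\<in>Basis. (h \<bullet> i) * partial i k z)) <= (e/(B * V)) * norm h"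
   using partial_linearization[OF k bK K(2), of "e/(B * V)"] e B(2) V(1) by (metis divide_pos_pos mult_pos_pos)
  show "EX d>0. ALL y. norm (y - x) < d -->
    norm (conv u k y - conv u k x - (\<Sum>i\<in>Basis. ((y - x) \<bullet> i) * conv u (partial i k) x)) <= e * norm (y - x)"
  proof (intro exI[of _ "min d 1"] conjI allI impI)
   fix y assume y: "norm (y - x) < min d 1"
   define h where "h = y - x"
   define F where "F w = u w * (k ((x - w) + h) - k (x - w) - (\<Sum>i\<in>Basis. (h \<bullet> i) * partial i k (x - w)))" for w
   have "F w = u w * k (y - w) - u w * k (x - w) - (\<Sum>i\<in>Basis. (h \<bullet> i) * (u w * partial i k (x - w)))" for w
    unfolding F_def h_def by (simp add: algebra_simps sum_distrib_left)
   then have "(LINT w|lborel. F w) = conv u k y - conv u k x - (\<Sum>i\<in>Basis. (h \<bullet> i) * conv u (partial i k) x)"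
    using i1 i2 by (simp add: conv_def Lint_sum)
   moreover have "abs (LINT w|lborel. F w) <= (B * ((e/(B * V)) * norm h)) * measure lborel (ball x (r + 1))"
   proof (rule abs_integral_le_ball)
    fix w assume "w : ball x (r + 1)"
    show "abs (F w) <= B * ((e/(B * V)) * norm h)"
     unfolding F_def abs_mult by (intro mult_mono B d) (use y B(2) in \<open>auto simp: h_def\<close>)
   next
    fix w assume w: "w ~: ball x (r + 1)"
    have "norm (x - w) >= r + 1" using w by (simp add: dist_norm)
    moreover have "norm (x - w + h) >= norm (x - w) - norm h" by (metis norm_diff_ineq)
    ultimately have "x - w ~: ball 0 r" "x - w + h ~: ball 0 r" using y by (auto simp: h_def)
    then have "x - w ~: K" "x - w + h ~: K" using r by blast+
    then show "F w = 0" unfolding F_def using K(2) partial_support[OF bK(2) K(2)] by simp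
   qed (use B(2) e V(1) in simp)
   moreover have "(B * ((e/(B * V)) * norm h)) * measure lborel (ball x (r + 1)) <= (B * ((e/(B * V)) * norm h)) * V"
    by (intro mult_left_mono V) (use B(2) e V(1) in simp)
   moreover have "(B * ((e/(B * V)) * norm h)) * V = e * norm h" using B(2) V(1) by simp
   ultimately show "norm (conv u k y - conv u k x - (\<Sum>i\<in>Basis. ((y - x) \<bullet> i) * conv u (partial i k) x)) <= e * norm (y - x)"
    by (simp add: h_def)
  qed (use d in auto)
 qed
qed

lemma conv_partial:
 fixes u k :: "'a::euclidean_space => real"
 assumes "bdd_borel u" "smooth k" "compact K" "!!x. x ~: K ==> k x = 0" "i : Basis"
 shows "partial i (conv u k) x = conv u (partial i k) x"
proof -
 have "partial i (conv u k) x = (\<Sum>j\<in>Basis. (i \<bullet> j) * conv u (partial j k) x)"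
  by (rule partial_eqI[OF conv_has_derivative[OF assms(1) smooth_Ck[OF assms(2)] assms(3,4)]])
 also have "... = (\<Sum>j\<in>Basis. if j = i then conv u (partial j k) x else 0)"
  by (rule sum.cong) (use assms(5) in \<open>auto simp: inner_Basis\<close>)
 finally show ?thesis using assms(5) by simp
qed

lemma conv_Ck:
 fixes u k :: "'a::euclidean_space => real"
 assumes "bdd_borel u" "compact K"
 shows "smooth k ==> (!!x. x ~: K ==> k x = 0) ==> Ck n (conv u k)"
proof (induction n arbitrary: k)
 case 0
 have "conv u k differentiable at x" for x
  using conv_has_derivative[OF assms(1) smooth_Ck[OF 0(1)] assms(2) 0(2)] differentiable_def by blast
 then show ?case by (simp add: continuous_on_eq_continuous_at differentiable_imp_continuous_within)
next
 case (Suc n)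
 have "conv u k differentiable at x" for x
  using conv_has_derivative[OF assms(1) smooth_Ck[OF Suc(2)] assms(2) Suc(3)] differentiable_def by blast
 moreover have "Ck n (partial i (conv u k))" if i: "i : Basis" for i
 proof -
  have "partial i (conv u k) = conv u (partial i k)"
   using conv_partial[OF assms(1) Suc(2) assms(2) Suc(3) i] by blast
  moreover have "Ck n (conv u (partial i k))"
   by (rule Suc.IH) (use Suc.prems i smooth_partial partial_support[OF compact_imp_closed[OF assms(2)]] in blast)+
  ultimately show ?thesis by simp
 qed
 ultimately show ?case by (simp add: differentiable_on_eq_differentiable_at)
qed

definition unit_kernel :: "('a::euclidean_space => real) => bool" where
 "unit_kernel a \<longleftrightarrow> smooth a & (ALL z. norm z >= 1 --> a z = 0)"

lemma unit_kernelD: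
 assumes "unit_kernel a"
 shows "smooth a" "norm z >= 1 ==> a z = 0" "z ~: ball 0 1 ==> a z = 0" "z ~: cball 0 1 ==> a z = 0"
  "continuous_on S a" "a : borel_measurable borel" "EX A>=0. ALL z. abs (a z) <= A" "integrable lborel a"
proof -
 show s: "smooth a" and z: "norm z >= 1 ==> a z = 0" for z using assms by (auto simp: unit_kernel_def)
 show "z ~: ball 0 1 ==> a z = 0" "z ~: cball 0 1 ==> a z = 0" for z using z by auto
 show "continuous_on S a" by (rule smooth_continuous[OF s])
 show "a : borel_measurable borel" by (rule borel_measurable_continuous_onI[OF smooth_continuous[OF s]])
 show "EX A>=0. ALL z. abs (a z) <= A"
  by (rule bounded_support_bound[OF smooth_continuous[OF s] bounded_ball[of 0 1]]) (use z in auto)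
 show "integrable lborel a"
  by (rule integrable_continuous_support[OF smooth_continuous[OF s] bounded_ball[of 0 1]]) (use z in auto)
qed

lemma unit_kernel_partial:
 assumes "unit_kernel a" "i : Basis" shows "unit_kernel (partial i a)"
 unfolding unit_kernel_def
proof (intro conjI allI impI)
 show s: "smooth (partial i a)" using assms smooth_partial unit_kernelD(1) by blast
 fix z :: 'a assume z: "norm z >= 1"
 have out: "partial i a z = 0" if "norm z > 1" for z
  by (rule partial_support[of "cball 0 1" a z i]) (use unit_kernelD(2)[OF assms(1)] that in auto)
 show "partial i a z = 0"
 proof (cases "norm z > 1")
  \<comment> \<open>On the unit sphere itself the derivative is the limit of its values at points
    slightly outside, where it vanishes.\<close>
  case False
  with z have z1: "norm z = 1" by simp
  have "((%n. partial i a ((1 + 1/Suc n) *\<^sub>R z)) ----> partial i a ((1 + 0) *\<^sub>R z))"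
   by (intro continuous_on_tendsto_compose[OF smooth_continuous[OF s, of UNIV]] tendsto_intros LIMSEQ_Suc[OF lim_1_over_n]) auto
  moreover have "partial i a ((1 + 1/Suc n) *\<^sub>R z) = 0" for n
   by (rule out) (simp add: z1)
  ultimately show ?thesis by (simp add: LIMSEQ_const_iff)
 qed (rule out)
qed

lemma Sop_conv:
 fixes u a :: "'a::euclidean_space => real"
 assumes "u : borel_measurable borel" "a : borel_measurable borel" "t > 0"
 shows "Sop t a u x = conv u (%z. a (z /\<^sub>R t)) x/t^DIM('a)"
proof -
 note [measurable] = assms(1,2)
 have "conv u (%z. a (z /\<^sub>R t)) x = abs (- t)^DIM('a) * (LINT z|lborel. u (x + (- t) *\<^sub>R z) * a ((x - (x + (- t) *\<^sub>R z)) /\<^sub>R t))"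
  unfolding conv_def by (rule lborel_integral_affine) (use assms in auto)
 also have "... = t^DIM('a) * Sop t a u x"
  using assms(3) by (simp add: Sop_def mult.commute)
 finally show ?thesis using assms(3) by simp
qed

lemma smooth_scale: "smooth a ==> smooth (%z. a (z /\<^sub>R t))"
 using smooth_affine[of a 0 "inverse t"] by simp

lemma unit_kernel_scale_support:
 assumes "unit_kernel a" "t > 0" "z ~: cball 0 t"
 shows "a (z /\<^sub>R t) = 0"
 by (rule unit_kernelD(2)[OF assms(1)]) (use assms(2,3) in \<open>auto simp: field_simps\<close>)

lemma Sop_smooth:
 fixes u a :: "'a::euclidean_space => real"
 assumes "bdd_borel u" "unit_kernel a" "t > 0"
 shows "smooth (Sop t a u)"
proof -
 have "smooth (conv u (%z. a (z /\<^sub>R t)))"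
  unfolding smooth_def using conv_Ck[OF assms(1) compact_cball smooth_scale[OF unit_kernelD(1)[OF assms(2)]]
    unit_kernel_scale_support[OF assms(2,3)]] by blast
 moreover have "Sop t a u = (%x. (1/t^DIM('a)) * conv u (%z. a (z /\<^sub>R t)) x)"
  using Sop_conv[OF bdd_borelD(1)[OF assms(1)] unit_kernelD(6)[OF assms(2)] assms(3)] by auto
 ultimately show ?thesis by (simp only: smooth_mult smooth_const)
qed

lemma Sop_partial:
 fixes u a :: "'a::euclidean_space => real"
 assumes u: "bdd_borel u" and a: "unit_kernel a" and t: "t > 0" and i: "i : Basis"
 shows "partial i (Sop t a u) x = Sop t (partial i a) u x/t"
proof -
 define k where "k z = a (z /\<^sub>R t)" for z
 have sk: "smooth k" "!!z. z ~: cball 0 t ==> k z = 0" 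
  unfolding k_def using smooth_scale[OF unit_kernelD(1)[OF a]] unit_kernel_scale_support[OF a t] by auto
 have pk: "partial i k = (%z. (1/t) * partial i a (z /\<^sub>R t))"
  using partial_affine_smooth[OF unit_kernelD(1)[OF a], of i 0 "inverse t"] unfolding k_def[abs_def] by (simp add: inverse_eq_divide)
 have e: "Sop t a u = (%x. (1/t^DIM('a)) * conv u k x)"
  using Sop_conv[OF bdd_borelD(1)[OF u] unit_kernelD(6)[OF a] t] unfolding k_def[abs_def] by auto
 have "smooth (conv u k)"
  unfolding smooth_def using conv_Ck[OF u compact_cball sk] by blast
 note * = this
 have "partial i (Sop t a u) x = (1/t^DIM('a)) * conv u (partial i k) x"
  unfolding e partial_cmult_smooth[OF *] using conv_partial[OF u sk(1) compact_cball[of 0 t] _ i, of x] sk(2) by simp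
 also have "conv u (partial i k) x = (1/t) * conv u (%z. partial i a (z /\<^sub>R t)) x"
  unfolding pk conv_def by (simp add: mult.left_commute)
 also have "(1/t^DIM('a)) * ((1/t) * conv u (%z. partial i a (z /\<^sub>R t)) x) = Sop t (partial i a) u x/t"
  using Sop_conv[OF bdd_borelD(1)[OF u] unit_kernelD(6)[OF unit_kernel_partial[OF a i]] t] by simp
 finally show ?thesis .
qed

lemma Sop_integrable:
 fixes u a :: "'a::euclidean_space => real"
 assumes u: "bdd_borel u" and a: "unit_kernel a"
 shows "integrable lborel (%z. a z * u (x - t *\<^sub>R z))"
proof -
 obtain B where B: "!!y. abs (u y) <= B" "B > 0" using bdd_borelD(2)[OF u] by blast
 obtain A where A: "!!y. abs (a y) <= A" "A >= 0" using unit_kernelD(7)[OF a] by blast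
 note [measurable] = bdd_borelD(1)[OF u] unit_kernelD(6)[OF a]
 show ?thesis
  by (rule integrable_bounded_support[where B="A * B" and S="ball 0 1"])
    (use A B unit_kernelD(3)[OF a] in \<open>auto simp: abs_mult intro!: mult_mono\<close>)
qed

abbreviation unit_vol :: "'a::euclidean_space itself => real" where
 "unit_vol _ \<equiv> measure lborel (ball (0::'a) 1)"

lemma Sop_bound:
 fixes u a :: "'a::euclidean_space => real"
 assumes a: "unit_kernel a" "!!z. abs (a z) <= A" and B: "!!y. dist x y < t ==> abs (u y) <= B" "B >= 0" and t: "t > 0"
 shows "abs (Sop t a u x) <= A * B * unit_vol TYPE('a)"
 unfolding Sop_def
proof (rule abs_integral_le_ball)
 have A: "A >= 0" using a(2)[of 0] by simp
 show "abs (a z * u (x - t *\<^sub>R z)) <= A * B" if z: "z : ball 0 1" for z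
 proof -
  have "dist x (x - t *\<^sub>R z) < t" using z t by (simp add: dist_norm)
  then show ?thesis unfolding abs_mult by (intro mult_mono a(2) B A) auto
 qed
 show "A * B >= 0" using A B by simp
qed (use unit_kernelD(3)[OF a(1)] in simp)

text \<open>Subtracting the constant inside the average leaves only the oscillation of u. For a
  kernel of integral 0 the subtracted term disappears, and smallness of the oscillation becomes
  smallness of the average.\<close>

lemma Sop_diff_const_bound:
 fixes u a :: "'a::euclidean_space => real"
 assumes a: "unit_kernel a" "!!z. abs (a z) <= A" and u: "bdd_borel u"
  and B: "!!y. dist x y < t ==> abs (u y - c) <= B" "B >= 0" and t: "t > 0"
 shows "abs (Sop t a u x - c * (LINT z|lborel. a z)) <= A * B * unit_vol TYPE('a)"
proof -
 have "Sop t a u x - c * (LINT z|lborel. a z) = Sop t a (%y. u y - c) x"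
  using Sop_integrable[OF u a(1)] unit_kernelD(8)[OF a(1)] by (simp add: Sop_def right_diff_distrib mult.commute)
 then show ?thesis using Sop_bound[OF a B t] by simp
qed

lemma Sop_diff:
 assumes "bdd_borel u" "bdd_borel v" "unit_kernel a"
 shows "Sop t a (%y. u y - v y) x = Sop t a u x - Sop t a v x"
 using Sop_integrable[OF assms(1,3)] Sop_integrable[OF assms(2,3)] by (simp add: Sop_def right_diff_distrib)

lemma Sop_tendsto:
 fixes u a :: "'a::euclidean_space => real"
 assumes a: "unit_kernel a" and u: "bdd_borel u" "isCont u x" and t: "t ----> 0" "!!n. t n > 0"
 shows "(%n. Sop (t n) a u x) ----> u x * (LINT z|lborel. a z)"
proof (rule LIMSEQ_I)
 fix e :: real assume e: "e > 0"
 obtain A where A: "!!y. abs (a y) <= A" "A >= 0" using unit_kernelD(7)[OF a] by blast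
 define c where "c = e/(2 * (A + 1) * (unit_vol TYPE('a) + 1))"
 have c: "c > 0" unfolding c_def using e A(2) by (intro divide_pos_pos mult_pos_pos) (auto simp: add_nonneg_pos)
 obtain d where d: "d > 0" "!!y. dist y x < d ==> abs (u y - u x) < c"
  using u(2) c unfolding continuous_at dist_real_def by (metis continuous_at continuous_at_eps_delta dist_norm real_norm_def)
 have "\<forall>\<^sub>F n in sequentially. t n < d" using t(1) d(1) by (rule order_tendstoD)
 then obtain N where N: "!!n. n >= N ==> t n < d" by (auto simp: eventually_sequentially)
 show "EX no. ALL n>=no. norm (Sop (t n) a u x - u x * (LINT z|lborel. a z)) < e"
 proof (intro exI[of _ N] allI impI)
  fix n assume n: "n >= N"
  have "abs (Sop (t n) a u x - u x * (LINT z|lborel. a z)) <= A * c * unit_vol TYPE('a)"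
  proof (rule Sop_diff_const_bound[OF a A(1) u(1) _ _ t(2)])
   fix y assume "dist x y < t n"
   then show "abs (u y - u x) <= c" using d(2)[of y] N[OF n] by (force simp: dist_commute)
  qed (use c in simp)
  also have "... <= (A + 1) * c * (unit_vol TYPE('a) + 1)"
   using A(2) c by (intro mult_mono) auto
  also have "... = e/2"
  proof -
   have "A + 1 ~= 0" "unit_vol TYPE('a) + 1 ~= 0" using A(2) by (auto simp: add_nonneg_eq_0_iff)
   moreover have "x ~= 0 ==> y ~= 0 ==> x * (e/(2 * x * y)) * y = e/2" for x y by simp
   ultimately show ?thesis unfolding c_def by blast
  qed
  finally show "norm (Sop (t n) a u x - u x * (LINT z|lborel. a z)) < e" using e by simp
 qed
qed

lemma lborel_integral_reflect:
 fixes f :: "'a::euclidean_space => real"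
 assumes "f : borel_measurable borel"
 shows "(LINT z|lborel. f (- z)) = (LINT z|lborel. f z)"
 using lborel_integral_affine[OF assms, of "-1" 0] by simp

text \<open>Fubini, the translation by t z, and the reflection z -> -z, which an even kernel
  absorbs. The translation moves the region in which the integrand lives, so integrability on the
  product is established once before and once after it.\<close>

lemma Sop_adjoint:
 fixes u a phi :: "'a::euclidean_space => real"
 assumes u: "bdd_borel u" and a: "unit_kernel a" "!!z. a (- z) = a z"
  and phi: "bdd_borel phi" "bounded S" "!!x. x ~: S ==> phi x = 0"
 shows "(LINT x|lborel. Sop t a u x * phi x) = (LINT x|lborel. u x * Sop t a phi x)"
proof -
 note [measurable] = bdd_borelD(1)[OF u] unit_kernelD(6)[OF a(1)] bdd_borelD(1)[OF phi(1)]
 obtain B where B: "!!y. abs (u y) <= B" "B > 0" using bdd_borelD(2)[OF u] by blast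
 obtain A where A: "!!y. abs (a y) <= A" "A >= 0" using unit_kernelD(7)[OF a(1)] by blast
 obtain C where C: "!!y. abs (phi y) <= C" "C > 0" using bdd_borelD(2)[OF phi(1)] by blast
 obtain r where r: "S <= ball 0 r" using phi(2) bounded_subset_ballD by blast
 define F where "F = (%(x, z). a z * u (x - t *\<^sub>R z) * phi x)"
 have Fm: "F : borel_measurable (lborel \<Otimes>\<^sub>M lborel)" unfolding F_def by measurable
 have Fi: "integrable (lborel \<Otimes>\<^sub>M lborel) F"
 proof (rule integrableI_bounded_set[where A="ball 0 r \<times> ball 0 1" and B="A * B * C"])
  show "emeasure (lborel \<Otimes>\<^sub>M lborel) (ball (0::'a) r \<times> ball (0::'a) 1) < \<infinity>"
   by (subst lborel.emeasure_pair_measure_Times) (auto simp: ennreal_mult_less_top)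
  show "AE x in lborel \<Otimes>\<^sub>M lborel. x : ball 0 r \<times> ball 0 1 --> norm (F x) <= A * B * C"
   using A B C by (auto intro!: AE_I2 mult_mono simp: F_def abs_mult)
  show "AE x in lborel \<Otimes>\<^sub>M lborel. x ~: ball 0 r \<times> ball 0 1 --> F x = 0"
  proof (intro AE_I2 impI)
   fix w :: "'a \<times> 'a" assume w: "w ~: ball 0 r \<times> ball 0 1"
   obtain x z where xz: "w = (x, z)" by force
   then have "x ~: S | z ~: ball 0 1" using w r by auto
   then show "F w = 0" using phi(3) unit_kernelD(3)[OF a(1)] by (auto simp: xz F_def)
  qed
 qed (use Fm in auto)
 have "(LINT x|lborel. Sop t a u x * phi x) = (LINT x|lborel. LINT z|lborel. F (x, z))"
  by (simp add: Sop_def F_def)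
 also have "... = (LINT z|lborel. LINT x|lborel. F (x, z))"
  using lborel_pair.Fubini_integral[of "%x z. F (x, z)"] Fi by simp
 also have "... = (LINT z|lborel. LINT x|lborel. a z * u x * phi (x + t *\<^sub>R z))"
 proof (rule Bochner_Integration.integral_cong[OF refl])
  fix z
  show "(LINT x|lborel. F (x, z)) = (LINT x|lborel. a z * u x * phi (x + t *\<^sub>R z))"
   using lborel_integral_translate[of "%x. F (x, z)" "t *\<^sub>R z"] Fm by (simp add: F_def)
 qed
 also have "... = (LINT x|lborel. LINT z|lborel. a z * u x * phi (x + t *\<^sub>R z))"
 proof -
  define G where "G = (%(z, x). a z * u x * phi (x + t *\<^sub>R z))"
  have Gm: "G : borel_measurable (lborel \<Otimes>\<^sub>M lborel)" unfolding G_def by measurable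
  have "integrable (lborel \<Otimes>\<^sub>M lborel) G"
  proof (rule integrableI_bounded_set[where A="ball 0 1 \<times> ball 0 (r + abs t)" and B="A * B * C"])
   show "emeasure (lborel \<Otimes>\<^sub>M lborel) (ball (0::'a) 1 \<times> ball (0::'a) (r + abs t)) < \<infinity>"
    by (subst lborel.emeasure_pair_measure_Times) (auto simp: ennreal_mult_less_top)
   show "AE x in lborel \<Otimes>\<^sub>M lborel. x : ball 0 1 \<times> ball 0 (r + abs t) --> norm (G x) <= A * B * C"
    using A B C by (auto intro!: AE_I2 mult_mono simp: G_def abs_mult)
   show "AE x in lborel \<Otimes>\<^sub>M lborel. x ~: ball 0 1 \<times> ball 0 (r + abs t) --> G x = 0"
   proof (intro AE_I2 impI)
    fix w :: "'a \<times> 'a" assume w: "w ~: ball 0 1 \<times> ball 0 (r + abs t)"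
    obtain z x where xz: "w = (z, x)" by force
    show "G w = 0"
    proof (cases "z : ball 0 1")
     case True
     then have "norm x >= r + abs t" using w by (auto simp: xz)
     moreover have "norm (x + t *\<^sub>R z) >= norm x - norm (t *\<^sub>R z)" by (metis norm_diff_ineq)
     moreover have "norm (t *\<^sub>R z) <= abs t" using True mult_left_le[of "norm z" "abs t"] by simp
     ultimately have "x + t *\<^sub>R z ~: S" using r by auto
     then show ?thesis using phi(3) by (simp add: xz G_def)
    qed (use unit_kernelD(3)[OF a(1)] in \<open>auto simp: xz G_def\<close>)
   qed
  qed (use Gm in auto)
  then show ?thesis using lborel_pair.Fubini_integral[of "%z x. G (z, x)"] by (simp add: G_def)
 qed
 also have "... = (LINT x|lborel. u x * Sop t a phi x)"
 proof (rule Bochner_Integration.integral_cong[OF refl])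
  fix x
  have "(LINT z|lborel. a z * u x * phi (x + t *\<^sub>R z)) = u x * (LINT z|lborel. a z * phi (x + t *\<^sub>R z))"
   by (subst Bochner_Integration.integral_mult_right_zero[symmetric]) (simp only: mult_ac)
  also have "(LINT z|lborel. a z * phi (x + t *\<^sub>R z)) = Sop t a phi x"
   using lborel_integral_reflect[of "%z. a z * phi (x + t *\<^sub>R z)"] by (simp add: Sop_def a(2))
  finally show "(LINT z|lborel. a z * u x * phi (x + t *\<^sub>R z)) = u x * Sop t a phi x" .
 qed
 finally show ?thesis .
qed

section \<open>Weak solutions of the Poisson equation\<close>

lemma AE_continuous_eq_0:
 fixes f :: "'a::euclidean_space => real"
 assumes "continuous_on U f" "open U" "AE x in lborel. x : U --> f x = 0" "x : U"
 shows "f x = 0"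
proof (rule ccontr)
 assume "f x ~= 0"
 have "open (U \<inter> f -` (- {0}))" 
  using continuous_open_preimage[OF assms(1,2), of "- {0}"] by auto
 moreover have "x : U \<inter> f -` (- {0})" using assms(4) \<open>f x ~= 0\<close> by simp
 ultimately have nn: "~ negligible (U \<inter> f -` (- {0}))" using open_not_negligible by blast
 obtain N where N: "{x : space lborel. ~ (x : U --> f x = 0)} <= N" "N : null_sets lborel"
  using assms(3) by (auto simp: eventually_ae_filter)
 then have "negligible N" by (simp add: negligible_iff_null_sets null_sets_completionI)
 moreover have "U \<inter> f -` (- {0}) <= N" using N(1) by auto
 ultimately show False using nn negligible_subset by blast
qed

lemma test_functionI:
 assumes "smooth phi" "compact K" "K <= Om" "!!x. x ~: K ==> phi x = 0"
 shows "test_function Om phi"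
proof -
 have "closure {x. phi x ~= 0} <= K"
  by (rule closure_minimal) (use assms(2,4) compact_imp_closed in auto)
 then show ?thesis using assms
  by (auto simp: test_function_def smooth_def intro: compact_closure[THEN iffD2] bounded_subset[OF compact_imp_bounded])
qed

lemma test_functionE:
 assumes "test_function Om phi"
 obtains K where "smooth phi" "compact K" "K <= Om" "!!x. x ~: K ==> phi x = 0" "bounded K" "closed K"
proof (rule that[of "closure {x. phi x ~= 0}"])
 show "compact (closure {x. phi x ~= 0})" using assms by (simp add: test_function_def)
 then show "bounded (closure {x. phi x ~= 0})" by (rule compact_imp_bounded)
 show "phi x = 0" if "x ~: closure {x. phi x ~= 0}" for x
  using that closure_subset[of "{x. phi x ~= 0}"] by blast
qed (use assms in \<open>auto simp: test_function_def smooth_def\<close>)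

lemma test_function_partial: "test_function Om phi ==> i : Basis ==> test_function Om (partial i phi)"
 by (elim test_functionE, rule test_functionI) (auto intro: smooth_partial partial_support)

lemma test_function_lap: "test_function Om phi ==> test_function Om (lap phi)"
 by (elim test_functionE, rule test_functionI) (auto intro: smooth_lap lap_support)

lemma test_function_borel: "test_function Om phi ==> bdd_borel phi"
 by (elim test_functionE, rule bdd_borel_continuous_support) (auto intro: smooth_continuous)

lemma test_function_integrable:
 assumes "test_function Om phi" "bdd_borel u"
 shows "integrable lborel (%x. u x * phi x)"
proof -
 obtain K where K: "smooth phi" "bounded K" "!!x. x ~: K ==> phi x = 0"
  using assms(1) by (rule test_functionE) blast
 obtain B where B: "!!y. abs (u y) <= B" "B > 0" using bdd_borelD(2)[OF assms(2)] by blast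
 obtain C where C: "!!y. abs (phi y) <= C" "C > 0" using bdd_borelD(2)[OF test_function_borel[OF assms(1)]] by blast
 note [measurable] = bdd_borelD(1)[OF assms(2)] bdd_borelD(1)[OF test_function_borel[OF assms(1)]]
 show ?thesis
  by (rule integrable_bounded_support[where B="B * C" and S=K])
    (use B C K in \<open>auto simp: abs_mult less_imp_le intro!: mult_mono\<close>)
qed

text \<open>The number C q^n/(1 - q) is the tail of the geometric series, and the increments
  telescope against it. The estimate is asked only from an index k on, because means of a solution
  are controlled only at scales below the distance to the boundary.\<close>

lemma geometric_Cauchy:
 fixes s :: "nat => real"
 assumes s: "!!n. n >= k ==> abs (s (Suc n) - s n) <= C * q^n" and q: "0 < q" "q < 1"
 shows "convergent s" "n >= k ==> abs (lim s - s n) <= C * q^n/(1 - q)"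
proof -
 define b where "b n = C * q^n/(1 - q)" for n
 have C: "C >= 0"
  using order_trans[OF abs_ge_zero s[OF order_refl]] zero_less_power[OF q(1), of k]
  by (auto simp: zero_le_mult_iff)
 have bS: "b n = C * q^n + b (Suc n)" for n using q by (simp add: b_def field_simps)
 have step: "abs (s (n + j) - s n) <= b n - b (n + j)" if "n >= k" for n j
 proof (induction j)
  case (Suc j)
  then show ?case using s[of "n + j"] bS[of "n + j"] that by simp
 qed simp
 have b0: "b n >= 0" for n using C q by (simp add: b_def)
 have step': "abs (s (n + j) - s n) <= b n" if "n >= k" for n j
  using step[OF that, of j] b0[of "n + j"] by linarith
 have "(%n. C * q^n/(1 - q)) ----> C * 0/(1 - q)"
  using q by (intro tendsto_intros LIMSEQ_realpow_zero) auto
 then have bl: "b ----> 0" unfolding b_def[abs_def] by simp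
 have "Cauchy s"
 proof (rule metric_CauchyI)
  fix e :: real assume "e > 0"
  then have "\<forall>\<^sub>F n in sequentially. b n < e/2" using bl by (intro order_tendstoD) auto
  then obtain M where M: "!!n. n >= M ==> b n < e/2" by (auto simp: eventually_sequentially)
  have *: "abs (s m - s (max M k)) < e/2" if "m >= max M k" for m
   using step'[of "max M k" "m - max M k"] M[of "max M k"] that by auto
  show "EX M. ALL m>=M. ALL n>=M. dist (s m) (s n) < e"
  proof (intro exI[of _ "max M k"] allI impI)
   fix m n assume "m >= max M k" "n >= max M k"
   then have "abs (s m - s (max M k)) < e/2" "abs (s n - s (max M k)) < e/2" using * by blast+
   then show "dist (s m) (s n) < e" unfolding dist_real_def by linarith
  qed
 qed
 then show cv: "convergent s" by (rule Cauchy_convergent)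
 show "abs (lim s - s n) <= C * q^n/(1 - q)" if "n >= k"
 proof (rule LIMSEQ_le_const2)
  show "(%j. abs (s j - s n)) ----> abs (lim s - s n)"
   using cv by (intro tendsto_intros) (simp add: convergent_LIMSEQ_iff)
  show "EX N. ALL j>=N. abs (s j - s n) <= C * q^n/(1 - q)"
   using step'[OF that] by (intro exI[of _ n]) (auto simp: b_def le_iff_add)
 qed
qed

section \<open>Kernel pairs and the dyadic mean value identity\<close>

definition ker_mass :: "'a::euclidean_space itself => real" where
 "ker_mass _ = (LINT z|lborel. radial bumpP 0 (z::'a))"

definition kerP :: "'a::euclidean_space itself => nat => real => real" where
 "kerP T n s = bumpP n s/ker_mass T"

definition kerk :: "'a::euclidean_space itself => nat => real => real" where
 "kerk T n s = bumpk DIM('a) n s/ker_mass T"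

definition radial1 :: "(nat => real => real) => 'a::euclidean_space => 'a => real" where
 "radial1 D xi z = 2 * ((z \<bullet> xi) * radial D 1 z)"

definition radial2 :: "(nat => real => real) => 'a::euclidean_space => 'a => 'a => real" where
 "radial2 D xi eta z = 4 * ((z \<bullet> xi) * (z \<bullet> eta) * radial D 2 z) + 2 * (xi \<bullet> eta) * radial D 1 z"

lemma radial_deriv:
 assumes "deriv_seq D"
 shows "partial i (radial D 0) = radial1 D i" "partial i (radial1 D xi) = radial2 D xi i"
proof -
 show "partial i (radial D 0) = radial1 D i"
  by (auto simp: radial1_def partial_radial[OF assms])
 show "partial i (radial1 D xi) = radial2 D xi i"
 proof
  fix z
  have "partial i (%z. 2 * ((z \<bullet> xi) * radial D 1 z)) z
   = 2 * ((z \<bullet> xi) * (2 * (z \<bullet> i) * radial D (Suc 1) z) + (i \<bullet> xi) * radial D 1 z)"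
   unfolding partial_cmult_smooth[OF smooth_mult[OF smooth_inner smooth_radial[OF assms]]]
    partial_mult_smooth[OF smooth_inner smooth_radial[OF assms]] partial_radial[OF assms] partial_inner ..
  then show "partial i (radial1 D xi) z = radial2 D xi i z"
   unfolding radial1_def[abs_def] radial2_def by (simp add: inner_commute flip: numeral_2_eq_2)
 qed
qed

text \<open>The exponent m counts the derivatives taken of the basic pair: each of them gives the
  copy at twice the argument another factor 2, in addition to the factor 2^N that preserves its
  mass.\<close>

definition kernel_pair :: "('a::euclidean_space => real) => ('a => real) => nat => bool" where
 "kernel_pair a b m \<longleftrightarrow> unit_kernel a & unit_kernel b &
   (ALL z. lap b z = a z - 2^(DIM('a) + m) * a (2 *\<^sub>R z))"

lemma unit_kernel_radial:
 assumes "deriv_seq D" "!!n s. s >= 1 ==> D n s = 0"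
 shows "unit_kernel (radial D n)" "unit_kernel (radial1 D xi)" "unit_kernel (radial2 D xi eta)"
 unfolding unit_kernel_def radial1_def radial2_def
 by (intro conjI smooth_intros smooth_radial assms(1), use assms(2) in simp)+

context
 fixes T :: "'a::euclidean_space itself"
begin

lemma ker_mass_pos: "ker_mass T > 0"
proof -
 have uk: "unit_kernel (radial bumpP 0 :: 'a => real)"
  by (rule unit_kernel_radial(1)[OF deriv_seq_bumpP bump_eq_0(2)])
 have "(LINT z|lborel. radial bumpP 0 (z::'a)) ~= 0"
 proof
  assume "(LINT z|lborel. radial bumpP 0 (z::'a)) = 0"
  then have "AE z in lborel. radial bumpP 0 (z::'a) = 0"
   using integral_nonneg_eq_0_iff_AE[OF unit_kernelD(8)[OF uk]] bump_nonneg(1) by auto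
  then have "AE z in lborel. z : UNIV --> radial bumpP 0 (z::'a) = 0" by simp
  from AE_continuous_eq_0[OF unit_kernelD(5)[OF uk] open_UNIV this UNIV_I]
  have "radial bumpP 0 (0::'a) = 0" .
  then show False using flat_pos(2)[of 1] by (simp add: bumpP_def bumpR_def)
 qed
 moreover have "(LINT z|lborel. radial bumpP 0 (z::'a)) >= 0"
  by (rule Lint_nonneg) (simp add: bump_nonneg)
 ultimately show ?thesis unfolding ker_mass_def by linarith
qed

lemma deriv_seq_ker: "deriv_seq (kerP T)" "deriv_seq (kerk T)"
 using deriv_seq_bumpP deriv_seq_bumpk[of "DIM('a)"] unfolding deriv_seq_def kerP_def kerk_def
 by (auto intro!: DERIV_cdivide)

lemma ker_eq_0: "s >= 1 ==> kerP T n s = 0" "s >= 1 ==> kerk T n s = 0"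
 by (auto simp: kerP_def kerk_def bump_eq_0)

lemma ker_nonneg: "kerP T 0 s >= 0" "kerk T 0 s >= 0"
 using ker_mass_pos by (auto simp: kerP_def kerk_def bump_nonneg)

lemma ker_ode: "4 * s * kerk T (Suc (Suc n)) s + (2 * DIM('a) + 4 * n) * kerk T (Suc n) s
  = kerP T n s - 2^DIM('a) * 4^n * kerP T n (4 * s)"
 using arg_cong[OF bump_ode[of s "DIM('a)" n], of "%x. x/ker_mass T"]
 by (simp add: kerP_def kerk_def add_divide_distrib diff_divide_distrib)

lemmas unit_kernel_P = unit_kernel_radial[OF deriv_seq_ker(1) ker_eq_0(1)]
lemmas unit_kernel_k = unit_kernel_radial[OF deriv_seq_ker(2) ker_eq_0(2)]

lemma integral_kerP: "(LINT z|lborel. radial (kerP T) 0 (z::'a)) = 1"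
 using ker_mass_pos by (simp add: kerP_def ker_mass_def)

text \<open>If the integral were 0, the nonnegative continuous kernel would vanish identically; but
  its Laplacian at the origin is (1 - 2^N) times the positive value of \<open>kerP\<close>
  there.\<close>

lemma integral_kerk: "(LINT z|lborel. radial (kerk T) 0 (z::'a)) > 0"
proof -
 have uk: "unit_kernel (radial (kerk T) 0 :: 'a => real)" by (rule unit_kernel_k)
 have ge: "radial (kerk T) 0 z >= 0" for z :: 'a by (rule ker_nonneg)
 have "(LINT z|lborel. radial (kerk T) 0 (z::'a)) ~= 0"
 proof
  assume "(LINT z|lborel. radial (kerk T) 0 (z::'a)) = 0"
  then have "AE z in lborel. radial (kerk T) 0 (z::'a) = 0"
   using integral_nonneg_eq_0_iff_AE[OF unit_kernelD(8)[OF uk]] ge by auto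
  then have "AE z in lborel. z : UNIV --> radial (kerk T) 0 (z::'a) = 0" by simp
  from AE_continuous_eq_0[OF unit_kernelD(5)[OF uk] open_UNIV this UNIV_I]
  have all0: "radial (kerk T) 0 z = 0" for z :: 'a .
  have "lap (radial (kerk T) 0) (0::'a) = 0" unfolding lap_def
   using partial_eq_0_outside[of UNIV _ "radial (kerk T) 0"] all0 by auto
  moreover have "lap (radial (kerk T) 0) (0::'a) = kerP T 0 0 - 2^DIM('a) * kerP T 0 0"
   using lap_radial[OF deriv_seq_ker(2), of 0 "0::'a"] ker_ode[of 0 0] by simp
  moreover have "kerP T 0 0 > 0" using ker_mass_pos flat_pos(2)[of 1] by (simp add: kerP_def bumpP_def bumpR_def)
  moreover have "(2::real)^DIM('a) > 1" by (rule one_less_power) auto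
  ultimately show False by (simp add: mult_less_cancel_right)
 qed
 then show ?thesis using Lint_nonneg[of lborel "radial (kerk T) 0 :: 'a => real"] ge by fastforce
qed

lemma kernel_pair0: "kernel_pair (radial (kerP T) 0 :: 'a => real) (radial (kerk T) 0) 0"
 unfolding kernel_pair_def 
proof (intro conjI allI unit_kernel_P unit_kernel_k)
 show "lap (radial (kerk T) 0) z = radial (kerP T) 0 z - 2^(DIM('a) + 0) * radial (kerP T) 0 (2 *\<^sub>R z)" for z :: 'a
  using lap_radial[OF deriv_seq_ker(2), of 0 z] ker_ode[of "(norm z)^2" 0] by (simp add: power_mult_distrib)
qed

lemma kernel_pair1: "kernel_pair (radial1 (kerP T) (xi::'a)) (radial1 (kerk T) xi) 1"
proof -
 have "lap (radial1 (kerk T) xi) z = radial1 (kerP T) xi z - 2^(DIM('a) + 1) * radial1 (kerP T) xi (2 *\<^sub>R z)" for z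
 proof -
  have "lap (radial1 (kerk T) xi) z = 2 * ((z \<bullet> xi) * (4 * (norm z)^2 * radial (kerk T) 3 z
    + (2 * DIM('a) + 4) * radial (kerk T) 2 z))"
   unfolding radial1_def[abs_def]
   by (subst lap_cmult[OF smooth_mult[OF smooth_inner smooth_radial[OF deriv_seq_ker(2)]]])
     (simp add: lap_radial1[OF deriv_seq_ker(2)] flip: numeral_2_eq_2)
  also have "4 * (norm z)^2 * radial (kerk T) 3 z + (2 * DIM('a) + 4) * radial (kerk T) 2 z
    = radial (kerP T) 1 z - 2^DIM('a) * 4 * kerP T 1 (4 * (norm z)^2)"
   using ker_ode[of "(norm z)^2" 1] by (simp flip: numeral_2_eq_2)
  finally show ?thesis by (simp add: radial1_def[of "kerP T"] power_mult_distrib algebra_simps)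
 qed
 then show ?thesis unfolding kernel_pair_def using unit_kernel_P unit_kernel_k by blast
qed

lemma kernel_pair2: "kernel_pair (radial2 (kerP T) (xi::'a) eta) (radial2 (kerk T) xi eta) 2"
proof -
 have "lap (radial2 (kerk T) xi eta) z = radial2 (kerP T) xi eta z - 2^(DIM('a) + 2) * radial2 (kerP T) xi eta (2 *\<^sub>R z)" for z
 proof -
  let ?s = "(norm z)^2"
  define F where "F z = (z \<bullet> xi) * (z \<bullet> eta) * radial (kerk T) 2 z" for z
  have F: "smooth F" unfolding F_def[abs_def]
   by (rule smooth_mult[OF smooth_mult[OF smooth_inner smooth_inner] smooth_radial[OF deriv_seq_ker(2)]])
  have R: "smooth (radial (kerk T) 1 :: 'a => real)" by (rule smooth_radial[OF deriv_seq_ker(2)])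
  have "lap (radial2 (kerk T) xi eta) z = 4 * lap F z + 2 * (xi \<bullet> eta) * lap (radial (kerk T) 1) z"
   unfolding radial2_def[abs_def] F_def[symmetric]
    lap_add[OF smooth_mult[OF smooth_const F] smooth_mult[OF smooth_const R]] lap_cmult[OF F] lap_cmult[OF R] ..
  also have "... = 4 * ((z \<bullet> xi) * (z \<bullet> eta)) * (4 * ?s * kerk T 4 ?s + (2 * DIM('a) + 8) * kerk T 3 ?s)
    + 2 * (xi \<bullet> eta) * (4 * ?s * kerk T 3 ?s + (2 * DIM('a) + 4) * kerk T 2 ?s)"
   unfolding F_def lap_radial2[OF deriv_seq_ker(2)] lap_radial[OF deriv_seq_ker(2)]
   by (simp add: algebra_simps flip: numeral_2_eq_2)
  also have "4 * ?s * kerk T 4 ?s + (2 * DIM('a) + 8) * kerk T 3 ?s = kerP T 2 ?s - 2^DIM('a) * 16 * kerP T 2 (4 * ?s)"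
   using ker_ode[of ?s 2] by simp
  also have "4 * ?s * kerk T 3 ?s + (2 * DIM('a) + 4) * kerk T 2 ?s = kerP T 1 ?s - 2^DIM('a) * 4 * kerP T 1 (4 * ?s)"
   using ker_ode[of ?s 1] by (simp flip: numeral_2_eq_2)
  finally show ?thesis by (simp add: radial2_def[of "kerP T"] power_mult_distrib algebra_simps)
 qed
 then show ?thesis unfolding kernel_pair_def using unit_kernel_P unit_kernel_k by blast
qed

end

text \<open>The equation -Lap u = g in its very weak form: with both derivatives on the test
  function it makes sense for bounded u and survives bounded pointwise limits. Zero boundary values
  are expressed separately, by continuity and vanishing outside the domain.\<close>

definition poisson :: "'a::euclidean_space set => ('a => real) => ('a => real) => bool" where
 "poisson Om u g \<longleftrightarrow> (ALL phi. test_function Om phi -->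
   (LINT x|lborel. u x * lap phi x) = - (LINT x|lborel. g x * phi x))"

lemma test_function_scaled_kernel:
 fixes b :: "'a::euclidean_space => real"
 assumes "unit_kernel b" "t > 0" "cball x t <= Om"
 shows "test_function Om (%y. b ((x - y) /\<^sub>R t))"
proof (rule test_functionI[OF _ compact_cball assms(3)])
 have "smooth (%y. b (x /\<^sub>R t + (- inverse t) *\<^sub>R y))"
  by (rule smooth_affine[OF unit_kernelD(1)[OF assms(1)]])
 then show "smooth (%y. b ((x - y) /\<^sub>R t))" by (simp add: scaleR_diff_right)
 show "b ((x - y) /\<^sub>R t) = 0" if "y ~: cball x t" for y
  by (rule unit_kernel_scale_support[OF assms(1,2)]) (use that in \<open>auto simp: dist_norm norm_minus_commute\<close>)
qed

lemma lap_scaled_kernel: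
 assumes "unit_kernel b"
 shows "lap (%y. b ((x - y) /\<^sub>R t)) y = lap b ((x - y) /\<^sub>R t)/t^2"
 using lap_affine[OF unit_kernelD(1)[OF assms], of "x /\<^sub>R t" "- inverse t" y]
 by (simp add: scaleR_diff_right divide_inverse mult.commute power_inverse)

lemma conv_kernel_Sop:
 fixes u a :: "'a::euclidean_space => real"
 assumes "bdd_borel u" "unit_kernel a" "t > 0"
 shows "(LINT y|lborel. u y * a ((x - y) /\<^sub>R t)) = t^DIM('a) * Sop t a u x"
 using Sop_conv[OF bdd_borelD(1)[OF assms(1)] unit_kernelD(6)[OF assms(2)] assms(3), of x] assms(3)
 by (simp add: conv_def)

lemma kernel_integrable:
 fixes u a :: "'a::euclidean_space => real"
 assumes "bdd_borel u" "unit_kernel a" "t > 0"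
 shows "integrable lborel (%y. u y * a ((x - y) /\<^sub>R t))"
 by (rule test_function_integrable[OF test_function_scaled_kernel[OF assms(2,3) subset_UNIV] assms(1)])

text \<open>This concerns the kernels alone and holds for every bounded Borel function u. It
  therefore also serves at scales whose ball leaves the domain, where the equation cannot be tested
  with the kernel.\<close>

lemma integral_lap_kernel:
 fixes u a :: "'a::euclidean_space => real"
 assumes u: "bdd_borel u" and ab: "kernel_pair a b m" and t: "t > 0"
 shows "(LINT y|lborel. u y * lap (%y. b ((x - y) /\<^sub>R t)) y)
  = t^DIM('a)/t^2 * (Sop t a u x - 2^m * Sop (t/2) a u x)"
proof -
 have a: "unit_kernel a" and b: "unit_kernel b" using ab by (auto simp: kernel_pair_def)
 have lp: "lap b z = a z - 2^(DIM('a) + m) * a (2 *\<^sub>R z)" for z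
  using ab unfolding kernel_pair_def by blast
 have sc: "2 *\<^sub>R (w /\<^sub>R t) = w /\<^sub>R (t/2)" for w :: 'a
 proof -
  have "inverse (t/2) = 2 * inverse t" by (simp add: inverse_eq_divide)
  then show ?thesis by (simp only: scaleR_scaleR)
 qed
 have "u y * lap (%y. b ((x - y) /\<^sub>R t)) y
   = (u y * a ((x - y) /\<^sub>R t) - 2^(DIM('a) + m) * (u y * a ((x - y) /\<^sub>R (t/2))))/t^2" for y
  unfolding lap_scaled_kernel[OF b] lp sc times_divide_eq_right right_diff_distrib
   mult.left_commute[of "u y" "2^(DIM('a) + m)"] ..
 then have "(LINT y|lborel. u y * lap (%y. b ((x - y) /\<^sub>R t)) y)
   = ((LINT y|lborel. u y * a ((x - y) /\<^sub>R t)) - 2^(DIM('a) + m) * (LINT y|lborel. u y * a ((x - y) /\<^sub>R (t/2))))/t^2"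
  using kernel_integrable[OF u a t] kernel_integrable[OF u a, of "t/2"] t by simp
 also have "... = (t^DIM('a) * Sop t a u x - 2^(DIM('a) + m) * ((t/2)^DIM('a) * Sop (t/2) a u x))/t^2"
  using conv_kernel_Sop[OF u a t] conv_kernel_Sop[OF u a, of "t/2"] t by simp
 also have "... = t^DIM('a)/t^2 * (Sop t a u x - 2^m * Sop (t/2) a u x)"
  by (simp add: power_add power_divide field_simps)
 finally show ?thesis .
qed

text \<open>The rescaled b is a test function because its support lies in a closed ball of radius t
  inside \<open>Om\<close>, so the equation replaces its Laplacian by g. The factor t^2 comes from
  the two derivatives.\<close>

lemma poisson_step:
 fixes u g a :: "'a::euclidean_space => real"
 assumes p: "poisson Om u g" and u: "bdd_borel u" "bdd_borel g"
  and ab: "kernel_pair a b m" and t: "t > 0" "cball x t <= Om"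
 shows "Sop t a u x - 2^m * Sop (t/2) a u x = - t\<^sup>2 * Sop t b g x"
proof -
 have b: "unit_kernel b" using ab by (auto simp: kernel_pair_def)
 have "(LINT y|lborel. u y * lap (%y. b ((x - y) /\<^sub>R t)) y) = - (LINT y|lborel. g y * b ((x - y) /\<^sub>R t))"
  using p test_function_scaled_kernel[OF b t] by (simp add: poisson_def)
 then have "t^DIM('a) * ((Sop t a u x - 2^m * Sop (t/2) a u x)/t^2) = t^DIM('a) * (- Sop t b g x)"
  unfolding integral_lap_kernel[OF u(1) ab t(1)] conv_kernel_Sop[OF u(2) b t(1)] by simp
 then have "(Sop t a u x - 2^m * Sop (t/2) a u x)/t^2 = - Sop t b g x"
  using t(1) by (simp only: mult_left_cancel power_not_zero less_imp_neq[symmetric] simp_thms)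
 then show ?thesis using t(1) by (simp add: field_simps)
qed

section \<open>Boundary distance, functions vanishing outside a set, cut-off functions\<close>

abbreviation rho :: "'a::euclidean_space => real" where
 "rho \<equiv> radial (kerP TYPE('a)) 0"

text \<open>Measured to the complement and not to the frontier, so that it vanishes outside U and is
  Lipschitz on the whole space; no case distinction at the boundary arises.\<close>

abbreviation bdist :: "'a::euclidean_space set => 'a => real" where
 "bdist U x \<equiv> infdist x (- U)"

lemma rho_facts:
 fixes z :: "'a::euclidean_space"
 shows "unit_kernel (rho :: 'a => real)" "rho z >= 0" "rho (- z) = rho z" "(LINT z|lborel. rho (z::'a)) = 1"
  "norm z < 1 ==> rho z > 0"
proof -
 show "norm z < 1 ==> rho z > 0"
  using flat_pos(2)[of "1 - (norm z)^2"] ker_mass_pos[of "TYPE('a)"]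
  by (simp add: kerP_def bumpP_def bumpR_def abs_square_less_1)
qed (auto simp: unit_kernel_P ker_nonneg integral_kerP)

lemma bdist_pos:
 fixes U :: "'a::euclidean_space set"
 assumes "open U" "bounded U" "x : U"
 shows "bdist U x > 0"
proof -
 have "- U ~= {}" using assms(2) not_bounded_UNIV by (metis Compl_UNIV_eq double_complement)
 then show ?thesis using assms in_closed_iff_infdist_zero[of "- U" x] infdist_nonneg[of x "- U"]
  by (metis Compl_iff closed_Compl less_eq_real_def)
qed

lemma bdist_outside: "x ~: U ==> bdist U x = 0"
 by (simp add: infdist_zero)

lemma bdist_lipschitz: "abs (bdist U x - bdist U y) <= dist x y"
 by (rule infdist_triangle_abs)

lemma bdist_le: "y ~: U ==> bdist U x <= dist x y"
 by (simp add: infdist_le)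

lemma ball_bdist_subset:
 assumes "t <= bdist U x" shows "ball x t <= U"
 using bdist_le[of _ U x] assms by (metis dual_order.trans linorder_not_le mem_ball subsetI)

lemma cball_bdist_subset:
 assumes "t < bdist U x" shows "cball x t <= U"
 using bdist_le[of _ U x] assms by (metis dual_order.trans linorder_not_le mem_cball subsetI)

lemma bdist_attained:
 fixes U :: "'a::euclidean_space set"
 assumes "open U" "bounded U" "x : U"
 obtains y where "y : frontier U" "bdist U x = dist x y"
proof -
 have "- U ~= {}" using assms(2) not_bounded_UNIV by (metis Compl_UNIV_eq double_complement)
 then obtain y where y: "y : - U" "bdist U x = dist x y"
  using infdist_attains_inf[of "- U" x] assms(1) by (metis closed_Compl)
 have "ball x (dist x y) <= U" using ball_bdist_subset y(2) by (metis order_refl)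
 then have "cball x (dist x y) <= closure U"
  using closure_mono[of "ball x (dist x y)" U] bdist_pos[OF assms] y(2) by (simp add: closure_ball)
 then have "y : closure U" by auto
 moreover have "y ~: interior U" using y(1) interior_subset by blast
 ultimately have "y : frontier U" by (simp add: frontier_def)
 then show ?thesis using y(2) that by blast
qed

text \<open>Zero boundary values and the extension by zero are built in: the functions are
  continuous on the whole space, so averages over balls that cross the boundary remain
  meaningful.\<close>

definition C0 :: "'a::euclidean_space set => ('a => real) set" where
 "C0 U = {u. continuous_on UNIV u & (ALL x. x ~: U --> u x = 0)}"

lemma C0D: "u : C0 U ==> continuous_on S u" "u : C0 U ==> x ~: U ==> u x = 0"
 by (auto simp: C0_def intro: continuous_on_subset)

lemma C0_isCont: "u : C0 U ==> isCont u x"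
 using C0D(1)[of u U UNIV] by (simp add: continuous_on_eq_continuous_at)

lemma C0_add: "u : C0 U ==> v : C0 U ==> (%x. u x + v x) : C0 U"
 and C0_cmult: "u : C0 U ==> (%x. c * u x) : C0 U"
 and C0_diff: "u : C0 U ==> v : C0 U ==> (%x. u x - v x) : C0 U"
 and C0_compose: "u : C0 U ==> continuous_on UNIV h ==> h 0 = 0 ==> (%x. h (u x)) : C0 U"
 by (auto simp: C0_def intro!: continuous_intros intro: continuous_on_compose2)

lemma C0_bdd_borel:
 assumes "bounded U" "u : C0 U" shows "bdd_borel u"
 using bdd_borel_continuous_support[OF C0D(1)[OF assms(2)] assms(1)] C0D(2)[OF assms(2)] by blast

lemma C0_integrable:
 assumes "bounded U" "u : C0 U" shows "integrable lborel u"
 using integrable_continuous_support[OF C0D(1)[OF assms(2)] assms(1)] C0D(2)[OF assms(2)] by blast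

lemma bdist_C0:
 fixes U :: "'a::euclidean_space set"
 shows "bdist U : C0 U"
 by (auto simp: C0_def bdist_outside intro!: continuous_intros)

abbreviation is_cutoff :: "'a::euclidean_space set => real => real => ('a => real) => bool" where
 "is_cutoff U C s eta \<equiv> test_function U eta & (ALL y. 0 <= eta y & eta y <= 1) & (ALL y. bdist U y >= 2 * s --> eta y = 1)
  & (ALL y. bdist U y <= s --> eta y = 0) & (ALL i:Basis. ALL y. abs (partial i eta y) <= C/s) & (ALL y. abs (lap eta y) <= C/s^2)"

lemma cutoff_exists:
 "EX C>0. ALL (U::'a::euclidean_space set) s. open U & bounded U & s > 0 -->
  (EX eta. is_cutoff U C s eta)"
proof -
 have "EX A>=0. ALL z. abs (partial i rho (z::'a)) <= A & abs (partial i (partial i rho) z) <= A" if i: "i : Basis" for i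
 proof -
  have u1: "unit_kernel (partial i (rho::'a=>real))" by (rule unit_kernel_partial[OF rho_facts(1) i])
  obtain A where A: "A >= 0" "!!z. abs (partial i rho (z::'a)) <= A" using unit_kernelD(7)[OF u1] by blast
  obtain A' where A': "A' >= 0" "!!z. abs (partial i (partial i rho) (z::'a)) <= A'"
   using unit_kernelD(7)[OF unit_kernel_partial[OF u1 i]] by blast
  show ?thesis by (rule exI[of _ "max A A'"]) (use A A' in \<open>auto simp: le_max_iff_disj\<close>)
 qed
 then obtain A where A: "!!i. i : Basis ==> A i >= 0" 
  "!!i z. i : Basis ==> abs (partial i rho (z::'a)) <= A i" "!!i z. i : Basis ==> abs (partial i (partial i rho) (z::'a)) <= A i"
  by metis
 define M where "M = (\<Sum>i\<in>Basis. A i) * unit_vol TYPE('a)"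
 have M: "A i * unit_vol TYPE('a) <= M" if "i : Basis" for i
  unfolding M_def using A(1) that by (intro mult_right_mono member_le_sum) auto
 have M0: "M >= 0" unfolding M_def using A(1) by (intro mult_nonneg_nonneg sum_nonneg) auto
 \<comment> \<open>With t = s/4 the factors 1/t and 1/t^2 of the first and second derivatives become
   4/s and 16/s^2.\<close>
 define C where "C = 16 * M * DIM('a) + 4 * M + 1"
 have C: "C > 0" unfolding C_def using M0 by (simp add: add_nonneg_pos)
 show ?thesis
 proof (intro exI[of _ C] conjI allI impI C)
  fix U :: "'a set" and s :: real assume *: "open U & bounded U & s > 0"
  define t where "t = s/4"
  have t: "t > 0" and s4: "s = 4 * t" using * by (auto simp: t_def)
  \<comment> \<open>The profile rises from 0 to 1 between the distances 5t and 6t. Mollifying at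
    scale t leaves it 0 up to the distance 4t = s and 1 from 7t on, hence from 2s = 8t on.\<close>
  define theta where "theta y = min 1 (max 0 ((bdist U y - 5 * t)/t))" for y
  have ctheta: "continuous_on UNIV theta" unfolding theta_def using t by (intro continuous_intros) auto
  have btheta: "0 <= theta y" "theta y <= 1" for y by (auto simp: theta_def)
  have u: "bdd_borel theta"
   by (rule bdd_borelI[OF borel_measurable_continuous_onI[OF ctheta], of 1]) (use btheta in \<open>simp add: abs_le_iff\<close>)
  define eta where "eta = Sop t rho theta"
  note uk = rho_facts(1)[where 'a='a]
  have sm: "smooth eta" unfolding eta_def by (rule Sop_smooth[OF u uk t])
  have d: "abs (bdist U (y - t *\<^sub>R z) - bdist U y) <= t" if "norm z < 1" for y z
  proof -
   have "dist (y - t *\<^sub>R z) y <= t" using that t by (simp add: dist_norm)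
   then show ?thesis using bdist_lipschitz[where U=U and x="y - t *\<^sub>R z" and y=y] by linarith
  qed
  have z: "eta y = 0" if "bdist U y <= s" for y
  proof -
   have eq: "rho z * theta (y - t *\<^sub>R z) = 0" for z :: 'a
   proof (cases "norm z < 1")
    case True
    then have "bdist U (y - t *\<^sub>R z) - 5 * t <= 0" using d[of z y] that t s4 by linarith
    then have "(bdist U (y - t *\<^sub>R z) - 5 * t)/t <= 0" using t by (simp only: divide_le_0_iff) simp
    then have "theta (y - t *\<^sub>R z) = 0" unfolding theta_def by (simp only: max_absorb1)
    then show ?thesis by simp
   qed (use unit_kernelD(2)[OF uk] in simp)
   show ?thesis unfolding eta_def Sop_def eq by simp
  qed
  have o: "eta y = 1" if "bdist U y >= 2 * s" for y
  proof -
   have eq: "rho z * theta (y - t *\<^sub>R z) = rho z" for z :: 'a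
   proof (cases "norm z < 1")
    case True
    then have "bdist U (y - t *\<^sub>R z) - 5 * t >= t" using d[of z y] that t s4 by linarith
    then have "(bdist U (y - t *\<^sub>R z) - 5 * t)/t >= 1" using t by (simp only: le_divide_eq_1_pos)
    then show ?thesis by (simp add: theta_def)
   qed (use unit_kernelD(2)[OF uk] in simp)
   show ?thesis unfolding eta_def Sop_def eq by (rule rho_facts(4))
  qed
  have r: "0 <= eta y" "eta y <= 1" for y
  proof -
   show "0 <= eta y" unfolding eta_def Sop_def by (intro Lint_nonneg mult_nonneg_nonneg btheta rho_facts(2))
   have "eta y <= (LINT z|lborel. rho (z::'a))" unfolding eta_def Sop_def
    by (intro integral_mono[OF Sop_integrable[OF u uk] unit_kernelD(8)[OF uk]] mult_left_le btheta rho_facts(2))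
   then show "eta y <= 1" using rho_facts(4)[where 'a='a] by simp
  qed
  have p1: "partial i eta = (%y. (1/t) * Sop t (partial i rho) theta y)" if "i : Basis" for i
   unfolding eta_def using Sop_partial[OF u uk t that] by auto
  have p2: "partial i (partial i eta) y = Sop t (partial i (partial i rho)) theta y/t^2" if "i : Basis" for i y
  proof -
   note uk1 = unit_kernel_partial[OF uk that]
   show ?thesis unfolding p1[OF that] partial_cmult_smooth[OF Sop_smooth[OF u uk1 t]] Sop_partial[OF u uk1 t that]
    by (simp add: power2_eq_square)
  qed
  have "test_function U eta"
  proof (rule test_functionI[OF sm])
   have "closed {y. s <= bdist U y}" by (intro closed_Collect_le continuous_intros)
   moreover have sub: "{y. s <= bdist U y} <= U"
   proof
    fix y assume "y : {y. s <= bdist U y}"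
    then have "bdist U y ~= 0" using * by auto
    then show "y : U" using bdist_outside[of y U] by blast
   qed
   ultimately show "compact {y. s <= bdist U y}" using * bounded_subset by (auto simp: compact_eq_bounded_closed)
   show "{y. s <= bdist U y} <= U" by (rule sub)
  qed (use z in auto)
  moreover have "abs (partial i eta y) <= C/s" if i: "i : Basis" for i y
  proof -
   have "abs (Sop t (partial i rho) theta y) <= A i * 1 * unit_vol TYPE('a)"
    by (rule Sop_bound[OF unit_kernel_partial[OF uk i] A(2)[OF i] _ _ t]) (use btheta in \<open>auto simp: abs_le_iff\<close>)
   then have "abs (Sop t (partial i rho) theta y) <= M" using M[OF i] by simp
   then have "abs (partial i eta y) <= M/t" using t unfolding p1[OF i] by (simp add: abs_mult divide_right_mono)
   also have "... = 4 * M/s" by (simp add: t_def)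
   also have "... <= C/s" unfolding C_def using * M0 by (intro divide_right_mono) auto
   finally show ?thesis .
  qed
  moreover have "abs (lap eta y) <= C/s^2" for y
  proof -
   have "abs (partial i (partial i eta) y) <= M/t^2" if i: "i : Basis" for i
   proof -
    have "abs (Sop t (partial i (partial i rho)) theta y) <= A i * 1 * unit_vol TYPE('a)"
     by (rule Sop_bound[OF unit_kernel_partial[OF unit_kernel_partial[OF uk i] i] A(3)[OF i] _ _ t])
       (use btheta in \<open>auto simp: abs_le_iff\<close>)
    then have "abs (Sop t (partial i (partial i rho)) theta y) <= M" using M[OF i] by simp
    then show ?thesis using t unfolding p2[OF i] by (simp add: abs_mult divide_right_mono)
   qed
   then have "abs (lap eta y) <= (\<Sum>i\<in>(Basis::'a set). M/t^2)"
    unfolding lap_def by (intro order_trans[OF sum_abs] sum_mono)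
   also have "... = 16 * M * DIM('a)/s^2" by (simp add: t_def power_divide)
   also have "... <= C/s^2" unfolding C_def using * M0 by (intro divide_right_mono) auto
   finally show ?thesis .
  qed
  ultimately show "EX eta. is_cutoff U C s eta"
   using z o r by (intro exI[of _ eta]) auto
 qed
qed

section \<open>Mean values of supersolutions and the minimum principle\<close>

lemma poisson_lincomb:
 assumes "poisson U u g" "poisson U v h" 
  "bdd_borel u" "bdd_borel v" "bdd_borel g" "bdd_borel h"
 shows "poisson U (%x. a * u x + b * v x) (%x. a * g x + b * h x)"
 unfolding poisson_def
proof (intro allI impI)
 fix phi assume t: "test_function U phi"
 note I = test_function_integrable[OF t] test_function_integrable[OF test_function_lap[OF t]]
 have "(LINT x|lborel. (a * u x + b * v x) * lap phi x) = a * (LINT x|lborel. u x * lap phi x) + b * (LINT x|lborel. v x * lap phi x)"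
  using I(2)[OF assms(3)] I(2)[OF assms(4)] by (simp add: distrib_right mult.assoc)
 also have "... = - (a * (LINT x|lborel. g x * phi x) + b * (LINT x|lborel. h x * phi x))"
  using assms(1,2) t by (simp add: poisson_def)
 also have "... = - (LINT x|lborel. (a * g x + b * h x) * phi x)"
  using I(1)[OF assms(5)] I(1)[OF assms(6)] by (simp add: distrib_right mult.assoc)
 finally show "(LINT x|lborel. (a * u x + b * v x) * lap phi x) = - (LINT x|lborel. (a * g x + b * h x) * phi x)" .
qed

lemma poisson_mean_decreasing:
 fixes u g :: "'a::euclidean_space => real"
 assumes p: "poisson U u g" and u: "bdd_borel u" "bdd_borel g"
  and c: "c >= 0" "!!y. y : cball x t ==> g y >= c" and t: "t > 0" "cball x t <= U"
 shows "Sop t rho u x <= Sop (t/2) rho u x - c * t^2 * (LINT z|lborel. radial (kerk TYPE('a)) 0 (z::'a))"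
proof -
 have uk: "unit_kernel (radial (kerk TYPE('a)) 0 :: 'a => real)" by (rule unit_kernel_k)
 have "Sop t rho u x - 2^0 * Sop (t/2) rho u x = - t\<^sup>2 * Sop t (radial (kerk TYPE('a)) 0) g x"
  by (rule poisson_step[OF p u kernel_pair0 t])
 moreover have "Sop t (radial (kerk TYPE('a)) 0) g x >= (LINT z|lborel. radial (kerk TYPE('a)) 0 (z::'a) * c)"
  unfolding Sop_def
 proof (rule integral_mono)
  show "integrable lborel (%z::'a. radial (kerk TYPE('a)) 0 z * c)" using unit_kernelD(8)[OF uk] by simp
  show "integrable lborel (%z::'a. radial (kerk TYPE('a)) 0 z * g (x - t *\<^sub>R z))" by (rule Sop_integrable[OF u(2) uk])
  fix z :: 'a
  show "radial (kerk TYPE('a)) 0 z * c <= radial (kerk TYPE('a)) 0 z * g (x - t *\<^sub>R z)"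
  proof (cases "norm z < 1")
   case True
   then have "g (x - t *\<^sub>R z) >= c" using t by (intro c) (auto simp: dist_norm mult_left_le)
   then show ?thesis by (intro mult_left_mono ker_nonneg)
  qed (use unit_kernelD(2)[OF uk] in simp)
 qed
 ultimately show ?thesis using mult_left_mono[of "(LINT z|lborel. radial (kerk TYPE('a)) 0 (z::'a) * c)" "Sop t (radial (kerk TYPE('a)) 0) g x" "t^2"]
  by (simp add: mult_ac)
qed

text \<open>Under repeated halving of the scale the means increase to the value at x. Only the gain
  of the first halving is kept; the later gains are nonnegative and are dropped.\<close>

lemma poisson_mean_le:
 fixes u g :: "'a::euclidean_space => real"
 assumes p: "poisson U u g" and u: "bdd_borel u" "bdd_borel g" "isCont u x"
  and c: "c >= 0" "!!y. y : cball x t ==> g y >= c" and t: "t > 0" "cball x t <= U"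
 shows "Sop t rho u x <= u x - c * t^2 * (LINT z|lborel. radial (kerk TYPE('a)) 0 (z::'a))"
proof -
 define k where "k = (LINT z|lborel. radial (kerk TYPE('a)) 0 (z::'a))"
 have k: "k > 0" unfolding k_def by (rule integral_kerk)
 have "Sop t rho u x <= Sop (t/2^Suc n) rho u x - c * t^2 * k" for n
 proof (induction n)
  case 0 then show ?case using poisson_mean_decreasing[OF p u(1,2) c t] by (simp add: k_def)
 next
  case (Suc n)
  have sub: "cball x (t/2^Suc n) <= cball x t" using t(1) 
   by (intro subset_cball) (simp add: divide_le_eq mult_le_cancel_left1 del: power_Suc)
  have "Sop (t/2^Suc n) rho u x <= Sop (t/2^Suc n/2) rho u x - c * (t/2^Suc n)^2 * k"
   unfolding k_def by (rule poisson_mean_decreasing[OF p u(1,2) c(1)]) (use c(2) t sub in auto)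
  moreover have "c * (t/2^Suc n)^2 * k >= 0" using c(1) k by simp
  ultimately show ?case using Suc by (simp add: mult.commute)
 qed
 moreover have "(%n. Sop (t/2^Suc n) rho u x - c * t^2 * k) ----> u x * (LINT z|lborel. rho (z::'a)) - c * t^2 * k"
 proof (intro tendsto_diff tendsto_const Sop_tendsto[OF rho_facts(1) u(1,3)])
  have "(%n. t * (1/2)^Suc n) ----> t * 0"
   by (intro tendsto_intros LIMSEQ_Suc[OF LIMSEQ_realpow_zero]) auto
  then show "(%n. t/2^Suc n) ----> 0" by (simp add: power_divide)
 qed (use t in auto)
 ultimately have "Sop t rho u x <= u x * (LINT z|lborel. rho (z::'a)) - c * t^2 * k"
  by (intro LIMSEQ_le_const) auto
 then show ?thesis by (simp add: rho_facts k_def)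
qed

text \<open>At a minimum point of largest norm the mean value property would force \<open>u\<close> to attain its
 minimum on a whole ball.\<close>

lemma minimum_principle:
 fixes u g :: "'a::euclidean_space => real"
 assumes U: "open U" "bounded U" and u: "u : C0 U" and g: "bdd_borel g" "!!x. x : U ==> g x >= 0"
  and p: "poisson U u g"
 shows "u x >= 0"
proof (rule ccontr)
 assume neg: "~ u x >= 0"
 note cu = C0D(1)[OF u]
 have xU: "x : U" using neg C0D(2)[OF u] by force
 obtain x0 where x0: "x0 : closure U" "!!y. y : closure U ==> u x0 <= u y"
  using continuous_attains_inf[of "closure U" u] U(2) cu xU closure_subset by (metis compact_closure empty_iff subsetD)
 have m: "u x0 <= u y" for y
 proof (cases "y : closure U")
  case False
  then have "u y = 0" using C0D(2)[OF u] closure_subset by blast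
  moreover have "u x0 <= u x" using x0(2) xU closure_subset by blast
  ultimately show ?thesis using neg by linarith
 qed (rule x0(2))
 have m0: "u x0 < 0" using m[of x] neg by linarith
 define M where "M = {y. u y = u x0}"
 have MU: "M <= U" unfolding M_def using C0D(2)[OF u] m0 by force
 have "closed M" unfolding M_def using continuous_closed_preimage_constant[OF cu closed_UNIV] by (simp add: vimage_def)
 then have cM: "compact M" using MU U(2) bounded_subset compact_eq_bounded_closed by blast
 have "x0 : M" by (simp add: M_def)
 then obtain x1 where x1: "x1 : M" "!!y. y : M ==> norm y <= norm x1"
  using continuous_attains_sup[OF cM, of norm] by (metis continuous_on_norm_id empty_iff)
 have x1U: "x1 : U" using x1(1) MU by blast
 define t where "t = bdist U x1/2"
 have t: "t > 0" "cball x1 t <= U" 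
  using bdist_pos[OF U x1U] by (auto simp: t_def intro!: cball_bdist_subset)
 note uk = rho_facts(1)[where 'a='a]
 have ub: "bdd_borel u" by (rule C0_bdd_borel[OF U(2) u])
 have "Sop t rho u x1 <= u x1 - 0 * t^2 * (LINT z|lborel. radial (kerk TYPE('a)) 0 (z::'a))"
  by (rule poisson_mean_le[OF p ub g(1) C0_isCont[OF u]]) (use t g(2) in auto)
 then have le: "Sop t rho u x1 <= u x0" using x1(1) by (simp add: M_def)
 have i: "integrable lborel (%z. rho z * (u (x1 - t *\<^sub>R z) - u x0))"
  using Sop_integrable[OF ub uk] unit_kernelD(8)[OF uk] by (simp add: right_diff_distrib)
 have "(LINT z|lborel. rho z * (u (x1 - t *\<^sub>R z) - u x0)) = Sop t rho u x1 - u x0"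
  using Sop_integrable[OF ub uk] unit_kernelD(8)[OF uk] rho_facts(4)[where 'a='a] by (simp add: right_diff_distrib Sop_def)
 moreover have nn: "rho z * (u (x1 - t *\<^sub>R z) - u x0) >= 0" for z
  by (intro mult_nonneg_nonneg rho_facts(2)) (use m in simp)
 ultimately have "(LINT z|lborel. rho z * (u (x1 - t *\<^sub>R z) - u x0)) = 0"
  using le Lint_nonneg[of lborel "%z. rho z * (u (x1 - t *\<^sub>R z) - u x0)"] by simp
 then have "AE z in lborel. rho z * (u (x1 - t *\<^sub>R z) - u x0) = 0"
  using integral_nonneg_eq_0_iff_AE[OF i] nn by simp
 then have ae: "AE z in lborel. z : UNIV --> rho z * (u (x1 - t *\<^sub>R z) - u x0) = 0" by simp
 have "continuous_on UNIV (%z. rho z * (u (x1 - t *\<^sub>R z) - u x0))"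
  by (intro continuous_intros unit_kernelD(5)[OF uk] continuous_on_compose2[OF cu[of UNIV]]) auto
 from AE_continuous_eq_0[OF this open_UNIV ae UNIV_I] 
 have z: "rho z * (u (x1 - t *\<^sub>R z) - u x0) = 0" for z .
 obtain e :: 'a where e: "norm e = 1" using vector_choose_size[of 1] by auto
 \<comment> \<open>The point x1 + (t/2) w has larger norm than x1. Since rho is positive in the open
   unit ball, the vanishing integrand forces u to take its minimum there too, against the choice of
   x1.\<close>
 define w where "w = (if x1 = 0 then e else x1 /\<^sub>R norm x1)"
 have w: "norm w = 1" "norm (x1 + (t/2) *\<^sub>R w) = norm x1 + t/2"
 proof -
  show "norm w = 1" using e by (simp add: w_def)
  show "norm (x1 + (t/2) *\<^sub>R w) = norm x1 + t/2"
  proof (cases "x1 = 0")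
   case False
   then have "w = inverse (norm x1) *\<^sub>R x1" by (simp add: w_def)
   then have "x1 + (t/2) *\<^sub>R w = (1 + t/2/norm x1) *\<^sub>R x1"
    by (simp only: scaleR_add_left scaleR_one scaleR_scaleR divide_inverse[of "t/2"])
   then have "norm (x1 + (t/2) *\<^sub>R w) = (1 + t/2/norm x1) * norm x1"
    using t(1) by (simp only: norm_scaleR) (simp add: abs_of_pos add_pos_nonneg)
   then show ?thesis using False by (simp add: distrib_right)
  qed (use e t in \<open>simp add: w_def\<close>)
 qed
 have "rho ((- 1/2) *\<^sub>R w) > 0" by (rule rho_facts(5)) (simp add: w)
 with z[of "(- 1/2) *\<^sub>R w"] have "u (x1 + (t/2) *\<^sub>R w) = u x0" by (simp add: field_simps)
 then have "norm (x1 + (t/2) *\<^sub>R w) <= norm x1" using x1(2) by (simp add: M_def)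
 then show False using w t by simp
qed

section \<open>Boundary geometry and barriers\<close>

lemma Ck2_Taylor:
 fixes h :: "'a::euclidean_space => real"
 assumes h: "Ck 2 h"
 shows "EX C>0. ALL a:ball 0 R. ALL b:ball 0 R. abs (h b - h a) <= C * norm (b - a) &
   abs (h b - h a - (\<Sum>i\<in>Basis. ((b - a) \<bullet> i) * partial i h a)) <= C * (norm (b - a))^2"
proof -
 have h2: "Ck (Suc (Suc 0)) h" using h by (simp only: numeral_2_eq_2)
 have dh: "h differentiable at x" for x using h2 by (rule Ck_differentiable)
 have p1: "Ck (Suc 0) (partial i h)" if "i : Basis" for i by (rule Ck_partial[OF h2 that])
 have bd: "EX B>0. ALL x:ball 0 R. abs (f x) <= B" if "continuous_on UNIV f" for f :: "'a => real"
 proof -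
  have "bounded (f ` cball 0 R)"
   by (intro compact_imp_bounded compact_continuous_image continuous_on_subset[OF that]) auto
  then obtain B where "B > 0" "ALL x:cball 0 R. abs (f x) <= B" by (auto simp: bounded_pos)
  then show ?thesis by (intro exI[of _ B]) auto
 qed
 have "ALL i:Basis. EX B>0. ALL x:ball 0 R. abs (partial i h x) <= B"
  using bd[OF Ck_continuous[OF p1]] by blast
 then obtain B1 where B1: "!!i x. i : Basis ==> x : ball 0 R ==> abs (partial i h x) <= B1 i" "!!i. i : Basis ==> B1 i > 0"
  by metis
 have "ALL i:Basis. ALL j:Basis. EX B>0. ALL x:ball 0 R. abs (partial j (partial i h) x) <= B"
  using bd[OF Ck_continuous[OF Ck_partial[OF p1]]] by blast
 then obtain B2 where B2: "!!i j x. i : Basis ==> j : Basis ==> x : ball 0 R ==> abs (partial j (partial i h) x) <= B2 i j"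
   "!!i j. i : Basis ==> j : Basis ==> B2 i j > 0" by metis
 define M where "M = (\<Sum>i\<in>Basis. B1 i) + (\<Sum>i\<in>Basis. \<Sum>j\<in>Basis. B2 i j)"
 have s1: "(\<Sum>i\<in>Basis. B1 i) > 0" by (rule sum_pos) (use B1 in auto)
 have s2: "(\<Sum>i\<in>Basis. \<Sum>j\<in>Basis. B2 i j) > 0" by (intro sum_pos) (use B2 in auto)
 have M1: "abs (partial i h x) <= M" if "i : Basis" "x : ball 0 R" for i x
 proof -
  have "B1 i <= (\<Sum>i\<in>Basis. B1 i)" by (rule member_le_sum) (use B1 that in \<open>auto intro: less_imp_le\<close>)
  then show ?thesis using B1(1)[OF that] s2 unfolding M_def by linarith
 qed
 have M2: "abs (partial j (partial i h) x) <= M" if "i : Basis" "j : Basis" "x : ball 0 R" for i j x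
 proof -
  have "B2 i j <= (\<Sum>j\<in>Basis. B2 i j)" by (rule member_le_sum) (use B2 that in \<open>auto intro: less_imp_le\<close>)
  also have "... <= (\<Sum>i\<in>Basis. \<Sum>j\<in>Basis. B2 i j)" 
   by (rule member_le_sum[where f="%i. \<Sum>j\<in>Basis. B2 i j"]) (use that in \<open>auto intro!: sum_nonneg less_imp_le[OF B2(2)]\<close>)
  finally show ?thesis using B2(1)[OF that] s1 unfolding M_def by linarith
 qed
 define C where "C = DIM('a) * (DIM('a) * M) + DIM('a) * M"
 have M: "M > 0" using s1 s2 by (simp add: M_def)
 have C: "C > 0" using M by (simp add: C_def add_pos_pos)
 show ?thesis
 proof (intro exI[of _ C] conjI ballI C)
  fix a b :: 'a assume ab: "a : ball 0 R" "b : ball 0 R"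
  have "abs (h b - h a) <= DIM('a) * M * norm (b - a)"
   by (rule Ck1_abs_diff_le[OF dh convex_ball ab M1])
  also have "... <= C * norm (b - a)" unfolding C_def using M by (intro mult_right_mono) auto
  finally show "abs (h b - h a) <= C * norm (b - a)" .
  have seg: "closed_segment a b <= ball 0 R" using ab by (simp add: closed_segment_subset convex_ball)
  have "norm (h b - h a - (\<Sum>i\<in>Basis. ((b - a) \<bullet> i) * partial i h a)) <= norm (b - a) * (DIM('a) * (DIM('a) * M * norm (b - a)))"
  proof (rule differentiable_bound_linearization[where S="closed_segment a b"])
   show "a + t *\<^sub>R (b - a) : closed_segment a b" if "t : {0..1}" for t
    using that by (auto simp: in_segment algebra_simps intro!: exI[of _ t])
   show "(h has_derivative (%k. \<Sum>i\<in>Basis. (k \<bullet> i) * partial i h x)) (at x within closed_segment a b)" for x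
    using has_derivative_partial[OF dh] by (rule has_derivative_at_withinI)
   show "a : closed_segment a b" by simp
   fix x assume x: "x : closed_segment a b"
   have xR: "x : ball 0 R" using x seg by blast
   have xa: "norm (x - a) <= norm (b - a)" using dist_in_closed_segment[OF x] by (simp add: dist_norm norm_minus_commute)
   show "onorm ((%k. \<Sum>i\<in>Basis. (k \<bullet> i) * partial i h x) - (%k. \<Sum>i\<in>Basis. (k \<bullet> i) * partial i h a)) <= DIM('a) * (DIM('a) * M * norm (b - a))"
   proof (rule onorm_le)
    fix k :: 'a
    have "norm (((%k. \<Sum>i\<in>Basis. (k \<bullet> i) * partial i h x) - (%k. \<Sum>i\<in>Basis. (k \<bullet> i) * partial i h a)) k)
     = norm (\<Sum>i\<in>Basis. (k \<bullet> i) * (partial i h x - partial i h a))"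
     by (simp add: sum_subtractf right_diff_distrib)
    also have "... <= (\<Sum>i\<in>(Basis::'a set). abs (k \<bullet> i) * abs (partial i h x - partial i h a))"
     by (rule order_trans[OF norm_sum]) (simp add: abs_mult)
    also have "... <= (\<Sum>i\<in>(Basis::'a set). norm k * (DIM('a) * M * norm (b - a)))"
    proof (intro sum_mono mult_mono Basis_le_norm)
     fix i :: 'a assume i: "i : Basis"
     have "abs (partial i h x - partial i h a) <= DIM('a) * M * norm (x - a)"
      by (rule Ck1_abs_diff_le[OF Ck_differentiable[OF p1[OF i]] convex_ball ab(1) xR M2[OF i]])
     also have "... <= DIM('a) * M * norm (b - a)" using xa M by (intro mult_left_mono) auto
     finally show "abs (partial i h x - partial i h a) <= DIM('a) * M * norm (b - a)" .
    qed auto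
    finally show "norm (((%k. \<Sum>i\<in>Basis. (k \<bullet> i) * partial i h x) - (%k. \<Sum>i\<in>Basis. (k \<bullet> i) * partial i h a)) k)
      <= DIM('a) * (DIM('a) * M * norm (b - a)) * norm k"
     by (simp add: mult_ac)
   qed
  qed
  also have "... = DIM('a) * (DIM('a) * M) * (norm (b - a))^2" by (simp add: power2_eq_square)
  also have "... <= C * (norm (b - a))^2" unfolding C_def using M by (intro mult_right_mono) auto
  finally show "abs (h b - h a - (\<Sum>i\<in>Basis. ((b - a) \<bullet> i) * partial i h a)) <= C * (norm (b - a))^2" by simp
 qed
qed

text \<open>The function z takes values in the half-open interval from 0 to c on T and grows by c
  under each shift by c along e, so the shifted copies of T are disjoint. About r/c of them fit into
  the ball of radius 2r, and all have the same measure.\<close>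

lemma strip_translates:
 fixes T :: "'a::euclidean_space set" and z :: "'a => real"
 assumes T: "T : sets borel" "T <= ball x r" and e: "norm e = 1" and c: "c > 0" and r: "r > 0"
  and z: "!!y t. z (y + t *\<^sub>R e) = z y + t" "!!y. y : T ==> 0 < z y & z y <= c"
 shows "measure lborel T <= measure lborel (ball x (2 * r)) * c/r"
proof -
 define m where "m = nat \<lfloor>r/c\<rfloor>"
 have m: "real m * c <= r" "r <= real (Suc m) * c"
 proof -
  have "real m = of_int \<lfloor>r/c\<rfloor>" unfolding m_def using c r by simp
  then have "real m <= r/c" "r/c <= real (Suc m)" by linarith+
  then show "real m * c <= r" "r <= real (Suc m) * c" using c by (simp_all only: pos_le_divide_eq pos_divide_le_eq)
 qed
 define F where "F j y = indicat_real T (y + (- (real j * c)) *\<^sub>R e)" for j y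
 have bT: "bounded T" using T(2) bounded_subset bounded_ball by blast
 then have iT: "integrable lborel (indicat_real T)" using T(1) emeasure_bounded_finite by (intro integrable_real_indicator) auto
 have mF: "(%y. indicat_real T y) : borel_measurable borel" using T(1) by measurable
 have iF: "integrable lborel (F j)" for j
 proof (rule integrable_bounded_support[where B=1 and S="ball x (2 * r + real j * c)"])
  show "F j : borel_measurable borel" unfolding F_def[abs_def] using mF by measurable
  show "F j y = 0" if "y ~: ball x (2 * r + real j * c)" for y
  proof -
   have "y + (- (real j * c)) *\<^sub>R e ~: ball x r"
   proof
    assume "y + (- (real j * c)) *\<^sub>R e : ball x r"
    then have "norm (x - (y - (real j * c) *\<^sub>R e)) < r" by (simp add: dist_norm)
    moreover have "norm (x - y) <= norm (x - (y - (real j * c) *\<^sub>R e)) + norm ((real j * c) *\<^sub>R e)"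
     using norm_triangle_ineq4[of "x - (y - (real j * c) *\<^sub>R e)" "(real j * c) *\<^sub>R e"] by simp
    ultimately show False using that e c r by (simp add: dist_norm)
   qed
   then show ?thesis using T(2) unfolding F_def by (auto simp: indicator_def)
  qed
 qed (auto simp: F_def indicator_def)
 have "real (Suc m) * measure lborel T = (\<Sum>j\<le>m. LINT y|lborel. F j y)"
 proof -
  have "(LINT y|lborel. F j y) = measure lborel T" for j
   unfolding F_def using lborel_integral_translate[OF mF, of "(- (real j * c)) *\<^sub>R e"] T(1) by simp
  then show ?thesis by simp
 qed
 also have "... = (LINT y|lborel. (\<Sum>j\<le>m. F j y))"
  using iF by (simp add: Lint_sum)
 also have "... <= (LINT y|lborel. indicator (ball x (2 * r)) y)"
 proof (rule integral_mono)
  show "integrable lborel (%y. \<Sum>j\<le>m. F j y)" using iF by simp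
  fix y
  show "(\<Sum>j\<le>m. F j y) <= indicator (ball x (2 * r)) y"
  proof (cases "EX j<=m. y + (- (real j * c)) *\<^sub>R e : T")
   case False
   then have "(\<Sum>j\<le>m. F j y) = 0" by (intro sum.neutral) (auto simp: F_def)
   then show ?thesis by simp
  next
   case True
   then obtain j where j: "j <= m" "y + (- (real j * c)) *\<^sub>R e : T" by blast
   have uni: "F k y = 0" if "k ~= j" for k
   proof (rule ccontr)
    assume "F k y ~= 0"
    then have "y + (- (real k * c)) *\<^sub>R e : T" by (auto simp: F_def indicator_def split: if_splits)
    from z(2)[OF this] z(2)[OF j(2)] have k: "0 < z y - real k * c" "z y - real k * c <= c" "0 < z y - real j * c" "z y - real j * c <= c"
     unfolding z(1) by simp_all
    then have "real k * c < (real j + 1) * c" "real j * c < (real k + 1) * c" by (simp_all only: distrib_right)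
    then have "real k < real j + 1" "real j < real k + 1" using c by simp_all
    then have "k = j" by linarith
    then show False using that by simp
   qed
   have "(\<Sum>j\<le>m. F j y) = (\<Sum>i\<in>{j}. F i y)"
    by (rule sum.mono_neutral_right) (use j(1) uni in auto)
   also have "... <= 1" by (simp add: F_def)
   finally have "(\<Sum>j\<le>m. F j y) <= 1" .
   moreover have "y : ball x (2 * r)"
   proof -
    have "norm (x - (y - (real j * c) *\<^sub>R e)) < r" using j(2) T(2) by (auto simp: dist_norm subset_iff)
    moreover have "norm (x - y) <= norm (x - (y - (real j * c) *\<^sub>R e)) + norm ((real j * c) *\<^sub>R e)"
     using norm_triangle_ineq4[of "x - (y - (real j * c) *\<^sub>R e)" "(real j * c) *\<^sub>R e"] by simp
    moreover have "real j * c <= real m * c" using j(1) c by (intro mult_right_mono) auto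
    moreover have "norm ((real j * c) *\<^sub>R e) = real j * c" using c e by simp
    ultimately show ?thesis using m(1) unfolding mem_ball dist_norm by linarith
   qed
   ultimately show ?thesis by simp
  qed
 qed simp
 finally have le: "real (Suc m) * measure lborel T <= measure lborel (ball x (2 * r))" by simp
 have "(r/c) * measure lborel T <= real (Suc m) * measure lborel T"
  using m(2) c by (intro mult_right_mono) (auto simp: pos_divide_le_eq)
 with le have "(r/c) * measure lborel T <= measure lborel (ball x (2 * r))" by linarith
 then show ?thesis using c r by (simp add: field_simps)
qed

text \<open>Collects what later arguments use of the C^2 boundary. The quadratic deviation from the
  tangent plane with inner normal nu yields exterior balls and the reflection estimate; the volume
  of the boundary strip controls the error of cutting off near the boundary.\<close>

definition boundary_const :: "'a::euclidean_space set => 'a => real => real => bool" where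
 "boundary_const Om x0 r0 C \<longleftrightarrow>
   (EX nu. norm nu = 1 & (ALL y:frontier Om. dist x0 y < r0 --> abs (nu \<bullet> (y - x0)) <= C * (dist x0 y)^2) &
    (ALL y. dist x0 y < r0 & nu \<bullet> (y - x0) < - C * (dist x0 y)^2 --> y ~: Om)) &
   (ALL r s. 0 < s & s <= r & r <= r0 -->
    measure lborel {y : Om \<inter> ball x0 r. bdist Om y <= s} <= C * s * r^(DIM('a) - 1))"

lemma boundary_const_mono:
 assumes b: "boundary_const Om x0 r0 C" and le: "r1 <= r0" "C <= C'"
 shows "boundary_const Om (x0::'a::euclidean_space) r1 C'"
proof -
 obtain nu where nu: "norm nu = 1" "!!y. y : frontier Om ==> dist x0 y < r0 ==> abs (nu \<bullet> (y - x0)) <= C * (dist x0 y)^2"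
    "!!y. dist x0 y < r0 ==> nu \<bullet> (y - x0) < - C * (dist x0 y)^2 ==> y ~: Om"
  and st: "!!r s. 0 < s ==> s <= r ==> r <= r0 ==>
    measure lborel {y : Om \<inter> ball x0 r. bdist Om y <= s} <= C * s * r^(DIM('a) - 1)"
  using b unfolding boundary_const_def by blast
 have C: "C * (dist x0 y)^2 <= C' * (dist x0 y)^2" for y using le(2) by (intro mult_right_mono) auto
 show ?thesis unfolding boundary_const_def
 proof (intro conjI exI[of _ nu] ballI allI impI nu(1))
  fix y assume "y : frontier Om" "dist x0 y < r1"
  then show "abs (nu \<bullet> (y - x0)) <= C' * (dist x0 y)^2" using nu(2)[of y] C[of y] le by linarith
 next
  fix y assume "dist x0 y < r1 & nu \<bullet> (y - x0) < - C' * (dist x0 y)^2"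
  then show "y ~: Om" using nu(3)[of y] C[of y] le by simp
 next
  fix r s :: real assume rs: "0 < s & s <= r & r <= r1"
  then have "C * (s * r^(DIM('a) - 1)) <= C' * (s * r^(DIM('a) - 1))"
   using le(2) by (intro mult_right_mono mult_nonneg_nonneg) auto
  moreover have "measure lborel {y : Om \<inter> ball x0 r. bdist Om y <= s} <= C * s * r^(DIM('a) - 1)"
   using st[of s r] le rs by linarith
  ultimately show "measure lborel {y : Om \<inter> ball x0 r. bdist Om y <= s} <= C' * s * r^(DIM('a) - 1)"
   by (simp only: mult.assoc)
 qed
qed

lemma boundary_const_local:
 fixes Om :: "'a::euclidean_space set"
 assumes Om: "open Om" "bounded Om" and r: "r > 0" and e: "norm e = 1" and h: "Ck 2 h"
  and chart: "Om \<inter> ball x1 r = {y : ball x1 r. y \<bullet> e > h (y - (y \<bullet> e) *\<^sub>R e)}"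
 shows "EX C. ALL x0:frontier Om \<inter> ball x1 (r/8). boundary_const Om x0 (r/8) C"
proof -
 define P where "P y = y - (y \<bullet> e) *\<^sub>R e" for y
 \<comment> \<open>The height above the graph: inside the chart it is positive exactly on
   \<open>Om\<close>, vanishes on the frontier, is Lipschitz, and grows at unit speed along
   e.\<close>
 define z where "z y = y \<bullet> e - h (P y)" for y
 have ee: "e \<bullet> e = 1" using e by (simp add: power2_norm_eq_inner[symmetric])
 have Pdiff: "P a - P b = P (a - b)" for a b by (simp add: P_def algebra_simps inner_diff_left)
 have Pn: "norm (P v) <= norm v" for v
 proof -
  have "(norm (P v))^2 = (norm v)^2 - (v \<bullet> e)^2"
   unfolding P_def power2_norm_eq_inner by (simp add: inner_diff_left inner_diff_right ee inner_commute power2_eq_square)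
  then have "(norm (P v))^2 <= (norm v)^2" by simp
  then show ?thesis by (rule power2_le_imp_le) simp
 qed
 have Psym: "P v \<bullet> w = v \<bullet> P w" for v w by (simp add: P_def inner_diff_left inner_diff_right inner_commute)
 define R where "R = norm x1 + r"
 have bR: "y : ball x1 r ==> y : ball 0 R" for y
  using norm_triangle_ineq2[of y x1] by (simp add: R_def dist_norm norm_minus_commute)
 have PR: "y : ball x1 r ==> P y : ball 0 R" for y using bR[of y] Pn[of y] by simp
 obtain C where C: "C > 0" and C1: "!!a b. a : ball 0 R ==> b : ball 0 R ==> abs (h b - h a) <= C * norm (b - a)"
  and C2: "!!a b. a : ball 0 R ==> b : ball 0 R ==>
   abs (h b - h a - (\<Sum>i\<in>Basis. ((b - a) \<bullet> i) * partial i h a)) <= C * (norm (b - a))^2"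
  using Ck2_Taylor[OF h, of R] by blast
 have ch: "continuous_on UNIV h" using h by (rule Ck_continuous)
 have cz: "continuous_on UNIV z" unfolding z_def P_def
  by (intro continuous_intros continuous_on_compose2[OF ch]) auto
 have inOm: "y : Om \<longleftrightarrow> z y > 0" if "y : ball x1 r" for y
 proof -
  have "y : Om \<longleftrightarrow> y : {y : ball x1 r. y \<bullet> e > h (y - (y \<bullet> e) *\<^sub>R e)}"
   unfolding chart[symmetric] using that by blast
  then show ?thesis using that by (simp add: z_def P_def)
 qed
 have fr: "z y = 0" if "y : frontier Om" "y : ball x1 r" for y
 proof -
  have "y ~: Om" using that(1) Om(1) by (simp add: frontier_def interior_open)
  then have "~ z y > 0" using inOm that by blast
  moreover have "~ z y < 0"
  proof
   assume neg: "z y < 0"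
   have "open ({y. z y < 0} \<inter> ball x1 r)" 
    by (intro open_Int open_Collect_less cz continuous_intros open_ball)
   moreover have "y : {y. z y < 0} \<inter> ball x1 r" using neg that by simp
   moreover have "({y. z y < 0} \<inter> ball x1 r) \<inter> Om = {}" using inOm by force
   ultimately have "y ~: closure Om" using open_Int_closure_eq_empty by blast
   then show False using that(1) by (simp add: frontier_def)
  qed
  ultimately show ?thesis by simp
 qed
 have zshift: "z (y + t *\<^sub>R e) = z y + t" for y t
 proof -
  have "P (y + t *\<^sub>R e) = P y" by (simp add: P_def inner_add_left ee algebra_simps)
  then show ?thesis by (simp add: z_def inner_add_left ee)
 qed
 define \<Lambda> where "\<Lambda> = 1 + C"
 have zlip: "abs (z a - z b) <= \<Lambda> * norm (a - b)" if "a : ball x1 r" "b : ball x1 r" for a b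
 proof -
  have "abs (h (P a) - h (P b)) <= C * norm (P a - P b)" using C1[OF PR[OF that(2)] PR[OF that(1)]] .
  also have "... <= C * norm (a - b)" unfolding Pdiff using Pn C by (intro mult_left_mono) auto
  finally have 1: "abs (h (P a) - h (P b)) <= C * norm (a - b)" .
  have "abs ((a - b) \<bullet> e) <= norm (a - b) * norm e" by (rule Cauchy_Schwarz_ineq2)
  then have 2: "abs (a \<bullet> e - b \<bullet> e) <= norm (a - b)" by (simp add: e inner_diff_left)
  show ?thesis using 1 2 unfolding z_def \<Lambda>_def distrib_right by linarith
 qed
 define C' where "C' = C + unit_vol TYPE('a) * 2^DIM('a) * \<Lambda>"
 have C': "C <= C'" "unit_vol TYPE('a) * 2^DIM('a) * \<Lambda> <= C'" unfolding C'_def \<Lambda>_def using C by simp_all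
 have "boundary_const Om x0 (r/8) C'" if x0: "x0 : frontier Om \<inter> ball x1 (r/8)" for x0
 proof -
  \<comment> \<open>The radius r/8 leaves room in the chart: a point within r/8 of x0 has its
    nearest frontier point within r/4 of x0 when its boundary distance is at most r/8.\<close>
  have near: "y : ball x1 r" if "dist x0 y < r/2" for y
   using dist_triangle[of x1 y x0] x0 that r by simp
  have x0r: "x0 : ball x1 r" using near[of x0] r by simp
  define w where "w = (\<Sum>i\<in>Basis. partial i h (P x0) *\<^sub>R i)"
  \<comment> \<open>The gradient of z at x0. Its component along e is 1, so its norm is at least 1
    and normalising it preserves the quadratic bounds.\<close>
  define n where "n = e - P w"
  have n1: "n \<bullet> e = 1" by (simp add: n_def inner_diff_left ee P_def)
  then have n: "norm n >= 1" using Cauchy_Schwarz_ineq2[of n e] e by simp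
  have tay: "abs (z y - n \<bullet> (y - x0)) <= C * (dist x0 y)^2" if y: "dist x0 y < r/2" for y
  proof -
   have "(\<Sum>i\<in>Basis. ((P y - P x0) \<bullet> i) * partial i h (P x0)) = (P y - P x0) \<bullet> w"
    by (simp add: w_def inner_sum_right mult.commute)
   also have "... = P w \<bullet> (y - x0)" unfolding Pdiff using Psym[of w "y - x0"] by (simp add: inner_commute)
   finally have "abs (h (P y) - h (P x0) - P w \<bullet> (y - x0)) <= C * (norm (P y - P x0))^2"
    using C2[OF PR[OF x0r] PR[OF near[OF y]]] by simp
   also have "... <= C * (dist x0 y)^2" unfolding Pdiff dist_norm norm_minus_commute[of x0]
    using Pn C by (intro mult_left_mono power_mono) auto
   finally have "abs (h (P y) - h (P x0) - P w \<bullet> (y - x0)) <= C * (dist x0 y)^2" .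
   moreover have "z y - n \<bullet> (y - x0) = - (h (P y) - h (P x0) - P w \<bullet> (y - x0))"
    using fr[of x0] x0 x0r unfolding n_def z_def by (simp add: inner_diff_left inner_diff_right inner_commute)
   ultimately show ?thesis by simp
  qed
  have np: "norm n > 0" using n by linarith
  define nu where "nu = n /\<^sub>R norm n"
  have nu: "norm nu = 1" using np by (simp add: nu_def)
  have nun: "nu \<bullet> v = (n \<bullet> v)/norm n" for v by (simp add: nu_def divide_inverse mult.commute)
  have "boundary_const Om x0 (r/8) C'"
   unfolding boundary_const_def
  proof (intro conjI exI[of _ nu] ballI allI impI nu)
   fix y assume y: "y : frontier Om" "dist x0 y < r/8"
   have "z y = 0" using fr[OF y(1) near] y(2) r by simp
   then have "abs (n \<bullet> (y - x0)) <= C * (dist x0 y)^2" using tay[of y] y r by simp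
   moreover have "abs (n \<bullet> (y - x0))/norm n <= abs (n \<bullet> (y - x0))/1" using n by (intro divide_left_mono) auto
   moreover have "C * (dist x0 y)^2 <= C' * (dist x0 y)^2" using C' by (intro mult_right_mono) auto
   ultimately show "abs (nu \<bullet> (y - x0)) <= C' * (dist x0 y)^2" using n by (simp add: nun)
  next
   fix y assume y: "dist x0 y < r/8 & nu \<bullet> (y - x0) < - C' * (dist x0 y)^2"
   have "C * (dist x0 y)^2 <= C' * (dist x0 y)^2" using C' by (intro mult_right_mono) auto
   then have a: "(n \<bullet> (y - x0))/norm n < - (C * (dist x0 y)^2)" using y by (simp add: nun)
   have "n \<bullet> (y - x0) < - (C * (dist x0 y)^2) * norm n" using a np by (simp only: pos_divide_less_eq)
   also have "... <= - (C * (dist x0 y)^2) * 1" using n C by (intro mult_left_mono_neg) auto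
   finally have "n \<bullet> (y - x0) < - (C * (dist x0 y)^2)" by simp
   then have "z y < 0" using tay[of y] y r by simp
   then show "y ~: Om" using inOm[OF near] y r by auto
  next
   fix r' s :: real assume rs: "0 < s & s <= r' & r' <= r/8"
   define T where "T = {y : Om \<inter> ball x0 r'. bdist Om y <= s}"
   have "measure lborel T <= measure lborel (ball x0 (2 * r')) * (\<Lambda> * s)/r'"
   proof (rule strip_translates[OF _ _ e _ _ zshift])
    have "T = Om \<inter> ball x0 r' \<inter> {y. bdist Om y <= s}" by (auto simp: T_def)
    moreover have "closed {y. bdist Om y <= s}" by (intro closed_Collect_le continuous_intros)
    ultimately show "T : sets borel" using Om(1) by auto
    show "T <= ball x0 r'" by (auto simp: T_def)
    show "0 < \<Lambda> * s" using C rs by (simp add: \<Lambda>_def)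
    show "0 < r'" using rs by linarith
    fix y assume "y : T"
    then have y: "y : Om" "dist x0 y < r'" "bdist Om y <= s" by (auto simp: T_def)
    have yr: "y : ball x1 r" by (rule near) (use y rs r in auto)
    obtain y' where y': "y' : frontier Om" "bdist Om y = dist y y'" using bdist_attained[OF Om y(1)] by blast
    have y'r: "y' : ball x1 r" by (rule near) (use y y'(2) rs r dist_triangle[of x0 y' y] in auto)
    have "abs (z y - z y') <= \<Lambda> * norm (y - y')" by (rule zlip[OF yr y'r])
    also have "... <= \<Lambda> * s" using y'(2) y(3) C by (intro mult_left_mono) (auto simp: \<Lambda>_def dist_norm)
    finally show "0 < z y & z y <= \<Lambda> * s" using fr[OF y'(1) y'r] inOm[OF yr] y(1) by simp
   qed
   also have "measure lborel (ball x0 (2 * r')) = unit_vol TYPE('a) * (2 * r')^DIM('a)"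
    using content_ball[of "2 * r'" x0] content_ball[of 1 "0::'a"] rs by simp
   also have "... * (\<Lambda> * s)/r' = (unit_vol TYPE('a) * 2^DIM('a) * \<Lambda>) * (s * r'^(DIM('a) - 1))"
   proof -
    have "r'^DIM('a) = r' * r'^(DIM('a) - 1)" by (metis DIM_positive Suc_diff_1 power_Suc)
    then show ?thesis using rs by (simp add: power_mult_distrib)
   qed
   also have "... <= C' * (s * r'^(DIM('a) - 1))" using rs by (intro mult_right_mono C') auto
   finally show "measure lborel {y : Om \<inter> ball x0 r'. bdist Om y <= s} <= C' * s * r'^(DIM('a) - 1)"
    by (simp add: T_def mult.assoc)
  qed
  then show ?thesis .
 qed
 then show ?thesis by blast
qed

lemma boundary_const_exists:
 fixes Om :: "'a::euclidean_space set"
 assumes Om: "open Om" "bounded Om" and b: "Ck_boundary 2 Om"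
 shows "EX r0>0. EX C>0. ALL x0:frontier Om. boundary_const Om x0 r0 C"
proof -
 have "ALL x1:frontier Om. EX r>0. EX C. ALL x0:frontier Om \<inter> ball x1 r. boundary_const Om x0 r C"
 proof
  fix x1 assume "x1 : frontier Om"
  then obtain r e h where "r > 0" "norm e = 1" "Ck 2 h"
   "Om \<inter> ball x1 r = {y : ball x1 r. y \<bullet> e > h (y - (y \<bullet> e) *\<^sub>R e)}"
   using b unfolding Ck_boundary_def by blast
  from boundary_const_local[OF Om this] \<open>r > 0\<close>
  show "EX r>0. EX C. ALL x0:frontier Om \<inter> ball x1 r. boundary_const Om x0 r C"
   by (intro exI[of _ "r/8"]) simp
 qed
 then obtain r C where rC: "!!x1. x1 : frontier Om ==> r x1 > 0"
  "!!x1 x0. x1 : frontier Om ==> x0 : frontier Om \<inter> ball x1 (r x1) ==> boundary_const Om x0 (r x1) (C x1)"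
  by metis
 have cpt: "compact (frontier Om)" using Om(2) by (rule compact_frontier_bounded)
 have cov: "frontier Om <= (\<Union>x\<in>frontier Om. ball x (r x))" using rC(1) by auto
 obtain D where D: "D <= frontier Om" "finite D" "frontier Om <= (\<Union>x\<in>D. ball x (r x))"
  using compactE_image[OF cpt _ cov] by (metis open_ball)
 define r0 where "r0 = Min (insert 1 (r ` D))"
 define C0 where "C0 = Max (insert 1 (C ` D))"
 have r0: "r0 > 0" unfolding r0_def using D rC(1) by (subst Min_gr_iff) auto
 have C0: "C0 > 0" unfolding C0_def using D(2) by (subst Max_gr_iff) auto
 have "boundary_const Om x0 r0 C0" if x0: "x0 : frontier Om" for x0
 proof -
  obtain x1 where x1: "x1 : D" "x0 : ball x1 (r x1)" using D(3) x0 by blast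
  have "boundary_const Om x0 (r x1) (C x1)" using rC(2) D(1) x1 x0 by blast
  moreover have "r0 <= r x1" unfolding r0_def using D(2) x1(1) by (intro Min_le) auto
  moreover have "C x1 <= C0" unfolding C0_def using D(2) x1(1) by (intro Max_ge) auto
  ultimately show ?thesis by (rule boundary_const_mono)
 qed
 with r0 C0 show ?thesis by blast
qed

text \<open>A point x0 + v of the ball satisfies nu . v < -|v|^2/(2 delta), because the terms
  delta^2 cancel. Since 2 delta C <= 1, this is at least as strong as the quadratic condition that
  excludes the point from \<open>Om\<close>.\<close>

lemma exterior_balls:
 fixes Om :: "'a::euclidean_space set"
 assumes b: "boundary_const Om x0 r0 C" and x0: "x0 : frontier Om" and delta: "0 < delta" "2 * delta <= r0" "2 * delta * C <= 1" "C > 0"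
 obtains nu where "norm nu = 1" "ball (x0 - delta *\<^sub>R nu) delta \<inter> Om = {}"
  "!!y. y : frontier Om ==> dist x0 y < r0 ==> abs (nu \<bullet> (y - x0)) <= C * (dist x0 y)^2"
  "!!y. dist x0 y < r0 ==> nu \<bullet> (y - x0) < - C * (dist x0 y)^2 ==> y ~: Om"
proof -
 obtain nu where nu: "norm nu = 1" "!!y. y : frontier Om ==> dist x0 y < r0 ==> abs (nu \<bullet> (y - x0)) <= C * (dist x0 y)^2"
    "!!y. dist x0 y < r0 ==> nu \<bullet> (y - x0) < - C * (dist x0 y)^2 ==> y ~: Om"
  using b unfolding boundary_const_def by blast
 have "y ~: Om" if y: "y : ball (x0 - delta *\<^sub>R nu) delta" for y
 proof -
  define v where "v = y - x0"
  have n: "norm (v + delta *\<^sub>R nu) < delta" using y by (simp add: v_def dist_norm norm_minus_commute algebra_simps)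
  then have "(norm (v + delta *\<^sub>R nu))^2 < delta^2" by (intro power_strict_mono) auto
  moreover have "(norm (v + delta *\<^sub>R nu))^2 = (norm v)^2 + 2 * delta * (nu \<bullet> v) + delta^2"
  proof -
   have "nu \<bullet> nu = 1" using nu(1) by (simp add: power2_norm_eq_inner[symmetric])
   then show ?thesis unfolding power2_norm_eq_inner
    by (simp add: inner_add_left inner_add_right inner_commute power2_eq_square algebra_simps)
  qed
  ultimately have lt: "2 * delta * (nu \<bullet> v) < - (norm v^2)" by simp
  have "2 * delta * (C * (norm v)^2) <= 1 * (norm v)^2" unfolding mult.assoc[symmetric] by (intro mult_right_mono delta) simp
  moreover have "2 * delta * (- C * (norm v)^2) = - (2 * delta * (C * (norm v)^2))"
   by (simp only: mult_minus_left mult_minus_right)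
  ultimately have "2 * delta * (nu \<bullet> v) < 2 * delta * (- C * (norm v)^2)" using lt by linarith
  then have 1: "nu \<bullet> v < - C * (norm v)^2" using delta(1) by (simp only: mult_less_cancel_left_pos)
  have "norm v <= norm (v + delta *\<^sub>R nu) + norm (delta *\<^sub>R nu)" using norm_triangle_ineq4[of "v + delta *\<^sub>R nu" "delta *\<^sub>R nu"] by simp
  then have "norm v < 2 * delta" using n nu(1) delta(1) by simp
  then have "dist x0 y < r0" using delta(2) by (simp add: v_def dist_norm norm_minus_commute)
  then show ?thesis using nu(3)[of y] 1 by (simp add: v_def dist_norm norm_minus_commute)
 qed
 then show ?thesis using nu by (intro that[of nu]) auto
qed

lemma integral_by_parts2:
 fixes f phi :: "'a::euclidean_space => real"
 assumes f: "smooth f" and phi: "test_function U phi" and i: "i : Basis"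
 shows "(LINT x|lborel. f x * partial i phi x) = - (LINT x|lborel. partial i f x * phi x)"
 using phi by (rule test_functionE) (rule integral_by_parts[OF smooth_Ck[OF f] smooth_Ck i])

lemma smooth_poisson:
 fixes V :: "'a::euclidean_space => real"
 assumes V: "smooth V" "bdd_borel V" "bdd_borel (lap V)"
 shows "poisson UNIV V (%x. - lap V x)"
 unfolding poisson_def
proof (intro allI impI)
 fix phi :: "'a => real" assume t: "test_function UNIV phi"
 obtain K where K: "smooth phi" "bounded K" "closed K" "!!x. x ~: K ==> phi x = 0" using t by (rule test_functionE) blast
 have i1: "integrable lborel (%x. V x * partial i (partial i phi) x)" if "i : Basis" for i
  by (rule test_function_integrable[OF test_function_partial[OF test_function_partial[OF t that] that] V(2)])
 have i2: "integrable lborel (%x. partial i (partial i V) x * phi x)" if "i : Basis" for i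
  by (rule integrable_continuous_support[OF continuous_on_mult[OF smooth_continuous[OF smooth_partial[OF
      smooth_partial[OF V(1) that] that]] smooth_continuous[OF K(1)]] K(2)]) (simp add: K)
 have "(LINT x|lborel. V x * lap phi x) = (\<Sum>i\<in>Basis. LINT x|lborel. V x * partial i (partial i phi) x)"
  unfolding lap_def sum_distrib_left by (rule Lint_sum) (rule i1)
 also have "... = (\<Sum>i\<in>Basis. LINT x|lborel. partial i (partial i V) x * phi x)"
  using integral_by_parts2[OF V(1) test_function_partial[OF t]] integral_by_parts2[OF smooth_partial[OF V(1)] t]
  by (intro sum.cong refl) simp
 also have "... = (LINT x|lborel. lap V x * phi x)"
  unfolding lap_def sum_distrib_right by (rule Lint_sum[symmetric]) (rule i2)
 finally show "(LINT x|lborel. V x * lap phi x) = - (LINT x|lborel. - lap V x * phi x)" by simp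
qed

section \<open>Domains with uniform boundary constants, and their barriers\<close>

locale domain =
 fixes Om :: "'a::euclidean_space set" and r0 Cb :: real
 assumes open_Om: "open Om" and bounded_Om: "bounded Om" and r0_pos: "r0 > 0" and Cb_pos: "Cb > 0"
  and bconst: "!!x0. x0 : frontier Om ==> boundary_const Om x0 r0 Cb"
begin

abbreviation "LO == lebesgue_on Om"

definition "delta = min (r0/2) (1/(2 * Cb))"

lemma delta: "delta > 0" "2 * delta <= r0" "2 * delta * Cb <= 1"
proof -
 show "delta > 0" "2 * delta <= r0" using r0_pos Cb_pos by (auto simp: delta_def min_def)
 have "delta <= 1/(2 * Cb)" by (simp add: delta_def)
 then show "2 * delta * Cb <= 1" using Cb_pos by (simp add: field_simps)
qed

lemma gauss_lipschitz:
 fixes alpha :: real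
 assumes "alpha >= 1" shows "abs (exp (- alpha * a^2) - exp (- alpha * b^2)) <= 2 * alpha * abs (a - b)"
proof -
 have "norm (exp (- alpha * a^2) - exp (- alpha * b^2)) <= (2 * alpha) * norm (a - b)"
 proof (rule field_differentiable_bound[OF convex_UNIV])
  fix u :: real
  show "((%u. exp (- alpha * u^2)) has_field_derivative (- alpha * (2 * u)) * exp (- alpha * u^2)) (at u within UNIV)"
   by (auto intro!: derivative_eq_intros)
  have "abs u <= 1 + u^2" using sum_squares_bound[of 1 "abs u"] by simp
  also have "... <= 1 + alpha * u^2" using mult_right_mono[OF assms, of "u^2"] by simp
  also have "... <= exp (alpha * u^2)" by (rule exp_ge_add_one_self)
  finally have "abs u * exp (- alpha * u^2) <= exp (alpha * u^2) * exp (- alpha * u^2)" by (intro mult_right_mono) auto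
  then have "abs u * exp (- alpha * u^2) <= 1" by (simp add: exp_minus_inverse)
  then have "2 * alpha * (abs u * exp (- alpha * u^2)) <= 2 * alpha * 1" using assms by (intro mult_left_mono) auto
  then show "norm ((- alpha * (2 * u)) * exp (- alpha * u^2)) <= 2 * alpha" using assms by (simp add: abs_mult mult_ac)
 qed auto
 then show ?thesis by simp
qed

text \<open>The barrier is A (exp (-alpha delta^2) - exp (-alpha |y - c|^2)), with c the centre of
  the exterior ball at x0 and alpha large. It is Lipschitz in |y - c| and vanishes at |y - c| =
  delta. This bounds it above by the distance to x0, and below by -L t, because a ball of radius t
  around a point of \<open>Om\<close> enters the exterior ball only to depth t.\<close>

lemma barrier_exists:
 "EX L>0. EX t0>0. t0 <= 1 & (ALL x0:frontier Om. EX V. smooth V & bdd_borel V & bdd_borel (lap V) &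
   (ALL y. V y <= L * dist x0 y) &
   (ALL x:Om. ALL t. 0 < t & t <= t0 --> (ALL y:cball x t. - lap V y >= 1 & V y >= - L * t)))"
proof -
 obtain B where B: "Om <= cball 0 B" using bounded_Om by (metis bounded_subset_ballD ball_subset_cball subset_trans)
 define N where "N = real DIM('a)"
 have N: "N >= 0" by (simp add: N_def)
 \<comment> \<open>Where |y - c| >= delta/2, the quantity 4 |y - c|^2 alpha^2 - 2 N alpha is at
   least alpha (alpha delta^2 - 2 N), and this choice makes the latter at least 1.\<close>
 define alpha where "alpha = max 1 ((2 * N + 1)/delta^2)"
 have alpha1: "alpha >= 1" by (simp add: alpha_def)
 have alpha2: "alpha * delta^2 >= 2 * N + 1"
 proof -
  have "(2 * N + 1)/delta^2 * delta^2 <= alpha * delta^2" by (intro mult_right_mono) (auto simp: alpha_def)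
  then show ?thesis using delta(1) by simp
 qed
 define R where "R = 2 * abs B + 1 + delta"
 define A where "A = exp (alpha * R^2)"
 have A: "A > 0" by (simp add: A_def)
 define L where "L = A * (2 * alpha)"
 \<comment> \<open>A ball of radius at most delta/2 around a point of \<open>Om\<close> keeps the
   distance delta/2 from c. A radius of at most 1 keeps it within the distance R of c, where the
   factor A outweighs the smallest value of the exponential.\<close>
 define t0 where "t0 = min (delta/2) 1"
 define ex where "ex n s = (- alpha)^n * exp (- alpha * s)" for n s
 have ex: "deriv_seq ex" unfolding deriv_seq_def ex_def by (auto intro!: derivative_eq_intros)
 have main: "EX V. smooth V & bdd_borel V & bdd_borel (lap V) & (ALL y. V y <= L * dist x0 y) &
   (ALL x:Om. ALL t. 0 < t & t <= t0 --> (ALL y:cball x t. - lap V y >= 1 & V y >= - L * t))" if x0: "x0 : frontier Om" for x0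
 proof -
  obtain nu where nu: "norm nu = 1" "ball (x0 - delta *\<^sub>R nu) delta \<inter> Om = {}"
   by (rule exterior_balls[OF bconst[OF x0] x0 delta(1,2,3) Cb_pos])
  define c where "c = x0 - delta *\<^sub>R nu"
  have x0c: "norm (x0 - c) = delta" using nu(1) delta(1) by (simp add: c_def)
  have x0B: "norm x0 <= abs B"
  proof -
   have "closure Om <= cball 0 B" using B closure_minimal by blast
   then show ?thesis using x0 by (force simp: frontier_def)
  qed
  define E where "E y = radial ex 0 (- c + 1 *\<^sub>R y)" for y
  have E: "smooth E" unfolding E_def by (rule smooth_affine[OF smooth_radial[OF ex]])
  have Ey: "E y = exp (- alpha * (norm (y - c))^2)" for y by (simp add: E_def ex_def)
  define V where "V y = A * exp (- alpha * delta^2) - A * E y" for y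
  have V: "smooth V" unfolding V_def by (intro smooth_diff smooth_mult smooth_const E)
  have lapE: "lap E y = (4 * (norm (y - c))^2 * alpha^2 - 2 * N * alpha) * E y" for y
   unfolding E_def lap_affine[OF smooth_radial[OF ex]] lap_radial[OF ex]
   by (simp add: ex_def N_def power2_eq_square algebra_simps)
  have lapc: "lap (%y. A * exp (- alpha * delta^2)) y = 0" for y :: 'a by (simp add: lap_def)
  have lapV: "lap V y = - A * lap E y" for y
   unfolding V_def lap_diff[OF smooth_const smooth_mult[OF smooth_const E]] lap_cmult[OF E] lapc by simp
  have Vlip: "abs (V y) <= L * abs (norm (y - c) - delta)" for y
  proof -
   have "abs (V y) = A * abs (exp (- alpha * (norm (y - c))^2) - exp (- alpha * delta^2))"
    unfolding V_def Ey right_diff_distrib[symmetric] using A by (simp add: abs_mult abs_minus_commute)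
   also have "... <= A * (2 * alpha * abs (norm (y - c) - delta))" using A by (intro mult_left_mono gauss_lipschitz alpha1) auto
   finally show ?thesis by (simp add: L_def mult.assoc)
  qed
  have E1: "0 <= E y" "E y <= 1" for y using alpha1 by (auto simp: Ey)
  have "bdd_borel V"
  proof (rule bdd_borelI[of _ "A * 1 + A * 1"])
   have "A * exp (- alpha * delta^2) <= A * 1" using A alpha1 by (intro mult_left_mono) auto
   moreover have "A * E y <= A * 1" "0 <= A * E y" for y using A E1 by (auto intro!: mult_left_mono)
   moreover have "0 <= A * exp (- alpha * delta^2)" using A by simp
   ultimately show "abs (V y) <= A * 1 + A * 1" for y unfolding V_def by (smt (verit))
  qed (rule borel_measurable_continuous_onI[OF smooth_continuous[OF V]])
  moreover have "bdd_borel (lap V)"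
  proof (rule bdd_borelI[of _ "A * (4 * alpha + 2 * N * alpha)"])
   fix y
   define s where "s = (norm (y - c))^2"
   have s: "s >= 0" by (simp add: s_def)
   have "alpha * s <= exp (alpha * s)" using exp_ge_add_one_self[of "alpha * s"] by linarith
   then have "(alpha * s) * exp (- alpha * s) <= exp (alpha * s) * exp (- alpha * s)" by (intro mult_right_mono) auto
   then have 1: "alpha * s * E y <= 1" by (simp add: exp_minus_inverse Ey s_def)
   have "abs (lap E y) = abs (4 * alpha * (alpha * s * E y) - 2 * N * alpha * E y)"
    unfolding lapE s_def[symmetric] by (simp add: power2_eq_square algebra_simps)
   also have "... <= 4 * alpha * 1 + 2 * N * alpha * 1"
    using 1 E1[of y] alpha1 N s by (intro order_trans[OF abs_triangle_ineq4] add_mono) (auto simp: abs_mult mult_left_le)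
   finally show "abs (lap V y) <= A * (4 * alpha + 2 * N * alpha)" unfolding lapV using A by (simp add: abs_mult)
  qed (rule borel_measurable_continuous_onI[OF smooth_continuous[OF smooth_lap[OF V]]])
  moreover have "V y <= L * dist x0 y" for y
  proof -
   have "abs (norm (y - c) - delta) <= dist x0 y"
    using norm_triangle_ineq3[of "y - c" "x0 - c"] x0c by (simp add: dist_norm norm_minus_commute)
   then have "L * abs (norm (y - c) - delta) <= L * dist x0 y" using A alpha1 by (intro mult_left_mono) (auto simp: L_def)
   then show ?thesis using Vlip[of y] by linarith
  qed
  moreover have "- lap V y >= 1 & V y >= - L * t" if x: "x : Om" and t: "0 < t" "t <= t0" and y: "y : cball x t" for x t y
  proof
   have xc: "norm (x - c) >= delta" using nu(2) x unfolding c_def[symmetric] by (force simp: dist_norm norm_minus_commute)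
   have yx: "norm (y - x) <= t" using y by (simp add: dist_norm norm_minus_commute)
   have yc: "norm (y - c) >= delta - t" using xc yx norm_triangle_ineq4[of "x - c" "x - y"] norm_triangle_ineq[of "y - c" "x - y"] 
    by (simp add: norm_minus_commute algebra_simps)
   have t': "t <= delta/2" "t <= 1" using t(2) by (auto simp: t0_def)
   define s where "s = (norm (y - c))^2"
   have s1: "s >= (delta/2)^2" unfolding s_def using yc t' delta(1) by (intro power_mono) auto
   have "norm y <= B + 1" using B x yx t' norm_triangle_ineq2[of y x] by force
   moreover have "norm c <= abs B + delta" using x0c x0B norm_triangle_ineq4[of x0 "x0 - c"] by simp
   ultimately have "norm (y - c) <= R" using norm_triangle_ineq4[of y c] unfolding R_def by linarith
   then have s2: "s <= R^2" unfolding s_def by (intro power_mono) auto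
   have "4 * s * alpha^2 - 2 * N * alpha >= 4 * (delta/2)^2 * alpha^2 - 2 * N * alpha" using s1 by (intro diff_right_mono mult_right_mono mult_left_mono) auto
   also have "4 * (delta/2)^2 * alpha^2 - 2 * N * alpha = alpha * (alpha * delta^2 - 2 * N)" by (simp add: power2_eq_square algebra_simps)
   also have "... >= 1 * 1" using alpha1 alpha2 by (intro mult_mono) auto
   finally have k: "4 * s * alpha^2 - 2 * N * alpha >= 1" by simp
   have "E y >= exp (- alpha * R^2)" using s2 alpha1 by (simp add: Ey s_def[symmetric])
   then have "A * E y >= A * exp (- alpha * R^2)" using A by (intro mult_left_mono) auto
   then have AE: "A * E y >= 1" by (simp add: A_def exp_minus_inverse)
   have "1 * 1 <= (4 * s * alpha^2 - 2 * N * alpha) * (A * E y)" using k AE by (intro mult_mono) auto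
   then show "- lap V y >= 1" unfolding lapV lapE s_def by (simp add: mult_ac)
   show "V y >= - L * t"
   proof (cases "norm (y - c) >= delta")
    case True
    then have "exp (- alpha * (norm (y - c))^2) <= exp (- alpha * delta^2)" using alpha1 delta(1) by (simp add: power_mono)
    then have "V y >= 0" unfolding V_def Ey using A by simp
    moreover have "- L * t <= 0" using t(1) A alpha1 by (simp add: L_def)
    ultimately show ?thesis by linarith
   next
    case False
    then have "abs (norm (y - c) - delta) <= t" using yc by simp
    then have "L * abs (norm (y - c) - delta) <= L * t" using A alpha1 by (intro mult_left_mono) (auto simp: L_def)
    then show ?thesis using Vlip[of y] by simp
   qed
  qed
  ultimately show ?thesis using V by (intro exI[of _ V] conjI) auto
 qed
 show ?thesis
  by (intro exI[of _ L] conjI exI[of _ t0] ballI main) (use A alpha1 delta(1) in \<open>auto simp: L_def t0_def\<close>)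
qed

end

section \<open>Second order expansion of mean values\<close>

definition ker_const :: "'a::euclidean_space itself => real" where
 "ker_const T = (LINT z|lborel. radial (kerk T) 0 (z::'a))"

text \<open>The mean at scale t minus the value is the sum of the dyadic differences at the scales
  t/2^n. Each is close to (t/2^n)^2 times the constant times the Laplacian, and the factor 4/3 is
  the sum of the powers of 1/4.\<close>

lemma mean_expansion:
 fixes phi :: "'a::euclidean_space => real"
 assumes phi: "test_function U phi" and e: "e > 0"
 shows "EX t1>0. ALL t x. 0 < t & t < t1 --> abs (Sop t rho phi x - phi x - 4/3 * ker_const TYPE('a) * t^2 * lap phi x) <= e * t^2"
proof -
 let ?K = "radial (kerk TYPE('a)) 0 :: 'a => real" and ?k = "ker_const TYPE('a)"
 have uk: "unit_kernel ?K" by (rule unit_kernel_k)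
 obtain A where A: "!!z. abs (?K z) <= A" "A >= 0" using unit_kernelD(7)[OF uk] by blast
 define W where "W = A * unit_vol TYPE('a) + 1"
 have W: "W > 0" using A(2) by (simp add: W_def add_nonneg_pos)
 define e' where "e' = 3 * e/(4 * W)"
 have e': "e' > 0" using e W by (simp add: e'_def)
 have tl: "test_function U (lap phi)" using phi by (rule test_function_lap)
 have "uniformly_continuous_on UNIV (lap phi)"
  using tl by (rule test_functionE) (rule bounded_support_uniformly_continuous[OF smooth_continuous])
 then obtain t1 where t1: "t1 > 0" "!!x y. dist x y < t1 ==> abs (lap phi y - lap phi x) < e'"
  unfolding uniformly_continuous_on_def dist_real_def using e' by (metis UNIV_I dist_commute)
 have sm: "smooth phi" using phi by (rule test_functionE)
 have bb: "bdd_borel phi" "bdd_borel (lap phi)" "bdd_borel (%x. - lap phi x)"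
  using test_function_borel[OF phi] test_function_borel[OF tl] by (auto simp: bdd_borel_def)
 have po: "poisson UNIV phi (%x. - lap phi x)" by (rule smooth_poisson[OF sm bb(1,2)])
 have step: "abs (Sop t rho phi x - Sop (t/2) rho phi x - t\<^sup>2 * (?k * lap phi x)) <= t^2 * (W * e')" if t: "0 < t" "t < t1" for t x
 proof -
  have "Sop t rho phi x - 2^0 * Sop (t/2) rho phi x = - t\<^sup>2 * Sop t ?K (%x. - lap phi x) x"
   by (rule poisson_step[OF po bb(1,3) kernel_pair0 t(1) subset_UNIV])
  then have eq: "Sop t rho phi x - Sop (t/2) rho phi x = t^2 * Sop t ?K (lap phi) x" by (simp add: Sop_def)
  have "abs (Sop t ?K (lap phi) x - lap phi x * ?k) <= A * e' * unit_vol TYPE('a)"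
   unfolding ker_const_def
   by (rule Sop_diff_const_bound[OF uk A(1) bb(2) _ _ t(1)]) (use t1(2)[of x] t e' in \<open>auto intro: less_imp_le\<close>)
  also have "... <= W * e'" using e' by (simp add: W_def algebra_simps)
  finally have "t^2 * abs (Sop t ?K (lap phi) x - ?k * lap phi x) <= t^2 * (W * e')" by (intro mult_left_mono) (auto simp: mult.commute)
  then show ?thesis unfolding eq by (simp add: abs_mult right_diff_distrib[symmetric])
 qed
 have "abs (Sop t rho phi x - phi x - 4/3 * ?k * t^2 * lap phi x) <= e * t^2" if t: "0 < t" "t < t1" for t x
 proof -
  define G where "G n = 4/3 * (1 - (1/4)^n) * t^2" for n :: nat
  have GS: "G (Suc n) = G n + (t/2^n)^2" for n
   by (simp add: G_def power_divide power_mult[symmetric] field_simps power2_eq_square power_mult_distrib[symmetric])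
  have b: "abs (Sop t rho phi x - Sop (t/2^n) rho phi x - G n * (?k * lap phi x)) <= G n * (W * e')" for n
  proof (induction n)
   case (Suc n)
   have "t/2^n <= t" using t(1) by (simp add: divide_le_eq mult_le_cancel_left1)
   then have "abs (Sop (t/2^n) rho phi x - Sop (t/2^n/2) rho phi x - (t/2^n)^2 * (?k * lap phi x)) <= (t/2^n)^2 * (W * e')"
    using t by (intro step) auto
   moreover have "t/2^n/2 = t/2^Suc n" by simp
   ultimately show ?case using Suc unfolding GS distrib_right by (simp only:)
  qed (simp add: G_def)
  have z: "(%n. (1/4 :: real)^n) ----> 0" "(%n. t * (1/2 :: real)^n) ----> t * 0"
   by (intro tendsto_intros LIMSEQ_realpow_zero; simp)+
  have Gl: "G ----> 4/3 * (1 - 0) * t^2" unfolding G_def[abs_def] by (intro tendsto_intros z)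
  have c: "isCont phi x" using smooth_continuous[OF sm, of UNIV] by (simp add: continuous_on_eq_continuous_at)
  have "(%n. Sop (t/2^n) rho phi x) ----> phi x * (LINT z|lborel. rho (z::'a))"
   by (rule Sop_tendsto[OF rho_facts(1) bb(1) c]) (use z(2) t in \<open>auto simp: power_divide\<close>)
  then have "(%n. abs (Sop t rho phi x - Sop (t/2^n) rho phi x - G n * (?k * lap phi x)))
    ----> abs (Sop t rho phi x - phi x * 1 - 4/3 * (1 - 0) * t^2 * (?k * lap phi x))"
   unfolding rho_facts(4) by (intro tendsto_intros Gl)
  moreover have "(%n. G n * (W * e')) ----> 4/3 * (1 - 0) * t^2 * (W * e')" by (intro tendsto_intros Gl)
  ultimately have "abs (Sop t rho phi x - phi x * 1 - 4/3 * (1 - 0) * t^2 * (?k * lap phi x)) <= 4/3 * (1 - 0) * t^2 * (W * e')"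
   by (rule LIMSEQ_le) (use b in auto)
  also have "... = e * t^2" using W by (simp add: e'_def)
  finally show ?thesis by (simp add: mult_ac)
 qed
 with t1(1) show ?thesis by blast
qed

section \<open>The Green operator\<close>

lemma Sop_mono_bound:
 fixes u :: "'a::euclidean_space => real"
 assumes u: "bdd_borel u" and t: "t > 0" and B: "!!y. y : cball x t ==> u y <= v y" and v: "bdd_borel v"
 shows "Sop t rho u x <= Sop t rho v x"
 unfolding Sop_def
proof (rule integral_mono[OF Sop_integrable[OF u rho_facts(1)] Sop_integrable[OF v rho_facts(1)]])
 fix z :: 'a
 show "rho z * u (x - t *\<^sub>R z) <= rho z * v (x - t *\<^sub>R z)"
 proof (cases "norm z < 1")
  case True
  then have "x - t *\<^sub>R z : cball x t" using t by (simp add: dist_norm mult_left_le)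
  then show ?thesis by (intro mult_left_mono B rho_facts(2))
 next
  case False
  then have "rho z = 0" by (intro unit_kernelD(2)[OF rho_facts(1)]) simp
  then show ?thesis by simp
 qed
qed

lemma Sop_add_const:
 fixes u :: "'a::euclidean_space => real"
 assumes u: "bdd_borel u"
 shows "Sop t rho (%y. a * (u y + c)) x = a * (Sop t rho u x + c)"
proof -
 have "Sop t rho (%y. a * (u y + c)) x = (LINT z|lborel. a * (rho z * u (x - t *\<^sub>R z) + rho z * c))"
  unfolding Sop_def by (simp only: distrib_left mult.left_commute)
 also have "... = a * (Sop t rho u x + (LINT z|lborel. rho (z::'a)) * c)"
  using Sop_integrable[OF u rho_facts(1)] unit_kernelD(8)[OF rho_facts(1)[where 'a='a]] by (simp add: Sop_def)
 finally show ?thesis by (simp only: rho_facts(4) mult_1)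
qed

lemma Sop_le_const:
 fixes u :: "'a::euclidean_space => real"
 assumes u: "bdd_borel u" and t: "t > 0" and B: "!!y. y : cball x t ==> u y <= c"
 shows "Sop t rho u x <= c"
proof -
 have z: "bdd_borel (%y::'a. 0)" by (auto simp: bdd_borel_def)
 have "Sop t rho u x <= Sop t rho (%y. 1 * (0 + c)) x"
  by (rule Sop_mono_bound[OF u t]) (use B in \<open>auto simp: bdd_borel_def\<close>)
 also have "... = c" unfolding Sop_add_const[OF z] by (simp add: Sop_def)
 finally show ?thesis .
qed

lemma Sop_nonneg:
 fixes u :: "'a::euclidean_space => real"
 assumes "!!y. u y >= 0" shows "Sop t rho u x >= 0"
 unfolding Sop_def by (intro Lint_nonneg mult_nonneg_nonneg rho_facts(2) assms)

lemma Sop_dominated: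
 fixes u :: "nat => 'a::euclidean_space => real"
 assumes a: "unit_kernel a" and u: "!!n. u n : borel_measurable borel" "!!n y. abs (u n y) <= B" 
  and l: "!!y. (%n. u n y) ----> v y"
 shows "(%n. Sop t a (u n) x) ----> Sop t a v x"
 unfolding Sop_def
proof (rule integral_dominated_convergence[where w="%z. abs (a z) * B"])
 have [measurable]: "v : borel_measurable borel" by (rule borel_measurable_LIMSEQ_real[OF l u(1)]) 
 note [measurable] = unit_kernelD(6)[OF a] u(1)
 show "(%z. a z * v (x - t *\<^sub>R z)) : borel_measurable lborel" by measurable
 show "(%z. a z * u n (x - t *\<^sub>R z)) : borel_measurable lborel" for n by measurable
 show "integrable lborel (%z. abs (a z) * B)" using unit_kernelD(8)[OF a] by simp
 show "AE z in lborel. (%n. a z * u n (x - t *\<^sub>R z)) ----> a z * v (x - t *\<^sub>R z)"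
  by (intro AE_I2 tendsto_intros l)
 show "AE z in lborel. norm (a z * u n (x - t *\<^sub>R z)) <= abs (a z) * B" for n
  by (intro AE_I2) (simp add: abs_mult mult_left_mono u(2))
qed

lemma Sop_measurable:
 fixes u a :: "'a::euclidean_space => real"
 assumes "bdd_borel u" "unit_kernel a" "t > 0"
 shows "Sop t a u : borel_measurable borel"
 by (rule borel_measurable_continuous_onI[OF smooth_continuous[OF Sop_smooth[OF assms]]])

section \<open>The discrete mean value equation\<close>

context domain
begin

lemma bdist_bounded: "EX D>0. ALL x. bdist Om x <= D"
proof -
 obtain B where "!!x. abs (bdist Om x) <= B" "B > 0"
  using bdd_borelD(2)[OF C0_bdd_borel[OF bounded_Om bdist_C0]] by blast
 then show ?thesis by (intro exI[of _ B]) (auto simp: abs_le_iff)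
qed

definition dmax :: real where "dmax = (SOME D. D > 0 & (ALL x. bdist Om x <= D))"

lemma dmax: "dmax > 0" "bdist Om x <= dmax"
 using someI_ex[OF bdist_bounded[unfolded Bex_def]] unfolding dmax_def by blast+

text \<open>What the discretisation needs of a barrier. The decrease of the mean is recorded
  directly, and the lower bound on the ball makes V + L t nonnegative wherever the mean at a point
  of \<open>Om\<close> reaches across the boundary.\<close>

definition supersol :: "real => real => ('a => real) => bool" where
 "supersol L t0 V \<longleftrightarrow> bdd_borel V & (ALL x:Om. ALL t. 0 < t & t <= t0 -->
   Sop t rho V x <= V x - ker_const TYPE('a) * t^2 & (ALL y:cball x t. V y >= - L * t))"

lemma barrier_mean:
 "EX L>0. EX t0>0. t0 <= 1 & (ALL x0:frontier Om. EX V. supersol L t0 V & (ALL y. V y <= L * dist x0 y))"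
proof -
 have mean: "Sop t rho V x <= V x - ker_const TYPE('a) * t^2"
  if V: "smooth V" "bdd_borel V" "bdd_borel (lap V)" and "0 < t" "ALL y:cball x t. - lap V y >= 1" for V :: "'a => real" and x t
 proof -
  have "bdd_borel (%y. - lap V y)" using V(3) by (auto simp: bdd_borel_def)
  then have "Sop t rho V x <= V x - 1 * t^2 * (LINT z|lborel. radial (kerk TYPE('a)) 0 (z::'a))"
   using that smooth_continuous[OF V(1), of UNIV]
   by (intro poisson_mean_le[OF smooth_poisson[OF V] V(2)]) (auto simp: continuous_on_eq_continuous_at)
  then show ?thesis by (simp add: ker_const_def mult.commute)
 qed
 obtain L t0 where L: "L > 0" "t0 > 0" "t0 <= 1" and V: "!!x0. x0 : frontier Om ==> EX V. smooth V & bdd_borel V & bdd_borel (lap V) &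
   (ALL y. V y <= L * dist x0 y) & (ALL x:Om. ALL t. 0 < t & t <= t0 --> (ALL y:cball x t. - lap V y >= 1 & V y >= - L * t))"
  using barrier_exists by (elim exE conjE) blast
 show ?thesis
 proof (rule exI[of _ L], intro conjI L, rule exI[of _ t0], intro conjI L ballI)
  fix x0 assume "x0 : frontier Om"
  then obtain V where V: "smooth V" "bdd_borel V" "bdd_borel (lap V)" "!!y. V y <= L * dist x0 y"
   "!!x t y. x : Om ==> 0 < t ==> t <= t0 ==> y : cball x t ==> - lap V y >= 1 & V y >= - L * t" using V[of x0] by blast
  show "EX V. supersol L t0 V & (ALL y. V y <= L * dist x0 y)" unfolding supersol_def
   by (intro exI[of _ V] conjI ballI allI impI V(2,4) mean[OF V(1-3)])
    (auto simp del: mem_cball dest: V(5)[THEN conjunct1] V(5)[THEN conjunct2])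
 qed
qed

text \<open>The mean value form of -Lap u = g: the coefficient of g is that of the Laplacian in the
  expansion of the mean. The bound allows \<open>bdist Om x + t\<close> because averages at scale t
  do not see the boundary more finely than t.\<close>

definition discrete :: "real => ('a => real) => real => ('a => real) => bool" where
 "discrete L g t u \<longleftrightarrow> u : borel_measurable borel & (ALL x. 0 <= u x & u x <= L * (bdist Om x + t)) & (ALL x. x ~: Om --> u x = 0) &
   (ALL x:Om. u x = Sop t rho u x + 4/3 * ker_const TYPE('a) * t^2 * g x)"

lemma ker_const_pos: "ker_const TYPE('a) > 0"
 unfolding ker_const_def by (rule integral_kerk)

text \<open>Monotone iteration from 0. Every iterate stays below 4/3 (V + L t) for every barrier V:
  the mean of this majorant drops by 4/3 times the constant times t^2, which pays for the source
  term since g <= 1. Taking V at the nearest frontier point gives the linear bound.\<close>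

lemma discrete_solution:
 "EX L>0. EX t0>0. t0 <= 1 & (ALL g t. g : C0 Om & (ALL x. 0 <= g x & g x <= 1) & 0 < t & t <= t0 --> (EX u. discrete L g t u))"
proof -
 define k where "k = ker_const TYPE('a)"
 have k: "k > 0" unfolding k_def by (rule ker_const_pos)
 obtain L t0 where L: "L > 0" "t0 > 0" "t0 <= 1" and V: "!!x0. x0 : frontier Om ==> EX V. supersol L t0 V & (ALL y. V y <= L * dist x0 y)"
  using barrier_mean by auto
 define L' where "L' = 4/3 * L"
 have "EX u. discrete L' g t u" if g: "g : C0 Om" "!!x. 0 <= g x" "!!x. g x <= 1" and t: "0 < t" "t <= t0" for g t
 proof -
  define F where "F u x = (if x : Om then Sop t rho u x + 4/3 * k * t^2 * g x else 0)" for u x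
  define U where "U n = (F ^^ n) (%x. 0)" for n
  have US: "U (Suc n) = F (U n)" for n by (simp add: U_def)
  define ok where "ok u \<longleftrightarrow> (ALL x. 0 <= u x) & (ALL V y. supersol L t0 V --> y : Om --> u y <= 4/3 * (V y + L * t)) &
    u : borel_measurable borel & (ALL x. x ~: Om --> u x = 0)" for u
  have okd: "u x <= L' * (bdist Om x + t)" if u: "ok u" for u x
  proof (cases "x : Om")
   case True
   obtain x0 where x0: "x0 : frontier Om" "bdist Om x = dist x x0" by (rule bdist_attained[OF open_Om bounded_Om True])
   obtain V where V': "supersol L t0 V" "!!y. V y <= L * dist x0 y" using V[OF x0(1)] by blast
   have "u x <= 4/3 * (V x + L * t)" using u V'(1) True unfolding ok_def by blast
   also have "... <= 4/3 * (L * bdist Om x + L * t)" using V'(2)[of x] x0(2) by (simp add: dist_commute)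
   finally show ?thesis by (simp add: L'_def distrib_left)
  next
   case False
   have "0 <= L' * (bdist Om x + t)" using L t by (intro mult_nonneg_nonneg) (auto simp: L'_def infdist_nonneg)
   then show ?thesis using u False by (simp add: ok_def)
  qed
  have okB: "abs (u x) <= L' * (dmax + t)" if u: "ok u" for u x
  proof -
   have "L' * (bdist Om x + t) <= L' * (dmax + t)" using dmax(2)[of x] L by (intro mult_left_mono) (auto simp: L'_def)
   then show ?thesis using okd[OF u, of x] u by (simp add: ok_def)
  qed
  have okb: "bdd_borel u" if "ok u" for u by (rule bdd_borelI[OF _ okB[OF that]]) (use that in \<open>simp add: ok_def\<close>)
  have ok: "ok (U n)" for n
  proof (induction n)
   case 0
   have z: "0 <= 4/3 * (V y + L * t)" if "supersol L t0 V" "y : Om" for V y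
    using that t unfolding supersol_def by (auto dest!: bspec[of _ _ y] intro!: mult_nonneg_nonneg)
   show ?case unfolding ok_def U_def by (intro conjI allI impI) (use z in simp_all)
  next
   case (Suc n)
   note b = okb[OF Suc]
   have 0: "0 <= U (Suc n) x" for x
    using Sop_nonneg[of "U n" t x] Suc g(2)[of x] k unfolding US F_def ok_def by simp
   have 1: "U (Suc n) x <= 4/3 * (V x + L * t)" if V: "supersol L t0 V" and x: "x : Om" for V x
   proof -
    have Vb: "bdd_borel V" and SV: "Sop t rho V x <= V x - k * t^2" and VL: "!!y. y : cball x t ==> V y >= - L * t"
     using V x t by (auto simp: supersol_def k_def[symmetric])
    obtain M where M: "!!y. abs (V y) <= M" using bdd_borelD(2)[OF Vb] by blast
    have vb: "bdd_borel (%y. 4/3 * (V y + L * t))"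
    proof (rule bdd_borelI[of _ "4/3 * (M + L * t)"])
     show "abs (4/3 * (V y + L * t)) <= 4/3 * (M + L * t)" for y using M[of y] mult_pos_pos[OF L(1) t(1)] by (simp add: abs_mult)
    qed (use bdd_borelD(1)[OF Vb] in measurable)
    have "U n y <= 4/3 * (V y + L * t)" if "y : cball x t" for y
     using Suc V VL[OF that] by (cases "y : Om") (auto simp: ok_def)
    then have "Sop t rho (U n) x <= Sop t rho (%y. 4/3 * (V y + L * t)) x" by (intro Sop_mono_bound[OF b t(1) _ vb])
    moreover have "... = 4/3 * (Sop t rho V x + L * t)" by (rule Sop_add_const[OF Vb])
    moreover have "4/3 * k * t^2 * g x <= 4/3 * k * t^2 * 1" using k g(3) by (intro mult_left_mono) auto
    ultimately show ?thesis using x SV unfolding US F_def by simp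
   qed
   have "U (Suc n) : borel_measurable borel"
   proof -
    note [measurable] = Sop_measurable[OF b rho_facts(1) t(1)] borel_measurable_continuous_onI[OF C0D(1)[OF g(1)]]
    have [measurable]: "Om : sets borel" using open_Om by simp
    show ?thesis unfolding US F_def[abs_def] by measurable
   qed
   moreover have "ALL x. x ~: Om --> U (Suc n) x = 0" by (simp add: US F_def)
   ultimately show ?case using 0 1 unfolding ok_def by blast
  qed
  have "U n x <= U (Suc n) x" for n x
  proof (induction n arbitrary: x)
   case 0 then show ?case using ok[of 1] by (simp add: U_def ok_def)
  next
   case (Suc n)
   have "Sop t rho (U n) x <= Sop t rho (U (Suc n)) x" by (rule Sop_mono_bound[OF okb[OF ok] t(1) Suc okb[OF ok]])
   then show ?case unfolding US[of "Suc n"] unfolding US[of n] F_def[of "U n"] F_def[of "F (U n)"] by (simp add: US[symmetric])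
  qed
  then have inc: "incseq (%n. U n x)" for x by (rule incseq_SucI)
  define u where "u x = lim (%n. U n x)" for x
  have lim: "(%n. U n x) ----> u x" for x
  proof -
   have "ALL n. U n x <= L' * (dmax + t)" using okB[OF ok] abs_le_iff by blast
   from incseq_convergent[OF inc this] obtain l where "(%n. U n x) ----> l" by blast
   then show ?thesis unfolding u_def by (simp add: limI)
  qed
  have Um: "U n : borel_measurable borel" for n using ok by (simp add: ok_def)
  show ?thesis unfolding discrete_def
  proof (intro exI[of _ u] conjI allI ballI impI)
   show "u : borel_measurable borel" by (rule borel_measurable_LIMSEQ_real[OF lim Um])
   show "0 <= u x" for x by (rule LIMSEQ_le_const[OF lim]) (use ok in \<open>auto simp: ok_def\<close>)
   show "u x <= L' * (bdist Om x + t)" for x by (rule LIMSEQ_le_const2[OF lim]) (use okd[OF ok] in auto)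
   show "u x = 0" if "x ~: Om" for x using LIMSEQ_unique[OF lim[of x]] ok that by (simp add: ok_def)
   fix x assume x: "x : Om"
   have "(%n. Sop t rho (U n) x + 4/3 * k * t^2 * g x) ----> Sop t rho u x + 4/3 * k * t^2 * g x"
    by (intro tendsto_intros Sop_dominated[OF rho_facts(1) Um okB[OF ok] lim])
   then have "(%n. U (Suc n) x) ----> Sop t rho u x + 4/3 * k * t^2 * g x" using x by (simp add: US F_def)
   then show "u x = Sop t rho u x + 4/3 * ker_const TYPE('a) * t^2 * g x"
    unfolding k_def by (rule LIMSEQ_unique[OF LIMSEQ_Suc[OF lim]])
  qed
 qed
 moreover have "L' > 0" using L by (simp add: L'_def)
 ultimately show ?thesis using L by (meson order_refl)
qed

end

lemma Sop_bdd_borel: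
 assumes "bdd_borel u" "unit_kernel a" "t > 0" shows "bdd_borel (Sop t a u)"
proof -
 obtain A where A: "!!z. abs (a z) <= A" using unit_kernelD(7)[OF assms(2)] by blast
 obtain B where B: "!!z. abs (u z) <= B" "B > 0" using bdd_borelD(2)[OF assms(1)] by blast
 show ?thesis by (rule bdd_borelI[OF Sop_measurable[OF assms] Sop_bound[OF assms(2) A B(1) _ assms(3)]]) (use B in simp)
qed

lemma integrable_bounded_mult:
 fixes f g :: "'a => real"
 assumes "integrable M f" "g : borel_measurable M" "!!x. abs (g x) <= C"
 shows "integrable M (%x. f x * g x)"
proof (rule Bochner_Integration.integrable_bound)
 show "integrable M (%x. C * f x)" using assms(1) by simp
 show "(%x. f x * g x) : borel_measurable M" using assms(1,2) by simp
 have "C >= 0" using order_trans[OF abs_ge_zero assms(3)] .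
 then show "AE x in M. norm (f x * g x) <= norm (C * f x)"
  using mult_left_mono[OF assms(3) abs_ge_zero] by (auto simp: abs_mult mult.commute)
qed

lemma integrable_bdd_borel_mult:
 assumes "integrable lborel u" "bdd_borel f" shows "integrable lborel (%x. u x * f x)"
 using integrable_bounded_mult[OF assms(1)] bdd_borelD[OF assms(2)] by fastforce

text \<open>W is only bounded and Borel, so its supremum s may not be attained. A point with W > s -
  kappa is enough: it cannot lie in D, because the mean there is at most s.\<close>

lemma discrete_maximum:
 fixes W :: "'a::euclidean_space => real"
 assumes W: "bdd_borel W" and t: "t > 0" and kappa: "kappa > 0" and D: "!!x. x : D ==> W x <= Sop t rho W x - kappa"
  and m: "!!x. x ~: D ==> W x <= m"
 shows "W x <= m"
proof (rule ccontr)
 assume x: "~ W x <= m"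
 define s where "s = (SUP x. W x)"
 obtain B where "!!x. abs (W x) <= B" using bdd_borelD(2)[OF W] by blast
 then have bdd: "bdd_above (range W)" by (intro bdd_aboveI[of _ B]) (auto simp: abs_le_iff)
 have le: "W y <= s" for y unfolding s_def by (rule cSUP_upper[OF UNIV_I bdd])
 have "max m (s - kappa) < s" using le[of x] x kappa by simp
 then obtain y where y: "max m (s - kappa) < W y" unfolding s_def by (subst (asm) less_cSUP_iff[OF _ bdd]) auto
 then have "W y <= Sop t rho W y - kappa" using D m by fastforce
 moreover have "Sop t rho W y <= s" by (rule Sop_le_const[OF W t le])
 ultimately show False using y by simp
qed

context domain
begin

lemma discreteD:
 assumes d: "discrete L g t u" and L: "L > 0" "t <= 1"
 shows "bdd_borel u" "abs (u x) <= L * (dmax + 1)" "integrable lborel u"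
proof -
 show b: "abs (u x) <= L * (dmax + 1)" for x
 proof -
  have "L * (bdist Om x + t) <= L * (dmax + 1)" using dmax(2)[of x] L by (intro mult_left_mono) auto
  moreover have "0 <= u x" "u x <= L * (bdist Om x + t)" using d by (simp_all add: discrete_def)
  ultimately show ?thesis by linarith
 qed
 have m: "u : borel_measurable borel" using d by (simp add: discrete_def)
 show "bdd_borel u" by (rule bdd_borelI[OF m b])
 show "integrable lborel u" by (rule integrable_bounded_support[OF m b bounded_Om]) (use d in \<open>simp add: discrete_def\<close>)
qed

text \<open>The symmetry of rho moves the mean from u to phi, where it can be expanded. The source
  and the Laplacian carry the same factor c t^2, and the remainder is a small multiple of t^2, so
  dividing by c t^2 leaves a small error.\<close>

lemma discrete_weak_error:
 assumes phi: "test_function Om phi" and e: "e > 0" and L: "L > 0"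
 shows "EX t1>0. ALL t u g. 0 < t & t < t1 & t <= 1 & g : C0 Om & discrete L g t u -->
   abs ((LINT x|lborel. u x * lap phi x) + (LINT x|lborel. g x * phi x)) <= e"
proof -
 obtain K where K: "smooth phi" "K <= Om" "bounded K" "!!x. x ~: K ==> phi x = 0" using phi by (rule test_functionE) blast
 obtain r where r: "Om <= ball 0 r" using bounded_Om bounded_subset_ballD by blast
 define c where "c = 4/3 * ker_const TYPE('a)"
 have c: "c > 0" unfolding c_def using ker_const_pos by simp
 define M where "M = L * (dmax + 1) * measure lborel (ball (0::'a) r) + 1"
 have M: "M > 0" using L dmax(1) by (simp add: M_def add_nonneg_pos)
 define e' where "e' = e * c/M"
 have e': "e' > 0" using e c M by (simp add: e'_def)
 obtain t1 where t1: "t1 > 0" "!!t x. 0 < t ==> t < t1 ==> abs (Sop t rho phi x - phi x - c * t^2 * lap phi x) <= e' * t^2"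
  using mean_expansion[OF phi e'] unfolding c_def by blast
 have "abs ((LINT x|lborel. u x * lap phi x) + (LINT x|lborel. g x * phi x)) <= e"
  if t: "0 < t" "t < t1" "t <= 1" and g: "g : C0 Om" and u: "discrete L g t u" for t u g
 proof -
  note ub = discreteD[OF u L t(3)]
  have u0: "!!x. x ~: Om ==> u x = 0" and eq: "!!x. x : Om ==> u x = Sop t rho u x + c * t^2 * g x"
   using u by (simp_all add: discrete_def c_def)
  have phib: "bdd_borel phi" and lb: "bdd_borel (lap phi)" 
   by (rule test_function_borel[OF phi], rule test_function_borel[OF test_function_lap[OF phi]])
  have phi0: "phi x = 0" if "x ~: Om" for x using K(2,4) that by blast
  have "u x * phi x = Sop t rho u x * phi x + c * t^2 * (g x * phi x)" for x
   using eq[of x] phi0[of x] by (cases "x : Om") (auto simp: distrib_right mult.assoc)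
  then have "(LINT x|lborel. u x * phi x) = (LINT x|lborel. Sop t rho u x * phi x + c * t^2 * (g x * phi x))" by simp
  also have "... = (LINT x|lborel. Sop t rho u x * phi x) + c * t^2 * (LINT x|lborel. g x * phi x)"
   using test_function_integrable[OF phi Sop_bdd_borel[OF ub(1) rho_facts(1) t(1)]]
    test_function_integrable[OF phi C0_bdd_borel[OF bounded_Om g]] by simp
  also have "(LINT x|lborel. Sop t rho u x * phi x) = (LINT x|lborel. u x * Sop t rho phi x)"
   by (rule Sop_adjoint[OF ub(1) rho_facts(1) rho_facts(3) phib K(3,4)])
  finally have 1: "(LINT x|lborel. u x * phi x) = (LINT x|lborel. u x * Sop t rho phi x) + c * t^2 * (LINT x|lborel. g x * phi x)" .
  define E where "E x = u x * (Sop t rho phi x - phi x - c * t^2 * lap phi x)" for x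
  have "E x = u x * Sop t rho phi x - u x * phi x - c * t^2 * (u x * lap phi x)" for x by (simp add: E_def algebra_simps)
  then have "(LINT x|lborel. E x) = (LINT x|lborel. u x * Sop t rho phi x) - (LINT x|lborel. u x * phi x) - c * t^2 * (LINT x|lborel. u x * lap phi x)"
   using integrable_bdd_borel_mult[OF ub(3) phib] integrable_bdd_borel_mult[OF ub(3) lb]
    integrable_bdd_borel_mult[OF ub(3) Sop_bdd_borel[OF phib rho_facts(1) t(1)]] by simp
  then have 2: "(LINT x|lborel. E x) = - (c * t^2) * ((LINT x|lborel. u x * lap phi x) + (LINT x|lborel. g x * phi x))"
   using 1 by (simp add: algebra_simps)
  have "abs (LINT x|lborel. E x) <= L * (dmax + 1) * (e' * t^2) * measure lborel (ball (0::'a) r)"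
  proof (rule abs_integral_le_ball)
   show "abs (E x) <= L * (dmax + 1) * (e' * t^2)" for x
    unfolding E_def abs_mult[of "u x"] using ub(2) t1(2)[OF t(1,2)] L dmax(1) by (intro mult_mono) auto
   show "E x = 0" if "x ~: ball 0 r" for x unfolding E_def using u0[of x] subsetD[OF r, of x] that by auto
  qed (use L dmax(1) e' in simp)
  also have "... <= M * (e' * t^2)" using e' t(1) by (simp add: M_def algebra_simps)
  also have "... = (c * t^2) * e" using M by (simp add: e'_def)
  finally have "(c * t^2) * abs ((LINT x|lborel. u x * lap phi x) + (LINT x|lborel. g x * phi x)) <= (c * t^2) * e"
   unfolding 2 abs_mult using c by simp
  then show ?thesis using c t(1) by (simp only: mult_le_cancel_left_pos mult_pos_pos zero_less_power)
 qed
 then show ?thesis using t1(1) by blast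
qed

text \<open>Asymptotic equicontinuity of the discrete solutions: the maximum principle for the difference of
 a solution and its translate.\<close>

lemma discrete_modulus:
 assumes L: "L > 0"
 shows "EX C>0. EX t0>0. ALL g t u h omega. discrete L g t u & 0 < t & t <= t0 & t <= 1 & omega > 0 & (ALL x. abs (g x - g (x + h)) <= omega) -->
   (ALL x. abs (u x - u (x + h)) <= C * (norm h + t + omega))"
proof (cases "Om = {}")
 case True
 have "abs (u x - u (x + h)) <= 1 * (norm h + t + omega)" if "discrete L g t u" "0 < t" "omega > 0" for g t u x h omega
 proof -
  have "u x = 0" for x using that(1) unfolding discrete_def by (simp add: True)
  then show ?thesis using that by simp
 qed
 then show ?thesis by (intro exI[of _ "1::real"] conjI zero_less_one allI impI; elim conjE)
next
 case False
 then obtain x0 where "x0 : frontier Om" using bdist_attained[OF open_Om bounded_Om] by blast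
 then obtain L1 t0 V where t0: "t0 > 0" and V: "supersol L1 t0 V" using barrier_mean by blast
 have Vb: "bdd_borel V" using V by (simp add: supersol_def)
 obtain Mv where Mv: "!!x. abs (V x) <= Mv" "Mv > 0" using bdd_borelD(2)[OF Vb] by blast
 define k where "k = ker_const TYPE('a)"
 have k: "k > 0" unfolding k_def by (rule ker_const_pos)
 have one: "u x - u (x + h) <= (L + 4 * Mv) * (norm h + t + omega)"
  if d: "discrete L g t u" and t: "0 < t" "t <= t0" "t <= 1" and omega: "omega > 0" and g: "!!x. abs (g x - g (x + h)) <= omega" for g t u h omega x
 proof -
  note ub = discreteD(1)[OF d L t(3)]
  have u: "!!x. 0 <= u x" "!!x. u x <= L * (bdist Om x + t)" "!!x. x ~: Om ==> u x = 0" "!!x. x : Om ==> u x = Sop t rho u x + 4/3 * k * t^2 * g x"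
   using d by (simp_all add: discrete_def k_def)
  have uh: "bdd_borel (%y. u (y + h))"
   using ub by (auto simp: bdd_borel_def intro: measurable_compose[where f="%y. y + h"])
  have Va: "bdd_borel (%y. (2 * omega) * (V y + 0))"
   using Mv(1) omega bdd_borelD(1)[OF Vb] by (intro bdd_borelI[of _ "2 * omega * Mv"]) (auto simp: abs_mult)
  \<comment> \<open>The weight 2 omega lets the barrier gain 2 omega k t^2. The difference of the
    two source terms uses up at most 4/3 omega k t^2, and the remaining 2/3 is the strict defect
    required by the maximum principle.\<close>
  define W where "W y = u y - u (y + h) - (2 * omega) * (V y + 0)" for y
  have uu: "bdd_borel (%y. u y - u (y + h))"
  proof (rule bdd_borelI)
   show "abs (u y - u (y + h)) <= L * (dmax + 1) + L * (dmax + 1)" for y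
    using discreteD(2)[OF d L t(3), of y] discreteD(2)[OF d L t(3), of "y + h"] by linarith
  qed (use bdd_borelD(1)[OF ub] bdd_borelD(1)[OF uh] in simp)
  have Wb: "bdd_borel W"
   using uu Va unfolding W_def bdd_borel_def by (auto intro!: borel_measurable_diff) (meson abs_triangle_ineq4 add_mono order_trans)
  have Wd: "W x <= Sop t rho W x - 2/3 * k * t^2 * omega" if x: "x : {x : Om. x + h : Om}" for x
  proof -
   have "Sop t rho (%y. u (y + h)) x = Sop t rho u (x + h)" by (simp add: Sop_def algebra_simps)
   then have S: "Sop t rho W x = Sop t rho u x - Sop t rho u (x + h) - (2 * omega) * Sop t rho V x"
    unfolding W_def Sop_diff[OF uu Va rho_facts(1)] Sop_diff[OF ub uh rho_facts(1)] Sop_add_const[OF Vb] by simp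
   have "Sop t rho V x + k * t^2 <= V x" using V x t unfolding supersol_def k_def by fastforce
   then have "(2 * omega) * (Sop t rho V x + k * t^2) <= (2 * omega) * V x" using omega by (intro mult_left_mono) auto
   moreover have "4/3 * k * t^2 * (g x - g (x + h)) <= 4/3 * k * t^2 * omega" using g[of x] k by (intro mult_left_mono) auto
   ultimately show ?thesis using u(4)[of x] u(4)[of "x + h"] x unfolding S W_def by (simp add: algebra_simps)
  qed
  have Wm: "W x <= L * (norm h + t) + 2 * omega * Mv" if x: "x ~: {x : Om. x + h : Om}" for x
  proof -
   have "u x <= L * (norm h + t)"
   proof (cases "x : Om")
    case True
    then have "bdist Om x <= norm h" using x bdist_le[of "x + h" Om x] by (simp add: dist_norm)
    then have "L * (bdist Om x + t) <= L * (norm h + t)" using L by (intro mult_left_mono) auto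
    then show ?thesis using u(2)[of x] by linarith
   qed (use u(3) L t in simp)
   moreover have "(2 * omega) * (- V x) <= (2 * omega) * Mv" using Mv(1)[of x] omega by (intro mult_left_mono) auto
   ultimately show ?thesis using u(1)[of "x + h"] by (simp add: W_def algebra_simps)
  qed
  have pos: "2/3 * k * t^2 * omega > 0" using k t omega by simp
  have "W x <= L * (norm h + t) + 2 * omega * Mv" by (rule discrete_maximum[OF Wb t(1) pos Wd Wm])
  moreover have "(2 * omega) * V x <= (2 * omega) * Mv" using Mv(1)[of x] omega by (intro mult_left_mono) auto
  ultimately have "u x - u (x + h) <= L * (norm h + t) + 4 * Mv * omega" by (simp add: W_def algebra_simps)
  also have "... <= (L + 4 * Mv) * (norm h + t + omega)" using L Mv(2) t(1) omega by (simp add: algebra_simps add_increasing add_nonneg_nonneg)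
  finally show ?thesis .
 qed
 have "abs (u x - u (x + h)) <= (L + 4 * Mv) * (norm h + t + omega)"
  if d: "discrete L g t u" and t: "0 < t" "t <= t0" "t <= 1" and omega: "omega > 0" and g: "!!x. abs (g x - g (x + h)) <= omega" for g t u h omega x
 proof -
  have "abs (g y - g (y + - h)) <= omega" for y using g[of "y - h"] by (simp add: abs_minus_commute)
  from one[OF d t omega this, of "x + h"] one[OF d t omega g, of x] show ?thesis by (simp add: abs_le_iff)
 qed
 then show ?thesis using L Mv(2) t0 by (intro exI[of _ "L + 4 * Mv"] exI[of _ t0]) auto
qed

text \<open>The discrete solutions are only known to be Borel, so the theorem of Arzela and Ascoli
  is applied to their means, which are smooth and differ from them in \<open>Om\<close> by O(t^2).
  Equicontinuity of the means comes from the discrete modulus for small t and from continuity for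
  the finitely many other indices. The linear bound survives the limit and yields continuity at the
  boundary.\<close>

lemma green_exists:
 "EX L>0. ALL g. g : C0 Om & (ALL x. 0 <= g x & g x <= 1) --> (EX u:C0 Om. poisson Om u g & (ALL x. 0 <= u x & u x <= L * bdist Om x))"
proof -
 obtain L ta where L: "L > 0" and ta: "ta > 0" "ta <= 1"
  and ds: "!!g t. g : C0 Om ==> (ALL x. 0 <= g x & g x <= 1) ==> 0 < t ==> t <= ta ==> EX u. discrete L g t u"
  using discrete_solution by blast
 obtain C tb where C: "C > 0" and tb: "tb > 0" and mod: "ALL g t u h omega. discrete L g t u & 0 < t & t <= tb & t <= 1 & omega > 0 &
   (ALL x. abs (g x - g (x + h)) <= omega) --> (ALL x. abs (u x - u (x + h)) <= C * (norm h + t + omega))"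
  using discrete_modulus[OF L] by (elim exE conjE) (rule that)
 obtain A where A: "!!z. abs (rho (z::'a)) <= A" "A >= 0" using unit_kernelD(7)[OF rho_facts(1)] by blast
 have main: "EX u:C0 Om. poisson Om u g & (ALL x. 0 <= u x & u x <= L * bdist Om x)"
  if g: "g : C0 Om" "ALL x. 0 <= g x & g x <= 1" for g
 proof -
  define t where "t n = min ta tb/Suc n" for n
  have tn: "t n > 0" "t n <= min ta tb" for n using ta tb by (auto simp: t_def divide_le_eq mult_le_cancel_left1 min_def)
  have t: "t n > 0" "t n <= ta" "t n <= tb" "t n <= 1" for n using tn[of n] ta by auto
  have tl: "t ----> 0"
   using tendsto_mult[OF tendsto_const[of "min ta tb"] LIMSEQ_Suc[OF lim_1_over_n]] by (simp add: t_def[abs_def])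
  obtain u where u: "!!n. discrete L g (t n) (u n)" using ds[OF g t(1,2)] by metis
  note ub = discreteD[OF u L t(4)]
  define s where "s n = Sop (t n) rho (u n)" for n
  have sB: "abs (s n x) <= A * (L * (dmax + 1)) * unit_vol TYPE('a)" for n x
   unfolding s_def by (rule Sop_bound[OF rho_facts(1) A(1) ub(2) _ t(1)]) (use L dmax(1) in simp)
  have us: "u n x = s n x + 4/3 * ker_const TYPE('a) * (t n)^2 * g x" if "x : Om" for n x
   using u[of n] that by (simp add: discrete_def s_def)
  define Q where "Q = A * C * unit_vol TYPE('a) + 1"
  have Q: "Q > 0" using A(2) C by (simp add: Q_def add_nonneg_pos)
  have eq: "EX d>0. ALL n y. y : closure Om & norm (x - y) < d --> norm (s n x - s n y) < e" if e: "e > 0" for x e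
  proof -
   define omega where "omega = e/(4 * Q)"
   have omega: "omega > 0" "4 * (Q * omega) = e" using e Q by (auto simp: omega_def)
   have "uniformly_continuous_on UNIV g" by (rule bounded_support_uniformly_continuous[OF C0D(1)[OF g(1)] bounded_Om C0D(2)[OF g(1)]])
   then obtain d where d: "d > 0" "!!x y. dist y x < d ==> dist (g y) (g x) < omega"
    using omega(1) unfolding uniformly_continuous_on_def by (metis UNIV_I)
   obtain N where N: "!!n. n >= N ==> t n < omega" using order_tendstoD(2)[OF tl omega(1)] unfolding eventually_sequentially by blast
   have big: "norm (s n x - s n y) < e" if n: "n >= N" and y: "dist y x < min d omega" for n y
   proof -
    define h where "h = y - x"
    have h: "norm h < d" "norm h < omega" using y by (auto simp: h_def dist_norm)
    have "dist (g z) (g (z + h)) < omega" for z using h by (intro d(2)) (simp add: dist_norm)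
    then have gh: "ALL z. abs (g z - g (z + h)) <= omega" by (simp add: dist_real_def less_imp_le)
    have "C * (norm h + t n + omega) <= C * (3 * omega)" using h N[OF n] C by (intro mult_left_mono) auto
    moreover have pr: "discrete L g (t n) (u n) & 0 < t n & t n <= tb & t n <= 1 & omega > 0 & (ALL x. abs (g x - g (x + h)) <= omega)"
     using u t(1,3,4) omega(1) gh by simp
    ultimately have W: "abs (u n z - u n (z + h)) <= C * (3 * omega)" for z using mod[rule_format, OF pr, of z] by linarith
    have bh: "bdd_borel (%z. u n (z + h))"
     using ub(1)[of n] by (auto simp: bdd_borel_def intro: measurable_compose[where f="%y. y + h"])
    have "Sop (t n) rho (%z. u n (z + h)) x = s n y" by (simp add: s_def Sop_def h_def algebra_simps)
    then have "s n x - s n y = Sop (t n) rho (%z. u n z - u n (z + h)) x" using Sop_diff[OF ub(1) bh rho_facts(1)] by (simp add: s_def)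
    also have "abs (...) <= A * (C * (3 * omega)) * unit_vol TYPE('a)" by (rule Sop_bound[OF rho_facts(1) A(1) W _ t(1)]) (use C omega in simp)
    also have "... < e" unfolding omega(2)[symmetric] using omega(1) A(2) C by (simp add: Q_def algebra_simps add_increasing add_pos_nonneg)
    finally show ?thesis by simp
   qed
   have "\<forall>\<^sub>F y in nhds x. ALL n:{..<N}. dist (s n y) (s n x) < e"
   proof (rule eventually_ball_finite, simp, rule ballI)
    fix n
    have "isCont (s n) x" unfolding s_def
     using smooth_continuous[OF Sop_smooth[OF ub(1) rho_facts(1) t(1)], of UNIV] by (simp add: continuous_on_eq_continuous_at)
    then show "\<forall>\<^sub>F y in nhds x. dist (s n y) (s n x) < e" using e by (intro tendstoD) (auto simp: isCont_def tendsto_at_iff_tendsto_nhds)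
   qed
   then obtain d' where d': "d' > 0" "!!y n. dist y x < d' ==> n < N ==> dist (s n y) (s n x) < e"
    unfolding eventually_nhds_metric by auto
   show ?thesis
   proof (intro exI[of _ "min d' (min d omega)"] conjI allI impI)
    show "min d' (min d omega) > 0" using d' d omega by simp
    show "norm (s n x - s n y) < e" if "y : closure Om & norm (x - y) < min d' (min d omega)" for n y
     using that big[of n y] d'(2)[of y n] by (cases "n < N") (auto simp: dist_norm norm_minus_commute abs_minus_commute)
   qed
  qed
  obtain w0 and k :: "nat => nat" where w0: "continuous_on (closure Om) w0" and k: "strict_mono k"
   and kl: "!!e. 0 < e ==> EX N. ALL n x. n >= N & x : closure Om --> norm (s (k n) x - w0 x) < e"
   using Arzela_Ascoli[of "closure Om" s] bounded_Om sB eq by (simp add: compact_closure) metis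
  have tk: "(%n. t (k n)) ----> 0" using LIMSEQ_subseq_LIMSEQ[OF tl k] by (simp add: o_def)
  define w where "w x = (if x : Om then w0 x else 0)" for x
  have conv: "(%n. u (k n) x) ----> w x" for x
  proof (cases "x : Om")
   case True
   then have "x : closure Om" using closure_subset by blast
   then have "(%n. s (k n) x) ----> w0 x" by (intro LIMSEQ_I) (use kl in blast)
   then have "(%n. s (k n) x) ----> w x" using True by (simp add: w_def)
   moreover have "(%n. 4/3 * ker_const TYPE('a) * (t (k n))^2 * g x) ----> 4/3 * ker_const TYPE('a) * 0^2 * g x"
    by (intro tendsto_intros tk)
   ultimately have "(%n. s (k n) x + 4/3 * ker_const TYPE('a) * (t (k n))^2 * g x) ----> w x + 4/3 * ker_const TYPE('a) * 0^2 * g x"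
    by (rule tendsto_add)
   then show ?thesis using us[OF True] by simp
  qed (use u in \<open>simp add: w_def discrete_def\<close>)
  have w0n: "0 <= w x" for x by (rule LIMSEQ_le_const[OF conv]) (use u in \<open>auto simp: discrete_def\<close>)
  have wL: "w x <= L * bdist Om x" for x
  proof -
   have "(%n. L * (bdist Om x + t (k n))) ----> L * (bdist Om x + 0)" by (intro tendsto_intros tk)
   moreover have "u (k n) x <= L * (bdist Om x + t (k n))" for n using u by (simp add: discrete_def)
   ultimately show ?thesis using LIMSEQ_le[OF conv] by auto
  qed
  have "isCont w x" for x
  proof (cases "x : Om")
   case True
   have "continuous_on Om w" using continuous_on_subset[OF w0 closure_subset] by (subst continuous_on_cong[OF refl]) (auto simp: w_def)
   then show ?thesis using True open_Om by (simp add: continuous_on_eq_continuous_at)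
  next
   case False
   have "w \<midarrow>x\<rightarrow> 0"
   proof (rule tendsto_sandwich[OF _ _ tendsto_const])
    have "isCont (%y. L * bdist Om y) x" by (intro continuous_intros)
    then show "(%y. L * bdist Om y) \<midarrow>x\<rightarrow> 0" using bdist_outside[OF False] by (simp add: isCont_def)
   qed (use w0n wL in auto)
   then show ?thesis using False by (simp add: isCont_def w_def)
  qed
  then have wc: "continuous_on UNIV w" by (simp add: continuous_at_imp_continuous_on)
  have "poisson Om w g"
   unfolding poisson_def
  proof (intro allI impI)
   fix phi assume phi: "test_function Om phi"
   have lb: "bdd_borel (lap phi)" by (rule test_function_borel[OF test_function_lap[OF phi]])
   have "(%n. LINT x|lborel. u (k n) x * lap phi x) ----> (LINT x|lborel. w x * lap phi x)"
   proof (rule integral_dominated_convergence[where w="%x. L * (dmax + 1) * abs (lap phi x)"])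
    note [measurable] = bdd_borelD(1)[OF lb] bdd_borelD(1)[OF ub(1)] borel_measurable_continuous_onI[OF wc]
    show "(%x. w x * lap phi x) : borel_measurable lborel" "(%x. u (k n) x * lap phi x) : borel_measurable lborel" for n by measurable
    have "integrable lborel (%x. 1 * lap phi x)" by (rule test_function_integrable[OF test_function_lap[OF phi]]) (auto simp: bdd_borel_def)
    then show "integrable lborel (%x. L * (dmax + 1) * abs (lap phi x))" by simp
    show "AE x in lborel. (%n. u (k n) x * lap phi x) ----> w x * lap phi x" by (intro AE_I2 tendsto_intros conv)
    show "AE x in lborel. norm (u (k n) x * lap phi x) <= L * (dmax + 1) * abs (lap phi x)" for n
     using ub(2) by (intro AE_I2) (simp add: abs_mult mult_right_mono)
   qed
   moreover have "(%n. LINT x|lborel. u (k n) x * lap phi x) ----> - (LINT x|lborel. g x * phi x)"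
   proof (rule LIMSEQ_I)
    fix e :: real assume e: "e > 0"
    then obtain t1 where t1: "t1 > 0" "!!t u g. 0 < t & t < t1 & t <= 1 & g : C0 Om & discrete L g t u ==>
     abs ((LINT x|lborel. u x * lap phi x) + (LINT x|lborel. g x * phi x)) <= e/2"
     using discrete_weak_error[OF phi half_gt_zero[OF e] L] by blast
    obtain N where N: "!!n. n >= N ==> t (k n) < t1" using order_tendstoD(2)[OF tk t1(1)] unfolding eventually_sequentially by blast
    have "norm ((LINT x|lborel. u (k n) x * lap phi x) - - (LINT x|lborel. g x * phi x)) < e" if "n >= N" for n
     using t1(2)[of "t (k n)" g "u (k n)"] N[OF that] t g(1) u e by simp
    then show "EX no. ALL n>=no. norm ((LINT x|lborel. u (k n) x * lap phi x) - - (LINT x|lborel. g x * phi x)) < e" by blast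
   qed
   ultimately show "(LINT x|lborel. w x * lap phi x) = - (LINT x|lborel. g x * phi x)" by (rule LIMSEQ_unique)
  qed
  moreover have "w : C0 Om" using wc by (simp add: C0_def) (simp add: w_def)
  ultimately show ?thesis using w0n wL by blast
 qed
 then show ?thesis using L by blast
qed

end

text \<open>One constant for both profiles and for all directions of norm at most 1. Third
  derivatives are included because the difference between a kernel and its mirror image is estimated
  by a Lipschitz bound for second derivatives.\<close>

definition kernel_bound :: "'a::euclidean_space itself => real => bool" where
 "kernel_bound T A \<longleftrightarrow> A >= 1 & (ALL D:{kerP T, kerk T}. ALL xi eta z. norm xi <= 1 & norm (eta::'a) <= 1 -->
   abs (radial D 0 z) <= A & abs (radial1 D xi z) <= A & abs (radial2 D xi eta z) <= A &
   (ALL i:Basis. abs (partial i (radial2 D xi eta) z) <= A))"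

lemma partial_radial2:
 assumes "deriv_seq D"
 shows "partial i (radial2 D xi eta) z = 4 * ((i \<bullet> xi) * (z \<bullet> eta) + (z \<bullet> xi) * (i \<bullet> eta) + (xi \<bullet> eta) * (z \<bullet> i)) * radial D 2 z
   + 8 * ((z \<bullet> xi) * (z \<bullet> eta) * (z \<bullet> i)) * radial D 3 z"
proof -
 have s: "smooth (%z. (z \<bullet> xi) * (z \<bullet> eta))" by (rule smooth_mult[OF smooth_inner smooth_inner])
 note r = smooth_radial[OF assms]
 have "partial i (radial2 D xi eta) z = 4 * ((z \<bullet> xi) * (z \<bullet> eta) * (2 * (z \<bullet> i) * radial D (Suc 2) z)
   + ((z \<bullet> xi) * (i \<bullet> eta) + (i \<bullet> xi) * (z \<bullet> eta)) * radial D 2 z) + 2 * (xi \<bullet> eta) * (2 * (z \<bullet> i) * radial D (Suc 1) z)"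
  unfolding radial2_def[abs_def] partial_add_smooth[OF smooth_mult[OF smooth_const smooth_mult[OF s r]] smooth_mult[OF smooth_const r]]
   partial_cmult_smooth[OF smooth_mult[OF s r]] partial_cmult_smooth[OF r] partial_mult_smooth[OF s r]
   partial_mult_smooth[OF smooth_inner smooth_inner] partial_inner partial_radial[OF assms] ..
 then show ?thesis by (simp add: algebra_simps flip: numeral_2_eq_2 numeral_3_eq_3)
qed

lemma kernel_bound_exists: "EX A. kernel_bound (T::'a::euclidean_space itself) A"
proof -
 have one: "EX A>=1. ALL xi eta z. norm xi <= 1 & norm (eta::'a) <= 1 -->
   abs (radial D 0 z) <= A & abs (radial1 D xi z) <= A & abs (radial2 D xi eta z) <= A &
   (ALL i:Basis. abs (partial i (radial2 D xi eta) z) <= A)"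
  if D: "deriv_seq D" "!!n s. s >= 1 ==> D n s = 0" for D :: "nat => real => real"
 proof -
  have "EX B>=0. ALL z::'a. abs (radial D n z) <= B" for n
   using unit_kernelD(7)[OF unit_kernel_radial(1)[OF D]] by blast
  then obtain b where b: "!!n. b n >= 0" "!!n z. abs (radial D n (z::'a)) <= b n" by metis
  define A where "A = 1 + b 0 + 2 * b 1 + 12 * b 2 + 8 * b 3"
  have A: "1 <= A" "b 0 <= A" "2 * b 1 <= A" "4 * b 2 + 2 * b 1 <= A" "12 * b 2 + 8 * b 3 <= A"
   using b(1)[of 0] b(1)[of 1] b(1)[of 2] b(1)[of 3] by (auto simp: A_def)
  have main: "abs (radial D 0 z) <= A & abs (radial1 D xi z) <= A & abs (radial2 D xi eta z) <= A &
   (ALL i:Basis. abs (partial i (radial2 D xi eta) z) <= A)" if xi: "norm xi <= 1" and eta: "norm eta <= 1" for xi eta z :: 'a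
  proof (cases "norm z >= 1")
   case True
   then have "(norm z)^2 >= 1" by (simp add: one_le_power)
   then have z0: "radial D n z = 0" for n by (rule D(2))
   then show ?thesis unfolding partial_radial2[OF D(1)] radial1_def radial2_def z0 using A(1) by simp
  next
   case False
   have i1: "abs (v \<bullet> w) <= 1" if "norm v <= 1" "norm w <= 1" for v w :: 'a
    using Cauchy_Schwarz_ineq2[of v w] mult_mono[OF that] by simp
   have m: "abs (x * y) <= 1" if "abs x <= 1" "abs y <= 1" for x y :: real
    using mult_mono[OF that] by (simp add: abs_mult)
   have z1: "norm z <= 1" using False by simp
   note zi = i1[OF z1 xi] i1[OF z1 eta] i1[OF xi eta]
   have "abs (radial D 0 z) <= A" using b(2)[where n=0 and z=z] A(2) by linarith
   moreover have "abs (radial1 D xi z) <= 2 * (1 * b 1)" unfolding radial1_def abs_mult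
    by (intro mult_mono zi b) (auto simp: b)
   moreover have "abs (radial2 D xi eta z) <= 4 * (1 * b 2) + 2 * 1 * b 1" unfolding radial2_def
    by (intro order_trans[OF abs_triangle_ineq] add_mono; simp only: abs_mult[of 4] abs_mult[of _ "radial D _ z"] abs_mult[of 2] abs_numeral;
      intro mult_mono m zi b; simp add: b)
   moreover have "abs (partial i (radial2 D xi eta) z) <= A" if "i : Basis" for i
   proof -
    have ni: "norm i <= 1" using that by simp
    have "abs ((i \<bullet> xi) * (z \<bullet> eta) + (z \<bullet> xi) * (i \<bullet> eta) + (xi \<bullet> eta) * (z \<bullet> i)) <= 3"
     using m[OF i1[OF ni xi] zi(2)] m[OF zi(1) i1[OF ni eta]] m[OF zi(3) i1[OF z1 ni]] by linarith
    then have "abs (4 * ((i \<bullet> xi) * (z \<bullet> eta) + (z \<bullet> xi) * (i \<bullet> eta) + (xi \<bullet> eta) * (z \<bullet> i)) * radial D 2 z) <= (4 * 3) * b 2"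
     unfolding abs_mult by (intro mult_mono b) auto
    moreover have "abs (8 * ((z \<bullet> xi) * (z \<bullet> eta) * (z \<bullet> i)) * radial D 3 z) <= (8 * 1) * b 3"
     unfolding abs_mult[of _ "radial D 3 z"] abs_mult[of 8] abs_numeral
     by (intro mult_mono b m zi i1[OF z1 ni]) auto
    ultimately show ?thesis unfolding partial_radial2[OF D(1)] using A(5) by linarith
   qed
   ultimately show ?thesis using A by simp
  qed
  show ?thesis by (intro exI[of _ A] conjI allI impI A(1)) (use main in blast)+
 qed
 obtain A1 A2 where "A1 >= 1" "A2 >= 1" and A1: "!!xi eta z. norm xi <= 1 & norm (eta::'a) <= 1 -->
   abs (radial (kerP T) 0 z) <= A1 & abs (radial1 (kerP T) xi z) <= A1 & abs (radial2 (kerP T) xi eta z) <= A1 &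
   (ALL i:Basis. abs (partial i (radial2 (kerP T) xi eta) z) <= A1)"
  and A2: "!!xi eta z. norm xi <= 1 & norm (eta::'a) <= 1 -->
   abs (radial (kerk T) 0 z) <= A2 & abs (radial1 (kerk T) xi z) <= A2 & abs (radial2 (kerk T) xi eta z) <= A2 &
   (ALL i:Basis. abs (partial i (radial2 (kerk T) xi eta) z) <= A2)"
  using one[OF deriv_seq_ker(1)[of T] ker_eq_0(1)[of _ T]] one[OF deriv_seq_ker(2)[of T] ker_eq_0(2)[of _ T]] by blast
 have "kernel_bound T (max A1 A2)" unfolding kernel_bound_def
  using A1 A2 \<open>A1 >= 1\<close> by (auto simp: le_max_iff_disj)
 then show ?thesis by blast
qed

definition ker_bd :: "'a::euclidean_space itself => real" where
 "ker_bd T = (SOME A. kernel_bound T A)"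

lemma ker_bd: "kernel_bound T (ker_bd T)"
 unfolding ker_bd_def by (rule someI_ex[OF kernel_bound_exists])

lemma ker_bdD:
 fixes xi eta z :: "'a::euclidean_space"
 assumes "norm xi <= 1" "norm eta <= 1"
 shows "ker_bd TYPE('a) >= 1" "abs (radial (kerP TYPE('a)) 0 z) <= ker_bd TYPE('a)" "abs (radial (kerk TYPE('a)) 0 z) <= ker_bd TYPE('a)"
  "abs (radial1 (kerP TYPE('a)) xi z) <= ker_bd TYPE('a)" "abs (radial1 (kerk TYPE('a)) xi z) <= ker_bd TYPE('a)"
  "abs (radial2 (kerP TYPE('a)) xi eta z) <= ker_bd TYPE('a)" "abs (radial2 (kerk TYPE('a)) xi eta z) <= ker_bd TYPE('a)"
  "i : Basis ==> abs (partial i (radial2 (kerk TYPE('a)) xi eta) z) <= ker_bd TYPE('a)"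
 using ker_bd[of "TYPE('a)"] assms unfolding kernel_bound_def by auto

section \<open>The solution operator: linearity, monotonicity, bounds\<close>

context domain
begin

definition green_bd :: real where
 "green_bd = (SOME L. L > 0 & (ALL g. g : C0 Om & (ALL x. 0 <= g x & g x <= 1) -->
   (EX u:C0 Om. poisson Om u g & (ALL x. 0 <= u x & u x <= L * bdist Om x))))"

lemma green_bd: "green_bd > 0" "g : C0 Om ==> (!!x. 0 <= g x & g x <= 1) ==>
   EX u:C0 Om. poisson Om u g & (ALL x. 0 <= u x & u x <= green_bd * bdist Om x)"
 using someI_ex[OF green_exists, folded green_bd_def] by blast+

lemma C0_bb: "u : C0 Om ==> bdd_borel u"
 by (rule C0_bdd_borel[OF bounded_Om])

lemma poisson_mono:
 assumes "u : C0 Om" "v : C0 Om" "g : C0 Om" "h : C0 Om" "poisson Om u g" "poisson Om v h" "!!x. g x <= h x"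
 shows "u x <= v x"
proof -
 have p: "poisson Om (%x. 1 * v x + (-1) * u x) (%x. 1 * h x + (-1) * g x)"
  by (rule poisson_lincomb[OF assms(6,5) C0_bb[OF assms(2)] C0_bb[OF assms(1)] C0_bb[OF assms(4)] C0_bb[OF assms(3)]])
 have c: "(%x. 1 * v x + (-1) * u x) : C0 Om" "(%x. 1 * h x + (-1) * g x) : C0 Om"
  by (intro C0_add C0_cmult assms)+
 have "0 <= 1 * v x + (-1) * u x"
  by (rule minimum_principle[OF open_Om bounded_Om c(1) C0_bb[OF c(2)] _ p]) (use assms(7) in simp)
 then show ?thesis by simp
qed

lemma green_solution:
 assumes g: "g : C0 Om" and M: "!!x. abs (g x) <= M"
 shows "EX u:C0 Om. poisson Om u g & (ALL x. abs (u x) <= green_bd * M * bdist Om x)"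
proof -
 have "M >= 0" using M[of undefined] by simp
 have pos: "EX u:C0 Om. poisson Om u h & (ALL x. 0 <= u x & u x <= green_bd * M * bdist Om x)"
  if h: "h : C0 Om" "!!x. 0 <= h x & h x <= M" for h
 proof (cases "M = 0")
  case True
  then have "h = (%x. 0)" using h(2) by (auto simp: antisym)
  then show ?thesis using True by (intro bexI[of _ "%x. 0"]) (auto simp: poisson_def C0_def)
 next
  case False
  then have Mp: "M > 0" using \<open>M >= 0\<close> by simp
  have "(%x. (1/M) * h x) : C0 Om" by (rule C0_cmult[OF h(1)])
  then obtain u where u: "u : C0 Om" "poisson Om u (%x. (1/M) * h x)" "!!x. 0 <= u x & u x <= green_bd * bdist Om x"
   using green_bd(2)[of "%x. (1/M) * h x"] h(2) Mp by (auto simp: divide_le_eq)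
  have z: "poisson Om (%x. 0) (%x. 0)" by (simp add: poisson_def)
  have "poisson Om (%x. M * u x + 0 * 0) (%x. M * ((1/M) * h x) + 0 * 0)"
   by (rule poisson_lincomb[OF u(2) z C0_bb[OF u(1)] _ C0_bb[OF C0_cmult[OF h(1)]]]) (auto simp: bdd_borel_def)
  then have "poisson Om (%x. M * u x) h" using Mp by simp
  moreover have "0 <= M * u x & M * u x <= green_bd * M * bdist Om x" for x
   using u(3)[of x] mult_left_mono[of "u x" "green_bd * bdist Om x" M] Mp by (simp add: mult_ac)
  ultimately show ?thesis using C0_cmult[OF u(1)] by blast
 qed
 have "continuous_on UNIV (%t::real. max 0 t)" "continuous_on UNIV (%t::real. max 0 (- t))" by (intro continuous_intros)+
 from C0_compose[OF g this(1)] C0_compose[OF g this(2)]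
 have hp: "(%x. max 0 (g x)) : C0 Om" "(%x. max 0 (- g x)) : C0 Om" by simp_all
 obtain u where u: "u : C0 Om" "poisson Om u (%x. max 0 (g x))" "!!x. 0 <= u x & u x <= green_bd * M * bdist Om x"
  using pos[OF hp(1)] M by (auto simp: abs_le_iff \<open>M >= 0\<close>)
 obtain v where v: "v : C0 Om" "poisson Om v (%x. max 0 (- g x))" "!!x. 0 <= v x & v x <= green_bd * M * bdist Om x"
  using pos[OF hp(2)] M by (auto simp: abs_le_iff \<open>M >= 0\<close>)
 have "poisson Om (%x. 1 * u x + (-1) * v x) (%x. 1 * max 0 (g x) + (-1) * max 0 (- g x))"
  by (rule poisson_lincomb[OF u(2) v(2) C0_bb[OF u(1)] C0_bb[OF v(1)] C0_bb[OF hp(1)] C0_bb[OF hp(2)]])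
 moreover have "(%x. 1 * max 0 (g x) + (-1) * max 0 (- g x)) = g" by (auto simp: max_def)
 ultimately have "poisson Om (%x. u x - v x) g" by simp
 moreover have "abs (u x - v x) <= green_bd * M * bdist Om x" for x using u(3)[of x] v(3)[of x] by linarith
 ultimately show ?thesis using C0_diff[OF u(1) v(1)] by blast
qed

definition Gop :: "('a => real) => 'a => real" where
 "Gop g = (THE u. u : C0 Om & poisson Om u g)"

lemma Gop_eqI:
 assumes "g : C0 Om" "u : C0 Om" "poisson Om u g" shows "Gop g = u"
 unfolding Gop_def
proof (rule the_equality)
 fix v assume v: "v : C0 Om & poisson Om v g"
 show "v = u"
 proof
  fix x
  have "v x <= u x" "u x <= v x" using v assms by (auto intro: poisson_mono[of v u g g x] poisson_mono[of u v g g x])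
  then show "v x = u x" by simp
 qed
qed (use assms in auto)

lemma C0_bound: "g : C0 Om ==> EX M. ALL x. abs (g x) <= M"
 using bdd_borelD(2)[OF C0_bb] by blast

lemma Gop:
 assumes g: "g : C0 Om"
 shows "Gop g : C0 Om" "poisson Om (Gop g) g" "(!!x. abs (g x) <= M) ==> abs (Gop g x) <= green_bd * M * bdist Om x"
proof -
 obtain M0 where "!!x. abs (g x) <= M0" using C0_bound[OF g] by blast
 from green_solution[OF g this] obtain u where "u : C0 Om" "poisson Om u g" by blast
 with Gop_eqI[OF g] show "Gop g : C0 Om" "poisson Om (Gop g) g" by auto
 assume "!!x. abs (g x) <= M"
 from green_solution[OF g this] Gop_eqI[OF g] show "abs (Gop g x) <= green_bd * M * bdist Om x" by blast
qed

lemma Gop_lincomb: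
 assumes g: "g : C0 Om" "h : C0 Om"
 shows "Gop (%x. a * g x + b * h x) = (%x. a * Gop g x + b * Gop h x)"
 by (rule Gop_eqI) (intro C0_add C0_cmult g Gop poisson_lincomb C0_bb)+

lemma Gop_mono: "g : C0 Om ==> h : C0 Om ==> (!!x. g x <= h x) ==> Gop g x <= Gop h x"
 by (rule poisson_mono[OF Gop(1) Gop(1) _ _ Gop(2) Gop(2)])

lemma Gop_0: "Gop (%x. 0) = (%x. 0)"
 by (rule Gop_eqI) (auto simp: C0_def poisson_def)

lemma Gop_nonneg: "g : C0 Om ==> (!!x. 0 <= g x) ==> 0 <= Gop g x"
 using Gop_mono[of "%x. 0" g x] by (simp add: Gop_0 C0_def)

end

section \<open>Regularity up to the boundary\<close>

lemma uk_P:
 fixes xi eta :: "'a::euclidean_space"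
 shows "unit_kernel (radial (kerP TYPE('a)) n :: 'a => real)" "unit_kernel (radial1 (kerP TYPE('a)) xi)" "unit_kernel (radial2 (kerP TYPE('a)) xi eta)"
 by (rule unit_kernel_radial[OF deriv_seq_ker(1)], erule ker_eq_0)+

lemma uk_k:
 fixes xi eta :: "'a::euclidean_space"
 shows "unit_kernel (radial (kerk TYPE('a)) n :: 'a => real)" "unit_kernel (radial1 (kerk TYPE('a)) xi)" "unit_kernel (radial2 (kerk TYPE('a)) xi eta)"
 by (rule unit_kernel_radial[OF deriv_seq_ker(2)], erule ker_eq_0)+

lemma compact_bdist:
 fixes Om :: "'a::euclidean_space set"
 assumes "open Om" "bounded Om" "compact K" "K <= Om"
 shows "EX k. ALL x:K. 1/2^k < bdist Om x"
proof (cases "K = {}")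
 case False
 have "continuous_on K (bdist Om)" by (intro continuous_intros)
 from continuous_attains_inf[OF assms(3) False this]
 obtain x where x: "x : K" "!!y. y : K ==> bdist Om x <= bdist Om y" by blast
 have "bdist Om x > 0" using x(1) assms by (intro bdist_pos) auto
 then obtain k where "1/2^k < bdist Om x" using real_arch_pow_inv[of _ "1/2"] by (auto simp: power_divide)
 then show ?thesis using x(2) by (intro exI[of _ k]) fastforce
qed auto

text \<open>On the compact support of phi the boundary distance exceeds some 1/2^k. The bounds are
  therefore asked only level by level and for large n, and dominated convergence carries the
  integration by parts from the smooth approximations to the limit.\<close>

lemma weak_partial_limit:
 fixes S P :: "nat => 'a::euclidean_space => real"
 assumes Om: "open Om" "bounded Om" and i: "i : Basis" and S: "!!n. smooth (S n)" and P: "!!n. P n = partial i (S n)"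
  and lim: "!!x. x : Om ==> (%n. S n x) ----> f x" "!!x. x : Om ==> (%n. P n x) ----> f' x"
  and bd: "!!k. EX C n0. ALL n>=n0. ALL x. 1/2^k < bdist Om x --> abs (S n x) <= C & abs (P n x) <= C"
  and m: "f : borel_measurable borel" "f' : borel_measurable borel" and phi: "test_function Om phi"
 shows "(LINT x|lborel. f x * partial i phi x) = - (LINT x|lborel. f' x * phi x)"
proof -
 obtain K where K: "smooth phi" "compact K" "K <= Om" "!!x. x ~: K ==> phi x = 0" "closed K" using phi by (rule test_functionE) blast
 obtain k where k: "!!x. x : K ==> 1/2^k < bdist Om x" using compact_bdist[OF Om K(2,3)] by blast
 obtain C n0 where C: "!!n x. n >= n0 ==> 1/2^k < bdist Om x ==> abs (S n x) <= C & abs (P n x) <= C" using bd[of k] by blast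
 have dom: "(%n. LINT x|lborel. h (n + n0) x * psi x) ----> (LINT x|lborel. l x * psi x)"
  if h: "!!n x. n >= n0 ==> 1/2^k < bdist Om x ==> abs (h n x) <= C" "!!x. x : Om ==> (%n. h n x) ----> l x"
   "l : borel_measurable borel" "!!n. h n : borel_measurable borel"
   and psi: "test_function Om psi" "!!x. x ~: K ==> psi x = 0" for h l psi
 proof (rule integral_dominated_convergence[where w="%x. C * abs (psi x)"])
  note [measurable] = h(3,4) bdd_borelD(1)[OF test_function_borel[OF psi(1)]]
  show "(%x. l x * psi x) : borel_measurable lborel" by measurable
  show "(%x. h (n + n0) x * psi x) : borel_measurable lborel" for n by measurable
  have "integrable lborel (%x. 1 * psi x)" by (rule test_function_integrable[OF psi(1)]) (auto simp: bdd_borel_def)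
  then show "integrable lborel (%x. C * abs (psi x))" by simp
  show "AE x in lborel. (%n. h (n + n0) x * psi x) ----> l x * psi x"
  proof (intro AE_I2)
   fix x
   show "(%n. h (n + n0) x * psi x) ----> l x * psi x"
   proof (cases "x : K")
    case True
    then have "(%n. h n x) ----> l x" using K(3) by (intro h) auto
    then show ?thesis by (intro tendsto_intros LIMSEQ_ignore_initial_segment)
   qed (simp add: psi(2))
  qed
  show "AE x in lborel. norm (h (n + n0) x * psi x) <= C * abs (psi x)" for n
  proof (intro AE_I2)
   fix x
   show "norm (h (n + n0) x * psi x) <= C * abs (psi x)"
    using h(1)[of "n + n0" x] k[of x] psi(2)[of x] by (cases "x : K") (auto simp: abs_mult intro: mult_right_mono)
  qed
 qed
 have Sm: "S n : borel_measurable borel" "P n : borel_measurable borel" for n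
  unfolding P by (intro borel_measurable_continuous_onI smooth_continuous S smooth_partial i)+
 have "(%n. LINT x|lborel. S (n + n0) x * partial i phi x) ----> (LINT x|lborel. f x * partial i phi x)"
  by (rule dom[OF _ lim(1) m(1) Sm(1) test_function_partial[OF phi i]]) (use C partial_support[OF K(5,4)] in auto)
 moreover have "(%n. LINT x|lborel. P (n + n0) x * phi x) ----> (LINT x|lborel. f' x * phi x)"
  by (rule dom[OF _ lim(2) m(2) Sm(2) phi]) (use C K(4) in auto)
 moreover have "(LINT x|lborel. S n x * partial i phi x) = - (LINT x|lborel. P n x * phi x)" for n
  unfolding P by (rule integral_by_parts2[OF S phi i])
 ultimately show ?thesis
  using LIMSEQ_unique[OF _ tendsto_minus] by fastforce
qed

text \<open>The least k with 1/2^k below the boundary distance. Since the preceding scale fails,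
  this one is comparable to the distance; \<open>dmax\<close> covers the case k = 0, which has no
  predecessor.\<close>

lemma (in domain) level_exists:
 assumes "x : Om" obtains k where "1/2^k < bdist Om x" "bdist Om x <= (2 + dmax)/2^k"
proof -
 define k where "k = (LEAST k. 1/2^k < bdist Om x)"
 have "EX k. 1/2^k < bdist Om x"
  using compact_bdist[OF open_Om bounded_Om, of "{x}"] assms by auto
 then have k: "1/2^k < bdist Om x" unfolding k_def by (rule LeastI_ex)
 moreover have "bdist Om x <= (2 + dmax)/2^k"
 proof (cases k)
  case 0 then show ?thesis using dmax(2)[of x] by simp
 next
  case (Suc j)
  then have "~ 1/2^j < bdist Om x" using not_less_Least[of j "%k. 1/2^k < bdist Om x"] by (simp add: k_def)
  then have "bdist Om x <= 2/2^k" by (simp add: Suc)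
  also have "... <= (2 + dmax)/2^k" using dmax(1) by (intro divide_right_mono) auto
  finally show ?thesis .
 qed
 ultimately show ?thesis by (rule that)
qed

section \<open>Dyadic mollifications of a solution and its gradient\<close>

locale dirichlet = domain Om r0 Cb for Om :: "'a::euclidean_space set" and r0 Cb +
 fixes u g :: "'a => real" and B M :: real
 assumes uC: "u : C0 Om" and gC: "g : C0 Om" and po: "poisson Om u g"
  and uB: "!!x. abs (u x) <= B * bdist Om x" and gM: "!!x. abs (g x) <= M" and B0: "B >= 0"
begin

lemma M0: "M >= 0" using order_trans[OF abs_ge_zero gM] .
lemma KA1: "ker_bd TYPE('a) >= 1" using ker_bdD(1)[of "0::'a" 0] by simp
lemma KA0: "ker_bd TYPE('a) >= 0" using KA1 by linarith
lemma ub: "bdd_borel u" using uC by (rule C0_bb)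
lemma gb: "bdd_borel g" using gC by (rule C0_bb)
lemma pos2: "(0::real) < 1/2^n" by simp

text \<open>When a is an m-th derivative of rho, this is the corresponding derivative of the
  mollification of u at scale 2^-n: every derivative costs a factor 2^n.\<close>

definition sq :: "nat => ('a => real) => nat => 'a => real" where
 "sq m a n x = 2^(n * m) * Sop (1/2^n) a u x"

text \<open>The factor 2^(n m) 4^-n shows the role of the order. For m < 2 it is summable and
  bounded g suffices; for m = 2 it equals 1, and the decay has to come from cancellation in the
  kernel.\<close>

lemma sq_step:
 assumes ab: "kernel_pair a b m" and n: "1/2^n < bdist Om x"
 shows "sq m a (Suc n) x - sq m a n x = 2^(n * m) * (1/4)^n * Sop (1/2^n) b g x"
proof -
 have "Sop (1/2^n) a u x - 2^m * Sop (1/2^n/2) a u x = - (1/2^n)\<^sup>2 * Sop (1/2^n) b g x"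
  by (rule poisson_step[OF po ub gb ab pos2 cball_bdist_subset[OF n]])
 then have "2^(n * m) * (2^m * Sop (1/2^n/2) a u x - Sop (1/2^n) a u x) = 2^(n * m) * ((1/2^n)^2 * Sop (1/2^n) b g x)" by simp
 moreover have "(1/2^n :: real)^2 = (1/4)^n" by (simp add: power_divide power_even_eq[symmetric]) (simp add: power_mult)
 ultimately show ?thesis by (simp add: sq_def power_add algebra_simps)
qed

lemma sq_smooth: "unit_kernel a ==> smooth (sq m a n)"
 unfolding sq_def[abs_def] by (intro smooth_mult smooth_const Sop_smooth[OF ub _ pos2])

lemma sq_partial:
 assumes "unit_kernel a" "i : Basis" shows "partial i (sq m a n) = sq (Suc m) (partial i a) n"
 unfolding sq_def[abs_def] partial_cmult_smooth[OF Sop_smooth[OF ub assms(1) pos2]] Sop_partial[OF ub assms(1) pos2 assms(2)]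
 by (simp add: power_add mult_ac)

text \<open>Where the boundary distance is O(2^-n), the linear decay makes u itself O(2^-n) on the
  ball of the average, which pays for one of the \<open>Suc m\<close> derivatives.\<close>

lemma sq_bound:
 assumes a: "unit_kernel a" "!!z. abs (a z) <= ker_bd TYPE('a)" and d: "bdist Om x <= (2 + dmax)/2^n"
 shows "abs (sq (Suc m) a n x) <= 2^(n * m) * (ker_bd TYPE('a) * (B * (3 + dmax)) * unit_vol TYPE('a))"
proof -
 have "abs (Sop (1/2^n) a u x) <= ker_bd TYPE('a) * (B * ((3 + dmax)/2^n)) * unit_vol TYPE('a)"
 proof (rule Sop_bound[OF a _ _ pos2])
  fix y assume "dist x y < 1/2^n"
  then have "bdist Om y <= (3 + dmax)/2^n" using infdist_triangle[of y "- Om" x] d by (simp add: dist_commute add_divide_distrib)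
  then have "B * bdist Om y <= B * ((3 + dmax)/2^n)" using B0 by (intro mult_left_mono)
  then show "abs (u y) <= B * ((3 + dmax)/2^n)" using uB[of y] by linarith
 qed (use B0 dmax in simp)
 then have "2^(n * Suc m) * abs (Sop (1/2^n) a u x) <= 2^(n * Suc m) * (ker_bd TYPE('a) * (B * ((3 + dmax)/2^n)) * unit_vol TYPE('a))"
  by (intro mult_left_mono) auto
 also have "... = 2^(n * m) * (ker_bd TYPE('a) * (B * (3 + dmax)) * unit_vol TYPE('a))" by (simp add: power_add)
 finally show ?thesis by (simp add: sq_def abs_mult)
qed

lemma sq0: "(%n. sq 0 rho n x) ----> u x"
proof -
 have "(%n. Sop (1/2^n) rho u x) ----> u x * (LINT z|lborel. rho (z::'a))"
  using LIMSEQ_realpow_zero[of "1/2 :: real"] by (intro Sop_tendsto[OF rho_facts(1) ub C0_isCont[OF uC]]) (auto simp: power_divide)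
 then show ?thesis by (simp add: sq_def rho_facts(4))
qed

definition grad :: "'a => 'a => real" where
 "grad i x = (if x : Om then lim (%n. sq 1 (radial1 (kerP TYPE('a)) i) n x) else 0)"

text \<open>The first summand bounds the value at the scale comparable to the boundary distance. The
  factor 4 in the second stands for two geometric tails of size 2: from that scale to the limit, and
  from the limit back to any other admissible scale.\<close>

definition grad_bd :: real where "grad_bd = ker_bd TYPE('a) * (B * (3 + dmax)) * unit_vol TYPE('a) + 4 * (ker_bd TYPE('a) * M * unit_vol TYPE('a))"

text \<open>The increments decay like 2^-j, so the limit exists. Starting at the scale comparable to
  the boundary distance, where the decay of u controls the value, makes the bound uniform up to the
  boundary.\<close>

lemma grad_facts:
 assumes i: "norm i <= 1" and n: "1/2^n < bdist Om x"
 shows "(%n. sq 1 (radial1 (kerP TYPE('a)) i) n x) ----> grad i x"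
  "abs (sq 1 (radial1 (kerP TYPE('a)) i) n x) <= grad_bd" "abs (grad i x) <= grad_bd"
proof -
 let ?a = "radial1 (kerP TYPE('a)) i" let ?b = "radial1 (kerk TYPE('a)) i"
 have xO: "x : Om" using n bdist_outside[of x Om] pos2[of n] by (cases "x : Om") auto
 have nz: "norm (0::'a) <= 1" by simp
 have st: "abs (sq 1 ?a (Suc j) x - sq 1 ?a j x) <= (ker_bd TYPE('a) * M * unit_vol TYPE('a)) * (1/2)^j" if k: "1/2^k < bdist Om x" "k <= j" for j k
 proof -
  have "1/(2::real)^j <= 1/2^k" using k(2) by (simp add: frac_le power_increasing)
  then have j: "1/2^j < bdist Om x" using k(1) by linarith
  have "abs (Sop (1/2^j) ?b g x) <= ker_bd TYPE('a) * M * unit_vol TYPE('a)"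
   by (rule Sop_bound[OF uk_k(2) ker_bdD(5)[OF i nz] _ M0 pos2]) (rule gM)
  then have "(1/2)^j * abs (Sop (1/2^j) ?b g x) <= (1/2)^j * (ker_bd TYPE('a) * M * unit_vol TYPE('a))" by (intro mult_left_mono) auto
  moreover have "(2::real)^j * (1/4)^j = (1/2)^j" by (simp add: power_mult_distrib[symmetric])
  ultimately show ?thesis unfolding sq_step[OF kernel_pair1 j] by (simp add: abs_mult mult.commute)
 qed
 obtain k where k: "1/2^k < bdist Om x" "bdist Om x <= (2 + dmax)/2^k" by (rule level_exists[OF xO])
 note gc = geometric_Cauchy[OF st[OF k(1)], of k]
 have half: "(0::real) < 1/2" "(1::real)/2 < 1" by auto
 show lim: "(%n. sq 1 ?a n x) ----> grad i x"
  using gc(1)[OF _ half] xO by (simp add: grad_def convergent_LIMSEQ_iff)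
 then have lim': "lim (%n. sq 1 ?a n x) = grad i x" by (rule limI)
 have e: "abs (grad i x - sq 1 ?a j x) <= 2 * (ker_bd TYPE('a) * M * unit_vol TYPE('a))" if "j >= k" for j
 proof -
  have "abs (grad i x - sq 1 ?a j x) <= (ker_bd TYPE('a) * M * unit_vol TYPE('a)) * (1/2)^j/(1 - 1/2)"
   using geometric_Cauchy(2)[OF st[OF k(1)] half that] unfolding lim' by simp
  also have "... <= (ker_bd TYPE('a) * M * unit_vol TYPE('a)) * 1/(1 - 1/2)" using KA0 M0
   by (intro divide_right_mono mult_left_mono) (auto simp: power_le_one)
  finally show ?thesis by simp
 qed
 have b: "abs (sq 1 ?a j x) <= ker_bd TYPE('a) * (B * (3 + dmax)) * unit_vol TYPE('a)" if "bdist Om x <= (2 + dmax)/2^j" for j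
  using sq_bound[OF uk_P(2) ker_bdD(4)[OF i nz] that, of 0] by simp
 have nn: "ker_bd TYPE('a) * M * unit_vol TYPE('a) >= 0" using KA0 M0 by simp
 show "abs (grad i x) <= grad_bd" unfolding grad_bd_def using e[of k] b[OF k(2)] nn by linarith
 show "abs (sq 1 ?a n x) <= grad_bd"
 proof (cases "bdist Om x <= (2 + dmax)/2^n")
  case True
  then show ?thesis using b[OF True] nn unfolding grad_bd_def by linarith
 next
  case False
  have "n >= k"
  proof (rule ccontr)
   assume "~ n >= k"
   then have "(2 + dmax)/2^k <= (2 + dmax)/2^n" using dmax(1) by (intro divide_left_mono) (auto simp: power_increasing)
   then show False using k(2) False by linarith
  qed
  from e[OF this] e[of k] b[OF k(2)] show ?thesis unfolding grad_bd_def by linarith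
 qed
qed

lemma grad_outside: "x ~: Om ==> grad i x = 0"
 by (simp add: grad_def)

lemma grad_bd0: "grad_bd >= 0"
 unfolding grad_bd_def using KA0 M0 B0 dmax(1) by simp

lemma grad_bound: "norm i <= 1 ==> abs (grad i x) <= grad_bd"
 using grad_facts(3)[of i _ x] level_exists[of x] grad_outside[of x i] grad_bd0 by (metis abs_zero)

lemma lim_measurable:
 assumes "!!n. smooth (S n)" "!!x. x : Om ==> (%n. S n x) ----> f x" "!!x. x ~: Om ==> f x = 0"
 shows "f : borel_measurable borel"
proof (rule borel_measurable_LIMSEQ_real)
 show "(%n. indicator Om x * S n x) ----> f x" for x
  using assms(2,3)[of x] by (cases "x : Om") auto
 have [measurable]: "S n : borel_measurable borel" for n by (rule borel_measurable_continuous_onI[OF smooth_continuous[OF assms(1)]])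
 have [measurable]: "Om : sets borel" using open_Om by simp
 show "(%x. indicator Om x * S n x) : borel_measurable borel" for n by measurable
qed

lemma grad_tendsto: "norm i <= 1 ==> x : Om ==> (%n. sq 1 (radial1 (kerP TYPE('a)) i) n x) ----> grad i x"
 using grad_facts(1) level_exists by metis

lemma grad_measurable: "norm i <= 1 ==> grad i : borel_measurable borel"
 by (rule lim_measurable[OF sq_smooth[OF uk_P(2)] grad_tendsto grad_outside])

lemma uM: "abs (u x) <= B * dmax"
 using uB[of x] mult_left_mono[OF dmax(2)[of x] B0] by linarith

lemma u_weak_partial:
 assumes i: "i : Basis" and phi: "test_function Om phi"
 shows "(LINT x|lborel. u x * partial i phi x) = - (LINT x|lborel. grad i x * phi x)"
proof (rule weak_partial_limit[OF open_Om bounded_Om i sq_smooth[OF uk_P(1)] _ sq0 grad_tendsto _ _ _ phi])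
 show "sq 1 (radial1 (kerP TYPE('a)) i) n = partial i (sq 0 rho n)" for n
  unfolding sq_partial[OF uk_P(1) i] radial_deriv[OF deriv_seq_ker(1)] by simp
 show "norm i <= 1" using i by simp
 show "EX C n0. ALL n>=n0. ALL x. 1/2^k < bdist Om x --> abs (sq 0 rho n x) <= C & abs (sq 1 (radial1 (kerP TYPE('a)) i) n x) <= C" for k
 proof (intro exI[of _ "ker_bd TYPE('a) * (B * dmax) * unit_vol TYPE('a) + grad_bd"] exI[of _ k] allI impI)
  fix n x assume n: "k <= n" and k: "1/2^k < bdist Om x"
  have "1/(2::real)^n <= 1/2^k" using n by (simp add: frac_le power_increasing)
  then have nn: "1/2^n < bdist Om x" using k by linarith
  have "abs (sq 0 rho n x) <= ker_bd TYPE('a) * (B * dmax) * unit_vol TYPE('a)" unfolding sq_def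
   using Sop_bound[OF uk_P(1) ker_bdD(2)[of 0 0] uM _ pos2] B0 dmax by simp
  moreover have "abs (sq 1 (radial1 (kerP TYPE('a)) i) n x) <= grad_bd" using i nn by (intro grad_facts(2)) auto
  moreover have "0 <= ker_bd TYPE('a) * (B * dmax) * unit_vol TYPE('a)" using KA0 B0 dmax(1) by simp
  ultimately show "abs (sq 0 rho n x) <= ker_bd TYPE('a) * (B * dmax) * unit_vol TYPE('a) + grad_bd & abs (sq 1 (radial1 (kerP TYPE('a)) i) n x) <= ker_bd TYPE('a) * (B * dmax) * unit_vol TYPE('a) + grad_bd"
   using grad_bd0 by linarith
 qed
 show "u : borel_measurable borel" by (rule bdd_borelD(1)[OF ub])
 show "grad i : borel_measurable borel" using i by (intro grad_measurable) simp
qed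

definition lip :: real where "lip = DIM('a) * grad_bd + 5 * B"

text \<open>If x is within \<open>2 * dist x y\<close> of the boundary, the linear decay at x and at
  y contributes 2 B + 3 B. Otherwise y lies in the ball around x of half the boundary distance, on
  which the gradients of the mollifications are bounded.\<close>

lemma u_lipschitz: "abs (u x - u y) <= lip * dist x y"
proof -
 have far: "abs (u x - u y) <= 5 * B * dist x y" if "bdist Om x <= 2 * dist x y" for x y
 proof -
  have "B * bdist Om x <= B * (2 * dist x y)" using that B0 by (intro mult_left_mono)
  moreover have "bdist Om y <= 3 * dist x y" using infdist_triangle[of y "- Om" x] that by (simp add: dist_commute)
  then have "B * bdist Om y <= B * (3 * dist x y)" using B0 by (intro mult_left_mono)
  ultimately show ?thesis using uB[of x] uB[of y] by (simp add: algebra_simps)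
 qed
 have lip: "5 * B * dist x y <= lip * dist x y" "DIM('a) * grad_bd * dist x y <= lip * dist x y"
  unfolding lip_def using B0 grad_bd0 by (intro mult_right_mono; simp)+
 show ?thesis
 proof (cases "bdist Om x <= 2 * dist x y")
  case True then show ?thesis using far[OF True] lip by linarith
 next
  case False
  define r where "r = bdist Om x/2"
  have r: "r > 0" "dist x y < r" using False zero_le_dist[of x y] unfolding r_def by linarith+
  obtain k where k: "1/2^k < r" using r(1) real_arch_pow_inv[of r "1/2"] by (auto simp: power_divide)
  have "abs (sq 0 rho n y - sq 0 rho n x) <= DIM('a) * grad_bd * norm (y - x)" if n: "n >= k" for n
  proof (rule Ck1_abs_diff_le[OF smooth_differentiable[OF sq_smooth[OF uk_P(1)]] convex_ball[of x r]])
   show "x : ball x r" "y : ball x r" using r by auto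
   fix z i assume z: "z : ball x r" and i: "(i::'a) : Basis"
   have "1/(2::real)^n <= 1/2^k" using n by (simp add: frac_le power_increasing)
   moreover have "bdist Om z >= r" using infdist_triangle[of x "- Om" z] z by (simp add: r_def)
   ultimately have "1/2^n < bdist Om z" using k by linarith
   then have "abs (sq 1 (radial1 (kerP TYPE('a)) i) n z) <= grad_bd" using i by (intro grad_facts(2)) auto
   then show "abs (partial i (sq 0 rho n) z) <= grad_bd"
    unfolding sq_partial[OF uk_P(1) i] radial_deriv[OF deriv_seq_ker(1)] by simp
  qed
  moreover have "(%n. abs (sq 0 rho n y - sq 0 rho n x)) ----> abs (u y - u x)" by (intro tendsto_intros sq0)
  ultimately have "abs (u y - u x) <= DIM('a) * grad_bd * norm (y - x)" by (intro LIMSEQ_le_const2) auto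
  then show ?thesis using lip by (simp add: dist_norm norm_minus_commute abs_minus_commute)
 qed
qed

end

section \<open>Reflection at the tangent plane\<close>

definition mirror :: "'a::euclidean_space => 'a => 'a" where
 "mirror nu v = v - (2 * (nu \<bullet> v)) *\<^sub>R nu"

lemma mirror:
 assumes "norm nu = 1"
 shows "mirror nu v \<bullet> mirror nu w = v \<bullet> w" "norm (mirror nu v) = norm v" "mirror nu (mirror nu v) = v"
  "mirror nu (v - w) = mirror nu v - mirror nu w" "mirror nu (c *\<^sub>R v) = c *\<^sub>R mirror nu v" "norm (v - mirror nu v) = 2 * abs (nu \<bullet> v)"
proof -
 have n: "nu \<bullet> nu = 1" using assms by (simp add: power2_norm_eq_inner[symmetric])
 show 1: "mirror nu v \<bullet> mirror nu w = v \<bullet> w" for v w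
  by (simp add: mirror_def inner_diff_left inner_diff_right n inner_commute algebra_simps)
 show "norm (mirror nu v) = norm v" by (simp add: norm_eq_sqrt_inner 1)
 show "mirror nu (mirror nu v) = v" by (simp add: mirror_def inner_diff_right n algebra_simps)
 show "mirror nu (v - w) = mirror nu v - mirror nu w" by (simp add: mirror_def inner_diff_right algebra_simps)
 show "mirror nu (c *\<^sub>R v) = c *\<^sub>R mirror nu v" by (simp add: mirror_def algebra_simps)
 show "norm (v - mirror nu v) = 2 * abs (nu \<bullet> v)" by (simp add: mirror_def assms)
qed

lemma radial2_mirror: "norm nu = 1 ==> radial2 D (mirror nu xi) (mirror nu eta) (mirror nu z) = radial2 D xi eta z"
 by (simp add: radial2_def mirror)

lemma scaled_kernel_facts:
 fixes b :: "'a::euclidean_space => real"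
 assumes b: "unit_kernel b" and t: "t > 0"
 shows "smooth (%y. b ((x - y) /\<^sub>R t))" "partial i (%y. b ((x - y) /\<^sub>R t)) y = - (1/t) * partial i b ((x - y) /\<^sub>R t)"
  "y ~: cball x t ==> b ((x - y) /\<^sub>R t) = 0"
proof -
 have e: "(%y. b ((x - y) /\<^sub>R t)) = (%y. b (x /\<^sub>R t + (- inverse t) *\<^sub>R y))" by (simp add: scaleR_diff_right)
 show "smooth (%y. b ((x - y) /\<^sub>R t))" unfolding e by (rule smooth_affine[OF unit_kernelD(1)[OF b]])
 show "partial i (%y. b ((x - y) /\<^sub>R t)) y = - (1/t) * partial i b ((x - y) /\<^sub>R t)"
  unfolding e partial_affine_smooth[OF unit_kernelD(1)[OF b]] by (simp add: scaleR_diff_right inverse_eq_divide)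
 show "b ((x - y) /\<^sub>R t) = 0" if "y ~: cball x t"
  by (rule unit_kernel_scale_support[OF b t]) (use that in \<open>auto simp: dist_norm norm_minus_commute\<close>)
qed

definition flat_at :: "'a::euclidean_space set => real => real => 'a => 'a => bool" where
 "flat_at Om r0 C x0 nu \<longleftrightarrow> x0 : frontier Om & norm nu = 1 &
   (ALL y:frontier Om. dist x0 y < r0 --> abs (nu \<bullet> (y - x0)) <= C * (dist x0 y)^2)"

lemma (in domain) cutoff:
 obtains C where "C > 0" "!!s. s > 0 ==> (EX eta. is_cutoff Om C s eta)"
proof -
 obtain C where C: "C > 0" "ALL (U::'a set) s. open U & bounded U & s > 0 --> (EX eta. is_cutoff U C s eta)"
  by (rule exE[OF cutoff_exists[where 'a='a]], elim conjE, rule that)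
 show ?thesis by (rule that[OF C(1)], rule C(2)[rule_format]) (simp add: open_Om bounded_Om)
qed

context dirichlet
begin

text \<open>Testing the equation with the difference of a kernel and its mirror image: away from a
 boundary strip of width \<open>t^2\<close> the Laplacian of \<open>u\<close> is bounded, and in the strip the difference
 is of order \<open>t\<close> because the mirror deviates from the boundary by \<open>O(t^2)\<close>.\<close>

lemma mirror_kernel_bound:
 "EX C>=0. ALL x0 nu x t xi eta. flat_at Om r0 Cb x0 nu & 0 < t & t <= 1 & 8 * t < r0 & dist x0 x <= 4 * t & norm xi <= 1 & norm eta <= 1 -->
   abs (LINT y|lborel. u y * lap (%y. radial2 (kerk TYPE('a)) xi eta ((x - y) /\<^sub>R t)
    - radial2 (kerk TYPE('a)) (mirror nu xi) (mirror nu eta) ((x0 + mirror nu (x - x0) - y) /\<^sub>R t)) y) <= C * t^DIM('a)"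
proof -
 obtain Ce where Ce: "Ce > 0" and cut: "!!s. s > 0 ==>
  (EX eta. is_cutoff Om Ce s eta)"
  by (rule cutoff, rule that)
 define N where "N = real DIM('a)"
 define K where "K = ker_bd TYPE('a)"
 have K: "K >= 0" unfolding K_def by (rule KA0)
 have N: "N >= 0" by (simp add: N_def)
 define K' where "K' = (1 + 2^(DIM('a) + 2)) * K"
 have K': "K' >= 0" using K by (simp add: K'_def)
 \<comment> \<open>In the strip, 64 Cb comes from the quadratic bound at frontier points within 8t
   of x0, and 2 from the strip width 2 t^2.\<close>
 define C1 where "C1 = 64 * Cb + 2"
 \<comment> \<open>The summands belong to the three terms of the product rule for the Laplacian of
   the cut-off difference. Each is O(t^-3) on the strip: the Laplacian of the cut-off costs t^-4 but
   meets the kernel difference of order t, the mixed term is t^-2 times t^-1, and the last term is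
   O(t^-2) with t <= 1.\<close>
 define C4 where "C4 = Ce * (2 * N * K * C1) + 4 * N * Ce * K + 2 * K'"
 have C4: "C4 >= 0" using Ce K K' N Cb_pos by (simp add: C4_def C1_def)
 define C where "C = M * (2 * K) * unit_vol TYPE('a) * 6^DIM('a) + 2 * B * C4 * (Cb * 2 * 6^(DIM('a) - 1))"
 have C: "C >= 0" unfolding C_def using M0 K B0 C4 Cb_pos by simp
 have main: "abs (LINT y|lborel. u y * lap (%y. radial2 (kerk TYPE('a)) xi eta ((x - y) /\<^sub>R t)
    - radial2 (kerk TYPE('a)) (mirror nu xi) (mirror nu eta) ((x0 + mirror nu (x - x0) - y) /\<^sub>R t)) y) <= C * t^DIM('a)"
  if fl: "flat_at Om r0 Cb x0 nu" and t: "0 < t" "t <= 1" "8 * t < r0" and d: "dist x0 x <= 4 * t" and xi: "norm xi <= 1" and eta: "norm eta <= 1" for x0 nu x t xi eta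
 proof -
  have x0: "x0 : frontier Om" and nu: "norm nu = 1" and flat: "!!y. y : frontier Om ==> dist x0 y < r0 ==> abs (nu \<bullet> (y - x0)) <= Cb * (dist x0 y)^2"
   using fl by (auto simp: flat_at_def)
  define xi' where "xi' = mirror nu xi" define eta' where "eta' = mirror nu eta"
  have xi': "norm xi' <= 1" and eta': "norm eta' <= 1" using xi eta by (simp_all add: xi'_def eta'_def mirror[OF nu])
  define x' where "x' = x0 + mirror nu (x - x0)"
  define b where "b = radial2 (kerk TYPE('a)) xi eta" define b' where "b' = radial2 (kerk TYPE('a)) xi' eta'"
  have ub: "unit_kernel b" "unit_kernel b'" unfolding b_def b'_def by (rule uk_k)+
  define Bf where "Bf y = b ((x - y) /\<^sub>R t) - b' ((x' - y) /\<^sub>R t)" for y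
  note f1 = scaled_kernel_facts[OF ub(1) t(1), where x=x] note f2 = scaled_kernel_facts[OF ub(2) t(1), where x=x']
  have sB: "smooth Bf" unfolding Bf_def by (rule smooth_diff[OF f1(1) f2(1)])
  have pB: "abs (partial i Bf y) <= 2 * K/t" if i: "i : Basis" for i y
  proof -
   have "partial i Bf y = (partial i b' ((x' - y) /\<^sub>R t) - partial i b ((x - y) /\<^sub>R t))/t"
    unfolding Bf_def partial_diff_smooth[OF f1(1) f2(1)] f1(2) f2(2) by (simp add: diff_divide_distrib)
   moreover have "abs (partial i b' ((x' - y) /\<^sub>R t) - partial i b ((x - y) /\<^sub>R t)) <= 2 * K"
    using ker_bdD(8)[OF xi eta i, of "(x - y) /\<^sub>R t"] ker_bdD(8)[OF xi' eta' i, of "(x' - y) /\<^sub>R t"] unfolding b_def b'_def K_def by linarith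
   ultimately show ?thesis using t(1) by (simp add: divide_right_mono)
  qed
  have lb: "abs (lap (radial2 (kerk TYPE('a)) zeta theta) z) <= K'" if "norm zeta <= 1" "norm theta <= 1" for zeta theta z :: 'a
  proof -
   have "lap (radial2 (kerk TYPE('a)) zeta theta) z = radial2 (kerP TYPE('a)) zeta theta z - 2^(DIM('a) + 2) * radial2 (kerP TYPE('a)) zeta theta (2 *\<^sub>R z)"
    using kernel_pair2[of "TYPE('a)" zeta theta] unfolding kernel_pair_def by blast
   moreover have "abs (2^(DIM('a) + 2) * radial2 (kerP TYPE('a)) zeta theta (2 *\<^sub>R z)) <= 2^(DIM('a) + 2) * K"
    unfolding abs_mult power_abs abs_numeral K_def by (intro mult_left_mono ker_bdD(6) that) auto
   ultimately show ?thesis using ker_bdD(6)[OF that, of z] unfolding K'_def K_def distrib_right by linarith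
  qed
  have lB: "abs (lap Bf y) <= 2 * K'/t^2" for y
  proof -
   have "lap Bf y = (lap b ((x - y) /\<^sub>R t) - lap b' ((x' - y) /\<^sub>R t))/t^2"
    unfolding Bf_def lap_diff[OF f1(1) f2(1)] lap_scaled_kernel[OF ub(1)] lap_scaled_kernel[OF ub(2)] by (simp add: diff_divide_distrib)
   moreover have "abs (lap b ((x - y) /\<^sub>R t) - lap b' ((x' - y) /\<^sub>R t)) <= 2 * K'"
    using lb[OF xi eta, of "(x - y) /\<^sub>R t"] lb[OF xi' eta', of "(x' - y) /\<^sub>R t"] unfolding b_def b'_def by linarith
   ultimately show ?thesis by (simp add: divide_right_mono)
  qed
  have B2: "abs (Bf y) <= 2 * K" for y
   using ker_bdD(7)[OF xi eta, of "(x - y) /\<^sub>R t"] ker_bdD(7)[OF xi' eta', of "(x' - y) /\<^sub>R t"] unfolding Bf_def b_def b'_def K_def by linarith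
  define S where "S = cball x t \<union> cball x' t"
  have cS: "closed S" unfolding S_def by (intro closed_Un closed_cball)
  have BS: "Bf y = 0" if "y ~: S" for y using f1(3)[of y] f2(3)[of y] that by (simp add: S_def Bf_def)
  have x'x0: "dist x0 x' = dist x0 x" using mirror(2)[OF nu, of "x - x0"] by (simp add: x'_def dist_norm norm_minus_commute)
  have Sb: "y : ball x0 (6 * t)" if "y : S" for y
   using that d t(1) x'x0 dist_triangle[of x0 y x] dist_triangle[of x0 y x'] by (auto simp: S_def)
  have mir: "abs (Bf y) <= 2 * N * K * abs (nu \<bullet> (y - x0))/t" for y
  proof -
   define y' where "y' = x0 + mirror nu (y - x0)"
   have "x - y' = (x - x0) - mirror nu (y - x0)" by (simp add: y'_def)
   then have "mirror nu (x - y') = mirror nu (x - x0) - (y - x0)" by (simp only: mirror(4)[OF nu] mirror(3)[OF nu])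
   then have xy: "x' - y = mirror nu (x - y')" by (simp add: x'_def)
   have "b' ((x' - y) /\<^sub>R t) = b ((x - y') /\<^sub>R t)"
    unfolding b_def b'_def xi'_def eta'_def xy mirror(5)[OF nu, symmetric] radial2_mirror[OF nu] ..
   then have "abs (Bf y) = abs (b ((x - y) /\<^sub>R t) - b ((x - y') /\<^sub>R t))" by (simp add: Bf_def)
   also have "... <= DIM('a) * K * norm ((x - y) /\<^sub>R t - (x - y') /\<^sub>R t)"
    by (rule Ck1_abs_diff_le[OF smooth_differentiable[OF unit_kernelD(1)[OF ub(1)]] convex_UNIV UNIV_I UNIV_I])
      (use ker_bdD(8)[OF xi eta] in \<open>simp add: b_def K_def\<close>)
   also have "(x - y) /\<^sub>R t - (x - y') /\<^sub>R t = (y' - y) /\<^sub>R t" by (simp add: scaleR_diff_right[symmetric])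
   also have "norm ((y' - y) /\<^sub>R t) = 2 * abs (nu \<bullet> (y - x0))/t"

   proof -
    have "y' - y = - ((y - x0) - mirror nu (y - x0))" by (simp add: y'_def)
    then have "norm (y' - y) = 2 * abs (nu \<bullet> (y - x0))" by (simp only: norm_minus_cancel mirror(6)[OF nu])
    then show ?thesis using t(1) by (simp add: divide_inverse)
   qed
   finally show ?thesis by (simp add: N_def mult_ac)
  qed
  define s where "s = t^2"
  have s: "s > 0" "s <= t" using t by (auto simp: s_def power2_eq_square mult_left_le)
  define T where "T = {y : Om \<inter> ball x0 (6 * t). bdist Om y <= 2 * s}"
  have BT: "abs (Bf y) <= 2 * N * K * C1 * t" if y: "y : T" for y
  proof -
   have y1: "y : Om" "dist x0 y < 6 * t" "bdist Om y <= 2 * s" using y by (auto simp: T_def)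
   obtain y' where y': "y' : frontier Om" "bdist Om y = dist y y'" by (rule bdist_attained[OF open_Om bounded_Om y1(1)])
   have d': "dist x0 y' <= 8 * t" using dist_triangle[of x0 y' y] y1 y'(2) s by linarith
   have "abs (nu \<bullet> (y' - x0)) <= Cb * (dist x0 y')^2" using d' t by (intro flat y') auto
   also have "... <= Cb * (8 * t)^2" using d' Cb_pos by (intro mult_left_mono power_mono) auto
   finally have "abs (nu \<bullet> (y' - x0)) <= 64 * Cb * s" by (simp add: s_def power_mult_distrib)
   moreover have "abs (nu \<bullet> (y - y')) <= 2 * s" using Cauchy_Schwarz_ineq2[of nu "y - y'"] nu y'(2) y1(3) by (simp add: dist_norm)
   moreover have "nu \<bullet> (y - x0) = nu \<bullet> (y' - x0) + nu \<bullet> (y - y')" by (simp add: inner_diff_right)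
   ultimately have "abs (nu \<bullet> (y - x0)) <= C1 * s" unfolding C1_def distrib_right by linarith
   then have "2 * N * K * abs (nu \<bullet> (y - x0))/t <= 2 * N * K * (C1 * s)/t" using N K t by (intro divide_right_mono mult_left_mono) auto
   also have "... = 2 * N * K * C1 * t" using t by (simp add: s_def power2_eq_square)
   finally show ?thesis using mir[of y] by linarith
  qed
  obtain e where e: "test_function Om e" "!!y. 0 <= e y & e y <= 1" "!!y. bdist Om y >= 2 * s ==> e y = 1"
   "!!i y. i : Basis ==> abs (partial i e y) <= Ce/s" "!!y. abs (lap e y) <= Ce/s^2" using cut[OF s(1)] by blast
  obtain Ke where Ke: "smooth e" "compact Ke" "Ke <= Om" "!!x. x ~: Ke ==> e x = 0" using e(1) by (rule test_functionE) blast
  \<comment> \<open>The part e * Bf is an admissible test function even if the kernels reach across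
    the boundary. The remainder w meets the set where u lives only in the strip T.\<close>
  define w where "w y = (1 - e y) * Bf y" for y
  have s1: "smooth (%y. 1 - e y)" by (rule smooth_diff[OF smooth_const Ke(1)])
  have sw: "smooth w" unfolding w_def by (rule smooth_mult[OF s1 sB])
  have seB: "smooth (%y. e y * Bf y)" by (rule smooth_mult[OF Ke(1) sB])
  have teB: "test_function Om (%y. e y * Bf y)" by (rule test_functionI[OF seB Ke(2,3)]) (simp add: Ke(4))
  have cK: "compact S" unfolding S_def by (intro compact_Un compact_cball)
  have tw: "test_function UNIV w" by (rule test_functionI[OF sw cK subset_UNIV]) (simp add: w_def BS)
  have "Bf = (%y. e y * Bf y + w y)" by (auto simp: w_def algebra_simps)
  then have lapB: "lap Bf y = lap (%y. e y * Bf y) y + lap w y" for y using lap_add[OF seB sw, of y] by simp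
  have i1: "integrable lborel (%y. u y * lap (%y. e y * Bf y) y)" by (rule test_function_integrable[OF test_function_lap[OF teB] dirichlet.ub[OF dirichlet_axioms]])
  have i2: "integrable lborel (%y. u y * lap w y)" by (rule test_function_integrable[OF test_function_lap[OF tw] dirichlet.ub[OF dirichlet_axioms]])
  have "(LINT y|lborel. u y * lap Bf y) = (LINT y|lborel. u y * lap (%y. e y * Bf y) y) + (LINT y|lborel. u y * lap w y)"
   unfolding lapB distrib_left by (rule Lint_add[OF i1 i2])
  also have "(LINT y|lborel. u y * lap (%y. e y * Bf y) y) = - (LINT y|lborel. g y * (e y * Bf y))"
   using po teB by (simp add: poisson_def)
  finally have split: "(LINT y|lborel. u y * lap Bf y) = - (LINT y|lborel. g y * (e y * Bf y)) + (LINT y|lborel. u y * lap w y)" .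
  have "abs (LINT y|lborel. g y * (e y * Bf y)) <= (M * (1 * (2 * K))) * measure lborel (ball x0 (6 * t))"
  proof (rule abs_integral_le_ball)
   show "abs (g y * (e y * Bf y)) <= M * (1 * (2 * K))" for y unfolding abs_mult
    using e(2)[of y] by (intro mult_mono gM B2) (use M0 in auto)
   show "g y * (e y * Bf y) = 0" if "y ~: ball x0 (6 * t)" for y using BS[of y] Sb[of y] that by auto
  qed (use M0 K in simp)
  also have "measure lborel (ball x0 (6 * t)) = unit_vol TYPE('a) * (6 * t)^DIM('a)"
   using content_ball[of "6 * t" x0] content_ball[of 1 "0::'a"] t by simp
  finally have p1: "abs (LINT y|lborel. g y * (e y * Bf y)) <= M * (2 * K) * unit_vol TYPE('a) * 6^DIM('a) * t^DIM('a)"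
   by (simp add: power_mult_distrib mult_ac)
  have Tb: "T : sets borel"
  proof -
   have "T = Om \<inter> ball x0 (6 * t) \<inter> {y. bdist Om y <= 2 * s}" by (auto simp: T_def)
   moreover have "closed {y. bdist Om y <= 2 * s}" by (intro closed_Collect_le continuous_intros)
   ultimately show ?thesis using open_Om by auto
  qed
  \<comment> \<open>Count of orders: on the strip u is O(t^2) and the Laplacian of w is O(t^-3),
    while the strip has volume O(t^2 t^(N-1)); together this is O(t^N).\<close>
  have pw: "abs (u y * lap w y) <= (2 * B * C4 * (1/t)) * indicator T y" for y
  proof (cases "y : T")
   case False
   have "u y = 0 | lap w y = 0"
   proof (cases "y : Om & y : ball x0 (6 * t)")
    case True
    then have "2 * s < bdist Om y" using False by (auto simp: T_def)
    moreover have "open {y. 2 * s < bdist Om y}" by (intro open_Collect_less continuous_intros)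
    moreover have "w z = 0" if "z : {y. 2 * s < bdist Om y}" for z using that e(3)[of z] by (simp add: w_def)
    ultimately have "lap w y = 0"
     using lap_support[of "- {y. 2 * s < bdist Om y}" w y] by (simp add: closed_Compl)
    then show ?thesis by simp
   next
    case out: False
    then have "y ~: S | y ~: Om" using Sb by blast
    then show ?thesis using C0D(2)[OF uC] lap_support[OF cS, of w y] by (auto simp: w_def BS)
   qed
   then show ?thesis using False by auto
  next
   case True
   have "abs (u y) <= B * (2 * s)" using uB[of y] True B0 mult_left_mono[of "bdist Om y" "2 * s" B] by (auto simp: T_def)
   moreover have "abs (lap w y) <= C4/t^3"
   proof -
    have l1: "lap (%y. 1 - e y) y = - lap e y" using lap_diff[OF smooth_const Ke(1), of 1 y] by (simp add: lap_def)
    have p1: "partial i (%y. 1 - e y) y = - partial i e y" for i using partial_diff_smooth[OF smooth_const Ke(1), of i 1] by simp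
    have eq: "lap w y = - lap e y * Bf y + 2 * (\<Sum>i\<in>Basis. - partial i e y * partial i Bf y) + (1 - e y) * lap Bf y"
     unfolding w_def lap_mult[OF s1 sB] l1 p1 ..
    have a1: "abs (- lap e y * Bf y) <= (Ce/s^2) * (2 * N * K * C1 * t)" unfolding abs_mult abs_minus_cancel
     by (intro mult_mono e BT True) (use Ce in auto)
    have "abs (\<Sum>i\<in>Basis. - partial i e y * partial i Bf y) <= (\<Sum>i\<in>(Basis::'a set). (Ce/s) * (2 * K/t))"
     unfolding mult_minus_left by (intro order_trans[OF sum_abs] sum_mono, unfold abs_mult abs_minus_cancel, intro mult_mono e pB)
       (use Ce s in auto)
    then have a2: "abs (2 * (\<Sum>i\<in>Basis. - partial i e y * partial i Bf y)) <= 2 * (N * ((Ce/s) * (2 * K/t)))" by (simp add: N_def)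
    have a3: "abs ((1 - e y) * lap Bf y) <= 1 * (2 * K'/t^2)" unfolding abs_mult using e(2)[of y] by (intro mult_mono lB) auto
    have "abs (lap w y) <= (Ce/s^2) * (2 * N * K * C1 * t) + 2 * (N * ((Ce/s) * (2 * K/t))) + 2 * K'/t^2"
     unfolding eq using a1 a2 a3 by linarith
    also have "(Ce/s^2) * (2 * N * K * C1 * t) = Ce * (2 * N * K * C1)/t^3"
     using t(1) by (simp add: s_def eval_nat_numeral field_simps)
    also have "2 * (N * ((Ce/s) * (2 * K/t))) = 4 * N * Ce * K/t^3" using t(1) by (simp add: s_def eval_nat_numeral field_simps)
    also have "2 * K'/t^2 <= 2 * K'/t^3"
     using t K' by (intro divide_left_mono) (auto simp: power_decreasing)
    finally show ?thesis by (simp add: C4_def add_divide_distrib)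
   qed
   ultimately have "abs (u y * lap w y) <= (B * (2 * s)) * (C4/t^3)" unfolding abs_mult by (intro mult_mono) (use B0 s in auto)
   also have "... = 2 * B * C4 * (1/t)" using t(1) by (simp add: s_def eval_nat_numeral field_simps)
   finally show ?thesis using True by simp
  qed
  have bT: "emeasure lborel T < \<infinity>" by (rule emeasure_bounded_finite[OF bounded_subset[OF bounded_ball[of x0 "6 * t"]]]) (auto simp: T_def)
  have "abs (LINT y|lborel. u y * lap w y) <= (LINT y|lborel. abs (u y * lap w y))"
   using integral_norm_bound[of lborel "%y. u y * lap w y"] by simp
  also have "... <= (LINT y|lborel. (2 * B * C4 * (1/t)) * indicator T y)"
   by (intro integral_mono integrable_abs i2 pw integrable_mult_right integrable_real_indicator) (use Tb bT in auto)
  also have "... = (2 * B * C4 * (1/t)) * measure lborel T" by simp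
  also have "... <= (2 * B * C4 * (1/t)) * (Cb * (2 * s) * (6 * t)^(DIM('a) - 1))"
  proof (intro mult_left_mono)
   show "measure lborel T <= Cb * (2 * s) * (6 * t)^(DIM('a) - 1)"
   proof -
    have "ALL r s. 0 < s & s <= r & r <= r0 -->
     measure lborel {y : Om \<inter> ball x0 r. bdist Om y <= s} <= Cb * s * r^(DIM('a) - 1)"
     using bconst[OF x0] unfolding boundary_const_def by blast
    from spec[OF spec[OF this, of "6 * t"], of "2 * s"] show ?thesis using s t unfolding T_def by simp
   qed
  qed (use B0 C4 t in auto)
  also have "... = 2 * B * C4 * (Cb * 2 * 6^(DIM('a) - 1)) * t^DIM('a)"
  proof -
   have "t^DIM('a) = t * t^(DIM('a) - 1)" by (metis DIM_positive Suc_diff_1 power_Suc)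
   then show ?thesis using t(1) by (simp add: s_def power_mult_distrib power2_eq_square)
  qed
  finally have p2: "abs (LINT y|lborel. u y * lap w y) <= 2 * B * C4 * (Cb * 2 * 6^(DIM('a) - 1)) * t^DIM('a)" .
  have "abs (LINT y|lborel. u y * lap Bf y) <= C * t^DIM('a)" unfolding split C_def distrib_right using p1 p2 by linarith
  then show ?thesis unfolding Bf_def b_def b'_def xi'_def eta'_def x'_def .
 qed
 then show ?thesis using C by blast
qed

end

lemma (in domain) least_level:
 assumes "x : Om" obtains k where "1/2^k < bdist Om x" "!!j. j < k ==> bdist Om x <= 1/2^j"
proof (rule that[of "LEAST k. 1/2^k < bdist Om x"])
 have "EX k. 1/2^k < bdist Om x" using level_exists[OF assms] by metis
 then show "1/2^(LEAST k. 1/2^k < bdist Om x) < bdist Om x" by (rule LeastI_ex)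
 show "bdist Om x <= 1/2^j" if "j < (LEAST k. 1/2^k < bdist Om x)" for j
  using not_less_Least[OF that] by simp
qed

text \<open>The ball around x of radius \<open>bdist Om x\<close> lies in \<open>Om\<close> and the
  exterior ball does not meet it, so their centres are at least the sum of the radii apart. As both
  balls touch x0, the triangle inequality is an equality and the two radii are aligned.\<close>

lemma (in domain) touching_balls:
 assumes x: "x : Om" and x0: "x0 : frontier Om" "bdist Om x = dist x x0"
  and nu: "norm nu = 1" "ball (x0 - delta *\<^sub>R nu) delta \<inter> Om = {}"
 shows "x - x0 = bdist Om x *\<^sub>R nu"
proof -
 define d where "d = bdist Om x"
 define a where "a = x - x0"
 have d: "d > 0" unfolding d_def by (rule bdist_pos[OF open_Om bounded_Om x])
 have na: "norm a = d" using x0(2) by (simp add: a_def d_def dist_norm)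
 have nb: "norm (delta *\<^sub>R nu) = delta" using nu(1) delta(1) by simp
 have "norm (a + delta *\<^sub>R nu) >= d + delta"
 proof (rule ccontr)
  assume lt: "~ ?thesis"
  define v where "v = a + delta *\<^sub>R nu"
  define z where "z = x - (d/(d + delta)) *\<^sub>R v"
  have p: "d + delta > 0" "norm v < d + delta" using d delta(1) lt by (auto simp: v_def)
  have "norm ((d/(d + delta)) *\<^sub>R v) = d/(d + delta) * norm v" using d p by simp
  also have "... < d/(d + delta) * (d + delta)" using d p by (intro mult_strict_left_mono) auto
  finally have "z : ball x d" using p by (simp add: z_def dist_norm)
  then have zO: "z : Om" using ball_bdist_subset[where t=d and U=Om and x=x] by (auto simp: d_def)
  have c1: "d/(d + delta) = 1 - delta/(d + delta)" using p(1) by (simp add: field_simps)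
  have "z - (x0 - delta *\<^sub>R nu) = v - (d/(d + delta)) *\<^sub>R v" by (simp add: z_def v_def a_def)
  also have "... = (delta/(d + delta)) *\<^sub>R v" unfolding c1 by (simp add: scaleR_diff_left)
  finally have "norm (z - (x0 - delta *\<^sub>R nu)) = delta/(d + delta) * norm v" using delta(1) p by simp
  also have "... < delta/(d + delta) * (d + delta)" using delta(1) p by (intro mult_strict_left_mono) auto
  finally have "z : ball (x0 - delta *\<^sub>R nu) delta" using p by (simp add: dist_norm norm_minus_commute)
  then show False using zO nu(2) by blast
 qed
 then have "norm (a + delta *\<^sub>R nu) = norm a + norm (delta *\<^sub>R nu)" using norm_triangle_ineq[of a "delta *\<^sub>R nu"] na nb by simp
 then have "norm a *\<^sub>R (delta *\<^sub>R nu) = norm (delta *\<^sub>R nu) *\<^sub>R a" by (simp only: norm_triangle_eq)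
 then have "delta *\<^sub>R (d *\<^sub>R nu) = delta *\<^sub>R a" unfolding na nb by (simp add: mult.commute)
 then have "d *\<^sub>R nu = a" by (rule scaleR_left_imp_eq[rotated]) (use delta(1) in simp)
 then show ?thesis by (simp add: a_def d_def)
qed

lemma four_power: "(2::real)^(n * 2) = 4^n"
 by (simp add: mult.commute[of n] power_mult)

section \<open>Second derivatives at the scale of the boundary distance\<close>

context dirichlet
begin

abbreviation hk :: "'a => 'a => 'a => real" where "hk i j \<equiv> radial2 (kerP TYPE('a)) i j"

definition usup :: real where "usup = ker_bd TYPE('a) * (B * dmax) * unit_vol TYPE('a)"

lemma usup0: "usup >= 0" unfolding usup_def using KA0 B0 dmax(1) by simp

lemma Sop_usup: "norm i <= 1 ==> norm j <= 1 ==> abs (Sop (1/2^n) (hk i j) u x) <= usup"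
 unfolding usup_def by (rule Sop_bound[OF uk_P(3) ker_bdD(6) uM _ pos2]) (use B0 dmax in auto)

text \<open>At scales above the boundary distance, the average of u at x is compared with the
  mirrored average at the mirror point. The normalised difference changes by at most a constant per
  dyadic step, so after the roughly k steps from a fixed scale down to the boundary distance it is
  O(k). At the last scale the mirrored average vanishes, and the bound remains for u alone.\<close>

lemma hess_level:
 "EX C>=0. ALL x:Om. EX k. 1/2^k < bdist Om x & bdist Om x <= C/2^k & (ALL i j. norm i <= 1 & norm j <= 1 --> abs (sq 2 (hk i j) k x) <= C * (1 + real k))"
proof -
 obtain C1 where C1: "C1 >= 0" and mk: "!!x0 nu x t xi eta. flat_at Om r0 Cb x0 nu & 0 < t & t <= 1 & 8 * t < r0 & dist x0 x <= 4 * t & norm xi <= 1 & norm eta <= 1 ==>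
   abs (LINT y|lborel. u y * lap (%y. radial2 (kerk TYPE('a)) xi eta ((x - y) /\<^sub>R t)
    - radial2 (kerk TYPE('a)) (mirror nu xi) (mirror nu eta) ((x0 + mirror nu (x - x0) - y) /\<^sub>R t)) y) <= C1 * t^DIM('a)"
  using mirror_kernel_bound by (elim exE conjE) blast
 \<comment> \<open>The first entry keeps all scales within the reach of the boundary constants. The
   second gives Cb (3 d/2)^2 < d/2 for d < epsilon, which places the mirrored ball outside the
   domain.\<close>
 define epsilon where "epsilon = min (r0/8) (2/(9 * Cb))"
 have epsilon: "epsilon > 0" using r0_pos Cb_pos by (simp add: epsilon_def)
 obtain n0 where n0: "1/2^n0 < epsilon" using real_arch_pow_inv[OF epsilon, of "1/2"] by (auto simp: power_divide)
 define C where "C = 2 * (2 + dmax) + 4^(n0 + 1) * usup + (2 * 4^n0 * usup + C1)"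
 have C: "C >= 0" "4^(n0 + 1) * usup <= C" "2 * 4^n0 * usup + C1 <= C" "2 * (2 + dmax) <= C"
  unfolding C_def using dmax(1) usup0 C1 by auto
 have main: "EX k. 1/2^k < bdist Om x & bdist Om x <= C/2^k & (ALL i j. norm i <= 1 & norm j <= 1 --> abs (sq 2 (hk i j) k x) <= C * (1 + real k))"
  if x: "x : Om" for x
 proof -
  define d where "d = bdist Om x"
  obtain k where k: "1/2^k < d" "!!j. j < k ==> d <= 1/2^j" unfolding d_def using least_level[OF x] by metis
  \<comment> \<open>The scale finally used is \<open>Suc k\<close> and not k: its radius is at most
    d/2, half the depth of the mirror point behind the tangent plane.\<close>
  have t2: "1/2^Suc k <= d/2" using k(1) by (simp add: field_simps)
  have dpos: "d > 0" unfolding d_def by (rule bdist_pos[OF open_Om bounded_Om x])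
  have dk: "d <= (2 + dmax)/2^k"
  proof (cases k)
   case 0 then show ?thesis using dmax(2)[of x] by (simp add: d_def)
  next
   case (Suc j)
   then have "d <= 2/2^k" using k(2)[of j] by simp
   also have "... <= (2 + dmax)/2^k" using dmax(1) by (intro divide_right_mono) auto
   finally show ?thesis .
  qed
  have "d <= 2 * (2 + dmax)/2^Suc k" using dk by (simp only: power_Suc mult_divide_mult_cancel_left[OF zero_neq_numeral[symmetric]])
  also have "... <= C/2^Suc k" using C(4) by (intro divide_right_mono) auto
  finally have dC: "d <= C/2^Suc k" .
  have bound: "abs (sq 2 (hk i j) (Suc k) x) <= C * (1 + real (Suc k))" if i: "norm i <= 1" and j: "norm j <= 1" for i j
  proof (cases "k <= n0")
   case True
   have "abs (sq 2 (hk i j) (Suc k) x) = 4^Suc k * abs (Sop (1/2^Suc k) (hk i j) u x)"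
    by (simp add: sq_def abs_mult four_power)
   also have "... <= 4^(n0 + 1) * usup"
    using True by (intro mult_mono Sop_usup i j power_increasing) auto
   also have "... <= C * 1" using C(2) by simp
   also have "... <= C * (1 + real (Suc k))" using C(1) by (intro mult_left_mono) auto
   finally show ?thesis .
  next
   case False
   then have nk: "n0 < k" by simp
   obtain x0 where x0: "x0 : frontier Om" "d = dist x x0" unfolding d_def by (rule bdist_attained[OF open_Om bounded_Om x])
   obtain nu where nu: "norm nu = 1" "ball (x0 - delta *\<^sub>R nu) delta \<inter> Om = {}"
    "!!y. y : frontier Om ==> dist x0 y < r0 ==> abs (nu \<bullet> (y - x0)) <= Cb * (dist x0 y)^2"
    "!!y. dist x0 y < r0 ==> nu \<bullet> (y - x0) < - Cb * (dist x0 y)^2 ==> y ~: Om"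
    using exterior_balls[OF bconst[OF x0(1)] x0(1) delta(1,2,3) Cb_pos] by metis
   have fl: "flat_at Om r0 Cb x0 nu" unfolding flat_at_def using x0 nu by blast
   have tb: "x - x0 = d *\<^sub>R nu" using touching_balls[OF x x0(1) _ nu(1,2)] x0(2) unfolding d_def by simp
   have depsilon: "d < epsilon" using k(2)[OF nk] n0 by linarith
   have dr: "8 * d < r0" and dC': "9 * Cb * d < 2"
   proof -
    have "d < r0/8" "d < 2/(9 * Cb)" using depsilon by (auto simp: epsilon_def)
    then show "8 * d < r0" "9 * Cb * d < 2" using Cb_pos by (auto simp: field_simps)
   qed
   define x' where "x' = x0 + mirror nu (x - x0)"
   have nn: "nu \<bullet> nu = 1" using nu(1) by (simp add: power2_norm_eq_inner[symmetric])
   have x'e: "x' = x0 - d *\<^sub>R nu" unfolding x'_def tb mirror_def by (simp add: nn algebra_simps) (simp add: scaleR_add_left[symmetric])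
   define i' where "i' = mirror nu i" define j' where "j' = mirror nu j"
   have i': "norm i' <= 1" and j': "norm j' <= 1" using i j by (simp_all add: i'_def j'_def mirror(2)[OF nu(1)])
   \<comment> \<open>The factor 4^n normalises the averages as second derivatives, so that the
     estimate for the mirrored kernels becomes a bounded change from one n to the next.\<close>
   define Z where "Z n = 4^n * (Sop (1/2^n) (hk i j) u x - Sop (1/2^n) (hk i' j') u x')" for n
   have Zstep: "abs (Z (Suc n)) <= abs (Z n) + C1" if n: "n0 <= n" "n <= k" for n
   proof -
    define t where "t = 1/(2::real)^n"
    have t: "t > 0" "t <= 1" by (auto simp: t_def)
    have tn0: "t <= 1/2^n0" unfolding t_def using n(1) by (simp add: frac_le power_increasing)
    have "8 * t < r0" using tn0 n0 by (simp add: epsilon_def)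
    moreover have "dist x0 x <= 4 * t"
    proof -
     obtain m where m: "k = Suc m" using nk by (cases k) auto
     have "d <= 2/2^k" using k(2)[of m] m by simp
     also have "... <= 2/2^n" using n(2) by (simp add: frac_le power_increasing)
     finally have "dist x0 x <= 2 * t" using x0(2) by (simp add: dist_commute t_def)
     then show ?thesis using t by linarith
    qed
    ultimately have le: "abs (LINT y|lborel. u y * lap (%y. radial2 (kerk TYPE('a)) i j ((x - y) /\<^sub>R t)
     - radial2 (kerk TYPE('a)) i' j' ((x' - y) /\<^sub>R t)) y) <= C1 * t^DIM('a)"
     unfolding i'_def j'_def x'_def by (intro mk conjI fl t i j)
    note f1 = scaled_kernel_facts(1)[OF uk_k(3) t(1)]
    have tl: "integrable lborel (%y. u y * lap (%y. radial2 (kerk TYPE('a)) xi eta ((w - y) /\<^sub>R t)) y)" for xi eta w :: 'a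
     by (rule test_function_integrable[OF test_function_lap[OF test_function_scaled_kernel[OF uk_k(3) t(1) subset_UNIV]] ub])
    have "(LINT y|lborel. u y * lap (%y. radial2 (kerk TYPE('a)) i j ((x - y) /\<^sub>R t) - radial2 (kerk TYPE('a)) i' j' ((x' - y) /\<^sub>R t)) y)
     = t^DIM('a)/t^2 * (Sop t (hk i j) u x - 2^2 * Sop (t/2) (hk i j) u x) - t^DIM('a)/t^2 * (Sop t (hk i' j') u x' - 2^2 * Sop (t/2) (hk i' j') u x')"
     unfolding lap_diff[OF f1 f1] right_diff_distrib Lint_diff[OF tl tl]
      integral_lap_kernel[OF ub kernel_pair2 t(1)] ..
    also have "... = t^DIM('a) * (Z n - Z (Suc n))"
    proof -
     have "1/t^2 = 4^n" by (simp add: t_def power_divide power_even_eq[symmetric]) (simp add: power_mult)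
     moreover have "t/2 = 1/2^Suc n" by (simp add: t_def)
     ultimately show ?thesis unfolding Z_def t_def[symmetric] by (simp only: divide_inverse inverse_eq_divide[symmetric] mult_1) (simp add: algebra_simps)
    qed
    finally have "t^DIM('a) * abs (Z n - Z (Suc n)) <= t^DIM('a) * C1" using le t(1) by (simp add: abs_mult mult.commute)
    then have "abs (Z n - Z (Suc n)) <= C1" using t(1) by (simp only: mult_le_cancel_left_pos zero_less_power)
    then show ?thesis by linarith
   qed
   have "abs (Z (n0 + m)) <= abs (Z n0) + real m * C1" if "n0 + m <= Suc k" for m
    using that
   proof (induction m)
    case (Suc m)
    then show ?case using Zstep[of "n0 + m"] by (simp add: distrib_right)
   qed simp
   from this[of "Suc k - n0"] nk have Zk: "abs (Z (Suc k)) <= abs (Z n0) + real (Suc k - n0) * C1" by simp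
   have "abs (Z n0) <= 4^n0 * (usup + usup)" unfolding Z_def abs_mult power_abs abs_numeral
    by (intro mult_left_mono order_trans[OF abs_triangle_ineq4] add_mono Sop_usup i j i' j') auto
   then have "abs (Z (Suc k)) <= 2 * 4^n0 * usup * 1 + C1 * real (Suc k)"
    using Zk mult_left_mono[OF of_nat_mono[OF diff_le_self[of "Suc k" n0]] C1] by (simp add: mult_ac)
   also have "... <= 2 * 4^n0 * usup * (1 + real (Suc k)) + C1 * (1 + real (Suc k))"
    using usup0 C1 by (intro add_mono mult_left_mono) auto
   also have "... <= C * (1 + real (Suc k))" unfolding distrib_right[symmetric] using C(3) by (intro mult_right_mono) auto
   finally have fin: "abs (Z (Suc k)) <= C * (1 + real (Suc k))" .
   \<comment> \<open>Every point of the mirrored ball lies at least d/2 behind the tangent plane and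
     within 3 d/2 of x0. The quadratic condition excludes it from \<open>Om\<close>, and u vanishes
     there.\<close>
   have "Sop (1/2^Suc k) (hk i' j') u x' = 0"
   proof -
    have "hk i' j' z * u (x' - (1/2^Suc k) *\<^sub>R z) = 0" for z
    proof (cases "norm z < 1")
     case True
     define y where "y = x' - (1/2^Suc k) *\<^sub>R z"
     define v where "v = (1/2^Suc k) *\<^sub>R z"
     have "norm v <= (1/2^Suc k) * 1" unfolding v_def norm_scaleR using True by (intro mult_mono) auto
     then have nv: "norm v <= d/2" using t2 by simp
     have yx0: "y - x0 = - (d *\<^sub>R nu) - v" by (simp add: y_def v_def x'e)
     have "norm (y - x0) <= norm (d *\<^sub>R nu) + norm v" unfolding yx0 using norm_triangle_ineq4[of "- (d *\<^sub>R nu)" v] by simp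
     then have d1: "dist x0 y <= 3/2 * d" using nv nu(1) dpos by (simp add: dist_norm norm_minus_commute)
     have "abs (nu \<bullet> v) <= d/2" using Cauchy_Schwarz_ineq2[of nu v] nu(1) nv by simp
     moreover have "nu \<bullet> (y - x0) = - d - nu \<bullet> v" unfolding yx0 by (simp add: inner_diff_right nn)
     ultimately have l: "nu \<bullet> (y - x0) <= - (d/2)" by linarith
     have "Cb * (dist x0 y)^2 <= Cb * (3/2 * d)^2" using d1 Cb_pos by (intro mult_left_mono power_mono) auto
     also have "... = (9 * Cb * d) * (d/4)" by (simp add: power2_eq_square)
     also have "... < 2 * (d/4)" using dC' dpos by (intro mult_strict_right_mono) auto
     finally have "nu \<bullet> (y - x0) < - Cb * (dist x0 y)^2" using l by simp
     moreover have "dist x0 y < r0" using d1 dr dpos by linarith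
     ultimately have "y ~: Om" using nu(4) by blast
     then have "u y = 0" by (rule C0D(2)[OF uC])
     then show ?thesis by (simp add: y_def)
    next
     case False
     then have "hk i' j' z = 0" by (intro unit_kernelD(2)[OF uk_P(3)]) simp
     then show ?thesis by simp
    qed
    then show ?thesis unfolding Sop_def by (simp only: Bochner_Integration.integral_zero)
   qed
   then have "Z (Suc k) = sq 2 (hk i j) (Suc k) x"
    by (simp add: Z_def sq_def four_power)
   then show ?thesis using fin by simp
  qed
  show ?thesis
  proof (intro exI[of _ "Suc k"] conjI allI impI)
   show "1/2^Suc k < bdist Om x" using t2 dpos unfolding d_def by linarith
  qed (use dC bound in \<open>auto simp: d_def\<close>)
 qed
 show ?thesis by (intro exI[of _ C] conjI C ballI main)
qed

definition hess :: "'a => 'a => 'a => real" where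
 "hess i j x = (if x : Om then lim (%n. sq 2 (hk i j) n x) else 0)"

lemma hess_outside: "x ~: Om ==> hess i j x = 0"
 by (simp add: hess_def)

lemma integral_radial2:
 assumes "i : Basis" "j : Basis" shows "(LINT z|lborel. radial2 (kerk TYPE('a)) i j (z::'a)) = 0"
 unfolding radial_deriv(2)[OF deriv_seq_ker(2), symmetric]
 by (rule integral_partial_eq_0[OF smooth_Ck[OF unit_kernelD(1)[OF uk_k(2)]] assms(2) compact_cball[of 0 1] unit_kernelD(4)[OF uk_k(2)]])

text \<open>The kernels \<open>hk i i\<close> sum to the Laplacian of rho. As soon as the ball fits
  into \<open>Om\<close>, the equation tested with rho makes the trace exactly minus the mean of
  g.\<close>

lemma hess_trace: "x : Om ==> (%n. \<Sum>i\<in>Basis. sq 2 (hk i i) n x) ----> - g x"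
proof -
 assume x: "x : Om"
 obtain k where k: "1/2^k < bdist Om x" using level_exists[OF x] by metis
 have tr: "(\<Sum>i\<in>Basis. sq 2 (hk i i) n x) = - Sop (1/2^n) rho g x" if n: "n >= k" for n
 proof -
  define t where "t = 1/(2::real)^n"
  have t: "t > 0" by (simp add: t_def)
  have "t <= 1/2^k" unfolding t_def using n by (simp add: frac_le power_increasing)
  then have sub: "cball x t <= Om" using k by (intro cball_bdist_subset) simp
  have "(LINT y|lborel. u y * lap (%y. rho ((x - y) /\<^sub>R t)) y) = - (LINT y|lborel. g y * rho ((x - y) /\<^sub>R t))"
   using po test_function_scaled_kernel[OF uk_P(1) t sub] by (simp add: poisson_def)
  also have "... = - (t^DIM('a) * Sop t rho g x)" using conv_kernel_Sop[OF gb uk_P(1) t] by simp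
  also have "(LINT y|lborel. u y * lap (%y. rho ((x - y) /\<^sub>R t)) y) = (\<Sum>i\<in>Basis. (1/t^2) * (LINT y|lborel. u y * hk i i ((x - y) /\<^sub>R t)))"
  proof -
   have "u y * lap (%y. rho ((x - y) /\<^sub>R t)) y = (\<Sum>i\<in>Basis. (1/t^2) * (u y * hk i i ((x - y) /\<^sub>R t)))" for y
    unfolding lap_scaled_kernel[OF uk_P(1)] lap_def radial_deriv[OF deriv_seq_ker(1)] sum_divide_distrib sum_distrib_left by (simp add: mult.commute)
   then have "(LINT y|lborel. u y * lap (%y. rho ((x - y) /\<^sub>R t)) y) = (LINT y|lborel. (\<Sum>i\<in>Basis. (1/t^2) * (u y * hk i i ((x - y) /\<^sub>R t))))" by (simp only:)
   also have "... = (\<Sum>i\<in>Basis. LINT y|lborel. (1/t^2) * (u y * hk i i ((x - y) /\<^sub>R t)))"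
    by (rule Lint_sum) (rule integrable_mult_right[OF kernel_integrable[OF ub uk_P(3) t]])
   finally show ?thesis by (simp only: Bochner_Integration.integral_mult_right_zero)
  qed
  also have "... = (\<Sum>i\<in>Basis. (1/t^2) * (t^DIM('a) * Sop t (hk i i) u x))" unfolding conv_kernel_Sop[OF ub uk_P(3) t] ..
  also have "... = t^DIM('a) * (\<Sum>i\<in>Basis. sq 2 (hk i i) n x)"
  proof -
   have "1/t^2 = 2^(n * 2)" by (simp add: t_def power_divide power_even_eq[symmetric] mult.commute)
   then show ?thesis unfolding sum_distrib_left sq_def t_def[symmetric] by (simp only: mult.left_commute)
  qed
  finally have "t^DIM('a) * (\<Sum>i\<in>Basis. sq 2 (hk i i) n x) = t^DIM('a) * (- Sop t rho g x)" by simp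
  then show ?thesis using t unfolding t_def[symmetric] by (simp only: mult_cancel_left power_not_zero less_imp_neq[symmetric] simp_thms) 
 qed
 have "(%n. - Sop (1/2^n) rho g x) ----> - (g x * (LINT z|lborel. rho (z::'a)))"
  using LIMSEQ_realpow_zero[of "1/2 :: real"] by (intro tendsto_minus Sop_tendsto[OF rho_facts(1) gb C0_isCont[OF gC]]) (auto simp: power_divide)
 then have "(%n. - Sop (1/2^n) rho g x) ----> - g x" by (simp only: rho_facts(4) mult_1_right)
 then show ?thesis
  by (rule Lim_transform_eventually) (use tr in \<open>auto intro!: eventually_sequentiallyI[of k]\<close>)
qed

end

section \<open>Convergence of second derivatives for a Hoelder continuous right side\<close>

locale dirichlet_hoelder = dirichlet Om r0 Cb u g B M
 for Om :: "'a::euclidean_space set" and r0 Cb u g B M + 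
 fixes H beta :: real
 assumes gH: "!!x y. abs (g x - g y) <= H * dist x y powr beta" and beta: "beta > 0" and H0: "H >= 0"
begin

definition hess_err :: real where
 "hess_err = ker_bd TYPE('a) * H * unit_vol TYPE('a)/(1 - (1/2) powr beta)"

text \<open>For second derivatives the increments are averages of g without a small factor. The
  kernel has integral 0, so g may be replaced by g - g x, and Hoelder continuity makes the increment
  at level m a multiple of (1/2)^(beta m).\<close>

lemma hess_facts:
 assumes ij: "i : Basis" "j : Basis" and n: "1/2^n < bdist Om x"
 shows "(%n. sq 2 (hk i j) n x) ----> hess i j x" "abs (hess i j x - sq 2 (hk i j) n x) <= hess_err"
proof -
 let ?b = "radial2 (kerk TYPE('a)) i j"
 define q where "q = (1/2 :: real) powr beta"
 have q: "0 < q" "q < 1" using beta using powr_less_mono2[of beta "1/2 :: real" 1] by (auto simp: q_def)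
 have nij: "norm i <= 1" "norm j <= 1" using ij by auto
 have xO: "x : Om" using n bdist_outside[of x Om] pos2[of n] by (cases "x : Om") auto
 have st: "abs (sq 2 (hk i j) (Suc m) x - sq 2 (hk i j) m x) <= (ker_bd TYPE('a) * H * unit_vol TYPE('a)) * q^m" if m: "n <= m" for m
 proof -
  have "1/(2::real)^m <= 1/2^n" using m by (simp add: frac_le power_increasing)
  then have mm: "1/2^m < bdist Om x" using n by linarith
  have "(2::real)^(m * 2) * (1/4)^m = 1"
   by (simp add: mult.commute[of m] power_mult power_mult_distrib[symmetric])
  then have "sq 2 (hk i j) (Suc m) x - sq 2 (hk i j) m x = Sop (1/2^m) ?b g x" using sq_step[OF kernel_pair2[of _ i j] mm] by simp
  moreover have "abs (Sop (1/2^m) ?b g x - g x * (LINT z|lborel. ?b (z::'a))) <= ker_bd TYPE('a) * (H * (1/2^m) powr beta) * unit_vol TYPE('a)"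
  proof (rule Sop_diff_const_bound[OF uk_k(3) ker_bdD(7)[OF nij] gb _ _ pos2])
   fix y assume y: "dist x y < 1/2^m"
   have "abs (g y - g x) <= H * dist y x powr beta" by (rule gH)
   also have "... <= H * (1/2^m) powr beta" using y H0 beta by (intro mult_left_mono powr_mono2) (auto simp: dist_commute)
   finally show "abs (g y - g x) <= H * (1/2^m) powr beta" .
  qed (use H0 in simp)
  moreover have "(1/2^m :: real) powr beta = q^m"
   by (simp add: q_def powr_realpow[symmetric] powr_powr powr_divide mult.commute)
  ultimately show ?thesis unfolding integral_radial2[OF ij] by (simp add: mult_ac)
 qed
 show lim: "(%n. sq 2 (hk i j) n x) ----> hess i j x"
  using geometric_Cauchy(1)[OF st q] xO by (simp add: hess_def convergent_LIMSEQ_iff)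
 have "abs (hess i j x - sq 2 (hk i j) n x) <= (ker_bd TYPE('a) * H * unit_vol TYPE('a)) * q^n/(1 - q)"
  using geometric_Cauchy(2)[OF st q order_refl] limI[OF lim] by simp
 also have "... <= (ker_bd TYPE('a) * H * unit_vol TYPE('a)) * 1/(1 - q)"
  using q KA0 H0 by (intro divide_right_mono mult_left_mono) (auto simp: power_le_one)
 finally show "abs (hess i j x - sq 2 (hk i j) n x) <= hess_err" by (simp add: hess_err_def q_def)
qed

lemma hess_tendsto: "i : Basis ==> j : Basis ==> x : Om ==> (%n. sq 2 (hk i j) n x) ----> hess i j x"
 using hess_facts(1) level_exists by metis

lemma hess_measurable: "i : Basis ==> j : Basis ==> hess i j : borel_measurable borel"
 by (rule lim_measurable[OF sq_smooth[OF uk_P(3)] hess_tendsto hess_outside])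

lemma hess_err0: "hess_err >= 0"
 unfolding hess_err_def using KA0 H0 powr_less_mono2[of beta "1/2 :: real" 1] beta
 by (intro divide_nonneg_nonneg mult_nonneg_nonneg) auto

lemma grad_weak_partial:
 assumes ij: "i : Basis" "j : Basis" and phi: "test_function Om phi"
 shows "(LINT x|lborel. grad i x * partial j phi x) = - (LINT x|lborel. hess i j x * phi x)"
proof (rule weak_partial_limit[OF open_Om bounded_Om ij(2) sq_smooth[OF uk_P(2)] _ grad_tendsto hess_tendsto[OF ij] _ _ _ phi])
 show "sq 2 (hk i j) n = partial j (sq 1 (radial1 (kerP TYPE('a)) i) n)" for n
  unfolding sq_partial[OF uk_P(2) ij(2)] radial_deriv[OF deriv_seq_ker(1)] by (simp add: numeral_2_eq_2)
 show ni: "norm i <= 1" using ij by simp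
 have nj: "norm j <= 1" using ij by simp
 show "EX C n0. ALL n>=n0. ALL x. 1/2^k < bdist Om x --> abs (sq 1 (radial1 (kerP TYPE('a)) i) n x) <= C & abs (sq 2 (hk i j) n x) <= C" for k
 proof (intro exI[of _ "2^(k * 2) * usup + 2 * hess_err + grad_bd"] exI[of _ k] allI impI)
  fix n x assume n: "k <= n" and k: "1/2^k < bdist Om x"
  have "1/(2::real)^n <= 1/2^k" using n by (simp add: frac_le power_increasing)
  then have nn: "1/2^n < bdist Om x" using k by linarith
  \<comment> \<open>The crude bound is used only at the fixed level k; every finer level differs
    from it by at most two errors to the common limit.\<close>
  have "abs (sq 2 (hk i j) k x) <= 2^(k * 2) * usup" unfolding sq_def abs_mult power_abs abs_numeral
   by (intro mult_left_mono Sop_usup ni nj) auto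
  then have "abs (sq 2 (hk i j) n x) <= 2^(k * 2) * usup + 2 * hess_err"
   using hess_facts(2)[OF ij k] hess_facts(2)[OF ij nn] by linarith
  moreover have "abs (sq 1 (radial1 (kerP TYPE('a)) i) n x) <= grad_bd" by (rule grad_facts(2)[OF ni nn])
  moreover have "0 <= 2^(k * 2) * usup" using usup0 by simp
  ultimately show "abs (sq 1 (radial1 (kerP TYPE('a)) i) n x) <= 2^(k * 2) * usup + 2 * hess_err + grad_bd & abs (sq 2 (hk i j) n x) <= 2^(k * 2) * usup + 2 * hess_err + grad_bd"
   using grad_bd0 hess_err0 by linarith
 qed
 show "grad i : borel_measurable borel" by (rule grad_measurable[OF ni])
 show "hess i j : borel_measurable borel" by (rule hess_measurable[OF ij])
qed

lemma hess_sum: "x : Om ==> (\<Sum>i\<in>Basis. hess i i x) = - g x"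
 using LIMSEQ_unique[OF tendsto_sum[OF hess_tendsto] hess_trace] by auto

lemma hess_bound: "EX C>=0. ALL x:Om. EX k. bdist Om x <= C/2^k & (ALL i:Basis. ALL j:Basis. abs (hess i j x) <= C * (1 + real k))"
proof -
 obtain C where C: "C >= 0" and lev: "!!x. x : Om ==> EX k. 1/2^k < bdist Om x & bdist Om x <= C/2^k &
   (ALL i j. norm i <= 1 & norm j <= 1 --> abs (sq 2 (hk i j) k x) <= C * (1 + real k))"
  using hess_level by blast
 have e: "EX k. bdist Om x <= (C + hess_err)/2^k & (ALL i:Basis. ALL j:Basis. abs (hess i j x) <= (C + hess_err) * (1 + real k))" if x: "x : Om" for x
 proof -
  obtain k where k: "1/2^k < bdist Om x" "bdist Om x <= C/2^k"
   "!!i j. norm i <= 1 ==> norm j <= 1 ==> abs (sq 2 (hk i j) k x) <= C * (1 + real k)" using lev[OF x] by blast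
  show ?thesis
  proof (intro exI[of _ k] conjI ballI)
   have "C/2^k <= (C + hess_err)/2^k" using hess_err0 by (intro divide_right_mono) auto
   then show "bdist Om x <= (C + hess_err)/2^k" using k(2) by linarith
   fix i j :: 'a assume ij: "i : Basis" "j : Basis"
   have "abs (hess i j x) <= C * (1 + real k) + hess_err * 1" using hess_facts(2)[OF ij k(1)] k(3)[of i j] ij by simp
   also have "... <= C * (1 + real k) + hess_err * (1 + real k)" using hess_err0 C by (intro add_mono mult_left_mono) auto
   finally show "abs (hess i j x) <= (C + hess_err) * (1 + real k)" by (simp add: distrib_right)
  qed
 qed
 show ?thesis by (intro exI[of _ "C + hess_err"] conjI ballI e add_nonneg_nonneg C hess_err0)
qed

end

section \<open>Weak derivatives\<close>

context domain
begin

lemma open_measure: "Om : sets borel" "emeasure lborel Om < \<infinity>" "Om : lmeasurable"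
 using open_Om bounded_Om emeasure_bounded_finite by (auto simp: lmeasurable_open)

text \<open>By compactness finitely many balls of radius r0/2 cover the frontier, and for s < r0/2
  the balls of twice the radius cover the strip. A wider strip is compared with the whole
  domain.\<close>

lemma strip_measure: "EX C>=0. ALL s>0. measure lborel {x : Om. bdist Om x <= s} <= C * s"
proof -
 let ?T = "%s. {x : Om. bdist Om x <= s}" and ?r = "r0/2"
 have "compact (frontier Om)" using bounded_Om by (rule compact_frontier_bounded)
 moreover have "frontier Om <= (\<Union>x\<in>frontier Om. ball x ?r)" using r0_pos by auto
 ultimately obtain F where F: "F <= frontier Om" "finite F" "frontier Om <= (\<Union>x\<in>F. ball x ?r)"
  by (elim compactE_image) auto
 define C1 where "C1 = (\<Sum>x\<in>F. Cb * r0^(DIM('a) - 1))"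
 define C2 where "C2 = measure lborel Om / ?r"
 have C0: "C1 >= 0" "C2 >= 0" using Cb_pos r0_pos by (auto simp: C1_def C2_def intro!: sum_nonneg)
 have T: "?T s : sets borel" for s
 proof -
  have "closed {x. bdist Om x <= s}" by (intro closed_Collect_le continuous_intros)
  moreover have "?T s = Om \<inter> {x. bdist Om x <= s}" by blast
  ultimately show ?thesis using open_measure(1) by auto
 qed
 have Tb: "emeasure lborel (A \<inter> ?T s) < \<infinity>" for A s
  using emeasure_bounded_finite[OF bounded_subset[OF bounded_Om], of "A \<inter> ?T s"] by auto
 have "measure lborel (?T s) <= (C1 + C2) * s" if s: "s > 0" for s
 proof (cases "s < ?r")
  case True
  have "?T s <= (\<Union>x0\<in>F. {y : Om \<inter> ball x0 r0. bdist Om y <= s})"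
  proof
   fix x assume x: "x : ?T s"
   obtain y where y: "y : frontier Om" "bdist Om x = dist x y"
    using x by (auto intro: bdist_attained[OF open_Om bounded_Om, of x])
   obtain x0 where "x0 : F" "dist x0 y < ?r" using F(3) y(1) by auto
   moreover have "dist x0 x <= dist x0 y + dist x y" by (rule dist_triangle2)
   ultimately show "x : (\<Union>x0\<in>F. {y : Om \<inter> ball x0 r0. bdist Om y <= s})"
    using x y(2) True by (intro UN_I[of x0]) auto
  qed
  moreover have eq: "{y : Om \<inter> ball x0 r0. bdist Om y <= s} = ball x0 r0 \<inter> ?T s" for x0 by blast
  ultimately have sub: "?T s <= (\<Union>x0\<in>F. ball x0 r0 \<inter> ?T s)" by simp
  have ms: "ball x0 r0 \<inter> ?T s : fmeasurable lborel" for x0 using T Tb by (auto simp: fmeasurable_def)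
  have "measure lborel (?T s) <= measure lborel (\<Union>x0\<in>F. ball x0 r0 \<inter> ?T s)"
   using T ms F(2) by (intro measure_mono_fmeasurable[OF sub]) (auto intro!: fmeasurable.finite_UN simp del: UN_simps)
  also have "... <= (\<Sum>x0\<in>F. measure lborel (ball x0 r0 \<inter> ?T s))"
   by (intro measure_UNION_le fmeasurableD ms F(2))
  also have "... <= (\<Sum>x0\<in>F. Cb * r0^(DIM('a) - 1) * s)"
  proof (rule sum_mono)
   fix x0 assume "x0 : F"
   then have "boundary_const Om x0 r0 Cb" using F(1) bconst by blast
   then have "measure lborel {y : Om \<inter> ball x0 r0. bdist Om y <= s} <= Cb * s * r0^(DIM('a) - 1)"
    unfolding boundary_const_def using s True by auto
   then show "measure lborel (ball x0 r0 \<inter> ?T s) <= Cb * r0^(DIM('a) - 1) * s" unfolding eq by (simp add: mult_ac)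
  qed
  also have "... = C1 * s" by (simp add: C1_def)
  also have "... <= (C1 + C2) * s" using C0 s by simp
  finally show ?thesis .
 next
  case False
  have "measure lborel (?T s) <= measure lborel Om"
   using open_measure T by (intro measure_mono_fmeasurable) (auto simp: fmeasurable_def)
  also have "... = C2 * ?r" using r0_pos by (simp add: C2_def)
  also have "... <= C2 * s" using C0 False by (intro mult_left_mono) auto
  also have "... <= (C1 + C2) * s" using C0 s by simp
  finally show ?thesis .
 qed
 then show ?thesis using C0 by (intro exI[of _ "C1 + C2"]) auto
qed

text \<open>Every point x lies in some layer T k with |f x|^p <= c k. The layers have measure
  O(2^-k) and c k grows only polynomially, so the sum of c k times the measures converges. A natural
  exponent q above p makes c k a power, and D >= 1 takes care of values of f below 1.\<close>

lemma log_bounded_integrable: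
 assumes f: "f : borel_measurable borel" "!!x. x ~: Om ==> f x = 0"
  and C: "C >= 0" "!!x. x : Om ==> EX k. bdist Om x <= C/2^k & abs (f x) <= C * (1 + real k)"
  and p: "p > 0"
 shows "integrable lborel (%x. abs (f x) powr p)"
proof -
 obtain q :: nat where q: "p <= real q" using real_arch_simple by blast
 define D where "D = 1 + C"
 define T where "T k = {x : Om. bdist Om x <= D/2^k}" for k
 define c where "c k = (D * (1 + real k))^q" for k :: nat
 have D: "D >= 1" using C by (simp add: D_def)
 then have c0: "c k >= 0" for k by (simp add: c_def)
 obtain S where S: "S >= 0" "!!s. s > 0 ==> measure lborel {x : Om. bdist Om x <= s} <= S * s" using strip_measure by blast
 have T: "T k : sets borel" for k
 proof -
  have "closed {x. bdist Om x <= D/2^k}" by (intro closed_Collect_le continuous_intros)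
  moreover have "T k = Om \<inter> {x. bdist Om x <= D/2^k}" by (auto simp: T_def)
  ultimately show ?thesis using open_measure(1) by auto
 qed
 have mT: "emeasure lborel (T k) <= ennreal (S * (D/2^k))" for k
 proof -
  have "emeasure lborel (T k) = ennreal (measure lborel (T k))"
   using emeasure_bounded_finite[OF bounded_subset[OF bounded_Om], of "T k"]
   by (intro emeasure_eq_ennreal_measure) (auto simp: T_def)
  also have "... <= ennreal (S * (D/2^k))" using S(2)[of "D/2^k"] D by (intro ennreal_leI) (simp add: T_def)
  finally show ?thesis .
 qed
 have "summable (%k. real (Suc k)^q * (1/2)^k)"
 proof (rule ratio_test_convergence)
  let ?f = "%k. real (Suc k)^q * (1/2)^k"
  show "eventually (%k. 0 < ?f k) sequentially" by simp
  have "?f k / ?f (Suc k) = 2 * (real (Suc k)/real (Suc (Suc k)))^q" for k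
   by (simp add: power_divide field_simps)
  moreover have "(%k. real (Suc k)/real (Suc (Suc k))) ----> 1"
   using LIMSEQ_Suc[OF LIMSEQ_n_over_Suc_n] by simp
  then have "(%k. 2 * (real (Suc k)/real (Suc (Suc k)))^q) ----> 2 * 1^q" by (intro tendsto_intros)
  ultimately have lim: "(%k. ereal (?f k / ?f (Suc k))) ----> ereal 2" by simp
  show "1 < liminf (%k. ereal (?f k / ?f (Suc k)))"
   unfolding lim_imp_Liminf[OF trivial_limit_sequentially lim] by simp
 qed
 then have sm: "summable (%k. D^q * S * D * (real (Suc k)^q * (1/2)^k))" by (rule summable_mult)
 have pt: "ennreal (abs (f x) powr p) <= (\<Sum>k. ennreal (c k) * indicator (T k) x)" for x
 proof (cases "x : Om")
  case True
  obtain k where k: "bdist Om x <= C/2^k" "abs (f x) <= C * (1 + real k)" using C(2)[OF True] by blast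
  have "C/2^k <= D/2^k" by (intro divide_right_mono) (auto simp: D_def)
  then have xT: "x : T k" using k(1) True by (simp add: T_def)
  have le: "abs (f x) <= D * (1 + real k)" using k(2) C(1) by (simp add: D_def distrib_right)
  have D1: "D * (1 + real k) >= 1" using mult_mono[of 1 D 1 "1 + real k"] D by simp
  have "abs (f x) powr p <= c k"
  proof (cases "abs (f x) >= 1")
   case True
   then have "abs (f x) powr p <= abs (f x) powr real q" using q by (intro powr_mono) auto
   also have "... = abs (f x)^q" using True by (intro powr_realpow) auto
   also have "... <= c k" unfolding c_def using le by (intro power_mono) auto
   finally show ?thesis .
  next
   case False
   then have "abs (f x) powr p <= 1" using p by (intro powr_le1) auto
   also have "... <= c k" unfolding c_def using D1 by (rule one_le_power)
   finally show ?thesis .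
  qed
  then have "ennreal (abs (f x) powr p) <= ennreal (c k) * indicator (T k) x" using xT by (simp add: ennreal_leI)
  also have "... <= (\<Sum>k. ennreal (c k) * indicator (T k) x)"
   using sum_le_suminf[of "%k. ennreal (c k) * indicator (T k) x" "{k}"] by (simp del: sum_mult_indicator)
  finally show ?thesis .
 qed (simp add: f(2))
 have "(\<integral>\<^sup>+x. ennreal (abs (f x) powr p) \<partial>lborel) <= (\<integral>\<^sup>+x. (\<Sum>k. ennreal (c k) * indicator (T k) x) \<partial>lborel)"
  by (rule nn_integral_mono) (rule pt)
 also have "... = (\<Sum>k. ennreal (c k) * emeasure lborel (T k))"
  using T by (subst nn_integral_suminf) (auto simp: nn_integral_cmult)
 also have "... <= (\<Sum>k. ennreal (D^q * S * D * (real (Suc k)^q * (1/2)^k)))"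
 proof (rule suminf_le)
  fix k
  have "ennreal (c k) * emeasure lborel (T k) <= ennreal (c k) * ennreal (S * (D/2^k))" using mT by (intro mult_left_mono) auto
  also have "... = ennreal (D^q * S * D * (real (Suc k)^q * (1/2)^k))"
   unfolding ennreal_mult'[OF c0, symmetric] by (simp add: c_def power_mult_distrib power_divide mult_ac add.commute)
  finally show "ennreal (c k) * emeasure lborel (T k) <= ennreal (D^q * S * D * (real (Suc k)^q * (1/2)^k))" .
 qed auto
 also have "... < \<infinity>"
 proof -
  have "0 <= D^q * S * D * (real (Suc k)^q * (1/2)^k)" for k using D S(1) by (intro mult_nonneg_nonneg) auto
  then show ?thesis using suminf_ennreal2[OF _ sm] by (simp only: infinity_ennreal_def ennreal_less_top)
 qed
 finally show ?thesis using f(1) by (intro integrableI_bounded) auto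
qed

end

section \<open>Passage between Borel functions on the space and Lebesgue measure on the
  domain\<close>

lemma lebesgue_on_eq_lborel:
 fixes f :: "'a::euclidean_space => real"
 assumes f: "f : borel_measurable borel" "!!x. x ~: S ==> f x = 0" and S: "S : sets borel"
 shows "(LINT x|lebesgue_on S. f x) = (LINT x|lborel. f x)" "integrable (lebesgue_on S) f \<longleftrightarrow> integrable lborel f"
proof -
 have S': "S : sets lebesgue" using S by simp
 have e: "(%x. if x : S then f x else 0) = f" using f(2) by auto
 show "(LINT x|lebesgue_on S. f x) = (LINT x|lborel. f x)"
  using Lebesgue_Measure.integral_restrict_UNIV[OF S', of f] integral_completion[of f lborel] f(1) unfolding e by simp
 show "integrable (lebesgue_on S) f \<longleftrightarrow> integrable lborel f"
  using Lebesgue_Measure.integrable_restrict_UNIV[OF S', of f] integrable_completion[of f lborel] f(1) unfolding e by simp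
qed

lemma borel_lebesgue: "f : borel_measurable borel ==> (f :: 'a::euclidean_space => real) : borel_measurable lebesgue"
 by (rule measurable_completion) simp

lemma borel_lebesgue_on: "f : borel_measurable borel ==> (f :: 'a::euclidean_space => real) : borel_measurable (lebesgue_on S)"
 by (intro measurable_restrict_space1 borel_lebesgue)

context domain
begin

lemma open_lebesgue: "Om : sets lebesgue" using open_Om by simp

lemma locally_integrable_restrict:
 assumes li: "locally_integrable Om w" and K: "compact K" "K <= Om" and phi: "ALL x. x ~: K --> phi x = 0"
 shows "integrable lebesgue (%x. if x : K then w x else 0)"
  "(LINT x|LO. w x * phi x) = (LINT x|lebesgue. (if x : K then w x else 0) * phi x)"
  "integrable LO (%x. w x * phi x) \<longleftrightarrow> integrable lebesgue (%x. (if x : K then w x else 0) * phi x)"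
proof -
 have KS: "K : sets lebesgue" using K(1) by (simp add: borel_compact)
 show "integrable lebesgue (%x. if x : K then w x else 0)"
  unfolding Lebesgue_Measure.integrable_restrict_UNIV[OF KS] using li K by (simp add: locally_integrable_def)
 have e: "(%x. if x : Om then w x * phi x else 0) = (%x. (if x : K then w x else 0) * phi x)"
  using K(2) phi by (auto simp: fun_eq_iff)
 show "(LINT x|LO. w x * phi x) = (LINT x|lebesgue. (if x : K then w x else 0) * phi x)"
  unfolding Lebesgue_Measure.integral_restrict_UNIV[OF open_lebesgue, symmetric] e ..
 show "integrable LO (%x. w x * phi x) \<longleftrightarrow> integrable lebesgue (%x. (if x : K then w x else 0) * phi x)"
  unfolding Lebesgue_Measure.integrable_restrict_UNIV[OF open_lebesgue, symmetric] e ..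
qed

lemma locally_integrable_test:
 assumes li: "locally_integrable Om w" and phi: "test_function Om phi"
 shows "integrable LO (%x. w x * phi x)"
proof -
 obtain K where K: "smooth phi" "compact K" "K <= Om" "ALL x. x ~: K --> phi x = 0" using test_functionE[OF phi] by metis
 obtain C where C: "!!x. abs (phi x) <= C" using bdd_borelD(2)[OF test_function_borel[OF phi]] by blast
 show ?thesis
  unfolding locally_integrable_restrict(3)[where phi=phi, OF li K(2,3,4)]
  by (intro integrable_bounded_mult[OF locally_integrable_restrict(1)[where phi=phi, OF li K(2,3,4)] _ C]
    borel_lebesgue bdd_borelD(1)[OF test_function_borel[OF phi]])
qed

lemma locally_integrable_diff:
 "locally_integrable Om f ==> locally_integrable Om g ==> locally_integrable Om (%x. f x - g x)"
 unfolding locally_integrable_def by (blast intro: Bochner_Integration.integrable_diff)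

lemma integrable_locally_integrable: "integrable LO f ==> locally_integrable Om f"
 unfolding locally_integrable_def
proof (intro allI impI, elim conjE)
 fix K assume f: "integrable LO f" and K: "compact K" "K <= Om"
 have KS: "K : sets lebesgue" using K(1) by (simp add: borel_compact)
 have "(%x. if x : K then f x else 0) = (%x. (if x : Om then f x else 0) * indicator K x)"
  using K(2) by (auto simp: fun_eq_iff indicator_def)
 moreover have "integrable lebesgue (%x. (if x : Om then f x else 0) * indicator K x)"
  using f KS unfolding Lebesgue_Measure.integrable_restrict_UNIV[OF open_lebesgue, symmetric]
  by (intro integrable_bounded_mult[where C=1]) (auto simp: indicator_def)
 ultimately show "integrable (lebesgue_on K) f" unfolding Lebesgue_Measure.integrable_restrict_UNIV[OF KS, symmetric] by simp
qed

text \<open>Testing with mollified continuous functions, then with a sequence of continuous functions that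
 converges almost everywhere to the sign of \<open>w\<close>.\<close>

lemma fundamental_lemma:
 assumes li: "locally_integrable Om w" and z: "!!phi. test_function Om phi ==> (LINT x|LO. w x * phi x) = 0"
 shows "AE x in LO. w x = 0"
proof -
 \<comment> \<open>As w is only locally integrable, it is first restricted to the support of a
   cut-off function that is 1 where the boundary distance is at least 2/2^k. Countably many k
   exhaust \<open>Om\<close>.\<close>
 have loc: "AE x in lebesgue. 2 * (1/2^k) <= bdist Om x --> w x = 0" for k :: nat
 proof -
  obtain eta where eta: "test_function Om eta" "!!y. 0 <= eta y & eta y <= 1" "!!y. 2 * (1/2^k) <= bdist Om y ==> eta y = 1"
  proof (rule cutoff)
   fix C assume "!!s. s > 0 ==> (EX eta. is_cutoff Om C s eta)"
   from this[of "1/2^k"] show thesis using that by auto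
  qed
  obtain K where K: "smooth eta" "compact K" "K <= Om" "!!x. x ~: K ==> eta x = 0" using test_functionE[OF eta(1)] by metis
  define W where "W x = (if x : K then w x else 0)" for x
  note rs = locally_integrable_restrict[OF li K(2,3), folded W_def]
  have W: "integrable lebesgue W" using rs(1)[of "%_. 0"] unfolding W_def by simp
  have etam: "eta : borel_measurable lebesgue" by (rule borel_lebesgue[OF bdd_borelD(1)[OF test_function_borel[OF eta(1)]]])
  have step1: "(LINT x|lebesgue. W x * (eta x * g x)) = 0" if g: "continuous_on UNIV g" "!!x. abs (g x) <= 1" for g
  proof -
   have gb: "bdd_borel g" using g by (intro bdd_borelI borel_measurable_continuous_onI)
   define G where "G n = Sop (1/2^n) rho g" for n :: nat
   have p2: "(0::real) < 1/2^n" for n :: nat by simp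
   have Gs: "smooth (G n)" for n unfolding G_def by (rule Sop_smooth[OF gb rho_facts(1) p2])
   define C where "C = ker_bd TYPE('a) * 1 * unit_vol TYPE('a)"
   have GC: "abs (G n x) <= C" for n x unfolding G_def C_def
    by (rule Sop_bound[OF rho_facts(1) ker_bdD(2)[of 0 0] g(2) _ p2]) auto
   have "(LINT x|lebesgue. W x * (eta x * G n x)) = 0" for n
   proof -
    have "test_function Om (%x. eta x * G n x)" by (rule test_functionI[OF smooth_mult[OF K(1) Gs] K(2,3)]) (simp add: K(4))
    from z[OF this] show ?thesis using rs(2)[of "%x. eta x * G n x"] K(4) by simp
   qed
   moreover have "(%n. LINT x|lebesgue. W x * (eta x * G n x)) ----> (LINT x|lebesgue. W x * (eta x * g x))"
   proof (rule integral_dominated_convergence[where w="%x. C * abs (W x)"])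
    show "integrable lebesgue (%x. C * abs (W x))" using W by simp
    have "g : borel_measurable lebesgue" using bdd_borelD(1)[OF gb] by (rule borel_lebesgue)
    then show "(%x. W x * (eta x * g x)) : borel_measurable lebesgue" using W etam by simp
    have "G n : borel_measurable lebesgue" for n
     by (intro borel_lebesgue borel_measurable_continuous_onI smooth_continuous Gs)
    then show "(%x. W x * (eta x * G n x)) : borel_measurable lebesgue" for n using W etam by simp
    have "(%n. G n x) ----> g x * (LINT z|lborel. rho (z::'a))" for x unfolding G_def
     using g(1) LIMSEQ_realpow_zero[of "1/2 :: real"]
     by (intro Sop_tendsto[OF rho_facts(1) gb]) (auto simp: power_divide continuous_on_eq_continuous_at)
    then have "(%n. G n x) ----> g x" for x by (simp only: rho_facts(4) mult_1_right)
    then show "AE x in lebesgue. (%n. W x * (eta x * G n x)) ----> W x * (eta x * g x)"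
     by (intro AE_I2 tendsto_mult tendsto_const)
    have "abs (W x) * (eta x * abs (G n x)) <= abs (W x) * (1 * C)" for n x using eta(2)[of x] GC[of n x] by (intro mult_left_mono mult_mono) auto
    then show "AE x in lebesgue. norm (W x * (eta x * G n x)) <= C * abs (W x)" for n
     using eta(2) by (intro AE_I2) (simp add: abs_mult mult.commute)
   qed
   ultimately show ?thesis by (simp add: LIMSEQ_const_iff)
  qed
  have "(%x. sgn (W x)) : borel_measurable (lebesgue_on UNIV)" using W by (simp add: lebesgue_on_UNIV_eq)
  then have "(%x. sgn (W x)) measurable_on UNIV" by (subst measurable_on_iff_borel_measurable) auto
  then obtain N G where N: "negligible N" and G: "!!n. continuous_on UNIV (G n)" "!!x. x ~: N ==> (%n. G n x) ----> sgn (W x)"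
   unfolding measurable_on_def by auto
  \<comment> \<open>Truncation at -1 and 1 does not disturb the limit, a sign, and provides the
    dominating function.\<close>
  define g where "g n x = max (- 1) (min 1 (G n x))" for n :: nat and x
  have g1: "continuous_on UNIV (g n)" for n unfolding g_def using G(1) by (intro continuous_intros)
  have g2: "abs (g n x) <= 1" for n x by (auto simp: g_def)
  have g3: "(%n. g n x) ----> sgn (W x)" if "x ~: N" for x
  proof -
   have "(%n. g n x) ----> max (- 1) (min 1 (sgn (W x)))" unfolding g_def using G(2)[OF that] by (intro tendsto_max tendsto_min tendsto_const)
   then show ?thesis by (simp add: sgn_if split: if_splits)
  qed
  have "(%n. LINT x|lebesgue. W x * (eta x * g n x)) ----> (LINT x|lebesgue. W x * (eta x * sgn (W x)))"
  proof (rule integral_dominated_convergence[where w="%x. abs (W x)"])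
   show "integrable lebesgue (%x. abs (W x))" using W by simp
   show "(%x. W x * (eta x * sgn (W x))) : borel_measurable lebesgue" using W etam by simp
   have "g n : borel_measurable lebesgue" for n by (intro borel_lebesgue borel_measurable_continuous_onI g1)
   then show "(%x. W x * (eta x * g n x)) : borel_measurable lebesgue" for n using W etam by simp
   have "AE x in lebesgue. x ~: N" using N by (intro AE_not_in) (simp add: negligible_iff_null_sets)
   then show "AE x in lebesgue. (%n. W x * (eta x * g n x)) ----> W x * (eta x * sgn (W x))"
    by eventually_elim (intro tendsto_mult tendsto_const g3)
   have "abs (W x) * (eta x * abs (g n x)) <= abs (W x) * (1 * 1)" for n x using eta(2)[of x] g2[of n x] by (intro mult_left_mono mult_mono) auto
   then show "AE x in lebesgue. norm (W x * (eta x * g n x)) <= abs (W x)" for n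
    using eta(2) by (intro AE_I2) (simp add: abs_mult)
  qed
  then have "(LINT x|lebesgue. W x * (eta x * sgn (W x))) = 0" using step1[OF g1 g2] by (simp add: LIMSEQ_const_iff)
  moreover have "W x * (eta x * sgn (W x)) = abs (W x) * eta x" for x by (simp add: sgn_if)
  ultimately have "(LINT x|lebesgue. abs (W x) * eta x) = 0" by simp
  moreover have "integrable lebesgue (%x. abs (W x) * eta x)"
   using W etam eta(2) by (intro integrable_bounded_mult[where C=1]) auto
  ultimately have "AE x in lebesgue. abs (W x) * eta x = 0"
   using eta(2) by (subst (asm) integral_nonneg_eq_0_iff_AE) auto
  then show ?thesis
  proof eventually_elim
   case (elim x)
   show ?case
   proof
    assume "2 * (1/2^k) <= bdist Om x"
    then have "eta x = 1" by (rule eta(3))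
    moreover from this have "x : K" using K(4)[of x] by auto
    ultimately show "w x = 0" using elim by (simp add: W_def)
   qed
  qed
 qed
 then have "AE x in lebesgue. ALL k. 2 * (1/2^k) <= bdist Om x --> w x = 0" unfolding AE_all_countable ..
 then have "AE x in lebesgue. x : Om --> w x = 0"
 proof eventually_elim
  case (elim x)
  show ?case
  proof
   assume "x : Om"
   then have "bdist Om x/2 > 0" using bdist_pos[OF open_Om bounded_Om] by simp
   then obtain k where "(1/2)^k < bdist Om x/2" using real_arch_pow_inv[of "bdist Om x/2" "1/2"] by auto
   then show "w x = 0" using elim[rule_format, of k] by (simp add: power_divide)
  qed
 qed
 then show ?thesis using open_lebesgue by (simp add: AE_restrict_space_iff)
qed

lemma weak_partial_unique:
 assumes g: "has_weak_partial Om i u g" and h: "has_weak_partial Om i u h"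
 shows "AE x in LO. g x = h x"
proof -
 have l: "locally_integrable Om g" "locally_integrable Om h" using g h by (auto simp: has_weak_partial_def)
 have "AE x in LO. g x - h x = 0"
 proof (rule fundamental_lemma[OF locally_integrable_diff[OF l]])
  fix phi assume phi: "test_function Om phi"
  have "(LINT x|LO. g x * phi x) = (LINT x|LO. h x * phi x)"
   using g h phi unfolding has_weak_partial_def by (metis minus_equation_iff)
  then show "(LINT x|LO. (g x - h x) * phi x) = 0"
   unfolding left_diff_distrib
   by (subst Lint_diff[OF locally_integrable_test[OF l(1) phi] locally_integrable_test[OF l(2) phi]]) simp
 qed
 then show ?thesis by simp
qed

lemma weak_partial_AE:
 assumes "has_weak_partial Om i u g"
 shows "has_weak_partial Om i u (weak_partial Om i u)" "AE x in LO. weak_partial Om i u x = g x"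
proof -
 show "has_weak_partial Om i u (weak_partial Om i u)" unfolding weak_partial_def by (rule someI[where P="has_weak_partial Om i u", OF assms])
 from weak_partial_unique[OF this assms] show "AE x in LO. weak_partial Om i u x = g x" .
qed

text \<open>The weak Laplacian differentiates the chosen representative
  \<open>weak_partial Om i u\<close>, which agrees with a known first derivative only almost
  everywhere. This transfers the second derivative to that representative.\<close>

lemma has_weak_partial_cong:
 assumes g: "has_weak_partial Om i u g" and v: "locally_integrable Om v" "AE x in LO. v x = u x" and i: "i : Basis"
 shows "has_weak_partial Om i v g"
 unfolding has_weak_partial_def
proof (intro conjI allI impI v(1))
 show "locally_integrable Om g" using g by (simp add: has_weak_partial_def)
 fix phi assume phi: "test_function Om phi"
 have l: "locally_integrable Om u" using g by (simp add: has_weak_partial_def)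
 have "(LINT x|LO. v x * partial i phi x) = (LINT x|LO. u x * partial i phi x)"
  by (rule integral_cong_AE)
   (use v(2) in \<open>auto intro!: borel_measurable_integrable locally_integrable_test l v test_function_partial phi i\<close>)
 then show "(LINT x|LO. v x * partial i phi x) = - (LINT x|LO. g x * phi x)"
  using g phi by (simp add: has_weak_partial_def)
qed

lemma weak_laplacian_AE:
 assumes G: "!!i. i : Basis ==> has_weak_partial Om i u (G i)" and H: "!!i. i : Basis ==> has_weak_partial Om i (G i) (H i)"
 shows "AE x in LO. weak_laplacian Om u x = (\<Sum>i\<in>Basis. H i x)"
proof -
 have "AE x in LO. weak_partial Om i (weak_partial Om i u) x = H i x" if i: "i : Basis" for i
 proof (rule weak_partial_AE(2)[OF has_weak_partial_cong[OF H[OF i] _ weak_partial_AE(2)[OF G[OF i]] i]])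
  show "locally_integrable Om (weak_partial Om i u)"
   using weak_partial_AE(1)[OF G[OF i]] by (simp add: has_weak_partial_def)
 qed
 then have "AE x in LO. ALL i:Basis. weak_partial Om i (weak_partial Om i u) x = H i x"
  by (simp add: AE_ball_countable countable_finite)
 then show ?thesis by eventually_elim (simp add: weak_laplacian_def)
qed

end

section \<open>Sobolev spaces\<close>

text \<open>Above epsilon the power p dominates a after the stated rescaling. On a set of finite
  measure this turns L^p convergence into L^1 convergence: the first term is small with epsilon, the
  second tends to 0 for fixed epsilon.\<close>

lemma le_powr_interpolate:
 fixes a epsilon p :: real
 assumes "epsilon > 0" "p >= 1" shows "abs a <= epsilon + epsilon powr (1 - p) * abs a powr p"
proof (cases "abs a <= epsilon")
 case False
 then have "epsilon powr (p - 1) <= abs a powr (p - 1)" using assms by (intro powr_mono2) auto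
 then have "epsilon powr (1 - p) * epsilon powr (p - 1) * abs a <= epsilon powr (1 - p) * abs a powr (p - 1) * abs a"
  by (intro mult_right_mono mult_left_mono) auto
 also have "epsilon powr (1 - p) * epsilon powr (p - 1) = 1" using assms by (simp flip: powr_add)
 also have "epsilon powr (1 - p) * abs a powr (p - 1) * abs a = epsilon powr (1 - p) * abs a powr p"
  using False assms by (simp add: powr_mult_base' mult.assoc powr_diff)
 finally show ?thesis using assms by simp
qed (simp add: add_increasing2)

lemma abs_diff_powr_le:
 fixes a b p :: real
 assumes "p > 0" shows "abs (a - b) powr p <= 2 powr p * (abs a powr p + abs b powr p)"
proof -
 have "abs (a - b) powr p <= (2 * max (abs a) (abs b)) powr p" using assms by (intro powr_mono2) auto
 also have "... = 2 powr p * max (abs a) (abs b) powr p" by (simp add: powr_mult)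
 also have "max (abs a) (abs b) powr p <= abs a powr p + abs b powr p" by (auto simp: max_def)
 finally show ?thesis by simp
qed

lemma dominated_sequence:
 fixes w :: "'a => real"
 assumes "AE x in M. (%n. f n x) ----> F x" "!!n x. abs (f n x) <= C" "integrable M w" "F : borel_measurable M" "!!n. f n : borel_measurable M"
 shows "(%n. LINT x|M. w x * f n x) ----> (LINT x|M. w x * (F x :: real))"
proof (rule integral_dominated_convergence[where w="%x. abs (w x) * C"])
 show "AE x in M. norm (w x * f n x) <= abs (w x) * C" for n
  using assms(2) by (intro AE_I2) (simp add: abs_mult mult_left_mono)
 show "AE x in M. (%n. w x * f n x) ----> w x * F x" using assms(1) by eventually_elim (intro tendsto_intros)
qed (use assms in auto)

context domain
begin

lemma finite_measure_domain: "finite_measure LO"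
 by (rule finite_measure_lebesgue_on[OF open_measure(3)])

lemma const_integrable: "integrable LO (%_. c :: real)"
 by (rule finite_measure.integrable_const[OF finite_measure_domain])

text \<open>This is completeness of Lebesgue measure. Weak derivatives are chosen representatives
  known only up to null sets, and their measurability has to be inferred in this way.\<close>

lemma AE_measurable:
 fixes f g :: "'a => real"
 assumes "f : borel_measurable LO" "AE x in LO. g x = f x"
 shows "g : borel_measurable LO"
proof -
 have "AE x in lebesgue. (if x : Om then f x else 0) = (if x : Om then g x else 0)"
  using assms(2) open_lebesgue by (simp add: AE_restrict_space_iff) (erule eventually_mono, auto)
 then show ?thesis using assms(1) unfolding borel_measurable_if[OF open_lebesgue, symmetric] by (rule borel_measurable_AE[rotated])
qed

lemma Lp_AE:
 assumes f: "f : Lp p Om" and e: "AE x in LO. g x = f x"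
 shows "g : Lp p Om" "Lp_norm p Om g = Lp_norm p Om f"
proof -
 have m: "f : borel_measurable LO" "integrable LO (%x. abs (f x) powr p)" using f by (auto simp: Lp_def)
 have mg: "g : borel_measurable LO" by (rule AE_measurable[OF m(1) e])
 have e': "AE x in LO. abs (g x) powr p = abs (f x) powr p" using e by eventually_elim simp
 have "integrable LO (%x. abs (g x) powr p)"
  using integrable_cong_AE[OF _ _ e'] m mg by simp
 then show "g : Lp p Om" using mg by (simp add: Lp_def)
 show "Lp_norm p Om g = Lp_norm p Om f" unfolding Lp_norm_def using integral_cong_AE[OF _ _ e'] m mg by simp
qed

lemma Lp_bounded:
 assumes "f : borel_measurable LO" "!!x. abs (f x) <= C" "p > 0"
 shows "f : Lp p Om"
proof -
 have "integrable LO (%x. abs (f x) powr p)"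
  using assms by (intro Bochner_Integration.integrable_bound[OF const_integrable[of "C powr p"]]) (auto intro!: powr_mono2)
 then show ?thesis using assms(1) by (simp add: Lp_def)
qed

lemma Lp_diff:
 assumes "f : Lp p Om" "g : Lp p Om" "p > 0" shows "(%x. f x - g x) : Lp p Om"
proof -
 have m: "f : borel_measurable LO" "g : borel_measurable LO"
  "integrable LO (%x. 2 powr p * (abs (f x) powr p + abs (g x) powr p))" using assms by (auto simp: Lp_def)
 have "integrable LO (%x. abs (f x - g x) powr p)"
  using m abs_diff_powr_le[OF assms(3)] by (intro Bochner_Integration.integrable_bound[OF m(3)]) auto
 then show ?thesis using m by (simp add: Lp_def)
qed

lemma Lp_integrable:
 assumes "f : Lp p Om" "p >= 1" shows "integrable LO f"
proof -
 have m: "f : borel_measurable LO" "integrable LO (%x. abs (f x) powr p)" using assms by (auto simp: Lp_def)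
 have "integrable LO (%x. 1 + abs (f x) powr p)" using m(2) const_integrable by simp
 then show ?thesis using m(1)
  by (rule Bochner_Integration.integrable_bound) (use le_powr_interpolate[of 1 p] assms(2) in \<open>auto intro!: AE_I2\<close>)
qed

lemma Lp_norm_L1:
 assumes f: "!!n. f n : Lp p Om" "p >= 1" and lim: "(%n. Lp_norm p Om (f n)) ----> 0"
 shows "(%n. LINT x|LO. abs (f n x)) ----> 0"
proof -
 define I where "I n = (LINT x|LO. abs (f n x) powr p)" for n
 have ip: "integrable LO (%x. abs (f n x) powr p)" for n using f(1)[of n] by (simp add: Lp_def)
 have I0: "I n >= 0" for n unfolding I_def by (rule Lint_nonneg) simp
 have "(%n. Lp_norm p Om (f n) powr p) ----> 0"
  using lim f(2) by (intro tendsto_zero_powrI[where b=p]) (auto simp: Lp_norm_def)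
 moreover have "Lp_norm p Om (f n) powr p = I n" for n
  using f(2) I0 by (simp add: Lp_norm_def I_def[symmetric] powr_powr)
 ultimately have I: "I ----> 0" by simp
 define m where "m = (LINT x|LO. (1::real))"
 have m0: "m >= 0" unfolding m_def by (rule Lint_nonneg) simp
 have le: "(LINT x|LO. abs (f n x)) <= epsilon * m + epsilon powr (1 - p) * I n" if "epsilon > 0" for epsilon n
 proof -
  have "(LINT x|LO. abs (f n x)) <= (LINT x|LO. epsilon * 1 + epsilon powr (1 - p) * abs (f n x) powr p)"
   using Lp_integrable[OF f(1,2)] ip const_integrable le_powr_interpolate[OF that f(2)]
   by (intro integral_mono) auto
  also have "... = epsilon * m + epsilon powr (1 - p) * I n"
   unfolding m_def I_def
   by (subst Lint_add) (use ip const_integrable in \<open>auto simp del: mult_1_right\<close>)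
  finally show ?thesis .
 qed
 show ?thesis
 proof (rule LIMSEQ_I)
  fix e :: real assume e: "e > 0"
  define epsilon where "epsilon = e/(2 * (m + 1))"
  have epsilon: "epsilon > 0" "epsilon * m <= e/2"
  proof -
   show "epsilon > 0" using e m0 by (simp add: epsilon_def)
   then have "epsilon * m <= epsilon * (m + 1)" by simp
   also have "... = e/2" using m0 by (simp add: epsilon_def field_simps)
   finally show "epsilon * m <= e/2" .
  qed
  have "(%n. epsilon powr (1 - p) * I n) ----> epsilon powr (1 - p) * 0" using I by (intro tendsto_intros)
  then have "\<forall>\<^sub>F n in sequentially. epsilon powr (1 - p) * I n < e/2" using e by (intro order_tendstoD) auto
  then obtain n0 where n0: "!!n. n >= n0 ==> epsilon powr (1 - p) * I n < e/2" unfolding eventually_sequentially by blast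
  have "norm ((LINT x|LO. abs (f n x)) - 0) < e" if "n >= n0" for n
   using le[OF epsilon(1), of n] n0[OF that] epsilon(2) Lint_nonneg[of "LO" "%x. abs (f n x)"] by simp
  then show "EX no. ALL n>=no. norm ((LINT x|LO. abs (f n x)) - 0) < e" by blast
 qed
qed

lemma Lp_norm_bounded_tendsto:
 assumes f: "!!n. f n : borel_measurable LO" "!!n x. abs (f n x) <= C" "!!x. x : Om ==> (%n. f n x) ----> 0" and p: "p > 0"
 shows "(%n. Lp_norm p Om (f n)) ----> 0"
proof -
 have "(%n. LINT x|LO. abs (f n x) powr p) ----> (LINT x|LO. 0)"
 proof (rule integral_dominated_convergence[OF _ _ const_integrable[of "C powr p"]])
  show "AE x in LO. (%n. abs (f n x) powr p) ----> 0"
   using f(3) p by (intro AE_I2 tendsto_zero_powrI[where b=p]) (auto simp: tendsto_rabs_zero_iff)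
  show "AE x in LO. norm (abs (f n x) powr p) <= C powr p" for n
   using f(2) p by (auto intro!: AE_I2 powr_mono2)
 qed (use f(1) in auto)
 then show ?thesis unfolding Lp_norm_def using p
  by (intro tendsto_zero_powrI[where b="1/p"]) (auto intro!: always_eventually Lint_nonneg)
qed

lemma L1_bounded_tendsto:
 fixes b F :: "'a => real"
 assumes b: "b : borel_measurable borel" "!!x. abs (b x) <= C"
  and F: "integrable LO F" "!!n. integrable LO (f n)"
  and lim: "(%n. LINT x|LO. abs (F x - f n x)) ----> 0"
 shows "(%n. LINT x|LO. f n x * b x) ----> (LINT x|LO. F x * b x)"
proof -
 have bm: "b : borel_measurable LO" by (rule borel_lebesgue_on[OF b(1)])
 note i = integrable_bounded_mult[OF _ bm b(2)]
 have le: "abs ((LINT x|LO. f n x * b x) - (LINT x|LO. F x * b x)) <= C * (LINT x|LO. abs (F x - f n x))" for n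
 proof -
  have d: "integrable LO (%x. F x - f n x)" using F by simp
  have "(LINT x|LO. F x * b x) - (LINT x|LO. f n x * b x) = (LINT x|LO. (F x - f n x) * b x)"
   unfolding left_diff_distrib by (rule Lint_diff[OF i i, symmetric]) (use F in auto)
  also have "abs (...) <= (LINT x|LO. abs ((F x - f n x) * b x))" by (rule integral_abs_bound)
  also have "... <= (LINT x|LO. C * abs (F x - f n x))"
   using integrable_abs[OF i[OF d]] d b(2) by (intro integral_mono) (auto simp: abs_mult mult.commute[of C] intro!: mult_left_mono)
  finally show ?thesis by (simp add: abs_minus_commute)
 qed
 have "(%n. C * (LINT x|LO. abs (F x - f n x))) ----> 0" using tendsto_mult_left[OF lim, of C] by simp
 then have "(%n. (LINT x|LO. f n x * b x) - (LINT x|LO. F x * b x)) ----> 0"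
  by (rule Lim_null_comparison[rotated]) (simp only: real_norm_def le eventually_True)
 then show ?thesis by (simp add: LIM_zero_iff)
qed

lemma has_weak_partialI:
 assumes f: "f : borel_measurable borel" "!!x. x ~: Om ==> f x = 0" "integrable lborel f"
  and g: "g : borel_measurable borel" "!!x. x ~: Om ==> g x = 0" "integrable lborel g" and i: "i : Basis"
  and w: "!!phi. test_function Om phi ==> (LINT x|lborel. f x * partial i phi x) = - (LINT x|lborel. g x * phi x)"
 shows "has_weak_partial Om i f g"
 unfolding has_weak_partial_def
proof (intro conjI allI impI integrable_locally_integrable)
 show "integrable LO f" "integrable LO g"
  using lebesgue_on_eq_lborel(2)[OF f(1,2) open_measure(1)] lebesgue_on_eq_lborel(2)[OF g(1,2) open_measure(1)] f g by auto
 fix phi assume phi: "test_function Om phi"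
 have m: "phi : borel_measurable borel" "partial i phi : borel_measurable borel"
  using phi i by (auto intro!: bdd_borelD(1) test_function_borel test_function_partial)
 have "(LINT x|LO. f x * partial i phi x) = (LINT x|lborel. f x * partial i phi x)"
  using f g m by (intro lebesgue_on_eq_lborel open_measure) auto
 moreover have "(LINT x|LO. g x * phi x) = (LINT x|lborel. g x * phi x)"
  using f g m by (intro lebesgue_on_eq_lborel open_measure) auto
 ultimately show "(LINT x|LO. f x * partial i phi x) = - (LINT x|LO. g x * phi x)" using w[OF phi] by simp
qed

lemma test_function_off: "test_function Om phi ==> x ~: Om ==> phi x = 0"
 by (elim test_functionE) blast

lemma test_function_weak_partial:
 assumes phi: "test_function Om phi" and i: "i : Basis" shows "has_weak_partial Om i phi (partial i phi)"
proof (rule has_weak_partialI[OF _ test_function_off _ _ test_function_off _ i])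
 have p: "test_function Om (partial i phi)" by (rule test_function_partial[OF phi i])
 show "phi : borel_measurable borel" "partial i phi : borel_measurable borel" "integrable lborel phi" "integrable lborel (partial i phi)"
  using test_function_borel[OF phi] test_function_borel[OF p]
   test_function_integrable[OF phi, of "%_. 1"] test_function_integrable[OF p, of "%_. 1"]
  by (auto simp: bdd_borel_def)
 fix psi assume "test_function Om psi"
 then obtain K where K: "smooth psi" "compact K" "!!x. x ~: K ==> psi x = 0" by (rule test_functionE) blast
 have "smooth phi" using phi by (rule test_functionE)
 then show "(LINT x|lborel. phi x * partial i psi x) = - (LINT x|lborel. partial i phi x * psi x)"
  by (intro integral_by_parts[OF _ _ i K(2,3)] smooth_Ck K(1))
qed (use phi i test_function_partial in auto)

lemma has_weak_partial_diff:
 assumes f: "has_weak_partial Om i u f" and g: "has_weak_partial Om i v g" and i: "i : Basis"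
 shows "has_weak_partial Om i (%x. u x - v x) (%x. f x - g x)"
proof -
 have l: "locally_integrable Om u" "locally_integrable Om f" "locally_integrable Om v" "locally_integrable Om g"
  using f g by (auto simp: has_weak_partial_def)
 show ?thesis unfolding has_weak_partial_def
 proof (intro conjI allI impI locally_integrable_diff l)
  fix phi assume phi: "test_function Om phi"
  note t = locally_integrable_test[OF _ phi] locally_integrable_test[OF _ test_function_partial[OF phi i]]
  show "(LINT x|LO. (u x - v x) * partial i phi x) = - (LINT x|LO. (f x - g x) * phi x)"
   unfolding left_diff_distrib Lint_diff[OF t(2)[OF l(1)] t(2)[OF l(3)]]
    Lint_diff[OF t(1)[OF l(2)] t(1)[OF l(4)]]
   using f g phi by (simp add: has_weak_partial_def)
 qed
qed

end

section \<open>Approximation by test functions and the Green identity\<close>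

context dirichlet
begin

text \<open>Mollifications of \<open>u\<close> at scale \<open>2\<^sup>-\<^sup>n\<close>, cut off at a comparable distance from the boundary;
 the linear decay of \<open>u\<close> compensates the gradient of the cut-off function.\<close>

lemma test_approximation:
 "EX phi C. (ALL n. test_function Om (phi n)) & (ALL n x. abs (phi n x) <= C) & (ALL i:Basis. ALL n x. abs (partial i (phi n) x) <= C) &
   (ALL x:Om. (%n. phi n x) ----> u x) & (ALL i:Basis. ALL x:Om. (%n. partial i (phi n) x) ----> grad i x)"
proof -
 obtain Cc where Cc: "Cc > 0" "!!s. s > 0 ==> (EX eta. is_cutoff Om Cc s eta)"
  by (rule cutoff) blast
 have "EX eta. test_function Om eta & (ALL y. 0 <= eta y & eta y <= 1) & (ALL y. bdist Om y >= 2 * (1/2^n) --> eta y = 1)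
   & (ALL y. bdist Om y <= 1/2^n --> eta y = 0) & (ALL i:Basis. ALL y. abs (partial i eta y) <= Cc * 2^n)" for n :: nat
  using Cc(2)[OF pos2[of n]] by auto
 then obtain eta where eta: "!!n. test_function Om (eta n)" "!!n y. 0 <= eta n y & eta n y <= 1"
  "!!n y. 2 * (1/2^n) <= bdist Om y ==> eta n y = 1" "!!n y. bdist Om y <= 1/2^n ==> eta n y = 0"
  "!!n i y. i : Basis ==> abs (partial i (eta n) y) <= Cc * 2^n" by metis
 define S where "S = sq 0 rho"
 define phi where "phi n x = eta n x * S n x" for n x
 have S: "smooth (S n)" for n unfolding S_def by (rule sq_smooth[OF rho_facts(1)])
 have etas: "smooth (eta n)" for n using eta(1) by (rule test_functionE)
 have pS: "partial i (S n) = sq 1 (radial1 (kerP TYPE('a)) i) n" if "i : Basis" for i n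
  unfolding S_def sq_partial[OF rho_facts(1) that] radial_deriv[OF deriv_seq_ker(1)] by simp
 have pphi: "partial i (phi n) x = eta n x * partial i (S n) x + partial i (eta n) x * S n x" if "i : Basis" for i n x
  using partial_mult_smooth[OF etas S] unfolding phi_def by (simp add: fun_eq_iff)
 have p1: "partial i (eta n) x = 0" if x: "2 * (1/2^n) < bdist Om x" for i n x
 proof -
  have "open {y. 2 * (1/2^n) < bdist Om y}" by (intro open_Collect_less continuous_intros)
  then have "partial i (%y. eta n y - 1) x = 0"
   by (rule partial_eq_0_outside) (use x eta(3) in \<open>auto simp: less_imp_le\<close>)
  then show ?thesis using partial_diff_smooth[OF etas smooth_const[of 1]] by simp
 qed
 define K where "K = ker_bd TYPE('a) * (B * (3 + dmax)) * unit_vol TYPE('a)"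
 define K' where "K' = ker_bd TYPE('a) * (B * dmax) * unit_vol TYPE('a)"
 have K0: "K >= 0" "K' >= 0" using KA0 B0 dmax(1) by (auto simp: K_def K'_def)
 have SK': "abs (S n x) <= K'" for n x
 proof -
  have "abs (Sop (1/2^n) rho u x) <= K'" unfolding K'_def
   by (rule Sop_bound[OF rho_facts(1) ker_bdD(2)[of 0 0] uM _ pos2]) (use B0 dmax in auto)
  then show ?thesis by (simp add: S_def sq_def)
 qed
 have SK: "abs (S n x) * 2^n <= K" if "bdist Om x <= 2 * (1/2^n)" for n x
 proof -
  have "2 * (1/2^n) <= (2 + dmax)/2^n" using dmax(1) by (simp add: divide_right_mono)
  then have "abs (sq (Suc 0) rho n x) <= 2^(n * 0) * K" unfolding K_def
   using that by (intro sq_bound[OF rho_facts(1) ker_bdD(2)[of 0 0]]) auto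
  then show ?thesis by (simp add: S_def sq_def abs_mult mult.commute)
 qed
 have d1: "abs (partial i (eta n) x * S n x) <= Cc * K" if i: "i : Basis" for i n x
 proof (cases "2 * (1/2^n) < bdist Om x")
  case True
  then show ?thesis using p1 K0 Cc(1) by simp
 next
  case False
  have "abs (partial i (eta n) x * S n x) <= Cc * 2^n * abs (S n x)" unfolding abs_mult using eta(5)[OF i] by (intro mult_right_mono) auto
  also have "... <= Cc * K" unfolding mult.assoc using SK[of x n] False Cc(1) by (intro mult_left_mono) (auto simp: mult.commute)
  finally show ?thesis .
 qed
 have d2: "abs (eta n x * partial i (S n) x) <= grad_bd" if i: "i : Basis" for i n x
 proof (cases "bdist Om x <= 1/2^n")
  case True
  then show ?thesis using eta(4) grad_bd0 by simp
 next
  case False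
  have "abs (eta n x * partial i (S n) x) <= 1 * grad_bd" unfolding abs_mult pS[OF i]
   using eta(2)[of n x] grad_facts(2)[of i n x] False i by (intro mult_mono) auto
  then show ?thesis by simp
 qed
 have ev: "\<forall>\<^sub>F n in sequentially. 2 * (1/2^n) < bdist Om x" if "x : Om" for x
 proof -
  have "(%n. 2 * (1/2)^n) ----> 2 * (0::real)" by (intro tendsto_intros LIMSEQ_realpow_zero) auto
  then show ?thesis using bdist_pos[OF open_Om bounded_Om that] by (intro order_tendstoD) (auto simp: power_divide)
 qed
 show ?thesis
 proof (intro exI[of _ phi] exI[of _ "K' + (Cc * K + grad_bd)"] conjI ballI allI)
  show "test_function Om (phi n)" for n
  proof -
   obtain Ke where Ke: "smooth (eta n)" "compact Ke" "Ke <= Om" "!!x. x ~: Ke ==> eta n x = 0" using eta(1)[of n] by (rule test_functionE) blast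
   show ?thesis unfolding phi_def by (rule test_functionI[OF smooth_mult[OF Ke(1) S] Ke(2,3)]) (simp add: Ke(4))
  qed
  have c: "Cc * K >= 0" using Cc K0 by simp
  show "abs (phi n x) <= K' + (Cc * K + grad_bd)" for n x
  proof -
   have "abs (phi n x) <= 1 * K'" unfolding phi_def abs_mult using eta(2)[of n x] SK' by (intro mult_mono) auto
   then show ?thesis using c grad_bd0 by simp
  qed
  fix i :: 'a assume i: "i : Basis"
  show "abs (partial i (phi n) x) <= K' + (Cc * K + grad_bd)" for n x
   using d1[OF i, of n x] d2[OF i, of n x] K0 unfolding pphi[OF i] by linarith
  show "(%n. partial i (phi n) x) ----> grad i x" if x: "x : Om" for x
  proof (rule Lim_transform_eventually)
   show "(%n. partial i (S n) x) ----> grad i x" using grad_tendsto[OF _ x] i unfolding pS[OF i] by simp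
   show "\<forall>\<^sub>F n in sequentially. partial i (S n) x = partial i (phi n) x"
    using ev[OF x] by eventually_elim (simp add: pphi[OF i] p1 eta(3) less_imp_le)
  qed
 next
  fix x assume x: "x : Om"
  show "(%n. phi n x) ----> u x"
  proof (rule Lim_transform_eventually)
   show "(%n. S n x) ----> u x" unfolding S_def by (rule sq0)
   show "\<forall>\<^sub>F n in sequentially. S n x = phi n x" using ev[OF x] by eventually_elim (simp add: phi_def eta(3) less_imp_le)
  qed
 qed
qed

end

context domain
begin

lemma integral_AE:
 fixes f g :: "'a => real"
 assumes "AE x in LO. f x = g x" "g : borel_measurable LO"
 shows "(LINT x|LO. f x) = (LINT x|LO. g x)"
 using AE_measurable[OF assms(2,1)] assms by (intro integral_cong_AE)

lemma Lp_norm_nonneg: "Lp_norm p Om f >= 0"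
 by (simp add: Lp_norm_def)

lemma navier_space_partials:
 assumes v: "v : navier_space p Om"
 shows "EX G H. ALL i:Basis. has_weak_partial Om i v (G i) & has_weak_partial Om i (G i) (H i) & G i : Lp p Om & H i : Lp p Om"
proof -
 have "v : sobolev (Suc (Suc 0)) p Om" using v by (simp add: navier_space_def numeral_2_eq_2)
 then have "ALL i:Basis. EX G. has_weak_partial Om i v G & G : Lp p Om & (EX H:Lp p Om. has_weak_partial Om i G H)"
  by simp blast
 then show ?thesis by metis
qed

lemma weak_laplacian_measurable:
 assumes v: "v : navier_space p Om" shows "weak_laplacian Om v : borel_measurable LO"
proof -
 obtain G H where GH: "!!i. i : Basis ==> has_weak_partial Om i v (G i)" "!!i. i : Basis ==> has_weak_partial Om i (G i) (H i)"
  "!!i. i : Basis ==> H i : Lp p Om" using navier_space_partials[OF v] by metis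
 show ?thesis by (rule AE_measurable[OF _ weak_laplacian_AE[OF GH(1,2)]]) (use GH(3) in \<open>auto simp: Lp_def intro!: borel_measurable_sum\<close>)
qed

lemma sobolev1_norm_test:
 assumes G': "ALL i:Basis. has_weak_partial Om i v (G i) & G i : Lp p Om" and p: "p > 0"
  and psi: "test_function Om psi"
 shows "sobolev1_norm p Om (%x. v x - psi x) = Lp_norm p Om (%x. v x - psi x) + (\<Sum>i\<in>Basis. Lp_norm p Om (%x. G i x - partial i psi x))"
  "i : Basis ==> (%x. G i x - partial i psi x) : Lp p Om"
proof -
 have G: "has_weak_partial Om i v (G i)" "G i : Lp p Om" if "i : Basis" for i using G' that by auto
 have L: "(%x. G i x - partial i psi x) : Lp p Om" if i: "i : Basis" for i
 proof (rule Lp_diff[OF G(2)[OF i] _ p])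
  have b: "bdd_borel (partial i psi)" by (rule test_function_borel[OF test_function_partial[OF psi i]])
  then obtain C where "!!x. abs (partial i psi x) <= C" using bdd_borelD(2) by blast
  then show "partial i psi : Lp p Om" using p by (intro Lp_bounded borel_lebesgue_on bdd_borelD(1)[OF b])
 qed
 then show "i : Basis ==> (%x. G i x - partial i psi x) : Lp p Om" .
 have "Lp_norm p Om (weak_partial Om i (%x. v x - psi x)) = Lp_norm p Om (%x. G i x - partial i psi x)" if i: "i : Basis" for i
  by (intro Lp_AE(2)[OF L[OF i]] weak_partial_AE(2) has_weak_partial_diff G(1) test_function_weak_partial psi i)
 then show "sobolev1_norm p Om (%x. v x - psi x) = Lp_norm p Om (%x. v x - psi x) + (\<Sum>i\<in>Basis. Lp_norm p Om (%x. G i x - partial i psi x))"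
  unfolding sobolev1_norm_def by simp
qed

end

context dirichlet
begin

lemma u_Lp: "q > 0 ==> u : Lp q Om"
 using uM by (intro Lp_bounded borel_lebesgue_on bdd_borelD(1)[OF ub])

lemma grad_Lp: "q > 0 ==> i : Basis ==> grad i : Lp q Om"
 by (intro Lp_bounded[where C=grad_bd] borel_lebesgue_on grad_measurable grad_bound) auto

lemma grad_integrable: "i : Basis ==> integrable lborel (grad i)"
 by (rule integrable_bounded_support[OF grad_measurable grad_bound bounded_Om grad_outside]) auto

lemma u_has_weak_partial: "i : Basis ==> has_weak_partial Om i u (grad i)"
 by (rule has_weak_partialI[OF bdd_borelD(1)[OF ub] C0D(2)[OF uC] C0_integrable[OF bounded_Om uC]
    grad_measurable grad_outside grad_integrable _ u_weak_partial]) auto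

lemma grad_test_integral:
 assumes psi: "test_function Om psi"
 shows "(\<Sum>i\<in>Basis. LINT x|LO. partial i psi x * grad i x) = (LINT x|LO. psi x * g x)"
proof -
 have m: "psi : borel_measurable borel" "g : borel_measurable borel"
  by (rule bdd_borelD(1)[OF test_function_borel[OF psi]], rule bdd_borelD(1)[OF gb])
 have e: "(LINT x|LO. partial i psi x * grad i x) = - (LINT x|lborel. u x * partial i (partial i psi) x)" if i: "i : Basis" for i
 proof -
  have "(LINT x|LO. partial i psi x * grad i x) = (LINT x|lborel. partial i psi x * grad i x)"
   using grad_measurable[of i] i bdd_borelD(1)[OF test_function_borel[OF test_function_partial[OF psi i]]]
   by (intro lebesgue_on_eq_lborel open_measure) (auto simp: grad_outside)
  also have "... = - (LINT x|lborel. u x * partial i (partial i psi) x)"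
   using u_weak_partial[OF i test_function_partial[OF psi i]] by (simp add: mult.commute)
  finally show ?thesis .
 qed
 have "(\<Sum>i\<in>Basis. LINT x|LO. partial i psi x * grad i x) = - (\<Sum>i\<in>Basis. LINT x|lborel. u x * partial i (partial i psi) x)"
  by (simp add: e sum_negf)
 also have "(\<Sum>i\<in>Basis. LINT x|lborel. u x * partial i (partial i psi) x) = (LINT x|lborel. u x * lap psi x)"
  unfolding lap_def sum_distrib_left
  by (rule Lint_sum[symmetric]) (rule test_function_integrable[OF test_function_partial[OF test_function_partial[OF psi]] ub])
 also have "... = - (LINT x|lborel. g x * psi x)" using po psi by (simp add: poisson_def)
 also have "(LINT x|lborel. g x * psi x) = (LINT x|LO. psi x * g x)"
  unfolding mult.commute[of "g _"] using m by (intro lebesgue_on_eq_lborel[symmetric] open_measure) (auto simp: C0D(2)[OF gC])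
 finally show ?thesis by simp
qed

text \<open>Both sides equal minus the integral of grad u . grad v. On the left u is approximated by
  test functions that are bounded together with their gradients; on the right v is approximated in
  the Sobolev norm, and since g and grad u are bounded, convergence in L^1 suffices.\<close>

lemma green_identity:
 assumes v: "v : navier_space p Om" and p: "p >= 1"
 shows "(LINT x|LO. u x * weak_laplacian Om v x) = - (LINT x|LO. g x * v x)"
proof -
 let ?L = "LO"
 obtain G H where G: "!!i. i : Basis ==> has_weak_partial Om i v (G i)" "!!i. i : Basis ==> G i : Lp p Om"
  and H: "!!i. i : Basis ==> has_weak_partial Om i (G i) (H i)" "!!i. i : Basis ==> H i : Lp p Om"
  using navier_space_partials[OF v] by metis
 have vL: "v : Lp p Om" using v by (simp add: navier_space_def numeral_2_eq_2)
 have um: "u : borel_measurable ?L" by (rule borel_lebesgue_on[OF bdd_borelD(1)[OF ub]])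
 have iH: "integrable ?L (H i)" "integrable ?L (G i)" if "i : Basis" for i using G(2) H(2) p that by (auto intro: Lp_integrable)
 obtain phi C where phi: "!!n. test_function Om (phi n)" "!!n x. abs (phi n x) <= C" "!!i n x. i : Basis ==> abs (partial i (phi n) x) <= C"
   "!!x. x : Om ==> (%n. phi n x) ----> u x" "!!i x. i : Basis ==> x : Om ==> (%n. partial i (phi n) x) ----> grad i x"
  using test_approximation by metis
 have tm: "psi : borel_measurable ?L" if "test_function Om psi" for psi
  by (rule borel_lebesgue_on[OF bdd_borelD(1)[OF test_function_borel[OF that]]])
 have A: "(LINT x|?L. H i x * u x) = - (LINT x|?L. G i x * grad i x)" if i: "i : Basis" for i
 proof -
  have "(%n. LINT x|?L. H i x * phi n x) ----> (LINT x|?L. H i x * u x)"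
   using phi(4) by (intro dominated_sequence[OF _ phi(2) iH(1)[OF i] um] tm phi(1) AE_I2) auto
  moreover have "(%n. LINT x|?L. G i x * partial i (phi n) x) ----> (LINT x|?L. G i x * grad i x)"
   using phi(5)[OF i] i by (intro dominated_sequence[OF _ phi(3)[OF i] iH(2)[OF i]] tm test_function_partial phi(1) i AE_I2 borel_lebesgue_on grad_measurable) auto
  then have "(%n. - (LINT x|?L. G i x * partial i (phi n) x)) ----> - (LINT x|?L. G i x * grad i x)" by (rule tendsto_minus)
  moreover have "- (LINT x|?L. G i x * partial i (phi n) x) = (LINT x|?L. H i x * phi n x)" for n
   using H(1)[OF i] phi(1) by (simp add: has_weak_partial_def)
  ultimately show ?thesis using LIMSEQ_unique by simp
 qed
 obtain psi where psi: "!!n. test_function Om (psi n)" and lim: "(%n. sobolev1_norm p Om (%x. v x - psi n x)) ----> 0"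
  using v by (auto simp: navier_space_def sobolev1_zero_def)
 have p0: "p > 0" using p by simp
 have G': "ALL i:Basis. has_weak_partial Om i v (G i) & G i : Lp p Om" using G by blast
 note nn = sobolev1_norm_test[OF G' p0 psi]
 have psii: "integrable ?L (psi n)" "integrable ?L (partial i (psi n))" if "i : Basis" for n i
  using locally_integrable_test[OF integrable_locally_integrable[OF const_integrable[of 1]]] psi test_function_partial[OF psi that] by auto
 have vp: "(%x. v x - psi n x) : Lp p Om" for n
 proof -
  obtain C where "!!x. abs (psi n x) <= C" using bdd_borelD(2)[OF test_function_borel[OF psi]] by blast
  then show ?thesis using p0 by (intro Lp_diff vL Lp_bounded tm psi)
 qed
 have B1: "(%n. LINT x|?L. psi n x * g x) ----> (LINT x|?L. v x * g x)"
 proof (rule L1_bounded_tendsto[OF bdd_borelD(1)[OF gb] gM Lp_integrable[OF vL p] _ Lp_norm_L1[OF vp p]])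
  show "(%n. Lp_norm p Om (%x. v x - psi n x)) ----> 0"
   by (rule Lim_null_comparison[OF _ lim]) (simp add: nn Lp_norm_nonneg sum_nonneg)
  show "integrable ?L (psi n)" for n using psii SOME_Basis by blast
 qed
 have B2: "(%n. LINT x|?L. partial i (psi n) x * grad i x) ----> (LINT x|?L. G i x * grad i x)" if i: "i : Basis" for i
 proof (rule L1_bounded_tendsto[OF grad_measurable grad_bound iH(2)[OF i] psii(2)[OF i] Lp_norm_L1[OF nn(2)[OF i] p]])
  show "(%n. Lp_norm p Om (%x. G i x - partial i (psi n) x)) ----> 0"
  proof (rule Lim_null_comparison[OF always_eventually lim], rule allI)
   fix n
   have "Lp_norm p Om (%x. G i x - partial i (psi n) x) <= (\<Sum>i\<in>Basis. Lp_norm p Om (%x. G i x - partial i (psi n) x))"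
    using i Lp_norm_nonneg by (intro member_le_sum) auto
   then show "norm (Lp_norm p Om (%x. G i x - partial i (psi n) x)) <= sobolev1_norm p Om (%x. v x - psi n x)"
    unfolding nn(1) using Lp_norm_nonneg[of p "%x. v x - psi n x"] Lp_norm_nonneg[of p "%x. G i x - partial i (psi n) x"] by simp
  qed
 qed (use i in auto)
 have "(%n. \<Sum>i\<in>Basis. LINT x|?L. partial i (psi n) x * grad i x) ----> (\<Sum>i\<in>Basis. LINT x|?L. G i x * grad i x)"
  by (rule tendsto_sum) (rule B2)
 then have B: "(\<Sum>i\<in>Basis. LINT x|?L. G i x * grad i x) = (LINT x|?L. v x * g x)"
  unfolding grad_test_integral[OF psi] by (rule LIMSEQ_unique[OF _ B1])
 have iHu: "integrable ?L (%x. H i x * u x)" if "i : Basis" for i by (rule integrable_bounded_mult[OF iH(1)[OF that] um uM])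
 have wl: "AE x in ?L. weak_laplacian Om v x = (\<Sum>i\<in>Basis. H i x)" by (rule weak_laplacian_AE[OF G(1) H(1)])
 have "(LINT x|?L. u x * weak_laplacian Om v x) = (LINT x|?L. (\<Sum>i\<in>Basis. H i x * u x))"
 proof (rule integral_AE)
  show "AE x in ?L. u x * weak_laplacian Om v x = (\<Sum>i\<in>Basis. H i x * u x)"
   using wl by eventually_elim (simp add: sum_distrib_left mult.commute)
  show "(%x. \<Sum>i\<in>Basis. H i x * u x) : borel_measurable ?L"
   by (intro borel_measurable_sum borel_measurable_integrable iHu)
 qed
 also have "... = (\<Sum>i\<in>Basis. LINT x|?L. H i x * u x)" by (rule Lint_sum) (rule iHu)
 also have "... = - (LINT x|?L. g x * v x)" 
  using A B by (simp add: sum_negf mult.commute[of "g _"])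
 finally show ?thesis .
qed

end

section \<open>Solutions in the Navier space and the weak equation\<close>

context dirichlet_hoelder
begin

lemma hess_integrable: "q > 0 ==> i : Basis ==> j : Basis ==> integrable lborel (%x. abs (hess i j x) powr q)"
 using hess_bound by (elim exE conjE) (rule log_bounded_integrable[OF hess_measurable hess_outside], blast+)

lemma hess_Lp: assumes "q > 0" "i : Basis" "j : Basis" shows "hess i j : Lp q Om"
proof -
 have "integrable LO (%x. abs (hess i j x) powr q)"
  using hess_integrable[OF assms] hess_measurable[OF assms(2,3)] assms
  by (subst lebesgue_on_eq_lborel(2)) (auto simp: hess_outside open_measure)
 then show ?thesis using borel_lebesgue_on[OF hess_measurable[OF assms(2,3)]] by (simp add: Lp_def)
qed

lemma grad_has_weak_partial:
 assumes i: "i : Basis" and j: "j : Basis" shows "has_weak_partial Om j (grad i) (hess i j)"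
proof (rule has_weak_partialI[OF grad_measurable grad_outside grad_integrable[OF i] hess_measurable[OF i j] hess_outside _ j grad_weak_partial[OF i j]])
 have "integrable lborel (%x. abs (hess i j x))" using hess_integrable[of 1 i j] i j by simp
 then show "integrable lborel (hess i j)" using hess_measurable[OF i j] by (simp add: integrable_abs_iff)
qed (use i in auto)

lemma u_sobolev: assumes q: "q > 0" shows "u : navier_space q Om"
proof -
 have s1: "grad i : sobolev (Suc 0) q Om" if i: "i : Basis" for i
  using grad_Lp[OF q i] grad_has_weak_partial[OF i] hess_Lp[OF q i] by auto
 have s2: "u : sobolev 2 q Om" unfolding numeral_2_eq_2
  using u_Lp[OF q] s1 u_has_weak_partial by (auto simp del: sobolev.simps(2) simp: sobolev.simps(2)[of "Suc 0"])
 have s3: "u : sobolev 1 q Om" unfolding One_nat_def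
  using u_Lp[OF q] grad_Lp[OF q] u_has_weak_partial by auto
 obtain phi C where phi: "!!n. test_function Om (phi n)" "!!n x. abs (phi n x) <= C" "!!i n x. i : Basis ==> abs (partial i (phi n) x) <= C"
   "!!x. x : Om ==> (%n. phi n x) ----> u x" "!!i x. i : Basis ==> x : Om ==> (%n. partial i (phi n) x) ----> grad i x"
  using test_approximation by metis
 have tm: "psi : borel_measurable borel" if "test_function Om psi" for psi
  by (rule bdd_borelD(1)[OF test_function_borel[OF that]])
 have "(%n. Lp_norm q Om (%x. u x - phi n x)) ----> 0"
 proof (rule Lp_norm_bounded_tendsto[OF _ _ _ q])
  show "(%x. u x - phi n x) : borel_measurable LO" for n
   by (intro borel_lebesgue_on borel_measurable_diff tm phi(1) bdd_borelD(1)[OF ub])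
  show "abs (u x - phi n x) <= B * dmax + C" for n x using uM[of x] phi(2)[of n x] by linarith
  show "x : Om ==> (%n. u x - phi n x) ----> 0" for x using tendsto_diff[OF tendsto_const phi(4), of x "u x"] by simp
 qed
 moreover have "(%n. Lp_norm q Om (%x. grad i x - partial i (phi n) x)) ----> 0" if i: "i : Basis" for i
 proof (rule Lp_norm_bounded_tendsto[OF _ _ _ q])
  show "(%x. grad i x - partial i (phi n) x) : borel_measurable LO" for n
   using i by (intro borel_lebesgue_on borel_measurable_diff tm test_function_partial phi(1) grad_measurable) auto
  show "abs (grad i x - partial i (phi n) x) <= grad_bd + C" for n x using grad_bound[of i x] phi(3)[OF i, of n x] i by simp
  show "x : Om ==> (%n. grad i x - partial i (phi n) x) ----> 0" for x using tendsto_diff[OF tendsto_const phi(5)[OF i], of x "grad i x"] by simp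
 qed
 moreover have gp: "ALL i:Basis. has_weak_partial Om i u (grad i) & grad i : Lp q Om"
  using u_has_weak_partial grad_Lp[OF q] by blast
 ultimately have "(%n. Lp_norm q Om (%x. u x - phi n x) + (\<Sum>i\<in>Basis. Lp_norm q Om (%x. grad i x - partial i (phi n) x))) ----> 0 + (\<Sum>i\<in>(Basis :: 'a set). 0)"
  by (intro tendsto_add tendsto_sum)
 then have "(%n. sobolev1_norm q Om (%x. u x - phi n x)) ----> 0"
  unfolding sobolev1_norm_test(1)[OF gp q phi(1)] by simp
 then show ?thesis using s2 s3 phi(1) by (auto simp: navier_space_def sobolev1_zero_def)
qed

lemma u_weak_laplacian: "AE x in LO. weak_laplacian Om u x = - g x"
proof -
 have "AE x in LO. weak_laplacian Om u x = (\<Sum>i\<in>Basis. hess i i x)"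
  by (rule weak_laplacian_AE[OF u_has_weak_partial grad_has_weak_partial])
 moreover have "AE x in LO. x : Om" by (auto simp: AE_I2)
 ultimately show ?thesis by eventually_elim (simp add: hess_sum)
qed

lemma navier_norm_le:
 assumes q: "q > 0" shows "navier_norm q Om u <= (LINT x|LO. M powr q) powr (1/q)"
proof -
 have gL: "(%x. - g x) : Lp q Om"
  using gM q by (intro Lp_bounded[where C=M] borel_lebesgue_on borel_measurable_uminus bdd_borelD(1)[OF gb]) auto
 have "navier_norm q Om u = Lp_norm q Om (%x. - g x)" unfolding navier_norm_def by (rule Lp_AE(2)[OF gL u_weak_laplacian])
 also have "... <= (LINT x|LO. M powr q) powr (1/q)" unfolding Lp_norm_def
  using gL gM q const_integrable
  by (intro powr_mono2 integral_mono Lint_nonneg) (auto simp: Lp_def intro!: powr_mono2)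
 finally show ?thesis .
qed

text \<open>Since -Lap u = g, the nonlinear term is -w almost everywhere. The Green identity for w
  then turns the left side into the integral of h v. It asks no second derivatives of w, so h need
  only be continuous.\<close>

lemma weak_solution_criterion:
 assumes p: "p > 1" and w: "dirichlet Om r0 Cb w h B' M'"
  and gw: "!!x. abs (g x) powr (p - 2) * g x = w x" and h: "!!x. h x = mu * f (u x)"
 shows "weak_solution p Om f mu u"
 unfolding weak_solution_def
proof (intro conjI ballI)
 show "u : navier_space p Om" using p by (intro u_sobolev) simp
 fix v assume v: "v : navier_space p Om"
 interpret w: dirichlet Om r0 Cb w h B' M' by (rule w)
 have wm: "w : borel_measurable LO" by (rule borel_lebesgue_on[OF bdd_borelD(1)[OF w.ub]])
 have "(LINT x|LO. abs (weak_laplacian Om u x) powr (p - 2) * weak_laplacian Om u x * weak_laplacian Om v x)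
   = (LINT x|LO. - (w x * weak_laplacian Om v x))"
 proof (rule integral_AE)
  show "AE x in LO. abs (weak_laplacian Om u x) powr (p - 2) * weak_laplacian Om u x * weak_laplacian Om v x = - (w x * weak_laplacian Om v x)"
   using u_weak_laplacian by eventually_elim (simp add: gw[symmetric])
 qed (use wm weak_laplacian_measurable[OF v] in simp)
 also have "... = (LINT x|LO. h x * v x)" using w.green_identity[OF v] p by simp
 also have "... = mu * (LINT x|LO. f (u x) * v x)" by (simp add: h mult.assoc)
 finally show "(LINT x|LO. abs (weak_laplacian Om u x) powr (p - 2) * weak_laplacian Om u x * weak_laplacian Om v x)
   = mu * (LINT x|LO. f (u x) * v x)" .
qed

end

section \<open>A mountain pass principle\<close>

lemma positive_on_compact:
 fixes f :: "'a::topological_space => real"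
 assumes "compact S" "continuous_on S f" "!!x. x : S ==> f x > 0"
 shows "EX c>0. ALL x:S. c <= f x"
proof (cases "S = {}")
 case False
 then show ?thesis using continuous_attains_inf[OF assms(1) False assms(2)] assms(3) by blast
qed (auto intro: exI[of _ 1])

text \<open>The map \<open>A\<close> plays the role of a descent direction. Were there no fixed point at a positive
 level, one small step towards \<open>A g\<close>, switched off at low levels, would push a nearly optimal
 path between the two valleys below the mountain pass level.\<close>

lemma mountain_pass:
 fixes K :: "'x::real_normed_vector set" and J D N :: "'x => real" and A :: "'x => 'x"
 assumes K: "compact K" "convex K" and J: "continuous_on K J" and A: "continuous_on K A" "!!g. g : K ==> A g : K"
  and D: "continuous_on K D" "!!g. g : K ==> A g ~= g ==> D g > 0" and N: "continuous_on K N"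
  and desc: "!!eta. eta > 0 ==> EX tau>0. tau <= 1 & (ALL g:K. ALL t. 0 <= t & t <= tau --> J (g + t *\<^sub>R (A g - g)) <= J g - t * (D g - eta))"
  and z: "z : K" "J z = 0" "N z < theta" and g1: "g1 : K" "J g1 < 0" "theta < N g1"
  and ridge: "!!g. g : K ==> N g = theta ==> J g > 0"
 shows "EX a:K. EX b:K. A a = a & A b = b & J a < 0 & J b > 0"
proof -
 have step: "g + t *\<^sub>R (A g - g) : K" if "g : K" "0 <= t" "t <= 1" for g t
 proof -
  have "g + t *\<^sub>R (A g - g) = (1 - t) *\<^sub>R g + t *\<^sub>R A g" by (simp add: algebra_simps)
  then show ?thesis using convexD[OF K(2) that(1) A(2)[OF that(1)], of "1 - t" t] that by simp
 qed
 obtain a where a: "a : K" "!!g. g : K ==> J a <= J g" using continuous_attains_inf[OF K(1) _ J] z(1) by blast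
 have "A a = a"
 proof (rule ccontr)
  assume "A a ~= a"
  then have Da: "D a > 0" by (rule D(2)[OF a(1)])
  obtain tau where tau: "tau > 0" "tau <= 1" "!!g t. g : K ==> 0 <= t ==> t <= tau ==> J (g + t *\<^sub>R (A g - g)) <= J g - t * (D g - D a/2)"
   using desc[of "D a/2"] Da by auto
  have "J a <= J (a + tau *\<^sub>R (A a - a))" using tau by (intro a(2) step a(1)) auto
  also have "... <= J a - tau * (D a - D a/2)" using tau by (intro tau(3) a(1)) auto
  finally show False using tau(1) Da by (simp add: mult_le_0_iff)
 qed
 moreover have "J a < 0" using a(2)[OF g1(1)] g1(2) by simp
 moreover have "EX b:K. A b = b & J b > 0"
 proof (rule ccontr)
  assume no: "~ ?thesis"
  have "EX c>0. ALL g:K \<inter> N -` {theta}. c <= J g"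
  proof (rule positive_on_compact)
   have "closedin (top_of_set K) (K \<inter> N -` {theta})" using N by (intro continuous_closedin_preimage) auto
   then show "compact (K \<inter> N -` {theta})" by (rule closedin_compact[OF K(1)])
   show "continuous_on (K \<inter> N -` {theta}) J" using J by (rule continuous_on_subset) auto
  qed (use ridge in auto)
  then obtain c0 where c0: "c0 > 0" "!!g. g : K ==> N g = theta ==> c0 <= J g" by auto
  \<comment> \<open>The minimax level is expressed by sublevel sets: c will be the infimum of the
    levels m below which z and g1 can be joined by a path.\<close>
  define P where "P m \<longleftrightarrow> path_component {g:K. J g <= m} z g1" for m
  have lower: "c0 <= m" if "P m" for m
  proof -
   obtain gamma where gamma: "path gamma" "path_image gamma <= {g:K. J g <= m}" "pathstart gamma = z" "pathfinish gamma = g1"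
    using \<open>P m\<close> unfolding P_def path_component_def by blast
   have "connected (N ` path_image gamma)"
    by (intro connected_continuous_image connected_path_image gamma(1) continuous_on_subset[OF N]) (use gamma(2) in auto)
   moreover have "N z : N ` path_image gamma" "N g1 : N ` path_image gamma"
    using pathstart_in_path_image[of gamma] pathfinish_in_path_image[of gamma] gamma by auto
   ultimately have "theta : N ` path_image gamma" by (rule connectedD_interval) (use z g1 in auto)
   then show "c0 <= m" using c0(2) gamma(2) by force
  qed
  obtain b where b: "b : K" "!!g. g : K ==> J g <= J b" using continuous_attains_sup[OF K(1) _ J] z(1) by blast
  have "{g:K. J g <= J b} = K" using b by auto
  then have "P (J b)" unfolding P_def
   using convex_imp_path_connected[OF K(2)] z(1) g1(1) by (simp add: path_connected_component)
  define c where "c = Inf {m. P m}"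
  have bdd: "bdd_below {m. P m}" by (rule bdd_belowI[of _ c0]) (simp add: lower)
  have c: "c0 <= c" unfolding c_def using \<open>P (J b)\<close> lower by (intro cInf_greatest) auto
  have cpos: "c > 0" using c c0(1) by simp
  have "EX d>0. ALL g:K \<inter> J -` {c/2..}. d <= D g"
  proof (rule positive_on_compact)
   have "closedin (top_of_set K) (K \<inter> J -` {c/2..})" using J by (intro continuous_closedin_preimage) auto
   then show "compact (K \<inter> J -` {c/2..})" by (rule closedin_compact[OF K(1)])
   show "continuous_on (K \<inter> J -` {c/2..}) D" using D(1) by (rule continuous_on_subset) auto
   show "D g > 0" if "g : K \<inter> J -` {c/2..}" for g
    using that no cpos by (intro D(2)) auto
  qed
  then obtain d where d: "d > 0" "!!g. g : K ==> c/2 <= J g ==> d <= D g" by auto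
  obtain tau where tau: "tau > 0" "tau <= 1" "!!g t. g : K ==> 0 <= t ==> t <= tau ==> J (g + t *\<^sub>R (A g - g)) <= J g - t * (D g - d/2)"
   using desc[of "d/2"] d(1) by auto
  \<comment> \<open>psi is 0 where J <= c/2 and 1 where J >= 3 c/4. The ends of the path, at levels
    at most 0, stay fixed, while all high points are lowered by the full step.\<close>
  define psi where "psi g = max 0 (min 1 ((J g - c/2)/(c/4)))" for g
  define Phi where "Phi g = g + (tau * psi g) *\<^sub>R (A g - g)" for g
  have psi: "0 <= psi g" "psi g <= 1" for g by (auto simp: psi_def)
  have psi0: "psi g = 0" if "J g <= c/2" for g
  proof -
   have "(J g - c/2)/(c/4) <= 0" using that cpos by (intro divide_nonpos_pos) auto
   then show ?thesis by (simp add: psi_def)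
  qed
  have t01: "0 <= tau * psi g" "tau * psi g <= tau" for g using tau(1) psi[of g] by (auto simp: mult_left_le)
  have cont: "continuous_on K Phi" unfolding Phi_def psi_def using cpos by (intro continuous_intros J A(1)) auto
  have PhiJ: "Phi g : K & (J (Phi g) <= 3 * c/4 | J (Phi g) <= J g - tau * d/2)" if g: "g : K" for g
  proof
   show "Phi g : K" unfolding Phi_def using t01[of g] tau(2) by (intro step g) auto
   show "J (Phi g) <= 3 * c/4 | J (Phi g) <= J g - tau * d/2"
   proof (cases "c/2 <= J g")
    case False
    then have "psi g = 0" by (intro psi0) simp
    then show ?thesis using False cpos by (simp add: Phi_def)
   next
    case True
    have "J (Phi g) <= J g - (tau * psi g) * (D g - d/2)" unfolding Phi_def by (rule tau(3)[OF g t01])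
    moreover have "(tau * psi g) * (d/2) <= (tau * psi g) * (D g - d/2)"
     using d(2)[OF g True] t01(1)[of g] by (intro mult_left_mono) auto
    ultimately have le: "J (Phi g) <= J g - (tau * psi g) * (d/2)" by linarith
    show ?thesis
    proof (cases "3 * c/4 <= J g")
     case True
     then have "(J g - c/2)/(c/4) >= 1" using cpos by (simp add: field_simps)
     then have "psi g = 1" by (simp add: psi_def)
     then show ?thesis using le by simp
    next
     case False
     have "0 <= (tau * psi g) * (d/2)" using t01(1)[of g] d(1) by simp
     then show ?thesis using le False by linarith
    qed
   qed
  qed
  have ends: "Phi z = z" "Phi g1 = g1"
  proof -
   show "Phi z = z" "Phi g1 = g1" using z(2) g1(2) cpos psi0[of z] psi0[of g1] by (auto simp: Phi_def)
  qed
  have "EX m:{m. P m}. m < c + tau * d/4"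
   unfolding c_def using tau(1) d(1) by (intro cInf_lessD) (use \<open>P (J b)\<close> in auto)
  then obtain m where m: "P m" "m < c + tau * d/4" by auto
  \<comment> \<open>The deformed path stays below m'. This is smaller than c, because m exceeds c by
    less than tau d/4.\<close>
  define m' where "m' = max (3 * c/4) (m - tau * d/2)"
  obtain gamma where gamma: "path gamma" "path_image gamma <= {g:K. J g <= m}" "pathstart gamma = z" "pathfinish gamma = g1"
   using m(1) unfolding P_def path_component_def by blast
  have "P m'" unfolding P_def path_component_def
  proof (intro exI conjI)
   show "path (Phi \<circ> gamma)" using gamma(2) by (intro path_continuous_image gamma(1) continuous_on_subset[OF cont]) auto
   show "path_image (Phi \<circ> gamma) <= {g:K. J g <= m'}"
    unfolding path_image_compose m'_def using PhiJ gamma(2) by fastforce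
   show "pathstart (Phi \<circ> gamma) = z" "pathfinish (Phi \<circ> gamma) = g1" by (simp_all add: pathstart_compose pathfinish_compose gamma ends)
  qed
  then have "c <= m'" unfolding c_def using bdd by (intro cInf_lower) auto
  moreover have "tau * d > 0" using tau(1) d(1) by simp
  ultimately show False using cpos m(2) by (simp add: m'_def max_def split: if_splits)
 qed
 ultimately show ?thesis using a(1) by blast
qed

section \<open>Inequalities for powers, and the primitive of the nonlinearity\<close>

lemma powr_mvt:
 fixes a b q :: real
 assumes ab: "0 <= a" "a < b" and q: "q > 0"
 shows "EX xi. a < xi & xi < b & b powr q - a powr q = q * xi powr (q - 1) * (b - a)"
proof -
 have d: "((%x. x powr q) has_real_derivative q * x powr (q - 1)) (at x)" if "x > 0" for x
  using that by (auto intro!: derivative_eq_intros)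
 have c: "continuous_on {a..b} (%x. x powr q)"
  using ab q by (intro continuous_on_powr' continuous_intros) auto
 have "!!x. a < x ==> x < b ==> (%x. x powr q) differentiable (at x)"
  using d ab by (meson le_less_trans real_differentiable_def)
 then obtain l xi where *: "a < xi" "xi < b" "((%x. x powr q) has_real_derivative l) (at xi)" "b powr q - a powr q = (b - a) * l"
  using MVT[OF ab(2) c] by blast
 moreover have "l = q * xi powr (q - 1)" using DERIV_unique[OF *(3) d] * ab by simp
 ultimately show ?thesis by (auto simp: mult_ac)
qed

lemma powr_tangent:
 fixes a b p :: real
 assumes "a >= 0" "b >= 0" "p > 1" shows "b powr p - a powr p <= p * b powr (p - 1) * (b - a)"
proof (cases a b rule: linorder_cases)
 case less
 obtain xi where xi: "a < xi" "xi < b" "b powr p - a powr p = p * xi powr (p - 1) * (b - a)" using powr_mvt[OF assms(1) less, of p] assms by auto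
 then have "xi powr (p - 1) <= b powr (p - 1)" using assms by (intro powr_mono2) auto
 then show ?thesis unfolding xi(3) using less assms by (intro mult_right_mono mult_left_mono) auto
next
 case greater
 obtain xi where xi: "b < xi" "xi < a" "a powr p - b powr p = p * xi powr (p - 1) * (a - b)" using powr_mvt[OF assms(2) greater, of p] assms by auto
 then have "b powr (p - 1) <= xi powr (p - 1)" using assms by (intro powr_mono2) auto
 then have "p * b powr (p - 1) * (a - b) <= a powr p - b powr p" unfolding xi(3) using greater assms by (intro mult_right_mono mult_left_mono) auto
 then show ?thesis by (simp add: algebra_simps)
qed simp

text \<open>Powers with exponent at most 1 are subadditive; the others are Lipschitz on a bounded
  interval, with the derivative at W as constant.\<close>

lemma powr_hoelder:
 fixes theta W :: real
 assumes theta: "theta > 0" and W: "W >= 0"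
 shows "EX C>=0. ALL a:{0..W}. ALL b:{0..W}. abs (a powr theta - b powr theta) <= C * abs (a - b) powr min 1 theta"
proof -
 define C where "C = 1 + theta * W powr (theta - 1)"
 have C: "C >= 1" using theta by (simp add: C_def)
 have main: "abs (b powr theta - a powr theta) <= C * abs (b - a) powr min 1 theta" if ab: "0 <= a" "a < b" "b <= W" for a b
 proof -
  have mono: "a powr theta <= b powr theta" using ab theta by (intro powr_mono2) auto
  show ?thesis
  proof (cases "theta <= 1")
   case True
   have part: "x * b powr (theta - 1) <= x powr theta" if "0 <= x" "x <= b" for x
   proof (cases "x = 0")
    case False
    have "x * b powr (theta - 1) <= x * x powr (theta - 1)" using that False True by (intro mult_left_mono powr_mono2') auto
    also have "... = x powr theta" using that False by (simp add: powr_mult_base)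
    finally show ?thesis .
   qed simp
   have "b powr theta = a * b powr (theta - 1) + (b - a) * b powr (theta - 1)"
    using ab by (simp add: left_diff_distrib powr_mult_base)
   also have "... <= a powr theta + (b - a) powr theta" using ab by (intro add_mono part) auto
   finally have "b powr theta - a powr theta <= 1 * (b - a) powr theta" by simp
   also have "... <= C * (b - a) powr theta" using C by (intro mult_right_mono) auto
   finally show ?thesis using mono ab True by (simp add: min_def)
  next
   case False
   obtain xi where xi: "a < xi" "xi < b" "b powr theta - a powr theta = theta * xi powr (theta - 1) * (b - a)" using powr_mvt[OF ab(1,2) theta] by auto
   have "xi powr (theta - 1) <= W powr (theta - 1)" using xi ab False by (intro powr_mono2) auto
   then have "theta * xi powr (theta - 1) <= C" unfolding C_def using theta by (simp add: add_increasing)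
   then have "b powr theta - a powr theta <= C * (b - a)" unfolding xi(3) using ab by (intro mult_right_mono) auto
   then show ?thesis using mono ab False by (simp add: min_def)
  qed
 qed
 have "abs (a powr theta - b powr theta) <= C * abs (a - b) powr min 1 theta" if "a : {0..W}" "b : {0..W}" for a b
  using main[of a b] main[of b a] that by (cases a b rule: linorder_cases) (auto simp: abs_minus_commute)
 then show ?thesis using C by (intro exI[of _ C]) auto
qed

lemma powr_max_continuous: "q > 0 ==> continuous_on UNIV (%t::real. max 0 t powr q)"
 by (intro continuous_on_powr' continuous_intros) auto

text \<open>Extended by 0 to the negative axis, so that it is continuous on the whole line and can
  be composed with any function.\<close>

definition primitive :: "(real => real) => real => real" where
 "primitive f t = integral {0..max 0 t} f"

lemma primitive_diff:
 assumes f: "continuous_on UNIV f" and ab: "0 <= a" "0 <= b"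
 shows "EX xi. min a b <= xi & xi <= max a b & primitive f b - primitive f a = f xi * (b - a)"
proof -
 have main: "EX xi. a <= xi & xi <= b & primitive f b - primitive f a = f xi * (b - a)" if ab: "0 <= a" "a < b" for a b
 proof -
  have "((%x. integral {0..x} f) has_derivative (%y. f x * y)) (at x within {a..b})" if "a <= x" "x <= b" for x
  proof -
   have "((%x. integral {0..x} f) has_real_derivative f x) (at x within {0..b})"
    using that ab by (intro integral_has_real_derivative continuous_on_subset[OF f]) auto
   then have "((%x. integral {0..x} f) has_real_derivative f x) (at x within {a..b})"
    by (rule DERIV_subset) (use ab in auto)
   then show ?thesis by (simp add: has_field_derivative_def)
  qed
  from mvt_simple[OF ab(2) this] obtain xi where "xi : {a<..<b}" "integral {0..b} f - integral {0..a} f = f xi * (b - a)" by auto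
  then show ?thesis using ab by (intro exI[of _ xi]) (auto simp: primitive_def)
 qed
 show ?thesis
 proof (cases a b rule: linorder_cases)
  case less
  then show ?thesis using main[of a b] ab by auto
 next
  case equal
  then show ?thesis by auto
 next
  case greater
  then obtain xi where "b <= xi" "xi <= a" "primitive f a - primitive f b = f xi * (a - b)" using main[of b a] ab by auto
  then show ?thesis using greater by (intro exI[of _ xi]) (auto simp: algebra_simps)
 qed
qed

lemma primitive_continuous:
 assumes f: "continuous_on UNIV f" shows "continuous_on UNIV (primitive f)"
proof -
 have "continuous_on {0..b} (%x. integral {0..x} f)" for b
  by (intro indefinite_integral_continuous_1 integrable_continuous_real continuous_on_subset[OF f]) auto
 then have "continuous_on {..<b} (%t. integral {0..max 0 t} f)" for b
  by (rule continuous_on_compose2[where t="{0..max 0 b}"]) (auto intro!: continuous_intros)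
 then have "continuous_on (\<Union>b. {..<b}) (primitive f)"
  unfolding primitive_def by (intro continuous_on_open_UN) auto
 moreover have "(\<Union>b::real. {..<b}) = UNIV" using gt_ex by auto
 ultimately show ?thesis by simp
qed

lemma primitive_0 [simp]: "primitive f 0 = 0"
 by (simp add: primitive_def)

section \<open>Superposition operators on bounded continuous functions\<close>

lemma compose_bcontfun:
 assumes phi: "continuous_on UNIV (phi :: real => real)"
 shows "(%x. phi (apply_bcontfun u x)) : bcontfun"
proof -
 have "compact (closure (range (apply_bcontfun u)))" by (simp add: compact_closure)
 then have "bounded (phi ` closure (range (apply_bcontfun u)))"
  by (intro compact_imp_bounded compact_continuous_image continuous_on_subset[OF phi]) auto
 then have "bounded (range (%x. phi (apply_bcontfun u x)))" by (rule bounded_subset) (use closure_subset in blast)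
 moreover have "continuous_on UNIV (%x. phi (apply_bcontfun u x))"
  by (rule continuous_on_compose2[OF phi]) auto
 ultimately show ?thesis by (simp add: bcontfun_def)
qed

text \<open>The Nemytskii operator of phi. It acts on the normed space of bounded continuous
  functions, whose uniform norm supplies the topology for the compact set and for the paths of the
  mountain pass.\<close>

definition nem :: "(real => real) => ('a::topological_space \<Rightarrow>\<^sub>C real) => 'a \<Rightarrow>\<^sub>C real" where
 "nem phi u = Bcontfun (%x. phi (apply_bcontfun u x))"

lemma nem_apply [simp]: "continuous_on UNIV phi ==> apply_bcontfun (nem phi u) x = phi (apply_bcontfun u x)"
 unfolding nem_def by (simp add: Bcontfun_inverse compose_bcontfun)

lemma nem_continuous:
 assumes phi: "continuous_on UNIV phi"
 shows "continuous_on UNIV (nem phi)"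
proof -
 have "EX d>0. ALL v. dist v u < d --> dist (nem phi v) (nem phi u) < e" if e: "e > 0" for u :: "'a::topological_space \<Rightarrow>\<^sub>C real" and e
 proof -
  have "uniformly_continuous_on (cball 0 (norm u + 1)) phi"
   by (intro compact_uniformly_continuous continuous_on_subset[OF phi]) auto
  then obtain d where d: "d > 0" "!!s t. s : cball 0 (norm u + 1) ==> t : cball 0 (norm u + 1) ==> dist s t < d ==> dist (phi s) (phi t) < e/2"
   unfolding uniformly_continuous_on_def using e by (meson half_gt_zero)
  have "dist (nem phi v) (nem phi u) < e" if v: "dist v u < min d 1" for v
  proof -
   have "dist (nem phi v) (nem phi u) <= e/2"
   proof (rule dist_bound)
    fix x
    have 1: "dist (apply_bcontfun v x) (apply_bcontfun u x) < min d 1" using dist_bounded[of v x u] v by simp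
    have "norm (apply_bcontfun u x) <= norm u" by (rule norm_bounded)
    moreover have "norm (apply_bcontfun v x) <= norm (apply_bcontfun u x) + 1" using 1 unfolding dist_real_def real_norm_def by linarith
    ultimately have "dist (phi (apply_bcontfun v x)) (phi (apply_bcontfun u x)) < e/2" using 1 by (intro d(2)) auto
    then show "dist (apply_bcontfun (nem phi v) x) (apply_bcontfun (nem phi u) x) <= e/2" using phi by simp
   qed
   then show ?thesis using e by simp
  qed
  then show ?thesis using d(1) by (intro exI[of _ "min d 1"]) auto
 qed
 then show ?thesis unfolding continuous_on_iff by (metis UNIV_I)
qed

section \<open>The fixed point equation\<close>

text \<open>The second factor may be any pair (v, G) arising as a bounded limit of test functions
  and their gradients. Taking another solution for it, and exchanging the roles, shows that the
  solution operator is symmetric.\<close>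

lemma (in dirichlet) energy:
 assumes phi: "!!n. test_function Om (phi n)" "!!n x. abs (phi n x) <= C" "!!i n x. i : Basis ==> abs (partial i (phi n) x) <= C"
   "!!x. x : Om ==> (%n. phi n x) ----> v x" "!!i x. i : Basis ==> x : Om ==> (%n. partial i (phi n) x) ----> G i x"
  and m: "v : borel_measurable borel" "!!i. i : Basis ==> G i : borel_measurable borel"
 shows "(\<Sum>i\<in>Basis. LINT x|LO. grad i x * G i x) = (LINT x|LO. g x * v x)"
proof -
 have tm: "psi : borel_measurable LO" if "test_function Om psi" for psi
  by (rule borel_lebesgue_on[OF bdd_borelD(1)[OF test_function_borel[OF that]]])
 have gi: "integrable LO g"
  using C0_integrable[OF bounded_Om gC] by (subst lebesgue_on_eq_lborel(2)[OF bdd_borelD(1)[OF gb] C0D(2)[OF gC] open_measure(1)])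
 have "(%n. LINT x|LO. grad i x * partial i (phi n) x) ----> (LINT x|LO. grad i x * G i x)" if i: "i : Basis" for i
  using phi(5)[OF i] i m
  by (intro dominated_sequence[OF _ phi(3)[OF i] Lp_integrable[OF grad_Lp[of 1]]] tm test_function_partial phi(1) i AE_I2 borel_lebesgue_on) auto
 then have "(%n. \<Sum>i\<in>Basis. LINT x|LO. grad i x * partial i (phi n) x) ----> (\<Sum>i\<in>Basis. LINT x|LO. grad i x * G i x)"
  by (rule tendsto_sum)
 moreover have "(\<Sum>i\<in>Basis. LINT x|LO. grad i x * partial i (phi n) x) = (LINT x|LO. g x * phi n x)" for n
  using grad_test_integral[OF phi(1)[of n]] unfolding mult.commute[of "grad _ _"] mult.commute[of "g _"] .
 moreover have "(%n. LINT x|LO. g x * phi n x) ----> (LINT x|LO. g x * v x)"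
  using phi(4) m by (intro dominated_sequence[OF _ phi(2) gi] tm phi(1) AE_I2 borel_lebesgue_on) auto
 ultimately show ?thesis using LIMSEQ_unique by simp
qed

context domain
begin

lemma Gop_dirichlet:
 assumes g: "g : C0 Om" and M: "!!x. abs (g x) <= M"
 shows "dirichlet Om r0 Cb (Gop g) g (green_bd * M) M"
proof unfold_locales
 have "M >= 0" using order_trans[OF abs_ge_zero M] .
 then show "green_bd * M >= 0" using green_bd(1) by simp
 show "abs (Gop g x) <= green_bd * M * bdist Om x" for x using Gop(3)[OF g M] .
qed (use Gop[OF g] g M in auto)

lemma Gop_symmetric:
 assumes a: "a : C0 Om" and b: "b : C0 Om"
 shows "(LINT x|LO. a x * Gop b x) = (LINT x|LO. Gop a x * b x)"
proof -
 obtain Ma where Ma: "!!x. abs (a x) <= Ma" using C0_bound[OF a] by blast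
 obtain Mb where Mb: "!!x. abs (b x) <= Mb" using C0_bound[OF b] by blast
 interpret A: dirichlet Om r0 Cb "Gop a" a "green_bd * Ma" Ma by (rule Gop_dirichlet[OF a Ma])
 interpret B: dirichlet Om r0 Cb "Gop b" b "green_bd * Mb" Mb by (rule Gop_dirichlet[OF b Mb])
 have "(\<Sum>i\<in>Basis. LINT x|LO. A.grad i x * B.grad i x) = (LINT x|LO. a x * Gop b x)"
 proof -
  obtain phi C where phi: "!!n. test_function Om (phi n)" "!!n x. abs (phi n x) <= C" "!!i n x. i : Basis ==> abs (partial i (phi n) x) <= C"
   "!!x. x : Om ==> (%n. phi n x) ----> Gop b x" "!!i x. i : Basis ==> x : Om ==> (%n. partial i (phi n) x) ----> B.grad i x"
   using B.test_approximation by metis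
  show ?thesis by (rule A.energy[OF phi bdd_borelD(1)[OF B.ub] B.grad_measurable]) auto
 qed
 moreover have "(\<Sum>i\<in>Basis. LINT x|LO. B.grad i x * A.grad i x) = (LINT x|LO. b x * Gop a x)"
 proof -
  obtain phi C where phi: "!!n. test_function Om (phi n)" "!!n x. abs (phi n x) <= C" "!!i n x. i : Basis ==> abs (partial i (phi n) x) <= C"
   "!!x. x : Om ==> (%n. phi n x) ----> Gop a x" "!!i x. i : Basis ==> x : Om ==> (%n. partial i (phi n) x) ----> A.grad i x"
   using A.test_approximation by metis
  show ?thesis by (rule B.energy[OF phi bdd_borelD(1)[OF A.ub] A.grad_measurable]) auto
 qed
 ultimately show ?thesis by (simp add: mult.commute)
qed

lemma integral_C0_pos:
 assumes g: "g : C0 Om" "!!x. g x >= 0" and x: "g x > 0"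
 shows "(LINT x|LO. g x) > 0"
proof -
 have m: "g : borel_measurable borel" by (rule bdd_borelD(1)[OF C0_bb[OF g(1)]])
 have e: "(LINT x|LO. g x) = (LINT x|lborel. g x)" by (rule lebesgue_on_eq_lborel(1)[OF m C0D(2)[OF g(1)] open_measure(1)])
 have "(LINT x|lborel. g x) ~= 0"
 proof
  assume "(LINT x|lborel. g x) = 0"
  then have "AE x in lborel. g x = 0"
   using integral_nonneg_eq_0_iff_AE[OF C0_integrable[OF bounded_Om g(1)]] g(2) by simp
  then have "g x = 0" by (intro AE_continuous_eq_0[of UNIV g]) (use C0D(1)[OF g(1)] in auto)
  then show False using x by simp
 qed
 moreover have "(LINT x|lborel. g x) >= 0" using g(2) by (simp add: Lint_nonneg)
 ultimately show ?thesis unfolding e by simp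
qed

definition itg :: "('a \<Rightarrow>\<^sub>C real) => real" where
 "itg u = (LINT x|LO. u x)"

lemma itg_integrable: "integrable LO (apply_bcontfun (u :: 'a \<Rightarrow>\<^sub>C real))"
proof (rule Lp_integrable[where p=1])
 show "apply_bcontfun u : Lp 1 Om"
  using norm_bounded[of u] by (intro Lp_bounded[of _ "norm u"] borel_lebesgue_on borel_measurable_continuous_onI) auto
qed simp

lemma itg_mono: "(!!x. x : Om ==> apply_bcontfun u x <= apply_bcontfun v x + c) ==> itg u <= itg v + c * (LINT x|LO. 1)"
proof -
 assume le: "!!x. x : Om ==> u x <= v x + c"
 have "itg u <= (LINT x|LO. v x + c * 1)" unfolding itg_def
  using itg_integrable const_integrable le by (intro integral_mono) auto
 also have "... = itg v + c * (LINT x|LO. 1)" unfolding itg_def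
  by (subst Lint_add) (use itg_integrable const_integrable in \<open>auto simp del: mult_1_right\<close>)
 finally show ?thesis .
qed

lemma itg_add: "itg (u + v) = itg u + itg v"
 and itg_diff: "itg (u - v) = itg u - itg v"
 and itg_scaleR: "itg (c *\<^sub>R u) = c * itg u"
 by (simp_all add: itg_def Lint_add[OF itg_integrable itg_integrable]
   Lint_diff[OF itg_integrable itg_integrable])

lemma itg_continuous: "continuous_on S itg"
proof -
 define m where "m = (LINT x|LO. (1::real))"
 have m: "m >= 0" unfolding m_def by (rule Lint_nonneg) simp
 have le: "itg u <= itg v + dist u v * m" for u v
  unfolding m_def by (rule itg_mono) (use dist_bounded[of u _ v] in \<open>simp add: dist_real_def abs_le_iff algebra_simps\<close>)
 have "dist (itg u) (itg v) <= m * dist u v" for u v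
  using le[of u v] le[of v u] by (simp add: dist_real_def abs_le_iff dist_commute mult.commute)
 then have "m-lipschitz_on S itg" using m by (intro lipschitz_onI) auto
 then show ?thesis by (rule lipschitz_on_continuous_on)
qed

section \<open>The solution operator in the uniform norm, and the compact convex sets\<close>

definition CB :: "('a \<Rightarrow>\<^sub>C real) set" where "CB = {g. apply_bcontfun g : C0 Om}"

lemma C0_bcontfun: "g : C0 Om ==> g : bcontfun"
 using C0_bound[of g] C0D(1)[of g Om UNIV] bcontfun_normI[of g] by auto

lemma apply_C0: "g : C0 Om ==> apply_bcontfun (Bcontfun g) = g"
 by (rule Bcontfun_inverse[OF C0_bcontfun])

lemma CB_algebra: "u : CB ==> v : CB ==> u + v : CB" "u : CB ==> v : CB ==> u - v : CB" "u : CB ==> c *\<^sub>R u : CB" "0 : CB"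
 "u : CB ==> continuous_on UNIV phi ==> phi 0 = 0 ==> nem phi u : CB"
 by (auto simp: CB_def C0_def)

definition Gb :: "('a \<Rightarrow>\<^sub>C real) => 'a \<Rightarrow>\<^sub>C real" where "Gb g = Bcontfun (Gop (apply_bcontfun g))"

lemma Gb: "g : CB ==> apply_bcontfun (Gb g) = Gop (apply_bcontfun g)" "g : CB ==> Gb g : CB"
 using apply_C0 Gop(1) by (auto simp: CB_def Gb_def)

lemma Gb_lincomb: "g : CB ==> h : CB ==> Gb (g + c *\<^sub>R h) = Gb g + c *\<^sub>R Gb h"
 using Gop_lincomb[of "apply_bcontfun g" "apply_bcontfun h" 1 c]
 by (intro bcontfun_eqI) (simp add: Gb CB_algebra, simp add: CB_def plus_bcontfun.rep_eq scaleR_bcontfun.rep_eq)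

lemma Gop_le: "g : C0 Om ==> (!!x. abs (g x) <= M) ==> abs (Gop g x) <= green_bd * dmax * M"
proof -
 assume g: "g : C0 Om" "!!x. abs (g x) <= M"
 have M: "M >= 0" using order_trans[OF abs_ge_zero g(2)] .
 have "abs (Gop g x) <= green_bd * M * bdist Om x" by (rule Gop(3)[OF g])
 also have "... <= green_bd * M * dmax" using M green_bd(1) dmax by (intro mult_left_mono) auto
 finally show ?thesis by (simp add: mult_ac)
qed

lemma Gb_continuous: "continuous_on CB Gb"
proof -
 have "dist (Gb u) (Gb v) <= green_bd * dmax * dist u v" if uv: "u : CB" "v : CB" for u v
 proof (rule dist_bound)
  fix x
  have d: "u - v : CB" using uv by (rule CB_algebra)
  have "Gb u = Gb v + 1 *\<^sub>R Gb (u - v)" using Gb_lincomb[OF uv(2) d, of 1] by simp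
  then have "(Gb u) x - (Gb v) x = Gop (apply_bcontfun (u - v)) x" using Gb(1)[OF d] by simp
  moreover have "abs (Gop (apply_bcontfun (u - v)) x) <= green_bd * dmax * dist u v"
   by (rule Gop_le) (use d dist_bounded[of u _ v] in \<open>auto simp: CB_def dist_real_def\<close>)
  ultimately show "dist ((Gb u) x) ((Gb v) x) <= green_bd * dmax * dist u v" by (simp add: dist_real_def)
 qed
 then have "(green_bd * dmax)-lipschitz_on CB Gb" using green_bd(1) dmax(1) by (intro lipschitz_onI) auto
 then show ?thesis by (rule lipschitz_on_continuous_on)
qed

text \<open>The Hoelder bound has two purposes: with the bound M it makes the set compact in the
  uniform norm, and it is the hypothesis under which the corresponding solutions have weak second
  derivatives.\<close>

definition KK :: "real => real => real => ('a \<Rightarrow>\<^sub>C real) set" where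
 "KK M H beta = {g:CB. (ALL x. 0 <= g x & g x <= M) &
   (ALL x y. abs (g x - g y) <= H * dist x y powr beta)}"

lemma convex_KK: "convex (KK M H beta)"
 unfolding convex_def
proof (intro ballI allI impI)
 fix g h :: "'a \<Rightarrow>\<^sub>C real" and a b :: real
 assume gh: "g : KK M H beta" "h : KK M H beta" and ab: "0 <= a" "0 <= b" "a + b = 1"
 have "a *\<^sub>R g + b *\<^sub>R h : CB" using gh by (intro CB_algebra) (auto simp: KK_def)
 moreover have "0 <= a * g x + b * h x & a * g x + b * h x <= M" for x
  using gh ab by (auto simp: KK_def intro: convex_bound_le)
 moreover have "abs ((a * g x + b * h x) - (a * g y + b * h y)) <= H * dist x y powr beta" for x y
 proof -
  have "abs (a * (g x - g y) + b * (h x - h y))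
    <= a * abs (g x - g y) + b * abs (h x - h y)"
   using ab abs_triangle_ineq[of "a * (g x - g y)" "b * (h x - h y)"]
   by (simp add: abs_mult)
  also have "... <= H * dist x y powr beta" using gh ab by (intro convex_bound_le) (auto simp: KK_def)
  finally show ?thesis by (simp add: algebra_simps)
 qed
 ultimately show "a *\<^sub>R g + b *\<^sub>R h : KK M H beta" by (simp add: KK_def)
qed

text \<open>The theorem of Arzela and Ascoli on the closure of \<open>Om\<close>. All functions
  vanish outside \<open>Om\<close>, so uniform convergence there is convergence in norm, and the
  defining inequalities pass to pointwise limits.\<close>

lemma compact_KK:
 assumes beta: "beta > 0" and H: "H >= 0" shows "compact (KK M H beta)"
 unfolding compact_eq_seq_compact_metric seq_compact_def
proof (intro allI impI)
 fix f :: "nat => 'a \<Rightarrow>\<^sub>C real" assume "ALL n. f n : KK M H beta"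
 then have f: "!!n. apply_bcontfun (f n) : C0 Om" "!!n x. 0 <= (f n) x" "!!n x. (f n) x <= M"
  "!!n x y. abs ((f n) x - (f n) y) <= H * dist x y powr beta" by (auto simp: KK_def CB_def)
 obtain g and k :: "nat => nat" where k: "strict_mono k"
  "!!e. 0 < e ==> EX N. ALL n x. n >= N & x : closure Om --> norm ((f (k n)) x - g x) < e"
 proof (rule Arzela_Ascoli[of "closure Om" "%n. apply_bcontfun (f n)" M])
  show "compact (closure Om)" using bounded_Om by (simp add: compact_closure)
  show "norm ((f n) x) <= M" for n x using f(2,3)[of n x] by simp
  fix x :: 'a and e :: real assume e: "0 < e"
  define d where "d = (e/(H + 1)) powr (1/beta)"
  have d: "d > 0" "d powr beta = e/(H + 1)" using e H beta by (auto simp: d_def powr_powr)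
  have "norm ((f n) x - (f n) y) < e" if "norm (x - y) < d" for n y
  proof -
   have "norm ((f n) x - (f n) y) <= H * dist x y powr beta" using f(4) by simp
   also have "... <= H * d powr beta" using that H beta by (intro mult_left_mono powr_mono2) (auto simp: dist_norm)
   also have "... < e" unfolding d(2) using e H by (simp add: field_simps)
   finally show ?thesis .
  qed
  then show "EX d>0. ALL n y. y : closure Om & norm (x - y) < d --> norm ((f n) x - (f n) y) < e" using d(1) by blast
 qed blast
 have "Cauchy (f \<circ> k)"
 proof (rule metric_CauchyI)
  fix e :: real assume e: "e > 0"
  then obtain N where N: "!!n x. n >= N ==> x : closure Om ==> norm ((f (k n)) x - g x) < e/4" using k(2)[of "e/4"] by auto
  have "dist (f (k m)) (f (k n)) < e" if mn: "m >= N" "n >= N" for m n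
  proof -
   have "dist (f (k m)) (f (k n)) <= e/2"
   proof (rule dist_bound)
    fix x show "dist ((f (k m)) x) ((f (k n)) x) <= e/2"
    proof (cases "x : Om")
     case True
     then have "x : closure Om" using closure_subset by blast
     then show ?thesis using N[OF mn(1)] N[OF mn(2)] by (simp add: dist_real_def) (smt (verit, best) field_sum_of_halves)
    qed (use C0D(2)[OF f(1)] e in simp)
   qed
   then show ?thesis using e by simp
  qed
  then show "EX M. ALL m>=M. ALL n>=M. dist ((f \<circ> k) m) ((f \<circ> k) n) < e" by auto
 qed
 then obtain l where l: "(f \<circ> k) ----> l" using Cauchy_convergent convergent_def by blast
 have lx: "(%n. (f (k n)) x) ----> l x" for x
 proof (rule metric_LIMSEQ_I)
  fix e :: real assume "e > 0"
  then obtain N where "!!n. n >= N ==> dist (f (k n)) l < e" using metric_LIMSEQ_D[OF l] by auto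
  then show "EX N. ALL n>=N. dist ((f (k n)) x) (l x) < e" using dist_fun_lt_imp_dist_val_lt by blast
 qed
 have "l : KK M H beta" unfolding KK_def CB_def C0_def
 proof (intro CollectI conjI allI impI)
  show "l x = 0" if "x ~: Om" for x
   using lx[of x] C0D(2)[OF f(1) that] by (simp add: LIMSEQ_const_iff)
  show "0 <= l x" for x by (rule LIMSEQ_le_const[OF lx]) (use f(2) in auto)
  show "l x <= M" for x by (rule LIMSEQ_le_const2[OF lx]) (use f(3) in auto)
  show "abs (l x - l y) <= H * dist x y powr beta" for x y
   by (rule LIMSEQ_le_const2[OF tendsto_rabs[OF tendsto_diff[OF lx lx]]]) (use f(4) in auto)
 qed simp
 then show "EX l:KK M H beta. EX r. strict_mono r & (f \<circ> r) ----> l" using k(1) l by blast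
qed

end

lemma powr_monotone:
 fixes a b q :: real
 assumes "a >= 0" "b >= 0" "q > 0"
 shows "(a powr q - b powr q) * (a - b) >= 0" "a ~= b ==> (a powr q - b powr q) * (a - b) > 0"
proof -
 show pos: "a ~= b ==> (a powr q - b powr q) * (a - b) > 0"
  using powr_less_mono2[OF assms(3,1), of b] powr_less_mono2[OF assms(3,2), of a]
  by (cases a b rule: linorder_cases) (auto intro: mult_neg_neg)
 then show "(a powr q - b powr q) * (a - b) >= 0" by (cases "a = b") (auto intro: less_imp_le)
qed

text \<open>Taking the positive part first makes the power continuous on the whole line, as
  superposition requires; on nonnegative functions it is the plain power.\<close>

definition pw :: "real => real => real" where "pw q t = max 0 t powr q"

lemma pw: "q > 0 ==> continuous_on UNIV (pw q)" "pw q 0 = 0" "pw q t >= 0" "t >= 0 ==> pw q t = t powr q"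
 using powr_max_continuous[of q] by (auto simp: pw_def[abs_def])

section \<open>The operator A and its energy\<close>

locale navier = domain Om r0 Cb for Om :: "'a::euclidean_space set" and r0 Cb +
 fixes f :: "real => real" and p gamma :: real
 assumes ne: "Om ~= {}" and p: "p > 1" and fc: "continuous_on UNIV f" and f0: "!!t. f t >= 0" and gamma: "gamma > 0"
  and fgamma: "!!t. 0 <= t ==> t <= gamma ==> f t = 0" and fpos: "EX t>0. f t ~= 0"
  and growth: "!!epsilon. epsilon > 0 ==> EX C>=0. ALL t>=0. f t <= epsilon * t powr (p - 1) + C"
begin

definition "theta = 1/(p - 1)"
definition "L = green_bd * dmax"
definition "W mu g = mu *\<^sub>R Gb (nem f (Gb g))"
definition "A mu g = nem (pw theta) (W mu g)"
text \<open>For nonnegative g and u = G g this is (1/p) int |Lap u|^p - mu int F(u) with F' = f,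
  written in terms of g = -Lap u.\<close>

definition "J mu g = itg (nem (pw p) g)/p - mu * itg (nem (primitive f) (Gb g))"
text \<open>The pointwise product by polarisation: squaring is a superposition operator, so
  continuity and membership in \<open>CB\<close> are inherited from those operators.\<close>

definition "prodb a b = (1/2) *\<^sub>R (nem (%t. t^2) (a + b) - nem (%t. t^2) a - nem (%t. t^2) b)"
text \<open>By the symmetry of G, the function W mu g - g^(p-1) is minus the gradient of J at g.
  This is thus the rate at which J falls in the direction A mu g - g.\<close>

definition "D mu g = itg (prodb (W mu g - nem (pw (p - 1)) g) (A mu g - g))"

lemma theta: "theta > 0" using p by (simp add: theta_def)
lemma L: "L > 0" using green_bd(1) dmax(1) by (simp add: L_def)
lemma f00: "f 0 = 0" using fgamma[of 0] gamma by simp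
lemma sq_cont: "continuous_on UNIV (%t::real. t^2)" by (intro continuous_intros)
lemma primc: "continuous_on UNIV (primitive f)" by (rule primitive_continuous[OF fc])

lemma CB_ops: "g : CB ==> nem f (Gb g) : CB" "g : CB ==> W mu g : CB" "g : CB ==> A mu g : CB"
 "a : CB ==> b : CB ==> prodb a b : CB"
 using theta by (auto simp: W_def A_def prodb_def intro!: CB_algebra Gb(2) fc f00 pw sq_cont)

lemma apply_prodb: "(prodb a b) x = a x * b x"
 by (simp add: prodb_def sq_cont power2_sum)

lemma prim_facts: "0 <= t ==> 0 <= primitive f t" "0 <= t ==> t <= gamma ==> primitive f t = 0"
 "0 <= s ==> s <= t ==> primitive f s <= primitive f t"
proof -
 show mono: "0 <= s ==> s <= t ==> primitive f s <= primitive f t" for s t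
  using primitive_diff[OF fc, of s t] f0 by (smt (verit) mult_nonneg_nonneg)
 show "0 <= t ==> 0 <= primitive f t" using mono[of 0 t] by simp
 show "0 <= t ==> t <= gamma ==> primitive f t = 0" using primitive_diff[OF fc, of 0 t] fgamma by auto
qed

lemma continuity:
 shows "continuous_on CB (W mu)" "continuous_on CB (A mu)" "continuous_on CB (J mu)" "continuous_on CB (D mu)"
proof -
 have nc: "continuous_on CB (%g. nem phi (T g))" if "continuous_on UNIV phi" "continuous_on CB T" for phi and T :: "('a \<Rightarrow>\<^sub>C real) => 'a \<Rightarrow>\<^sub>C real"
  by (rule continuous_on_compose2[OF nem_continuous[OF that(1)] that(2)]) auto
 have ic: "continuous_on CB (%g. itg (T g))" if "continuous_on CB T" for T :: "('a \<Rightarrow>\<^sub>C real) => 'a \<Rightarrow>\<^sub>C real"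
  by (rule continuous_on_compose2[OF itg_continuous[of UNIV] that]) auto
 have "continuous_on CB (%g. Gb (nem f (Gb g)))"
  by (rule continuous_on_compose2[OF Gb_continuous nc[OF fc Gb_continuous]]) (use CB_ops(1) in auto)
 then show W: "continuous_on CB (W mu)" unfolding W_def by (intro continuous_intros)
 show A: "continuous_on CB (A mu)" unfolding A_def using theta by (intro nc W pw)
 show "continuous_on CB (J mu)" unfolding J_def using p
  by (intro continuous_intros ic nc pw Gb_continuous primc) auto
 show "continuous_on CB (D mu)" unfolding D_def prodb_def using p
  by (intro ic nc continuous_on_scaleR continuous_on_const continuous_on_add continuous_on_diff sq_cont W A pw continuous_on_id) auto
qed

definition "Kp = {g:CB. ALL x. 0 <= g x}"

lemma KpD: "g : Kp ==> g : CB" "g : Kp ==> 0 <= g x" "g : Kp ==> apply_bcontfun g : C0 Om"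
 by (auto simp: Kp_def CB_def)

lemma KpI: "g : CB ==> (!!x. 0 <= g x) ==> g : Kp"
 by (simp add: Kp_def)

lemma Gb_Kp: assumes g: "g : Kp" shows "Gb g : Kp"
 by (rule KpI[OF Gb(2)[OF KpD(1)[OF g]]], unfold Gb(1)[OF KpD(1)[OF g]]) (rule Gop_nonneg[OF KpD(3,2)[OF g]])

lemma nem_Kp: "g : Kp ==> nem f (Gb g) : Kp"
 by (rule KpI[OF CB_ops(1)[OF KpD(1)]]) (simp_all add: fc f0)

lemma W_Kp: assumes g: "g : Kp" and mu: "mu >= 0" shows "W mu g : Kp"
 by (rule KpI[OF CB_ops(2)[OF KpD(1)[OF g]]]) (simp add: W_def mu KpD(2)[OF Gb_Kp[OF nem_Kp[OF g]]])

lemma apply_W: "g : CB ==> apply_bcontfun (W mu g) = Gop (%x. mu * f (Gop (apply_bcontfun g) x))"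
proof -
 assume g: "g : CB"
 have n: "apply_bcontfun (nem f (Gb g)) = (%x. f (Gop (apply_bcontfun g) x))" using g by (simp add: fc Gb fun_eq_iff)
 have c: "(%x. f (Gop (apply_bcontfun g) x)) : C0 Om" using CB_ops(1)[OF g] unfolding CB_def mem_Collect_eq n .
 have "apply_bcontfun (W mu g) = (%x. mu * Gop (%x. f (Gop (apply_bcontfun g) x)) x)"
  using Gb(1)[OF CB_ops(1)[OF g]] by (simp add: W_def n fun_eq_iff)
 then show ?thesis using Gop_lincomb[OF c c, of mu 0] by simp
qed

lemma A_powr:
 assumes "g : Kp" "mu >= 0"
 shows "(A mu g) x = (W mu g) x powr theta" "(A mu g) x powr (p - 1) = (W mu g) x"
proof -
 show 1: "(A mu g) x = (W mu g) x powr theta"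
  using KpD(2)[OF W_Kp[OF assms]] theta by (simp add: A_def pw)
 show "(A mu g) x powr (p - 1) = (W mu g) x"
  unfolding 1 using KpD(2)[OF W_Kp[OF assms], of x] p by (simp add: powr_powr theta_def)
qed

text \<open>Since W mu g is the power p - 1 of a = A mu g, the integrand is (a^(p-1) - g^(p-1)) (a -
  g). It is nonnegative by monotonicity of the power, and positive wherever a and g differ.\<close>

lemma D_pos:
 assumes g: "g : Kp" "mu >= 0" and ne: "A mu g ~= g"
 shows "D mu g > 0"
proof -
 let ?P = "prodb (W mu g - nem (pw (p - 1)) g) (A mu g - g)"
 have e: "apply_bcontfun ?P x = ((A mu g) x powr (p - 1) - g x powr (p - 1)) * ((A mu g) x - g x)" for x
  using p KpD(2)[OF g(1)] by (simp add: apply_prodb A_powr(2)[OF g] pw)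
 have nn: "(A mu g) x >= 0" for x by (simp add: A_powr(1)[OF g])
 obtain x where x: "(A mu g) x ~= g x" using ne bcontfun_eqI by blast
 have "?P : CB" using p g(1) by (intro CB_ops CB_algebra pw KpD(1)) auto
 then have c: "apply_bcontfun ?P : C0 Om" by (simp only: CB_def mem_Collect_eq)
 have p1: "p - 1 > 0" using p by simp
 show ?thesis unfolding D_def itg_def
  by (rule integral_C0_pos[OF c, of x]; unfold e)
   (rule powr_monotone(1)[OF nn KpD(2)[OF g(1)] p1], rule powr_monotone(2)[OF nn KpD(2)[OF g(1)] p1 x])
qed

text \<open>The primitive vanishes on the interval from 0 to gamma, so the potential drops out and
  only the p-th power term remains.\<close>

lemma J_below:
 assumes g: "g : Kp" and N: "norm (Gb g) <= gamma"
 shows "J mu g >= 0" "g ~= 0 ==> J mu g > 0"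
proof -
 have "(nem (primitive f) (Gb g)) x = 0" for x
  using prim_facts(2)[of "(Gb g) x"] KpD(2)[OF Gb_Kp[OF g]] norm_bounded[of "Gb g" x] N primc by simp
 then have "apply_bcontfun (nem (primitive f) (Gb g)) = (%x. 0)" by (rule ext)
 then have J: "J mu g = itg (nem (pw p) g)/p" unfolding J_def itg_def[of "nem (primitive f) _"] by simp
 have c: "apply_bcontfun (nem (pw p) g) : C0 Om" using CB_algebra(5)[OF KpD(1)[OF g], of "pw p"] p pw by (simp add: CB_def)
 show "J mu g >= 0" unfolding J itg_def using p pw by (auto intro!: divide_nonneg_pos Lint_nonneg)
 assume "g ~= 0"
 then obtain x where "g x ~= 0" using bcontfun_eqI[of g 0] by auto
 then have "g x > 0" using KpD(2)[OF g, of x] by simp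
 then have "itg (nem (pw p) g) > 0" unfolding itg_def
  using p by (intro integral_C0_pos[OF c, of x]) (auto simp: pw)
 then show "J mu g > 0" using p by (simp add: J)
qed

text \<open>Slightly beyond a positive point t0 with f t0 > 0 the primitive is positive, say at t1.
  The boundary distance is scaled so that its image under G reaches the value t1 at a point
  x1.\<close>

lemma valley_exists:
 "EX T>0. itg (nem (primitive f) (Gb (Bcontfun (%x. T * bdist Om x)))) > 0"
proof -
 obtain t0 where t0: "t0 > 0" "f t0 > 0" using fpos f0 by (metis order_less_le)
 have "isCont f t0" using fc by (simp add: continuous_on_eq_continuous_at)
 then have "\<forall>\<^sub>F t in at t0. f t > 0" using t0(2) unfolding isCont_def by (rule order_tendstoD)
 then obtain d where d: "d > 0" "!!t. dist t t0 < d ==> f t > 0" using t0(2) unfolding eventually_at by (metis UNIV_I)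
 define t1 where "t1 = t0 + d/2"
 obtain xi where xi: "t0 <= xi" "xi <= t1" "primitive f t1 - primitive f t0 = f xi * (t1 - t0)"
  using primitive_diff[OF fc, of t0 t1] t0 d by (auto simp: t1_def)
 then have "f xi > 0" using d by (auto simp: t1_def dist_real_def)
 then have "f xi * (t1 - t0) > 0" using d(1) by (simp add: t1_def)
 then have pt1: "primitive f t1 > 0" using xi(3) prim_facts(1)[of t0] t0 by simp
 \<comment> \<open>If G mapped the boundary distance to 0, the equation tested with a cut-off
   function equal to 1 at some point of \<open>Om\<close> would annihilate the positive integral of
   their product.\<close>
 obtain x1 where x1: "Gop (bdist Om) x1 > 0"
 proof (rule ccontr)
  assume *: "~ thesis"
  have "Gop (bdist Om) x = 0" for x using that[of x] * Gop_nonneg[OF bdist_C0 infdist_nonneg, of x] by fastforce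
  then have g0: "Gop (bdist Om) = (%x. 0)" by auto
  obtain y where y: "y : Om" using ne by auto
  define d where "d = bdist Om y/2"
  have d: "d > 0" using bdist_pos[OF open_Om bounded_Om y] by (simp add: d_def)
  have "EX eta. test_function Om eta & (ALL y. 0 <= eta y) & eta y = 1"
  proof (rule cutoff)
   fix C assume "!!s. s > 0 ==> (EX eta. is_cutoff Om C s eta)"
   from this[OF d] show ?thesis by (auto simp: d_def)
  qed
  then obtain eta where eta: "test_function Om eta" "!!y. 0 <= eta y" "eta y = 1" by blast
  have "(LINT x|lborel. bdist Om x * eta x) = 0" using Gop(2)[OF bdist_C0] eta(1) unfolding g0 poisson_def by simp
  moreover have c: "(%x. bdist Om x * eta x) : C0 Om"
  proof -
   have "continuous_on UNIV eta" using eta(1) by (rule test_functionE) (rule smooth_continuous)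
   then show ?thesis by (auto simp: C0_def infdist_def[symmetric] bdist_outside intro!: continuous_intros)
  qed
  then have "(LINT x|LO. bdist Om x * eta x) = (LINT x|lborel. bdist Om x * eta x)"
   by (intro lebesgue_on_eq_lborel(1) open_measure bdd_borelD(1)[OF C0_bb[OF c]]) (simp add: bdist_outside)
  moreover have "(LINT x|LO. bdist Om x * eta x) > 0"
   using eta d by (intro integral_C0_pos[OF c, of y]) (auto simp: d_def infdist_nonneg)
  ultimately show False by simp
 qed
 define T where "T = t1/Gop (bdist Om) x1"
 have T: "T > 0" using x1 t0 d by (simp add: T_def t1_def)
 define h where "h = Bcontfun (%x. T * bdist Om x)"
 have hC: "(%x. T * bdist Om x) : C0 Om" by (rule C0_cmult[OF bdist_C0])
 have ah: "apply_bcontfun h = (%x. T * bdist Om x)" unfolding h_def by (rule apply_C0[OF hC])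
 have hK: "h : Kp" using hC T by (simp add: Kp_def CB_def ah infdist_nonneg)
 have "Gop (%x. T * bdist Om x) x1 = t1" using Gop_lincomb[OF bdist_C0 bdist_C0, of T 0] x1 by (simp add: T_def)
 then have v: "(Gb h) x1 = t1" using Gb(1)[OF KpD(1)[OF hK]] by (simp add: ah)
 have "itg (nem (primitive f) (Gb h)) > 0" unfolding itg_def
 proof (rule integral_C0_pos)
  show "apply_bcontfun (nem (primitive f) (Gb h)) : C0 Om"
   using CB_algebra(5)[OF Gb(2)[OF KpD(1)[OF hK]] primc] by (simp add: CB_def)
  show "(nem (primitive f) (Gb h)) x1 > 0" using pt1 by (simp add: primc v)
  show "(nem (primitive f) (Gb h)) x >= 0" for x using prim_facts(1)[OF KpD(2)[OF Gb_Kp[OF hK]]] by (simp add: primc)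
 qed
 then show ?thesis using T unfolding h_def by blast
qed

end

lemma uniformly_close:
 fixes phi :: "real => real"
 assumes "continuous_on UNIV phi" "e > 0"
 shows "EX d>0. ALL s:{0..R}. ALL t:{0..R}. abs (s - t) < d --> abs (phi s - phi t) <= e"
proof -
 have "uniformly_continuous_on {0..R} phi" by (intro compact_uniformly_continuous continuous_on_subset[OF assms(1)]) auto
 then obtain d where "d > 0" "!!s t. s : {0..R} ==> t : {0..R} ==> dist t s < d ==> dist (phi t) (phi s) < e"
  unfolding uniformly_continuous_on_def using assms(2) by meson
 then show ?thesis by (intro exI[of _ d]) (auto simp: dist_real_def intro: less_imp_le)
qed

lemma (in domain) Gop_lipschitz:
 assumes "M >= 0" shows "EX C>=0. ALL h:C0 Om. (ALL x. abs (h x) <= M) --> (ALL x y. abs (Gop h x - Gop h y) <= C * dist x y)"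
proof (intro exI[of _ "max 0 (dirichlet.lip Om (green_bd * M) M)"] conjI ballI impI allI)
 fix h x y assume h: "h : C0 Om" "ALL x. abs (h x) <= M"
 interpret H: dirichlet Om r0 Cb "Gop h" h "green_bd * M" M using h by (intro Gop_dirichlet) auto
 have "abs (Gop h x - Gop h y) <= H.lip * dist x y" by (rule H.u_lipschitz)
 also have "... <= max 0 H.lip * dist x y" by (intro mult_right_mono) auto
 finally show "abs (Gop h x - Gop h y) <= max 0 H.lip * dist x y" .
qed simp

section \<open>Invariance of the compact set and uniform descent\<close>

context navier
begin

text \<open>The functions W mu g are Lipschitz and bounded, and A mu g is their power theta. This is
  the Hoelder exponent of that power on bounded intervals.\<close>

definition "beta = min 1 theta"

lemma beta: "beta > 0" using theta by (simp add: beta_def)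

lemma KKD:
 assumes "g : KK M H beta"
 shows "g : Kp" "g x <= M" "abs (g x - g y) <= H * dist x y powr beta"
  "0 <= (Gb g) x" "(Gb g) x <= L * M"
proof -
 show g: "g : Kp" and M: "g x <= M" and "abs (g x - g y) <= H * dist x y powr beta" for x
  using assms by (auto simp: KK_def Kp_def)
 show "0 <= (Gb g) x" by (rule KpD(2)[OF Gb_Kp[OF g]])
 have "abs (g x) <= M" for x using KpD(2)[OF g] M by simp
 then have "abs (Gop (apply_bcontfun g) x) <= green_bd * dmax * M" by (rule Gop_le[OF KpD(3)[OF g]])
 then show "(Gb g) x <= L * M" by (simp add: Gb(1)[OF KpD(1)[OF g]] L_def)
qed

text \<open>The bound for A g needs only the bound M for g, by the slow growth of f. The Lipschitz
  constant of W mu g depends on the bound for f (G g) and not on the Hoelder constant of g, so every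
  sufficiently large H works with the same M.\<close>

lemma invariance:
 assumes mu1: "mu1 > 0" and T0: "T0 > 0"
 shows "EX M>=T0. EX H0. ALL H>=H0. ALL mu. 0 <= mu & mu <= mu1 --> (ALL g:KK M H beta. A mu g : KK M H beta)"
proof -
 \<comment> \<open>With this value the growth term contributes exactly half of M^(p-1) to mu1 L
   times the bound of f. The choice of M below makes the constant C contribute at most the other
   half.\<close>
 define epsilon where "epsilon = 1/(2 * mu1 * L powr p)"
 have epsilon: "epsilon > 0" using mu1 L by (simp add: epsilon_def)
 obtain C where C: "C >= 0" "!!t. t >= 0 ==> f t <= epsilon * t powr (p - 1) + C" using growth[OF epsilon] by blast
 define M where "M = max T0 ((2 * mu1 * L * C) powr theta)"
 have M: "M >= T0" "M > 0" using T0 by (auto simp: M_def)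
 have C0: "2 * mu1 * L * C >= 0" using mu1 L C by simp
 have "2 * mu1 * L * C = ((2 * mu1 * L * C) powr theta) powr (p - 1)" using C0 p by (simp add: powr_powr theta_def)
 also have "... <= M powr (p - 1)" using p by (intro powr_mono2) (auto simp: M_def)
 finally have CM: "2 * mu1 * L * C <= M powr (p - 1)" .
 define Mf where "Mf = epsilon * (L * M) powr (p - 1) + C"
 have Mf: "Mf >= 0" using epsilon C by (simp add: Mf_def)
 have LMf: "mu1 * L * Mf <= M powr (p - 1)"
 proof -
  have "L powr p = L * L powr (p - 1)" using L by (simp add: powr_mult_base)
  then have "mu1 * L * (epsilon * (L * M) powr (p - 1)) = M powr (p - 1)/2"
   using mu1 L M by (simp add: epsilon_def powr_mult)
  then show ?thesis using CM by (simp add: Mf_def distrib_left)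
 qed
 obtain Lw where Lw: "Lw >= 0" "!!h x y. h : C0 Om ==> (ALL x. abs (h x) <= Mf) ==> abs (Gop h x - Gop h y) <= Lw * dist x y"
  using Gop_lipschitz[OF Mf] by blast
 have "M powr (p - 1) >= 0" by simp
 then obtain Ch where Ch: "Ch >= 0" "!!a b. a : {0..M powr (p - 1)} ==> b : {0..M powr (p - 1)} ==> abs (a powr theta - b powr theta) <= Ch * abs (a - b) powr beta"
  using powr_hoelder[OF theta] unfolding beta_def by meson
 have "A mu g : KK M H beta" if H: "H >= Ch * (mu1 * Lw) powr beta" and mu: "0 <= mu" "mu <= mu1" and g: "g : KK M H beta" for H mu g
 proof -
  note gp = KKD(1)[OF g]
  have wn: "(W mu g) x >= 0" for x by (rule KpD(2)[OF W_Kp[OF gp mu(1)]])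
  have hC: "apply_bcontfun (nem f (Gb g)) : C0 Om" by (rule KpD(3)[OF nem_Kp[OF gp]])
  have hM: "abs ((nem f (Gb g)) x) <= Mf" for x
  proof -
   have "f ((Gb g) x) <= epsilon * (Gb g) x powr (p - 1) + C" by (rule C(2)[OF KKD(4)[OF g]])
   also have "... <= Mf" unfolding Mf_def using KKD(4,5)[OF g] epsilon p by (intro add_right_mono mult_left_mono powr_mono2) auto
   finally show ?thesis using f0 by (simp add: fc)
  qed
  have We: "(W mu g) x = mu * Gop (apply_bcontfun (nem f (Gb g))) x" for x
   by (simp add: W_def Gb(1)[OF CB_ops(1)[OF KpD(1)[OF gp]]])
  have wM: "(W mu g) x <= M powr (p - 1)" for x
  proof -
   have "Gop (apply_bcontfun (nem f (Gb g))) x <= L * Mf" using Gop_le[OF hC hM, of x] by (simp add: L_def)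
   then have "mu * Gop (apply_bcontfun (nem f (Gb g))) x <= mu1 * (L * Mf)"
    using mu mu1 Gop_nonneg[OF hC KpD(2)[OF nem_Kp[OF gp]]] by (intro mult_mono) auto
   then show ?thesis unfolding We using LMf by (simp add: mult.assoc)
  qed
  have wl: "abs ((W mu g) x - (W mu g) y) <= mu1 * Lw * dist x y" for x y
  proof -
   have "abs ((W mu g) x - (W mu g) y) = mu * abs (Gop (apply_bcontfun (nem f (Gb g))) x - Gop (apply_bcontfun (nem f (Gb g))) y)"
    unfolding We right_diff_distrib[symmetric] abs_mult using mu by simp
   also have "... <= mu1 * (Lw * dist x y)" using mu hM by (intro mult_mono Lw(2)[OF hC]) (auto simp: Lw(1))
   finally show ?thesis by simp
  qed
  note Ae = A_powr(1)[OF gp mu(1)]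
  have "(A mu g) x <= M" for x
  proof -
   have "(A mu g) x <= (M powr (p - 1)) powr theta" unfolding Ae using wn wM theta by (intro powr_mono2) auto
   also have "... = M" using M p by (simp add: powr_powr theta_def)
   finally show ?thesis .
  qed
  moreover have "abs ((A mu g) x - (A mu g) y) <= H * dist x y powr beta" for x y
  proof -
   have "abs ((A mu g) x - (A mu g) y) <= Ch * abs ((W mu g) x - (W mu g) y) powr beta"
    unfolding Ae using wn wM by (intro Ch(2)) auto
   also have "... <= Ch * (mu1 * Lw * dist x y) powr beta" using wl Ch(1) beta by (intro mult_left_mono powr_mono2) auto
   also have "... = Ch * (mu1 * Lw) powr beta * dist x y powr beta" using mu1 Lw(1) by (simp add: powr_mult)
   also have "... <= H * dist x y powr beta" using H by (intro mult_right_mono) auto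
   finally show ?thesis .
  qed
  moreover have "A mu g : CB" by (rule CB_ops(3)[OF KpD(1)[OF gp]])
  moreover have "0 <= (A mu g) x" for x by (simp add: Ae)
  ultimately show ?thesis by (simp add: KK_def)
 qed
 then show ?thesis using M(1) by blast
qed

text \<open>The symmetry of G moves it from f (G g) to A g - g. In this form D is the linear term in
  the expansion of J, whose potential is evaluated at G g.\<close>

lemma D_eq:
 assumes g: "g : Kp" and h: "A mu g : CB"
 shows "D mu g = mu * itg (prodb (nem f (Gb g)) (Gb (A mu g) - Gb g)) - itg (prodb (nem (pw (p - 1)) g) (A mu g - g))"
proof -
 have d: "A mu g - g : CB" by (intro CB_algebra h KpD(1) g)
 have n: "nem f (Gb g) : CB" by (rule CB_ops(1)[OF KpD(1)[OF g]])
 have "Gb (A mu g) = Gb g + 1 *\<^sub>R Gb (A mu g - g)" using Gb_lincomb[OF KpD(1)[OF g] d, of 1] by simp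
 then have Gd: "Gb (A mu g) - Gb g = Gb (A mu g - g)" by simp
 have "itg (prodb (nem f (Gb g)) (Gb (A mu g - g))) = itg (prodb (Gb (nem f (Gb g))) (A mu g - g))"
  using Gop_symmetric[of "apply_bcontfun (nem f (Gb g))" "apply_bcontfun (A mu g - g)"] n d
  unfolding itg_def apply_prodb Gb(1)[OF d] Gb(1)[OF n] CB_def mem_Collect_eq by blast
 then have "mu * itg (prodb (nem f (Gb g)) (Gb (A mu g) - Gb g)) = itg (mu *\<^sub>R prodb (Gb (nem f (Gb g))) (A mu g - g))"
  unfolding Gd itg_scaleR by simp
 moreover have "prodb (W mu g - nem (pw (p - 1)) g) (A mu g - g) = mu *\<^sub>R prodb (Gb (nem f (Gb g))) (A mu g - g) - prodb (nem (pw (p - 1)) g) (A mu g - g)"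
  by (rule bcontfun_eqI) (simp add: apply_prodb W_def algebra_simps)
 ultimately show ?thesis by (simp add: D_def itg_diff)
qed

text \<open>A first order expansion, uniform on the set. Convexity gives the tangent inequality for
  the power at the new point, and the mean value theorem treats the primitive. Uniform continuity of
  the power p - 1 on the range up to M, and of f on the range up to L M, moves both slopes back to g
  at a cost of at most eta t.\<close>

lemma descent:
 assumes inv: "!!g. g : KK M H beta ==> A mu g : KK M H beta" and M: "M > 0" and mu: "mu >= 0" and eta: "eta > 0"
 shows "EX tau>0. tau <= 1 & (ALL g:KK M H beta. ALL t. 0 <= t & t <= tau --> J mu (g + t *\<^sub>R (A mu g - g)) <= J mu g - t * (D mu g - eta))"
proof -
 define m where "m = (LINT x|LO. (1::real))"
 have m: "m >= 0" unfolding m_def by (rule Lint_nonneg) simp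
 \<comment> \<open>The two tolerances are budgeted so that, after integration over the domain of
   volume m, the power term and the potential each cost at most eta/2 per unit of t. The added 1
   avoids a division by zero.\<close>
 define e1 where "e1 = eta/(2 * M * (m + 1))"
 define e2 where "e2 = eta/(2 * (mu * (L * M) + 1) * (m + 1))"
 have LM: "L * M > 0" using L M by simp
 have muLM: "mu * (L * M) >= 0" using mu LM by simp
 have e: "e1 > 0" "e2 > 0" unfolding e1_def e2_def using eta M m muLM by auto
 have tot: "(M * e1 + mu * (e2 * (L * M))) * m <= eta"
 proof -
  have 2: "eta/2/(m + 1) + eta/2/(m + 1) = eta/(m + 1)" by (metis add_divide_distrib field_sum_of_halves)
  have 1: "M * e1 = eta/2/(m + 1)" using M m by (simp add: e1_def)
  have "mu * (e2 * (L * M)) <= e2 * (mu * (L * M) + 1)" using e by (simp add: algebra_simps)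
  also have "... = eta/2/(m + 1)"
  proof -
   have "eta/(2 * X * (m + 1)) * X = eta/2/(m + 1)" if "X > 0" for X using that by simp
   from this[of "mu * (L * M) + 1"] show ?thesis unfolding e2_def using muLM by linarith
  qed
  finally have "M * e1 + mu * (e2 * (L * M)) <= eta/(m + 1)" unfolding 1 using 2 by linarith
  then have "(M * e1 + mu * (e2 * (L * M))) * m <= eta/(m + 1) * m" using m by (rule mult_right_mono)
  also have "... <= eta" using eta m by (simp add: field_simps)
  finally show ?thesis .
 qed
 have pc: "continuous_on UNIV (pw (p - 1))" using p by (simp add: pw)
 obtain d1 where d1: "d1 > 0" "!!s t. s : {0..M} ==> t : {0..M} ==> abs (s - t) < d1 ==> abs (pw (p - 1) s - pw (p - 1) t) <= e1"
  using uniformly_close[OF pc e(1)] by meson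
 obtain d2 where d2: "d2 > 0" "!!s t. s : {0..L*M} ==> t : {0..L*M} ==> abs (s - t) < d2 ==> abs (f s - f t) <= e2"
  using uniformly_close[OF fc e(2)] by meson
 define tau where "tau = min 1 (min (d1/(2 * M)) (d2/(2 * (L * M))))"
 have tau: "tau > 0" "tau <= 1" using d1 d2 M LM by (auto simp: tau_def)
 have taud: "tau * M < d1" "tau * (L * M) < d2"
 proof -
  have "tau * M <= d1/(2 * M) * M" using M by (intro mult_right_mono) (auto simp: tau_def)
  then show "tau * M < d1" using d1(1) M by simp
  have "tau * (L * M) <= d2/(2 * (L * M)) * (L * M)" using LM by (intro mult_right_mono) (auto simp: tau_def)
  also have "... = d2/2" using LM L M by simp
  finally show "tau * (L * M) < d2" using d2(1) by simp
 qed
 have "J mu (g + t *\<^sub>R (A mu g - g)) <= J mu g - t * (D mu g - eta)" if g: "g : KK M H beta" and t: "0 <= t" "t <= tau" for g t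
 proof -
  define k where "k = A mu g - g"
  define q where "q = g + t *\<^sub>R k"
  have Ag: "A mu g : KK M H beta" by (rule inv[OF g])
  have kCB: "k : CB" unfolding k_def by (intro CB_algebra KpD(1) KKD(1)[OF g] KKD(1)[OF Ag])
  have q: "q : KK M H beta"
  proof -
   have "q = (1 - t) *\<^sub>R g + t *\<^sub>R A mu g" by (simp add: q_def k_def algebra_simps)
   then show ?thesis using convexD[OF convex_KK g Ag, of "1 - t" t] t tau by simp
  qed
  have Gk: "Gb (A mu g) - Gb g = Gb k"
   using Gb_lincomb[OF KpD(1)[OF KKD(1)[OF g]] kCB, of 1] by (simp add: k_def)
  have Gq: "Gb q = Gb g + t *\<^sub>R Gb k" unfolding q_def by (rule Gb_lincomb[OF KpD(1)[OF KKD(1)[OF g]] kCB])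
  define X where "X g = (1/p) *\<^sub>R nem (pw p) g - mu *\<^sub>R nem (primitive f) (Gb g)" for g
  have JX: "J mu g = itg (X g)" for g by (simp add: J_def X_def itg_diff itg_scaleR)
  define Y where "Y = prodb (nem (pw (p - 1)) g) k - mu *\<^sub>R prodb (nem f (Gb g)) (Gb k)"
  have Y: "itg Y = - D mu g"
   unfolding D_eq[OF KKD(1)[OF g] KpD(1)[OF KKD(1)[OF Ag]]] Gk k_def[symmetric] by (simp add: Y_def itg_diff itg_scaleR)
  define E where "E = t * (M * e1 + mu * (e2 * (L * M)))"
  have "(X q) x <= (X g + t *\<^sub>R Y) x + E" for x
  proof -
   define a where "a = g x"
   define b where "b = q x"
   define h where "h = k x"
   define U where "U = (Gb g) x"
   define V where "V = (Gb q) x"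
   define G where "G = (Gb k) x"
   have a: "0 <= a" "a <= M" using KpD(2)[OF KKD(1)[OF g]] KKD(2)[OF g] by (auto simp: a_def)
   have b: "0 <= b" "b <= M" using KpD(2)[OF KKD(1)[OF q]] KKD(2)[OF q] by (auto simp: b_def)
   have U: "0 <= U" "U <= L * M" using KKD(4,5)[OF g] by (auto simp: U_def)
   have V: "0 <= V" "V <= L * M" using KKD(4,5)[OF q] by (auto simp: V_def)
   have bh: "b - a = t * h" by (simp add: b_def a_def h_def q_def)
   have VG: "V - U = t * G" by (simp add: V_def U_def G_def Gq)
   have h: "abs h <= M"
    using KpD(2)[OF KKD(1)[OF Ag], of x] KKD(2)[OF Ag, of x] a by (simp add: h_def k_def a_def[symmetric] abs_le_iff)
   have G: "abs G <= L * M"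
    using KKD(4,5)[OF Ag, of x] U unfolding G_def Gk[symmetric] by (simp add: U_def[symmetric] abs_le_iff)
   have tM: "abs (b - a) < d1"
   proof -
    have "abs (b - a) <= tau * M" unfolding bh abs_mult using t h by (intro mult_mono) auto
    then show ?thesis using taud by simp
   qed
   have "b powr p - a powr p <= p * b powr (p - 1) * (b - a)" by (rule powr_tangent[OF a(1) b(1) p])
   then have 1: "b powr p/p - a powr p/p <= b powr (p - 1) * (t * h)" using p unfolding bh by (simp add: field_simps)
   have "abs (b powr (p - 1) - a powr (p - 1)) <= e1" using d1(2)[of b a] a b tM p by (simp add: pw)
   then have "abs ((b powr (p - 1) - a powr (p - 1)) * (t * h)) <= e1 * (t * M)"
    unfolding abs_mult using t h e by (intro mult_mono) auto
   then have 2: "b powr p/p <= a powr p/p + t * (a powr (p - 1) * h) + t * (M * e1)"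
    using 1 by (simp add: algebra_simps abs_le_iff)
   obtain xi where xi: "min U V <= xi" "xi <= max U V" "primitive f V - primitive f U = f xi * (V - U)"
    using primitive_diff[OF fc U(1) V(1)] by blast
   have "abs (V - U) <= tau * (L * M)" unfolding VG abs_mult using t G by (intro mult_mono) auto
   then have "abs (xi - U) < d2" using xi(1,2) taud(2) by (simp add: min_def max_def split: if_splits)
   then have "abs (f xi - f U) <= e2" using xi(1,2) U V by (intro d2(2)) auto
   then have "abs ((f xi - f U) * (t * G)) <= e2 * (t * (L * M))"
    unfolding abs_mult using t G e by (intro mult_mono) auto
   then have "primitive f V >= primitive f U + t * (f U * G) - t * (e2 * (L * M))"
    using xi(3) unfolding VG by (simp add: algebra_simps abs_le_iff)
   then have "mu * primitive f V >= mu * (primitive f U + t * (f U * G) - t * (e2 * (L * M)))" using mu by (rule mult_left_mono)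
   then have "b powr p/p - mu * primitive f V <= a powr p/p - mu * primitive f U + t * (a powr (p - 1) * h - mu * (f U * G)) + E"
    using 2 by (simp add: E_def algebra_simps)
   moreover have "(X q) x = b powr p/p - mu * primitive f V"
    using p b(1) by (simp add: X_def pw primc b_def[symmetric] V_def)
   moreover have "(X g) x = a powr p/p - mu * primitive f U"
    using p a(1) by (simp add: X_def pw primc a_def[symmetric] U_def)
   moreover have "Y x = a powr (p - 1) * h - mu * (f U * G)"
    using p a(1) by (simp add: Y_def apply_prodb pc fc a_def[symmetric] U_def[symmetric] h_def[symmetric] G_def[symmetric] pw)
   ultimately show ?thesis by simp
  qed
  then have "itg (X q) <= itg (X g + t *\<^sub>R Y) + E * m" unfolding m_def by (rule itg_mono)
  also have "... = J mu g - t * D mu g + E * m" by (simp add: itg_add itg_scaleR Y JX)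
  also have "E * m <= t * eta" unfolding E_def mult.assoc using tot t by (intro mult_left_mono) (auto simp: mult.assoc)
  finally show ?thesis unfolding k_def[symmetric] q_def[symmetric] JX by (simp add: right_diff_distrib)
 qed
 then show ?thesis using tau by blast
qed

end

section \<open>From fixed points to solutions\<close>

lemma (in domain) dirichlet_sign:
 assumes d: "dirichlet Om r0 Cb u g B M" and sg: "abs sg = 1"
 shows "dirichlet Om r0 Cb (%x. sg * u x) (%x. sg * g x) B M"
proof -
 interpret d: dirichlet Om r0 Cb u g B M by (rule d)
 have "poisson Om (%x. sg * u x + 0 * u x) (%x. sg * g x + 0 * g x)"
  by (rule poisson_lincomb[OF d.po d.po d.ub d.ub d.gb d.gb])
 then show ?thesis
  using d.uB d.gM d.B0 sg by unfold_locales (auto simp: abs_mult intro: C0_cmult d.uC d.gC)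
qed

lemma (in domain) same_ae_eq:
 assumes u: "u : C0 Om" "v : C0 Om" and s: "same_ae Om u v" shows "u = v"
proof
 fix x
 show "u x = v x"
 proof (cases "x : Om")
  case True
  have "AE x in lebesgue. x : Om --> u x - v x = 0"
   using s open_lebesgue by (simp add: same_ae_def AE_restrict_space_iff)
  then have "AE x in lborel. x : Om --> u x - v x = 0" by (simp add: AE_completion_iff)
  then have "u x - v x = 0"
   by (rule AE_continuous_eq_0[OF continuous_on_diff[OF C0D(1)[OF u(1)] C0D(1)[OF u(2)]] open_Om _ True])
  then show ?thesis by simp
 qed (use C0D(2)[OF u(1)] C0D(2)[OF u(2)] in simp)
qed

context navier
begin

lemma zero_facts: "Gb 0 = 0" "J mu 0 = 0"
proof -
 have z: "0 : CB" by (rule CB_algebra)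
 show G: "Gb 0 = 0" using Gb_lincomb[OF z z, of "-1"] by simp
 have "nem (pw p) 0 = (0 :: 'a \<Rightarrow>\<^sub>C real)" "nem (primitive f) 0 = (0 :: 'a \<Rightarrow>\<^sub>C real)"
  using p by (auto intro!: bcontfun_eqI simp: pw primc)
 then show "J mu 0 = 0" using itg_scaleR[of 0 0] by (simp add: J_def G)
qed

lemma two_fixed_points:
 "EX mu0>0. EX M>0. EX H>=0. ALL mu. mu0 <= mu & mu <= mu0 + 1 -->
   (EX a:KK M H beta. EX b:KK M H beta. A mu a = a & A mu b = b & J mu a < 0 & J mu b > 0)"
proof -
 obtain T where T: "T > 0" and v: "itg (nem (primitive f) (Gb (Bcontfun (%x. T * bdist Om x)))) > 0" using valley_exists by blast
 define h where "h = Bcontfun (%x. T * bdist Om x)"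
 have hC: "(%x. T * bdist Om x) : C0 Om" by (rule C0_cmult[OF bdist_C0])
 have ah: "apply_bcontfun h = (%x. T * bdist Om x)" unfolding h_def by (rule apply_C0[OF hC])
 define F where "F = itg (nem (primitive f) (Gb h))"
 have F: "F > 0" using v by (simp add: F_def h_def)
 define S where "S = itg (nem (pw p) h)/p"
 have S: "S >= 0" unfolding S_def itg_def using p pw by (auto intro!: divide_nonneg_pos Lint_nonneg)
 \<comment> \<open>From this value on, J at h is at most S - (S + F) = -F, hence negative.\<close>
 define mu0 where "mu0 = S/F + 1"
 have mu0: "mu0 > 0" using S F by (simp add: mu0_def add_nonneg_pos)
 have Jh: "J mu h < 0" if "mu >= mu0" for mu
 proof -
  have "mu0 * F = S + F" using F by (simp add: mu0_def distrib_right)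
  moreover have "mu0 * F <= mu * F" using that F by (intro mult_right_mono) auto
  ultimately show ?thesis using F by (simp add: J_def S_def[symmetric] F_def[symmetric])
 qed
 have Td: "T * dmax > 0" using T dmax(1) by simp
 have mu1: "mu0 + 1 > 0" using mu0 by simp
 obtain M H0 where M: "M >= T * dmax"
  and inv: "!!H mu g. H >= H0 ==> 0 <= mu ==> mu <= mu0 + 1 ==> g : KK M H beta ==> A mu g : KK M H beta"
  using invariance[OF mu1 Td] by meson
 \<comment> \<open>The valley function h must lie in the set: T bounds the quotient for points at
   distance at most 1, and T * dmax bounds the difference for all others.\<close>
 define H where "H = max (max 0 H0) (max T (T * dmax))"
 have H: "H >= 0" "H >= H0" "T <= H" "T * dmax <= H" by (auto simp: H_def)
 have M0: "M > 0" using M Td by simp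
 have hK: "h : KK M H beta"
  unfolding KK_def CB_def mem_Collect_eq ah
 proof (intro conjI allI hC)
  show "0 <= T * bdist Om x" for x using T by (simp add: infdist_nonneg)
  have le: "T * bdist Om x <= T * dmax" for x using T dmax(2) by (intro mult_left_mono) auto
  show "T * bdist Om x <= M" for x using le[of x] M by simp
  fix x y :: 'a
  show "abs (T * bdist Om x - T * bdist Om y) <= H * dist x y powr beta"
  proof (cases "dist x y <= 1")
   case True
   have "abs (T * bdist Om x - T * bdist Om y) = T * abs (bdist Om x - bdist Om y)"
    using T by (simp add: right_diff_distrib[symmetric] abs_mult)
   also have "... <= T * dist x y powr 1" using T bdist_lipschitz[where U=Om and x=x and y=y] by simp
   also have "... <= H * dist x y powr beta" using True H(1,3) T by (intro mult_mono powr_mono') (auto simp: beta_def)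
   finally show ?thesis .
  next
   case False
   have "abs (T * bdist Om x - T * bdist Om y) <= T * dmax"
   proof -
    have "0 <= T * bdist Om x" "0 <= T * bdist Om y" using T by (simp_all add: infdist_nonneg)
    then show ?thesis using le[of x] le[of y] by linarith
   qed
   also have "... <= H * 1" using H(4) by simp
   also have "... <= H * dist x y powr beta" using False H(1) beta by (intro mult_left_mono ge_one_powr_ge_zero) auto
   finally show ?thesis .
  qed
 qed
 have sub: "KK M H beta <= CB" by (auto simp: KK_def)
 have "0 : CB" by (rule CB_algebra)
 then have zK: "0 : KK M H beta" using M0 H(1) by (simp add: KK_def)
 have "EX a:KK M H beta. EX b:KK M H beta. A mu a = a & A mu b = b & J mu a < 0 & J mu b > 0" if mu: "mu0 <= mu" "mu <= mu0 + 1" for mu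
 proof (rule mountain_pass[where N="%g. norm (Gb g)" and z=0 and theta=gamma and ?g1.0=h and D="D mu"])
  have mu1: "mu >= 0" using mu mu0 by simp
  show "compact (KK M H beta)" by (rule compact_KK[OF beta H(1)])
  show "convex (KK M H beta)" by (rule convex_KK)
  show "continuous_on (KK M H beta) (J mu)" "continuous_on (KK M H beta) (A mu)" "continuous_on (KK M H beta) (D mu)"
   by (rule continuous_on_subset[OF continuity(3) sub] continuous_on_subset[OF continuity(2) sub] continuous_on_subset[OF continuity(4) sub])+
  show "continuous_on (KK M H beta) (%g. norm (Gb g))" by (intro continuous_on_norm continuous_on_subset[OF Gb_continuous sub])
  show inv': "A mu g : KK M H beta" if "g : KK M H beta" for g by (rule inv[OF H(2) mu1 mu(2) that])
  show "0 < D mu g" if "g : KK M H beta" "A mu g ~= g" for g by (rule D_pos[OF KKD(1)[OF that(1)] mu1 that(2)])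
  show "EX tau>0. tau <= 1 & (ALL g:KK M H beta. ALL t. 0 <= t & t <= tau --> J mu (g + t *\<^sub>R (A mu g - g)) <= J mu g - t * (D mu g - eta))"
   if "eta > 0" for eta by (rule descent[OF inv' M0 mu1 that])
  show "0 : KK M H beta" "h : KK M H beta" by (rule zK, rule hK)
  show "J mu 0 = 0" "J mu h < 0" by (rule zero_facts, rule Jh[OF mu(1)])
  show "norm (Gb 0) < gamma" using gamma by (simp add: zero_facts)
  show "gamma < norm (Gb h)" using J_below(1)[OF KKD(1)[OF hK], of mu] Jh[OF mu(1)] by linarith
  show "0 < J mu g" if "g : KK M H beta" "norm (Gb g) = gamma" for g
   using that(2) gamma zero_facts(1) by (intro J_below(2) KKD(1)[OF that(1)]) auto
 qed
 then show ?thesis using mu0 M0 H(1) by blast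
qed

text \<open>The factor sg carries solutions for the possibly reflected nonlinearity f back to F: the
  function, its right side and the parameter change sign together. The bound S is common to all
  parameters because M and H do not depend on mu.\<close>

lemma solutions:
 assumes sg: "abs sg = 1" and F: "!!t. f t = F (sg * t)"
 shows "EX mu0>0. EX S>0. ALL mu. mu0 <= mu & mu <= mu0 + 1 --> (EX u\<^sub>1 u\<^sub>2.
   nontrivial_weak_solution p Om F (sg * mu) u\<^sub>1 & nontrivial_weak_solution p Om F (sg * mu) u\<^sub>2 &
   ~ same_ae Om u\<^sub>1 u\<^sub>2 & navier_norm p Om u\<^sub>1 < S & navier_norm p Om u\<^sub>2 < S)"
proof -
 obtain mu0 M H where mu0: "mu0 > 0" and M: "M > 0" and H: "H >= 0"
  and fp: "!!mu. mu0 <= mu ==> mu <= mu0 + 1 ==> EX a:KK M H beta. EX b:KK M H beta. A mu a = a & A mu b = b & J mu a < 0 & J mu b > 0"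
  using two_fixed_points by metis
 define S where "S = (LINT x|LO. M powr p) powr (1/p) + 1"
 define u where "u g x = sg * Gop (apply_bcontfun g) x" for g x
 have sol: "weak_solution p Om F (sg * mu) (u g)" "navier_norm p Om (u g) < S" "u g : C0 Om" "u g = (%_. 0) ==> J mu g = 0"
  if g: "g : KK M H beta" "A mu g = g" and mu: "mu >= 0" for g mu
 proof -
  note gp = KKD(1)[OF g(1)]
  have gM: "abs (g x) <= M" for x using KpD(2)[OF gp, of x] KKD(2)[OF g(1), of x] by simp
  have d: "dirichlet Om r0 Cb (u g) (%x. sg * g x) (green_bd * M) M"
   unfolding u_def by (rule dirichlet_sign[OF Gop_dirichlet[OF KpD(3)[OF gp] gM] sg])
  interpret D: dirichlet_hoelder Om r0 Cb "u g" "%x. sg * g x" "green_bd * M" M H beta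
  proof (rule dirichlet_hoelder.intro[OF d], unfold_locales)
   show "abs (sg * g x - sg * g y) <= H * dist x y powr beta" for x y
    unfolding right_diff_distrib[symmetric] abs_mult sg using KKD(3)[OF g(1)] by simp
  qed (rule beta, rule H)
  show "u g : C0 Om" by (rule D.uC)
  have p0: "p > 0" using p by simp
  show "navier_norm p Om (u g) < S" using D.navier_norm_le[OF p0] unfolding S_def by simp
  define h where "h x = mu * f (Gop (apply_bcontfun g) x)" for x
  have hC: "h : C0 Om"
  proof -
   have "apply_bcontfun (mu *\<^sub>R nem f (Gb g)) = h" using KpD(1)[OF gp] by (simp add: fun_eq_iff h_def fc Gb)
   moreover have "mu *\<^sub>R nem f (Gb g) : CB" by (intro CB_algebra(3) CB_ops(1) KpD(1)[OF gp])
   ultimately show ?thesis unfolding CB_def by auto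
  qed
  obtain M' where M': "!!x. abs (h x) <= M'" using C0_bound[OF hC] by blast
  have w: "dirichlet Om r0 Cb (%x. sg * Gop h x) (%x. sg * h x) (green_bd * M') M'"
   by (rule dirichlet_sign[OF Gop_dirichlet[OF hC M'] sg])
  show "weak_solution p Om F (sg * mu) (u g)"
  proof (rule D.weak_solution_criterion[OF p w])
   fix x
   have "g x powr (p - 1) = Gop h x"
    using A_powr(2)[OF gp mu, of x] apply_W[OF KpD(1)[OF gp], of mu] unfolding g(2) h_def[abs_def] by simp
   moreover have "abs (g x) powr (p - 2) * g x = g x powr (p - 1)"
   proof (cases "g x = 0")
    case False
    then have "g x > 0" using KpD(2)[OF gp, of x] by simp
    then show ?thesis using powr_mult_base[of "g x" "p - 2"] by (simp add: mult.commute)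
   qed simp
   ultimately show "abs (sg * g x) powr (p - 2) * (sg * g x) = sg * Gop h x"
    by (simp add: abs_mult sg mult.left_commute)
   show "sg * h x = sg * mu * F (u g x)" by (simp add: h_def F u_def)
  qed
  \<comment> \<open>If G g = 0, then f (G g) = f 0 = 0, so W = 0 and g = A g = 0. A fixed point at a
    level other than 0 therefore gives a nontrivial solution.\<close>
  assume z: "u g = (%_. 0)"
  have "Gb g = 0"
  proof (rule bcontfun_eqI)
   fix x have "sg * Gop (apply_bcontfun g) x = 0" using fun_cong[OF z, of x] by (simp add: u_def)
   then show "(Gb g) x = apply_bcontfun 0 x" using sg by (auto simp: Gb(1)[OF KpD(1)[OF gp]])
  qed
  then have N: "norm (Gb g) <= gamma" and hz: "h = (%x. 0)"
   using gamma f00 Gb(1)[OF KpD(1)[OF gp]] by (auto simp: h_def fun_eq_iff)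
  have "g x powr (p - 1) = 0" for x
   using A_powr(2)[OF gp mu, of x] apply_W[OF KpD(1)[OF gp], of mu] hz Gop_0 unfolding g(2) h_def[abs_def] by simp
  then have g0: "g = 0" by (intro bcontfun_eqI) simp
  show "J mu g = 0" unfolding g0 by (rule zero_facts)
 qed
 have "EX u\<^sub>1 u\<^sub>2. nontrivial_weak_solution p Om F (sg * mu) u\<^sub>1 & nontrivial_weak_solution p Om F (sg * mu) u\<^sub>2 &
   ~ same_ae Om u\<^sub>1 u\<^sub>2 & navier_norm p Om u\<^sub>1 < S & navier_norm p Om u\<^sub>2 < S" if m: "mu0 <= mu" "mu <= mu0 + 1" for mu
 proof -
  obtain a b where a: "a : KK M H beta" "A mu a = a" "J mu a < 0" and b: "b : KK M H beta" "A mu b = b" "J mu b > 0"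
   using fp[OF m] by blast
  have mu: "mu >= 0" using m mu0 by simp
  note sa = sol[OF a(1,2) mu] note sb = sol[OF b(1,2) mu]
  have z: "(%_. 0) : C0 Om" by (simp add: C0_def)
  have "~ same_ae Om (u a) (%_. 0)" using same_ae_eq[OF sa(3) z] sa(4) a(3) by auto
  moreover have "~ same_ae Om (u b) (%_. 0)" using same_ae_eq[OF sb(3) z] sb(4) b(3) by auto
  \<comment> \<open>A depends on its argument only through G. Equal solutions would thus give equal
    images under A, that is a = b, against the signs of J.\<close>
  moreover have "~ same_ae Om (u a) (u b)"
  proof
   assume "same_ae Om (u a) (u b)"
   then have e: "u a = u b" by (rule same_ae_eq[OF sa(3) sb(3)])
   have "Gb a = Gb b"
   proof (rule bcontfun_eqI)
    fix x have "sg * Gop (apply_bcontfun a) x = sg * Gop (apply_bcontfun b) x" using fun_cong[OF e, of x] by (simp add: u_def)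
    then show "(Gb a) x = (Gb b) x"
     using sg by (auto simp: Gb(1)[OF KpD(1)[OF KKD(1)[OF a(1)]]] Gb(1)[OF KpD(1)[OF KKD(1)[OF b(1)]]])
   qed
   then have "A mu a = A mu b" by (simp add: A_def W_def)
   then show False using a b by simp
  qed
  ultimately show ?thesis using sa(1,2) sb(1,2) unfolding nontrivial_weak_solution_def by blast
 qed
 moreover have "S > 0" by (simp add: S_def add_nonneg_pos)
 ultimately show ?thesis using mu0 by blast
qed

end

text \<open>Beyond a radius R >= 1 the limit gives epsilon t^(s-1), which is at most epsilon t^(p-1)
  since s <= p; below R, continuity supplies the constant C.\<close>

lemma growth_bound:
 fixes f :: "real => real"
 assumes f: "continuous_on UNIV f" and s: "s <= p" and sg: "abs sg = 1"
  and lim: "((%t. f t/abs t powr (s - 1)) \<longlongrightarrow> 0) at_infinity" and epsilon: "epsilon > 0"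
 shows "EX C>=0. ALL t>=0. f (sg * t) <= epsilon * t powr (p - 1) + C"
proof -
 have "\<forall>\<^sub>F t in at_infinity. f t/abs t powr (s - 1) < epsilon" using lim epsilon by (rule order_tendstoD)
 then obtain b where b: "!!t. norm t >= b ==> f t/abs t powr (s - 1) < epsilon" unfolding eventually_at_infinity by blast
 define R where "R = max 1 b"
 have "compact (f ` {-R..R})" by (intro compact_continuous_image continuous_on_subset[OF f]) auto
 then obtain C where C: "ALL t:{-R..R}. abs (f t) <= C" using compact_imp_bounded[of "f ` {-R..R}"] by (auto simp: bounded_iff)
 have C0: "C >= 0" using order_trans[OF abs_ge_zero C[rule_format, of 0]] by (simp add: R_def)
 have "f (sg * t) <= epsilon * t powr (p - 1) + C" if t: "t >= 0" for t
 proof (cases "t <= R")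
  case True
  then have "abs (sg * t) <= R" using sg t by (simp add: abs_mult)
  then have "f (sg * t) <= C" using C[rule_format, of "sg * t"] by (auto simp: abs_le_iff)
  moreover have "0 <= epsilon * t powr (p - 1)" using epsilon by simp
  ultimately show ?thesis by linarith
 next
  case False
  have at: "abs (sg * t) = t" using sg t by (simp add: abs_mult)
  have t1: "t > 1" "t >= b" using False by (auto simp: R_def)
  have "f (sg * t)/t powr (s - 1) < epsilon" using b[of "sg * t"] t1 at by simp
  then have "f (sg * t) <= epsilon * t powr (s - 1)" using t1 by (simp add: pos_divide_less_eq)
  also have "... <= epsilon * t powr (p - 1)" using t1 s epsilon by (intro mult_left_mono powr_mono) auto
  finally show ?thesis using C0 by simp
 qed
 then show ?thesis using C0 by blast
qed

theorem theorem1p1: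
  fixes \<Omega> :: "'a::euclidean_space set" and p s \<gamma> :: real and f :: "real \<Rightarrow> real"
  assumes "open \<Omega>" and "bounded \<Omega>" and "\<Omega> \<noteq> {}" and "Ck_boundary 2 \<Omega>"
    and "p > max 1 (real DIM('a) / 2)"
    and "continuous_on UNIV f" and "\<And>t. f t \<ge> 0" and "\<exists>t. f t \<noteq> 0"
    and "\<gamma> > 0" and "\<And>t. t \<in> {-\<gamma>..\<gamma>} \<Longrightarrow> f t = 0"
    and "1 \<le> s" and "s \<le> p"
    and "((\<lambda>t. f t / \<bar>t\<bar> powr (s - 1)) \<longlongrightarrow> 0) at_infinity"
  shows "\<exists>\<Lambda>\<^sub>1 \<Lambda>\<^sub>2 :: real set.
     nondegenerate_interval \<Lambda>\<^sub>1 \<and> nondegenerate_interval \<Lambda>\<^sub>2 \<and>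
     ((\<exists>t>0. f t \<noteq> 0) \<longrightarrow> \<Lambda>\<^sub>1 \<subseteq> {0<..} \<and> \<Lambda>\<^sub>2 \<subseteq> {0<..}) \<and>
     (\<forall>\<mu>\<in>\<Lambda>\<^sub>1. \<exists>u\<^sub>1 u\<^sub>2.
        nontrivial_weak_solution p \<Omega> f \<mu> u\<^sub>1 \<and> nontrivial_weak_solution p \<Omega> f \<mu> u\<^sub>2 \<and>
        \<not> same_ae \<Omega> u\<^sub>1 u\<^sub>2) \<and>
     (\<exists>\<sigma>>0. \<forall>\<mu>\<in>\<Lambda>\<^sub>2. \<exists>u\<^sub>1 u\<^sub>2.
        nontrivial_weak_solution p \<Omega> f \<mu> u\<^sub>1 \<and> nontrivial_weak_solution p \<Omega> f \<mu> u\<^sub>2 \<and>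
        \<not> same_ae \<Omega> u\<^sub>1 u\<^sub>2 \<and>
        navier_norm p \<Omega> u\<^sub>1 < \<sigma> \<and> navier_norm p \<Omega> u\<^sub>2 < \<sigma>)"
proof -
 obtain r0 Cb where r: "r0 > 0" "Cb > 0" "!!x0. x0 : frontier \<Omega> ==> boundary_const \<Omega> x0 r0 Cb"
  using boundary_const_exists[OF assms(1,2,4)] by blast
 define \<sigma> :: real where "\<sigma> = (if EX t>0. f t ~= 0 then 1 else - 1)"
 have \<sigma>: "\<bar>\<sigma>\<bar> = 1" by (simp add: \<sigma>_def)
 interpret navier \<Omega> r0 Cb "%t. f (\<sigma> * t)" p \<gamma>
 proof (unfold_locales)
  show "continuous_on UNIV (%t. f (\<sigma> * t))"
   by (rule continuous_on_compose2[OF assms(6)]) (auto intro!: continuous_intros)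
  show "f (\<sigma> * t) = 0" if "0 <= t" "t <= \<gamma>" for t by (rule assms(10)) (use that in \<open>auto simp: \<sigma>_def\<close>)
  obtain t where t: "f t ~= 0" using assms(8) by blast
  have "t ~= 0" using t assms(9) assms(10)[of 0] by auto
  then show "EX t>0. f (\<sigma> * t) ~= 0"
  proof (cases "EX t>0. f t ~= 0")
   case False
   then have "t < 0" using t \<open>t ~= 0\<close> by (meson linorder_neqE_linordered_idom)
   then show ?thesis using False t by (intro exI[of _ "- t"]) (auto simp: \<sigma>_def)
  qed (auto simp: \<sigma>_def)
 qed (use assms r growth_bound[OF assms(6,12) \<sigma> assms(13)] in auto)
 obtain \<mu>0 S where \<mu>0: "\<mu>0 > 0" and S: "S > 0" and sol: "!!\<mu>. \<mu>0 <= \<mu> ==> \<mu> <= \<mu>0 + 1 ==> (EX u\<^sub>1 u\<^sub>2.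
   nontrivial_weak_solution p \<Omega> f (\<sigma> * \<mu>) u\<^sub>1 & nontrivial_weak_solution p \<Omega> f (\<sigma> * \<mu>) u\<^sub>2 &
   ~ same_ae \<Omega> u\<^sub>1 u\<^sub>2 & navier_norm p \<Omega> u\<^sub>1 < S & navier_norm p \<Omega> u\<^sub>2 < S)"
  using solutions[OF \<sigma>, of f] by auto
 \<comment> \<open>One interval serves for both claims, since the bound S holds on all of
   it.\<close>
 define \<Lambda> where "\<Lambda> = {\<mu>. \<mu>0 <= \<sigma> * \<mu> & \<sigma> * \<mu> <= \<mu>0 + 1}"
 have \<Lambda>: "\<Lambda> = {\<mu>0..\<mu>0 + 1} | \<Lambda> = {- (\<mu>0 + 1)..- \<mu>0}" unfolding \<Lambda>_def by (auto simp: \<sigma>_def)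
 then have nd: "nondegenerate_interval \<Lambda>"
  unfolding nondegenerate_interval_def by (auto simp: interior_atLeastAtMost_real)
 have pos: "\<Lambda> <= {0<..}" if "EX t>0. f t ~= 0" using that \<mu>0 by (auto simp: \<Lambda>_def \<sigma>_def)
 have sol': "EX u\<^sub>1 u\<^sub>2. nontrivial_weak_solution p \<Omega> f \<mu> u\<^sub>1 & nontrivial_weak_solution p \<Omega> f \<mu> u\<^sub>2 &
   ~ same_ae \<Omega> u\<^sub>1 u\<^sub>2 & navier_norm p \<Omega> u\<^sub>1 < S & navier_norm p \<Omega> u\<^sub>2 < S" if "\<mu> : \<Lambda>" for \<mu>
 proof -
  have "\<sigma> * (\<sigma> * \<mu>) = \<mu>" by (simp add: \<sigma>_def split: if_splits)
  then show ?thesis using sol[of "\<sigma> * \<mu>"] that unfolding \<Lambda>_def by (simp only: mem_Collect_eq)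
 qed
 show ?thesis
 proof (intro exI[of _ \<Lambda>] conjI nd impI pos ballI)
  show "EX u\<^sub>1 u\<^sub>2. nontrivial_weak_solution p \<Omega> f \<mu> u\<^sub>1 & nontrivial_weak_solution p \<Omega> f \<mu> u\<^sub>2 & ~ same_ae \<Omega> u\<^sub>1 u\<^sub>2" if "\<mu> : \<Lambda>" for \<mu>
   using sol'[OF that] by blast
  show "EX \<sigma>>0. ALL \<mu>:\<Lambda>. EX u\<^sub>1 u\<^sub>2. nontrivial_weak_solution p \<Omega> f \<mu> u\<^sub>1 & nontrivial_weak_solution p \<Omega> f \<mu> u\<^sub>2 &
    ~ same_ae \<Omega> u\<^sub>1 u\<^sub>2 & navier_norm p \<Omega> u\<^sub>1 < \<sigma> & navier_norm p \<Omega> u\<^sub>2 < \<sigma>"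
   using sol' S by blast
 qed
qed

end
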